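(* Let $(g,X)$ be a Kähler--Ricci soliton on a complex manifold $M$. Every Kähler immersion of $(M,g)$ into a definite complex space form of nonpositive holomorphic sectional curvature is totally geodesic.
   Context: A Kähler--Ricci soliton on a complex manifold $M$ is a pair $(g,X)$ consisting of a Kähler metric $g$ and a holomorphic vector field $X$ (regarded as a real vector field, i.e. the real part of a holomorphic vector field) such that $\mathrm{Ric}_g=\lambda g+L_Xg$ for some $\lambda\in\mathbb{R}$, where $\mathrm{Ric}_g$ is the Ricci tensor and $L_X$ the Lie derivative. A definite complex space form of nonpositive holomorphic sectional curvature is a finite dimensional complex manifold with a (positive definite) Kähler metric of constant holomorphic sectional curvature $2c\le 0$; it is locally holomorphically isometric to $\mathbb{C}^N$ with the flat metric (if $c=0$) or to the complex hyperbolic space $\{z\in\mathbb{C}^N:|z|<1\}$ with Kähler form $\frac ic\partial\bar\partial\log(1-|z|^2)$ (if $c<0$). A Kähler immersion is a holomorphic map which pulls the ambient Kähler metric back to $g$; it is not required to be injective. *)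

theory Defs
  imports "HOL-Analysis.Analysis"
begin

section \<open>Calculus on open subsets of a Euclidean space\<close>

abbreviation ddir :: "('a::real_normed_vector \<Rightarrow> 'b::real_normed_vector) \<Rightarrow> 'a \<Rightarrow> 'a \<Rightarrow> 'b"
  where "ddir F x v \<equiv> frechet_derivative F (at x) v"

primrec Ck_on :: "nat \<Rightarrow> ('a::real_normed_vector \<Rightarrow> 'b::real_normed_vector) \<Rightarrow> 'a set \<Rightarrow> bool"
  where
    "Ck_on 0 F S \<longleftrightarrow> continuous_on S F"
  | "Ck_on (Suc k) F S \<longleftrightarrow>
       (\<forall>x\<in>S. F differentiable (at x)) \<and> (\<forall>v. Ck_on k (\<lambda>x. ddir F x v) S)"

definition smooth_on :: "('a::real_normed_vector \<Rightarrow> 'b::real_normed_vector) \<Rightarrow> 'a set \<Rightarrow> bool"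
  where "smooth_on F S \<longleftrightarrow> (\<forall>k. Ck_on k F S)"

definition cJ :: "complex^'n \<Rightarrow> complex^'n"
  where "cJ v = \<i> *s v"

definition hol_map_on :: "(complex^'n \<Rightarrow> complex^'m) \<Rightarrow> (complex^'n) set \<Rightarrow> bool"
  where "hol_map_on F S \<longleftrightarrow>
    (\<forall>x\<in>S. F differentiable (at x) \<and> (\<forall>v. ddir F x (cJ v) = cJ (ddir F x v)))"


section \<open>Riemannian geometry in a coordinate domain\<close>

text \<open>
  A metric on an open subset of a Euclidean space is written \<open>h x u v\<close>; tangent vectors are
  elements of the Euclidean space. All covariant derivatives below are taken of vector fields
  that are constant in the coordinates, so that their Lie brackets vanish.
\<close>

text \<open>The Levi-Civita connection \<open>\<nabla>\<^sub>u v\<close>, given by the Koszul formula.\<close>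

definition christoffel ::
  "('e::euclidean_space \<Rightarrow> 'e \<Rightarrow> 'e \<Rightarrow> real) \<Rightarrow> 'e \<Rightarrow> 'e \<Rightarrow> 'e \<Rightarrow> 'e"
  where "christoffel h x u v =
    (THE z. \<forall>w. 2 * h x z w =
        ddir (\<lambda>y. h y v w) x u + ddir (\<lambda>y. h y u w) x v - ddir (\<lambda>y. h y u v) x w)"

text \<open>\<open>R(u,v)w = \<nabla>\<^sub>u \<nabla>\<^sub>v w - \<nabla>\<^sub>v \<nabla>\<^sub>u w\<close>\<close>

definition riemann ::
  "('e::euclidean_space \<Rightarrow> 'e \<Rightarrow> 'e \<Rightarrow> real) \<Rightarrow> 'e \<Rightarrow> 'e \<Rightarrow> 'e \<Rightarrow> 'e \<Rightarrow> 'e"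
  where "riemann h x u v w =
      (ddir (\<lambda>y. christoffel h y v w) x u + christoffel h x u (christoffel h x v w))
    - (ddir (\<lambda>y. christoffel h y u w) x v + christoffel h x v (christoffel h x u w))"

text \<open>The trace of \<open>u \<mapsto> R(u,v)w\<close>; being a trace, it does not depend on the basis used.\<close>

definition ricci :: "('e::euclidean_space \<Rightarrow> 'e \<Rightarrow> 'e \<Rightarrow> real) \<Rightarrow> 'e \<Rightarrow> 'e \<Rightarrow> 'e \<Rightarrow> real"
  where "ricci h x v w = (\<Sum>b\<in>Basis. riemann h x b v w \<bullet> b)"

definition sectional_curvature ::
  "('e::euclidean_space \<Rightarrow> 'e \<Rightarrow> 'e \<Rightarrow> real) \<Rightarrow> 'e \<Rightarrow> 'e \<Rightarrow> 'e \<Rightarrow> real"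
  where "sectional_curvature h x u v =
    h x (riemann h x u v v) u / (h x u u * h x v v - (h x u v)\<^sup>2)"

text \<open>\<open>(L\<^sub>X h)(u,v) = X(h(u,v)) - h([X,u],v) - h(u,[X,v])\<close>, where \<open>[X,u] = - DX(u)\<close> for constant \<open>u\<close>.\<close>

definition lie_metric ::
  "('e::euclidean_space \<Rightarrow> 'e) \<Rightarrow> ('e \<Rightarrow> 'e \<Rightarrow> 'e \<Rightarrow> real) \<Rightarrow> 'e \<Rightarrow> 'e \<Rightarrow> 'e \<Rightarrow> real"
  where "lie_metric X h x u v =
    ddir (\<lambda>y. h y u v) x (X x) + h x (ddir X x u) v + h x u (ddir X x v)"

text \<open>
  The second fundamental form \<open>\<nabla>\<^bsup>k\<^esup>\<^sub>u (dF v) - dF (\<nabla>\<^bsup>h\<^esup>\<^sub>u v)\<close> of a map \<open>F\<close> between coordinate domains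
  with metrics \<open>h\<close> and \<open>k\<close> (for isometric immersions, this is the Gauss formula).
\<close>

definition second_fundamental_form ::
  "('d::euclidean_space \<Rightarrow> 'd \<Rightarrow> 'd \<Rightarrow> real) \<Rightarrow> ('e::euclidean_space \<Rightarrow> 'e \<Rightarrow> 'e \<Rightarrow> real)
    \<Rightarrow> ('d \<Rightarrow> 'e) \<Rightarrow> 'd \<Rightarrow> 'd \<Rightarrow> 'd \<Rightarrow> 'e"
  where "second_fundamental_form h k F x u v =
      ddir (\<lambda>y. ddir F y v) x u + christoffel k (F x) (ddir F x u) (ddir F x v)
    - ddir F x (christoffel h x u v)"


section \<open>Complex manifolds, Kaehler metrics and holomorphic vector fields\<close>

text \<open>A chart is a pair of its domain and a map, which is irrelevant outside the domain.\<close>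

type_synonym ('m, 'n) chart = "'m set \<times> ('m \<Rightarrow> complex^'n)"

abbreviation chart_dom :: "('m, 'n) chart \<Rightarrow> 'm set"
  where "chart_dom \<equiv> fst"

abbreviation chart_map :: "('m, 'n) chart \<Rightarrow> 'm \<Rightarrow> complex^'n"
  where "chart_map \<equiv> snd"

definition local_rep ::
  "('m, 'n::finite) chart \<Rightarrow> ('p, 'q::finite) chart \<Rightarrow> ('m \<Rightarrow> 'p) \<Rightarrow> complex^'n \<Rightarrow> complex^'q"
  where "local_rep a b f = chart_map b \<circ> f \<circ> inv_into (chart_dom a) (chart_map a)"

definition local_dom ::
  "('m, 'n::finite) chart \<Rightarrow> ('p, 'q::finite) chart \<Rightarrow> ('m \<Rightarrow> 'p) \<Rightarrow> (complex^'n) set"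
  where "local_dom a b f = chart_map a ` {p \<in> chart_dom a. f p \<in> chart_dom b}"

definition complex_manifold :: "'m topology \<Rightarrow> ('m, 'n::finite) chart set \<Rightarrow> bool"
  where "complex_manifold M A \<longleftrightarrow>
    Hausdorff_space M \<and> second_countable M \<and>
    \<Union> (chart_dom ` A) = topspace M \<and>
    (\<forall>a\<in>A. openin M (chart_dom a) \<and> open (chart_map a ` chart_dom a) \<and>
        homeomorphic_map (subtopology M (chart_dom a)) (top_of_set (chart_map a ` chart_dom a))
          (chart_map a)) \<and>
    (\<forall>a\<in>A. \<forall>b\<in>A. hol_map_on (local_rep a b id) (local_dom a b id))"

text \<open>
  Tensor fields are given by their components in the charts of the atlas, subject to the usual
  transformation law under changes of charts. A component is only relevant on the image of its
  chart. A tangent vector is identified with the element of \<open>\<complex>\<^sup>n\<close> representing it, regarded as a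
  real vector.
\<close>

type_synonym ('m, 'n) metric =
  "('m, 'n) chart \<Rightarrow> complex^'n \<Rightarrow> complex^'n \<Rightarrow> complex^'n \<Rightarrow> real"

type_synonym ('m, 'n) vfield = "('m, 'n) chart \<Rightarrow> complex^'n \<Rightarrow> complex^'n"

definition riemannian_metric :: "('m, 'n::finite) chart set \<Rightarrow> ('m, 'n) metric \<Rightarrow> bool"
  where "riemannian_metric A g \<longleftrightarrow>
    (\<forall>a\<in>A. (\<forall>u v. smooth_on (\<lambda>x. g a x u v) (chart_map a ` chart_dom a)) \<and>
        (\<forall>x \<in> chart_map a ` chart_dom a. bilinear (g a x) \<and>
            (\<forall>u v. g a x u v = g a x v u) \<and> (\<forall>u. u \<noteq> 0 \<longrightarrow> g a x u u > 0))) \<and>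
    (\<forall>a\<in>A. \<forall>b\<in>A. \<forall>x \<in> local_dom a b id. \<forall>u v.
        g a x u v = g b (local_rep a b id x) (ddir (local_rep a b id) x u) (ddir (local_rep a b id) x v))"

text \<open>The Kaehler form is \<open>\<omega>(u,v) = g(Ju,v)\<close>.\<close>

definition kaehler_metric :: "('m, 'n::finite) chart set \<Rightarrow> ('m, 'n) metric \<Rightarrow> bool"
  where "kaehler_metric A g \<longleftrightarrow> riemannian_metric A g \<and>
    (\<forall>a\<in>A. \<forall>x \<in> chart_map a ` chart_dom a.
        (\<forall>u v. g a x (cJ u) (cJ v) = g a x u v) \<and>
        (\<forall>u v w. ddir (\<lambda>y. g a y (cJ v) w) x u + ddir (\<lambda>y. g a y (cJ w) u) x v
                 + ddir (\<lambda>y. g a y (cJ u) v) x w = 0))"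

text \<open>
  The component \<open>\<zeta>\<close> of such a field stands for the real vector field
  \<open>\<Sum>\<^sub>j (\<zeta>\<^sub>j \<partial>/\<partial>z\<^sub>j + cnj \<zeta>\<^sub>j \<partial>/\<partial>(cnj z\<^sub>j))\<close>, the real part of \<open>2 \<Sum>\<^sub>j \<zeta>\<^sub>j \<partial>/\<partial>z\<^sub>j\<close>.
\<close>

definition holomorphic_vfield :: "('m, 'n::finite) chart set \<Rightarrow> ('m, 'n) vfield \<Rightarrow> bool"
  where "holomorphic_vfield A X \<longleftrightarrow>
    (\<forall>a\<in>A. hol_map_on (X a) (chart_map a ` chart_dom a)) \<and>
    (\<forall>a\<in>A. \<forall>b\<in>A. \<forall>x \<in> local_dom a b id.
        X b (local_rep a b id x) = ddir (local_rep a b id) x (X a x))"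

definition kaehler_ricci_soliton ::
  "('m, 'n::finite) chart set \<Rightarrow> ('m, 'n) metric \<Rightarrow> ('m, 'n) vfield \<Rightarrow> bool"
  where "kaehler_ricci_soliton A g X \<longleftrightarrow>
    kaehler_metric A g \<and> holomorphic_vfield A X \<and>
    (\<exists>l::real. \<forall>a\<in>A. \<forall>x \<in> chart_map a ` chart_dom a. \<forall>u v.
        ricci (g a) x u v = l * g a x u v + lie_metric (X a) (g a) x u v)"


section \<open>Complex space forms and Kaehler immersions\<close>

definition complex_space_form ::
  "'m topology \<Rightarrow> ('m, 'n::finite) chart set \<Rightarrow> ('m, 'n) metric \<Rightarrow> real \<Rightarrow> bool"
  where "complex_space_form M A g \<kappa> \<longleftrightarrow>
    complex_manifold M A \<and> kaehler_metric A g \<and>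
    (\<forall>a\<in>A. \<forall>x \<in> chart_map a ` chart_dom a. \<forall>u. u \<noteq> 0 \<longrightarrow>
        sectional_curvature (g a) x u (cJ u) = \<kappa>)"

definition holomorphic_map ::
  "'m topology \<Rightarrow> ('m, 'n::finite) chart set \<Rightarrow> 'p topology \<Rightarrow> ('p, 'q::finite) chart set \<Rightarrow> ('m \<Rightarrow> 'p) \<Rightarrow> bool"
  where "holomorphic_map M A N B f \<longleftrightarrow> continuous_map M N f \<and>
    (\<forall>a\<in>A. \<forall>b\<in>B. hol_map_on (local_rep a b f) (local_dom a b f))"

definition kaehler_immersion ::
  "'m topology \<Rightarrow> ('m, 'n::finite) chart set \<Rightarrow> ('m, 'n) metric \<Rightarrow>
   'p topology \<Rightarrow> ('p, 'q::finite) chart set \<Rightarrow> ('p, 'q) metric \<Rightarrow> ('m \<Rightarrow> 'p) \<Rightarrow> bool"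
  where "kaehler_immersion M A g N B h f \<longleftrightarrow> holomorphic_map M A N B f \<and>
    (\<forall>a\<in>A. \<forall>b\<in>B. \<forall>x \<in> local_dom a b f. \<forall>u v.
        g a x u v = h b (local_rep a b f x) (ddir (local_rep a b f) x u) (ddir (local_rep a b f) x v))"

definition totally_geodesic ::
  "('m, 'n::finite) chart set \<Rightarrow> ('m, 'n) metric \<Rightarrow> ('p, 'q::finite) chart set \<Rightarrow> ('p, 'q) metric \<Rightarrow>
   ('m \<Rightarrow> 'p) \<Rightarrow> bool"
  where "totally_geodesic A g B h f \<longleftrightarrow>
    (\<forall>a\<in>A. \<forall>b\<in>B. \<forall>x \<in> local_dom a b f. \<forall>u v.
        second_fundamental_form (g a) (h b) (local_rep a b f) x u v = 0)"

end

theory Submission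
  imports Defs "HOL-Complex_Analysis.Complex_Analysis" "HOL-Library.Function_Algebras"
begin

text \<open>
  The question is local, and by the Gauss equation it is one of sign. Let \<open>F\<close> be the immersion in a
  chart, \<open>\<sigma>\<close> its second fundamental form, \<open>\<kappa> = - c / 2 \<ge> 0\<close>, and restrict everything to a complex line
  \<open>z \<mapsto> x\<^sub>0 + z v\<close>. With \<open>\<tau>\<close> the trace of the Chern connection \<open>\<Gamma>(v, \<cdot>)\<close> of \<open>g\<close>, i.e. the logarithmic
  derivative of \<open>det g\<close>, the Gauss equation gives \<open>\<partial>bar \<tau> = (n + 1) \<kappa> |v|\<^sup>2 + t\<close> with
  \<open>t = \<Sum>\<^sub>i |\<sigma>(v, E\<^sub>i)|\<^sup>2 \<ge> 0\<close> for an orthonormal frame \<open>E\<close> (\<open>ricci_trace\<close>), and the soliton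
  equation, with constant \<open>l\<close>, says \<open>\<partial>bar \<tau> = - (l / 2) |v|\<^sup>2 - Re \<partial> \<langle>X, v\<rangle>\<close>. It remains to show \<open>t \<le> 0\<close>.

  The ambient geometry is flat, if \<open>\<kappa> > 0\<close> after adding one dimension. If \<open>\<kappa> = 0\<close>, parallel transport along the
  line identifies the metric with a constant Hermitian form on \<open>\<complex>\<^sup>N\<close>. If \<open>\<kappa> > 0\<close>, the holomorphic
  projective structure of the space form gives a flat holomorphic connection on a bundle of rank
  \<open>N + 1\<close> that preserves an indefinite Hermitian form (\<open>L_derivative\<close>); it replaces the hyperboloid
  model of complex hyperbolic space. In a parallel frame (\<open>parallel_frame\<close>) \<open>det g\<close>, the
  exponential of a Kaehler potential and the soliton potential are expressed by \<open>P(z, cnj z)\<close>,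
  \<open>H(z, cnj z)\<close> and \<open>(R / H)(z, cnj z)\<close>, with kernels that are finite sums \<open>\<Sum> a\<^sub>i(z) b\<^sub>i(w)\<close>, and
  the soliton equation turns into
  \<open>P\<^sub>z / P - s H\<^sub>z / H + (R / H)\<^sub>z = E(z)\<close> with \<open>s = n + 1 + l / (2 \<kappa>)\<close> and \<open>E\<close> holomorphic. By
  polarisation it holds for independent \<open>z\<close> and \<open>w\<close>.

  The heart of the proof is that this equation is rigid (\<open>kernel_equation_rigidity\<close>): \<open>(R / H)\<^sub>z\<close> does
  not depend on \<open>w\<close>, and \<open>s\<close> is a nonnegative rational number unless \<open>H\<close> is trivial. The coefficient
  functions \<open>b\<^sub>i\<close> generate an algebra of functions of \<open>w\<close>, and the equation survives the
  replacement of evaluation at \<open>w\<close> by any character of this algebra. An element with infinite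
  range of a finitely generated algebra takes arbitrarily large values on characters (\<open>character_unbounded\<close>, a
  form of the Nullstellensatz). On the other hand the solutions of the equation in a finite
  dimensional space of holomorphic functions can be normalised and have convergent subsequences; the
  limits show that the Taylor coefficients of \<open>(R / H)\<^sub>z\<close> are bounded on characters
  (\<open>quotient_derivatives_bounded\<close>), so they are constant, and comparing orders of vanishing in a limit
  with \<open>H(0) = 0\<close> gives \<open>s \<ge> 0\<close> (\<open>exponent_is_ratio_of_orders\<close>).

  Since \<open>(R / H)\<^sub>z\<close> is holomorphic on the diagonal, \<open>Re \<partial> \<langle>X, v\<rangle> = 0\<close>, and so
  \<open>t = - \<kappa> s |v|\<^sup>2 \<le> 0\<close>. For \<open>\<kappa> = 0\<close> the same argument with \<open>H = 1\<close> gives \<open>\<partial>bar \<tau> = 0\<close>, which is \<open>t = 0\<close>.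
\<close>

no_notation fps_nth (infixl "$" 75)

section \<open>Characters of finitely generated function algebras\<close>

interpretation fvs: vector_space "\<lambda>(c::complex) (f::'w \<Rightarrow> complex) x. c * f x"
  by unfold_locales (auto simp: fun_eq_iff algebra_simps)

primrec monomials :: "('w \<Rightarrow> complex) set \<Rightarrow> nat \<Rightarrow> ('w \<Rightarrow> complex) set" where
  "monomials S 0 = {1}"
| "monomials S (Suc n) = monomials S n \<union> (\<lambda>(g, p). g * p) ` (S \<times> monomials S n)"

definition falg :: "('w \<Rightarrow> complex) set \<Rightarrow> ('w \<Rightarrow> complex) set"
  where "falg S = (\<Union>n. fvs.span (monomials S n))"

lemma finite_monomials: "finite S \<Longrightarrow> finite (monomials S n)"
  by (induction n) auto

lemma monomials_mono: "m \<le> n \<Longrightarrow> monomials S m \<subseteq> monomials S n"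
  by (induction rule: dec_induct) auto

lemma span_monomials_mono: "m \<le> n \<Longrightarrow> fvs.span (monomials S m) \<subseteq> fvs.span (monomials S n)"
  by (intro fvs.span_mono monomials_mono)

lemma monomials_mult: "p \<in> monomials S m \<Longrightarrow> q \<in> monomials S n \<Longrightarrow> p * q \<in> monomials S (m + n)"
proof (induction m arbitrary: p)
  case 0
  then show ?case by simp
next
  case (Suc m)
  from Suc.prems(1) consider "p \<in> monomials S m" | g p' where "g \<in> S" "p' \<in> monomials S m" "p = g * p'"
    by auto
  then show ?case
  proof cases
    case 1
    with Suc show ?thesis by auto
  next
    case 2
    with Suc have "p' * q \<in> monomials S (m + n)" by blast
    with 2 have "g * (p' * q) \<in> (\<lambda>(g, p). g * p) ` (S \<times> monomials S (m + n))" by force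
    then have "p * q \<in> (\<lambda>(g, p). g * p) ` (S \<times> monomials S (m + n))"
      by (simp only: 2(3) mult.assoc)
    then show ?thesis by (simp only: monomials.simps add_Suc Un_iff simp_thms)
  qed
qed

lemma span_times:
  assumes "\<And>a b. a \<in> A \<Longrightarrow> b \<in> B \<Longrightarrow> a * b \<in> fvs.span C" and x: "x \<in> fvs.span A" and y: "y \<in> fvs.span B"
  shows "x * y \<in> fvs.span C"
proof -
  have *: "a * y \<in> fvs.span C" if "a \<in> A" for a
    using y
  proof (induction rule: fvs.span_induct_alt)
    case base
    show ?case using fvs.span_zero[of C] by (simp only: mult_zero_left mult_zero_right)
  next
    case (step c b y)
    have "a * ((\<lambda>x. c * b x) + y) = (\<lambda>x. c * (a * b) x) + a * y"
      by (auto simp: fun_eq_iff algebra_simps)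
    with step assms(1)[OF that step(1)] show ?case by (metis fvs.span_add fvs.span_scale)
  qed
  show ?thesis
    using x
  proof (induction rule: fvs.span_induct_alt)
    case base
    show ?case using fvs.span_zero[of C] by (simp only: mult_zero_left mult_zero_right)
  next
    case (step c b x)
    have "((\<lambda>x. c * b x) + x) * y = (\<lambda>x. c * (b * y) x) + x * y"
      by (auto simp: fun_eq_iff algebra_simps)
    with step *[OF step(1)] show ?case by (metis fvs.span_add fvs.span_scale)
  qed
qed

lemma falg_mult: assumes "x \<in> falg S" "y \<in> falg S" shows "x * y \<in> falg S"
proof -
  obtain m n where "x \<in> fvs.span (monomials S m)" "y \<in> fvs.span (monomials S n)"
    using assms by (auto simp: falg_def)
  then have "x * y \<in> fvs.span (monomials S (m + n))"
    by (rule span_times[rotated]) (auto intro: fvs.span_base monomials_mult)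
  then show ?thesis by (auto simp: falg_def)
qed

lemma falg_add: assumes "x \<in> falg S" "y \<in> falg S" shows "x + y \<in> falg S"
proof -
  obtain m n where "x \<in> fvs.span (monomials S m)" "y \<in> fvs.span (monomials S n)"
    using assms by (auto simp: falg_def)
  then have "x + y \<in> fvs.span (monomials S (max m n))"
    using span_monomials_mono[of m "max m n" S] span_monomials_mono[of n "max m n" S] by (auto intro: fvs.span_add)
  then show ?thesis by (auto simp: falg_def)
qed

lemma falg_const: "(\<lambda>_. c) \<in> falg S"
proof -
  have "(\<lambda>x. c * (1 :: 'a \<Rightarrow> complex) x) \<in> fvs.span (monomials S 0)"
    by (intro fvs.span_scale fvs.span_base) (simp only: monomials.simps insertI1)
  then have "(\<lambda>_. c) \<in> fvs.span (monomials S 0)" by (simp only: one_fun_apply mult_1_right)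
  then show ?thesis unfolding falg_def by blast
qed

lemma falg_scale: "x \<in> falg S \<Longrightarrow> (\<lambda>w. c * x w) \<in> falg S"
  using falg_mult[OF falg_const[of c S]] by (simp add: times_fun_def)

lemma falg_base: assumes "g \<in> S" shows "g \<in> falg S"
proof -
  have "g \<in> monomials S 1" using assms by (auto intro!: image_eqI[where x = "(g, 1)"])
  then show ?thesis unfolding falg_def using fvs.span_base by blast
qed

lemma falg_diff: "x \<in> falg S \<Longrightarrow> y \<in> falg S \<Longrightarrow> x - y \<in> falg S"
  using falg_add[OF _ falg_scale[of y S "-1"], of x] by (simp add: fun_diff_def plus_fun_def)

lemma falg_sum: "(\<And>i. i \<in> I \<Longrightarrow> x i \<in> falg S) \<Longrightarrow> (\<lambda>w. \<Sum>i\<in>I. x i w) \<in> falg S"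
  using falg_add falg_const
  by (induction I rule: infinite_finite_induct) (fastforce simp: plus_fun_def)+

lemma falg_poly: "a \<in> falg S \<Longrightarrow> (\<lambda>x. poly p (a x)) \<in> falg S"
proof (induction p)
  case 0
  then show ?case using falg_const[of 0] by simp
next
  case (pCons c p)
  then have "(\<lambda>_. c) + a * (\<lambda>x. poly p (a x)) \<in> falg S" by (intro falg_add falg_mult falg_const)
  then show ?case by (simp add: plus_fun_def times_fun_def)
qed

text \<open>The algebra is the increasing union of countably many finite dimensional spaces, so one of
  them contains infinitely many members of an uncountable family.\<close>

lemma falg_uncountable_dependent:
  assumes fin: "finite S" and M: "uncountable M" and y: "\<And>\<mu>. \<mu> \<in> M \<Longrightarrow> y \<mu> \<in> falg S"
    and inj: "inj_on y M"
  shows "\<exists>t u \<mu>0. finite t \<and> t \<subseteq> M \<and> \<mu>0 \<in> t \<and> u \<mu>0 \<noteq> 0 \<and> (\<forall>x. (\<Sum>\<mu>\<in>t. u \<mu> * y \<mu> x) = 0)"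
proof -
  have "M = (\<Union>n. {\<mu> \<in> M. y \<mu> \<in> fvs.span (monomials S n)})"
    using y by (auto simp: falg_def)
  then have "\<not> (\<forall>n. finite {\<mu> \<in> M. y \<mu> \<in> fvs.span (monomials S n)})"
    using M countable_UN[of "UNIV::nat set" "\<lambda>n. {\<mu> \<in> M. y \<mu> \<in> fvs.span (monomials S n)}"]
    by (auto dest: countable_finite)
  then obtain n where n: "infinite {\<mu> \<in> M. y \<mu> \<in> fvs.span (monomials S n)}" by blast
  define M' where "M' = {\<mu> \<in> M. y \<mu> \<in> fvs.span (monomials S n)}"
  have inj': "inj_on y M'" using inj by (auto simp: M'_def inj_on_def)
  have "infinite (y ` M')" using n inj' finite_imageD M'_def by blast
  then have "fvs.dependent (y ` M')"
    using fvs.independent_span_bound[OF finite_monomials[OF fin, of n], of "y ` M'"]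
    by (auto simp: M'_def)
  then obtain T U v where T: "finite T" "T \<subseteq> y ` M'" "(\<Sum>v\<in>T. (\<lambda>x. U v * v x)) = 0" "v \<in> T" "U v \<noteq> 0"
    unfolding fvs.dependent_explicit by blast
  obtain t where t: "t \<subseteq> M'" "T = y ` t" using T(2) subset_imageE by metis
  have injt: "inj_on y t" using inj' t(1) inj_on_subset by blast
  obtain \<mu>0 where \<mu>0: "\<mu>0 \<in> t" "v = y \<mu>0" using T(4) t(2) by blast
  have fint: "finite t" using T(1) t(2) injt finite_imageD by blast
  have sumapp: "(\<Sum>v\<in>T. (\<lambda>x. U v * v x)) x = (\<Sum>v\<in>T. U v * v x)" for x
    using T(1) by (induction T rule: finite_induct) auto
  have "(\<Sum>\<mu>\<in>t. U (y \<mu>) * y \<mu> x) = 0" for x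
    using sumapp[of x] T(3) t(2) sum.reindex[OF injt, of "\<lambda>v. U v * v x"] by simp
  then show ?thesis
    using fint t(1) \<mu>0 T(5) by (intro exI[of _ t] exI[of _ "\<lambda>\<mu>. U (y \<mu>)"] exI[of _ \<mu>0]) (auto simp: M'_def)
qed

text \<open>Clearing denominators in a dependency between the functions \<open>1 / (a - \<mu>)\<close> gives a polynomial
  relation for \<open>a\<close>.\<close>

lemma resolvent_relation:
  fixes u :: "complex \<Rightarrow> complex"
  assumes "finite t" "\<mu>0 \<in> t" "u \<mu>0 \<noteq> 0"
  obtains q where "q \<noteq> 0" "\<And>c. poly q c = (\<Sum>\<mu>\<in>t. u \<mu> * (\<Prod>\<nu>\<in>t - {\<mu>}. c - \<nu>))"
proof
  define q where "q = (\<Sum>\<mu>\<in>t. smult (u \<mu>) (\<Prod>\<nu>\<in>t - {\<mu>}. [:-\<nu>, 1:]))"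
  show eq: "poly q c = (\<Sum>\<mu>\<in>t. u \<mu> * (\<Prod>\<nu>\<in>t - {\<mu>}. c - \<nu>))" for c
    by (simp add: q_def poly_sum poly_prod)
  have "(\<Sum>\<mu>\<in>t. u \<mu> * (\<Prod>\<nu>\<in>t - {\<mu>}. \<mu>0 - \<nu>)) = (\<Sum>\<mu>\<in>{\<mu>0}. u \<mu> * (\<Prod>\<nu>\<in>t - {\<mu>}. \<mu>0 - \<nu>))"
    using assms by (intro sum.mono_neutral_right) (auto simp: prod_zero_iff)
  also have "\<dots> \<noteq> 0" using assms by (auto simp: prod_zero_iff)
  finally show "q \<noteq> 0" using eq[of \<mu>0] by auto
qed

definition proper_ideal :: "('w \<Rightarrow> complex) set \<Rightarrow> ('w \<Rightarrow> complex) set \<Rightarrow> bool" where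
  "proper_ideal R I \<longleftrightarrow> I \<subseteq> R \<and> 0 \<in> I \<and> (\<forall>x\<in>I. \<forall>y\<in>I. x + y \<in> I) \<and> (\<forall>x\<in>I. \<forall>y\<in>R. y * x \<in> I) \<and> 1 \<notin> I"

definition character :: "('w \<Rightarrow> complex) set \<Rightarrow> (('w \<Rightarrow> complex) \<Rightarrow> complex) \<Rightarrow> bool" where
  "character R ch \<longleftrightarrow> (\<forall>c. ch (\<lambda>_. c) = c) \<and>
     (\<forall>x\<in>R. \<forall>y\<in>R. ch (x + y) = ch x + ch y \<and> ch (x * y) = ch x * ch y)"

lemma maximal_ideal_exists:
  assumes "proper_ideal R I0"
  obtains I where "proper_ideal R I" "I0 \<subseteq> I" "\<And>J. proper_ideal R J \<Longrightarrow> I \<subseteq> J \<Longrightarrow> J = I"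
proof -
  have "\<exists>M\<in>{I. proper_ideal R I \<and> I0 \<subseteq> I}. \<forall>X\<in>{I. proper_ideal R I \<and> I0 \<subseteq> I}. M \<subseteq> X \<longrightarrow> X = M"
  proof (rule subset_Zorn_nonempty)
    show "{I. proper_ideal R I \<and> I0 \<subseteq> I} \<noteq> {}" using assms by auto
    fix \<C> assume ne: "\<C> \<noteq> {}" and ch: "subset.chain {I. proper_ideal R I \<and> I0 \<subseteq> I} \<C>"
    have all: "\<And>J. J \<in> \<C> \<Longrightarrow> proper_ideal R J \<and> I0 \<subseteq> J" using ch by (auto simp: subset.chain_def)
    have add: "x + y \<in> \<Union>\<C>" if "x \<in> \<Union>\<C>" "y \<in> \<Union>\<C>" for x y
    proof -
      from that obtain J K where JK: "J \<in> \<C>" "x \<in> J" "K \<in> \<C>" "y \<in> K" by blast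
      then have "J \<subseteq> K \<or> K \<subseteq> J" using ch unfolding subset.chain_def by blast
      then show ?thesis using JK all unfolding proper_ideal_def by blast
    qed
    show "\<Union>\<C> \<in> {I. proper_ideal R I \<and> I0 \<subseteq> I}"
      using ne all add unfolding proper_ideal_def by blast
  qed
  then show ?thesis using that by auto
qed

text \<open>Modulo a maximal ideal every nonzero element is invertible, as the ideal generated with it is everything.\<close>

lemma maximal_ideal_inverse:
  assumes R: "R = falg S" and I: "proper_ideal R I" and max: "\<And>J. proper_ideal R J \<Longrightarrow> I \<subseteq> J \<Longrightarrow> J = I"
    and a: "a \<in> R" "a \<notin> I"
  shows "\<exists>y\<in>R. y * a - 1 \<in> I"
proof (rule ccontr)
  assume no: "\<not> ?thesis"
  have neg: "- x \<in> I" if "x \<in> I" for x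
  proof -
    have "(\<lambda>_. -1) * x \<in> I" using that I falg_const unfolding proper_ideal_def R by blast
    then show ?thesis by (simp add: times_fun_def fun_Compl_def)
  qed
  define J where "J = {x + y * a |x y. x \<in> I \<and> y \<in> R}"
  have "1 \<notin> J"
  proof
    assume "1 \<in> J"
    then obtain x y where xy: "x \<in> I" "y \<in> R" "1 = x + y * a" by (auto simp: J_def)
    then have "y * a - 1 = - x" by (simp add: algebra_simps)
    with xy neg no show False by metis
  qed
  moreover have "I \<subseteq> J"
  proof
    fix x assume "x \<in> I"
    moreover have "0 \<in> R" using falg_const[of 0] by (simp add: R zero_fun_def)
    moreover have "x = x + 0 * a" by simp
    ultimately show "x \<in> J" unfolding J_def by blast
  qed
  moreover have "x + y \<in> J" if xy: "x \<in> J" "y \<in> J" for x y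
  proof -
    obtain p q p' q' where pq: "p \<in> I" "q \<in> R" "p' \<in> I" "q' \<in> R" "x = p + q * a" "y = p' + q' * a"
      using xy by (auto simp: J_def)
    then have "x + y = (p + p') + (q + q') * a" by (simp add: algebra_simps)
    moreover have "p + p' \<in> I" "q + q' \<in> R" using pq I falg_add by (auto simp: proper_ideal_def R)
    ultimately show ?thesis by (auto simp: J_def)
  qed
  moreover have "y * x \<in> J" if xy: "x \<in> J" "y \<in> R" for x y
  proof -
    obtain p q where pq: "p \<in> I" "q \<in> R" "x = p + q * a"
      using xy by (auto simp: J_def)
    then have "y * x = y * p + (y * q) * a" by (simp add: algebra_simps)
    moreover have "y * p \<in> I" "y * q \<in> R" using xy pq I falg_mult by (auto simp: proper_ideal_def R)
    ultimately show ?thesis by (auto simp: J_def)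
  qed
  moreover have "J \<subseteq> R"
    using I a(1) by (auto simp: J_def proper_ideal_def R intro!: falg_add falg_mult)
  moreover have "0 \<in> J" using I \<open>I \<subseteq> J\<close> by (auto simp: proper_ideal_def)
  ultimately have "J = I" by (intro max) (auto simp: proper_ideal_def)
  moreover have "a \<in> J"
  proof -
    have "1 \<in> R" using falg_const[of 1 S] by (simp add: R one_fun_def)
    moreover have "a = 0 + 1 * a" by simp
    ultimately show ?thesis unfolding J_def using I unfolding proper_ideal_def by blast
  qed
  ultimately show False using a(2) by simp
qed

text \<open>The quotient by a maximal ideal is a field of countable dimension over \<open>\<complex>\<close>. If it contained an
  element \<open>a\<close> that is not a scalar, the uncountably many elements \<open>1 / (a - \<mu>)\<close> would be dependent, which
  makes \<open>a\<close> algebraic over \<open>\<complex>\<close> and hence a scalar.\<close>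

lemma maximal_ideal_value:
  assumes fin: "finite S" and R: "R = falg S" and I: "proper_ideal R I"
    and max: "\<And>J. proper_ideal R J \<Longrightarrow> I \<subseteq> J \<Longrightarrow> J = I" and a: "a \<in> R"
  shows "\<exists>\<mu>. a - (\<lambda>_. \<mu>) \<in> I"
proof (rule ccontr)
  assume no: "\<not> ?thesis"
  have diffI: "x - y \<in> I" if "x \<in> I" "y \<in> I" for x y
  proof -
    have "(\<lambda>_. -1) * y \<in> I" using that I falg_const unfolding proper_ideal_def R by blast
    then have "x + (\<lambda>_. -1) * y \<in> I" using that I unfolding proper_ideal_def by blast
    then show ?thesis by (simp add: times_fun_def plus_fun_def fun_diff_def)
  qed
  have "\<exists>y\<in>R. y * (a - (\<lambda>_. \<mu>)) - 1 \<in> I" for \<mu>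
    using maximal_ideal_inverse[OF R I max, of "a - (\<lambda>_. \<mu>)"] no a falg_diff falg_const
    unfolding R by blast
  then obtain y where y: "\<And>\<mu>. y \<mu> \<in> R" "\<And>\<mu>. y \<mu> * (a - (\<lambda>_. \<mu>)) - 1 \<in> I" by metis
  \<comment> \<open>As \<open>\<complex>\<close> is algebraically closed, a polynomial relation for \<open>a\<close> would put some \<open>a - \<nu>\<close> into \<open>I\<close>.\<close>
  have nopoly: "p \<noteq> 0 \<Longrightarrow> (\<lambda>x. poly p (a x)) \<notin> I" for p
  proof (induction "degree p" arbitrary: p)
    case 0
    then obtain c where c: "p = [:c:]" "c \<noteq> 0" by (metis degree_eq_zeroE pCons_0_0)
    show ?case
    proof
      assume "(\<lambda>x. poly p (a x)) \<in> I"
      then have "(\<lambda>_. inverse c) * (\<lambda>x. poly p (a x)) \<in> I"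
        using I falg_const unfolding proper_ideal_def R by blast
      with c I show False by (simp add: times_fun_def proper_ideal_def one_fun_def)
    qed
  next
    case (Suc n)
    then obtain \<nu> where "poly p \<nu> = 0"

      using fundamental_theorem_of_algebra[of "coeff p" "degree p"]
      by (metis (no_types) Suc.hyps(2) Suc.prems atLeastAtMost_iff le_refl leading_coeff_0_iff One_nat_def
          Suc_le_eq zero_less_Suc poly_altdef)
    then obtain r where r: "p = [:-\<nu>, 1:] * r" unfolding poly_eq_0_iff_dvd by (rule dvdE)
    with Suc.prems have "r \<noteq> 0" by auto
    moreover have "degree r = n" using Suc(2) r \<open>r \<noteq> 0\<close> by (simp add: degree_mult_eq del: mult_pCons_left)
    ultimately have rI: "(\<lambda>x. poly r (a x)) \<notin> I" using Suc(1) by blast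
    show ?case
    proof
      assume "(\<lambda>x. poly p (a x)) \<in> I"
      then have 1: "y \<nu> * (\<lambda>x. poly p (a x)) \<in> I" using y(1) I unfolding proper_ideal_def by blast
      have 2: "(\<lambda>x. poly r (a x)) * (y \<nu> * (a - (\<lambda>_. \<nu>)) - 1) \<in> I"
        using y(2) I falg_poly[of a S r] a unfolding proper_ideal_def R by blast
      have "y \<nu> * (\<lambda>x. poly p (a x)) - (\<lambda>x. poly r (a x)) * (y \<nu> * (a - (\<lambda>_. \<nu>)) - 1) = (\<lambda>x. poly r (a x))"
        by (auto simp: r fun_eq_iff algebra_simps)
      with diffI[OF 1 2] rI show False by simp
    qed
  qed
  have "inj y"
  proof (rule injI, rule ccontr)
    fix \<mu> \<nu> assume eq: "y \<mu> = y \<nu>" and ne: "\<mu> \<noteq> \<nu>"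
    have "y \<mu> * (a - (\<lambda>_. \<mu>)) - 1 - (y \<nu> * (a - (\<lambda>_. \<nu>)) - 1) \<in> I" using diffI y(2) by blast
    then have "(\<lambda>_. inverse (\<nu> - \<mu>)) * (y \<mu> * (a - (\<lambda>_. \<mu>)) - 1 - (y \<nu> * (a - (\<lambda>_. \<nu>)) - 1)) \<in> I"
      using I falg_const unfolding proper_ideal_def R by blast
    also have "(\<lambda>_. inverse (\<nu> - \<mu>)) * (y \<mu> * (a - (\<lambda>_. \<mu>)) - 1 - (y \<nu> * (a - (\<lambda>_. \<nu>)) - 1)) = y \<mu>"
    proof
      fix x
      have "y \<mu> x * (a x - \<mu>) - 1 - (y \<nu> x * (a x - \<nu>) - 1) = (\<nu> - \<mu>) * y \<mu> x"
        unfolding eq by (simp add: algebra_simps)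
      then show "((\<lambda>_. inverse (\<nu> - \<mu>)) * (y \<mu> * (a - (\<lambda>_. \<mu>)) - 1 - (y \<nu> * (a - (\<lambda>_. \<nu>)) - 1))) x = y \<mu> x"
        using ne by simp
    qed
    finally have "y \<mu> \<in> I" .
    then have "(a - (\<lambda>_. \<mu>)) * y \<mu> \<in> I" using I a falg_diff falg_const unfolding proper_ideal_def R by blast
    from diffI[OF this y(2)[of \<mu>]] have "1 \<in> I" by (simp add: mult.commute)
    then show False using I by (simp add: proper_ideal_def)
  qed
  have "uncountable (UNIV :: complex set)" by (rule uncountable_UNIV_complex)
  then have "\<exists>t u \<mu>0. finite t \<and> t \<subseteq> UNIV \<and> \<mu>0 \<in> t \<and> u \<mu>0 \<noteq> 0 \<and> (\<forall>x. (\<Sum>\<mu>\<in>t. u \<mu> * y \<mu> x) = 0)"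
    using y(1) R \<open>inj y\<close> by (intro falg_uncountable_dependent[OF fin]) auto
  then obtain t u \<mu>0 where t: "finite t" "\<mu>0 \<in> t" "u \<mu>0 \<noteq> 0" "\<And>x. (\<Sum>\<mu>\<in>t. u \<mu> * y \<mu> x) = 0"
    by (elim exE conjE) blast
  obtain q where q: "q \<noteq> 0" "\<And>c. poly q c = (\<Sum>\<mu>\<in>t. u \<mu> * (\<Prod>\<nu>\<in>t - {\<mu>}. c - \<nu>))"
    using resolvent_relation[of t \<mu>0 u] t(1-3) by blast
  have sumI: "(\<lambda>x. \<Sum>\<mu>\<in>A. b \<mu> x) \<in> I" if "\<And>\<mu>. \<mu> \<in> A \<Longrightarrow> b \<mu> \<in> I" for A and b :: "complex \<Rightarrow> 'a \<Rightarrow> complex"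
    using that I
    by (induction A rule: infinite_finite_induct) (fastforce simp: proper_ideal_def zero_fun_def plus_fun_def)+
  have prodR: "(\<lambda>x. \<Prod>\<nu>\<in>A. a x - \<nu>) \<in> R" for A
    using falg_poly[of a S "\<Prod>\<nu>\<in>A. [:-\<nu>, 1:]"] a by (simp add: R poly_prod)
  have "(\<lambda>x. \<Sum>\<mu>\<in>t. (u \<mu> * (\<Prod>\<nu>\<in>t - {\<mu>}. a x - \<nu>)) * (y \<mu> * (a - (\<lambda>_. \<mu>)) - 1) x) \<in> I"
  proof (rule sumI)
    fix \<mu>
    have "(\<lambda>x. u \<mu> * (\<Prod>\<nu>\<in>t - {\<mu>}. a x - \<nu>)) \<in> R" using falg_scale prodR unfolding R by blast
    then have "(\<lambda>x. u \<mu> * (\<Prod>\<nu>\<in>t - {\<mu>}. a x - \<nu>)) * (y \<mu> * (a - (\<lambda>_. \<mu>)) - 1) \<in> I"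
      using y(2) I unfolding proper_ideal_def by blast
    then show "(\<lambda>x. (u \<mu> * (\<Prod>\<nu>\<in>t - {\<mu>}. a x - \<nu>)) * (y \<mu> * (a - (\<lambda>_. \<mu>)) - 1) x) \<in> I"
      by (simp add: times_fun_def)
  qed
  also have "(\<lambda>x. \<Sum>\<mu>\<in>t. (u \<mu> * (\<Prod>\<nu>\<in>t - {\<mu>}. a x - \<nu>)) * (y \<mu> * (a - (\<lambda>_. \<mu>)) - 1) x) = (\<lambda>x. - poly q (a x))"
  proof
    fix x
    have "(u \<mu> * (\<Prod>\<nu>\<in>t - {\<mu>}. a x - \<nu>)) * (y \<mu> * (a - (\<lambda>_. \<mu>)) - 1) x
        = (\<Prod>\<nu>\<in>t. a x - \<nu>) * (u \<mu> * y \<mu> x) - u \<mu> * (\<Prod>\<nu>\<in>t - {\<mu>}. a x - \<nu>)" if "\<mu> \<in> t" for \<mu>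
    proof -
      have "(\<Prod>\<nu>\<in>t. a x - \<nu>) = (a x - \<mu>) * (\<Prod>\<nu>\<in>t - {\<mu>}. a x - \<nu>)"
        by (rule prod.remove[OF t(1) that])
      then show ?thesis by (simp only:) (simp add: algebra_simps)
    qed
    then have "(\<Sum>\<mu>\<in>t. (u \<mu> * (\<Prod>\<nu>\<in>t - {\<mu>}. a x - \<nu>)) * (y \<mu> * (a - (\<lambda>_. \<mu>)) - 1) x)
       = (\<Prod>\<nu>\<in>t. a x - \<nu>) * (\<Sum>\<mu>\<in>t. u \<mu> * y \<mu> x) - poly q (a x)"
      unfolding q(2) sum_distrib_left sum_subtractf[symmetric] by (intro sum.cong refl)
    then show "(\<Sum>\<mu>\<in>t. (u \<mu> * (\<Prod>\<nu>\<in>t - {\<mu>}. a x - \<nu>)) * (y \<mu> * (a - (\<lambda>_. \<mu>)) - 1) x) = - poly q (a x)"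
      by (simp only: t(4) mult_zero_right diff_0)
  qed
  finally show False using nopoly[of "-q"] q(1) by simp
qed

text \<open>If \<open>a - \<xi>\<close> were invertible for all large \<open>\<xi>\<close>, the same count of dimensions would give a polynomial
  with root \<open>a\<close>, and \<open>a\<close> would have finite range. Otherwise \<open>a - \<xi>\<close> lies in a maximal ideal, and the
  values modulo this ideal form a character that maps \<open>a\<close> to \<open>\<xi>\<close>.\<close>

theorem character_unbounded:
  fixes a :: "'w \<Rightarrow> complex"
  assumes fin: "finite S" and a: "a \<in> falg S" and inf: "infinite (range a)"
  shows "\<exists>ch. character (falg S) ch \<and> norm (ch a) > B"
proof -
  define R where "R = falg S"
  have "\<exists>\<xi>. norm \<xi> > B \<and> (\<forall>y\<in>R. y * (a - (\<lambda>_. \<xi>)) \<noteq> 1)"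
  proof (rule ccontr)
    assume "\<not> ?thesis"
    then obtain y where y: "\<And>\<xi>. norm \<xi> > B \<Longrightarrow> y \<xi> \<in> R \<and> y \<xi> * (a - (\<lambda>_. \<xi>)) = 1" by metis
    then have y': "y \<xi> x * (a x - \<xi>) = 1" if "norm \<xi> > B" for \<xi> x
      using that by (metis fun_diff_def times_fun_apply one_fun_apply)
    have unc: "uncountable {\<xi>::complex. norm \<xi> > B}"
    proof -
      have "ball (of_real (\<bar>B\<bar> + 1)) 1 \<subseteq> {\<xi>::complex. norm \<xi> > B}"
      proof
        fix x :: complex assume "x \<in> ball (of_real (\<bar>B\<bar> + 1)) 1"
        then have "norm (of_real (\<bar>B\<bar> + 1) - x) < 1" by (simp add: dist_norm)
        moreover have "norm (complex_of_real (\<bar>B\<bar> + 1)) = \<bar>B\<bar> + 1" by (simp only: norm_of_real)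
        ultimately have "B < norm x" using norm_triangle_ineq2[of "complex_of_real (\<bar>B\<bar> + 1)" x] by linarith
        then show "x \<in> {\<xi>. norm \<xi> > B}" by simp
      qed
      moreover have "uncountable (ball (complex_of_real (\<bar>B\<bar> + 1)) 1)" by (simp add: uncountable_ball)
      ultimately show ?thesis using countable_subset by blast
    qed
    have inj: "inj_on y {\<xi>. norm \<xi> > B}"
    proof (rule inj_onI)
      fix \<xi> \<mu> assume h: "\<xi> \<in> {\<xi>. B < norm \<xi>}" "\<mu> \<in> {\<xi>. B < norm \<xi>}" "y \<xi> = y \<mu>"
      then have "y \<xi> x * (a x - \<xi>) = 1" "y \<xi> x * (a x - \<mu>) = 1" for x using y' by force+
      then show "\<xi> = \<mu>" by (metis diff_add_cancel mult_cancel_left diff_left_imp_eq add_diff_cancel_left' mult_zero_left zero_neq_one diff_diff_eq2)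
    qed
    have "\<exists>t u \<mu>0. finite t \<and> t \<subseteq> {\<xi>. norm \<xi> > B} \<and> \<mu>0 \<in> t \<and> u \<mu>0 \<noteq> 0 \<and>
        (\<forall>x. (\<Sum>\<mu>\<in>t. u \<mu> * y \<mu> x) = 0)"
      using y R_def by (intro falg_uncountable_dependent[OF fin unc _ inj]) auto
    then obtain t u \<mu>0 where t: "finite t" "t \<subseteq> {\<xi>. norm \<xi> > B}" "\<mu>0 \<in> t" "u \<mu>0 \<noteq> 0"
        "\<And>x. (\<Sum>\<mu>\<in>t. u \<mu> * y \<mu> x) = 0"
      by (elim exE conjE) blast
    obtain q where q: "q \<noteq> 0" "\<And>c. poly q c = (\<Sum>\<mu>\<in>t. u \<mu> * (\<Prod>\<nu>\<in>t - {\<mu>}. c - \<nu>))"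
      using resolvent_relation[of t \<mu>0 u] t(1,3,4) by blast
    have "poly q (a x) = 0" for x
    proof -
      have "u \<mu> * (\<Prod>\<nu>\<in>t - {\<mu>}. a x - \<nu>) = (\<Prod>\<nu>\<in>t. a x - \<nu>) * (u \<mu> * y \<mu> x)" if "\<mu> \<in> t" for \<mu>
      proof -
        have "(\<Prod>\<nu>\<in>t. a x - \<nu>) = (a x - \<mu>) * (\<Prod>\<nu>\<in>t - {\<mu>}. a x - \<nu>)"
          by (rule prod.remove[OF t(1) that])
        then have "(\<Prod>\<nu>\<in>t. a x - \<nu>) * (u \<mu> * y \<mu> x)
            = u \<mu> * (\<Prod>\<nu>\<in>t - {\<mu>}. a x - \<nu>) * (y \<mu> x * (a x - \<mu>))" by (simp only: mult_ac)
        also have "y \<mu> x * (a x - \<mu>) = 1" using y' that t(2) by blast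
        finally show ?thesis by (simp only: mult_1_right)
      qed
      then have "poly q (a x) = (\<Prod>\<nu>\<in>t. a x - \<nu>) * (\<Sum>\<mu>\<in>t. u \<mu> * y \<mu> x)"
        unfolding q(2) sum_distrib_left by (intro sum.cong refl)
      then show ?thesis by (simp only: t(5) mult_zero_right)
    qed
    then have "range a \<subseteq> {c. poly q c = 0}" by auto
    with poly_roots_finite[OF q(1)] inf finite_subset show False by blast
  qed
  then obtain \<xi> where \<xi>: "norm \<xi> > B" "\<And>y. y \<in> R \<Longrightarrow> y * (a - (\<lambda>_. \<xi>)) \<noteq> 1" by blast
  define I0 where "I0 = (\<lambda>y. y * (a - (\<lambda>_. \<xi>))) ` R"
  have bR: "a - (\<lambda>_. \<xi>) \<in> R" using a falg_diff falg_const unfolding R_def by blast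
  have "proper_ideal R I0"
    unfolding proper_ideal_def
  proof (intro conjI ballI)
    show "I0 \<subseteq> R" using bR falg_mult unfolding I0_def R_def by blast
    show "0 \<in> I0" unfolding I0_def R_def using falg_const[of 0 S]
      by (intro image_eqI[of _ _ 0]) (auto simp: zero_fun_def)
    show "1 \<notin> I0" using \<xi>(2) unfolding I0_def by force
    show "x + y \<in> I0" if "x \<in> I0" "y \<in> I0" for x y
    proof -
      from that obtain p q where pq: "p \<in> R" "q \<in> R" "x = p * (a - (\<lambda>_. \<xi>))" "y = q * (a - (\<lambda>_. \<xi>))"
        by (auto simp: I0_def)
      then have "x + y = (p + q) * (a - (\<lambda>_. \<xi>))" by (simp only: distrib_right)
      moreover have "p + q \<in> R" using pq falg_add R_def by blast
      ultimately show ?thesis unfolding I0_def by blast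
    qed
    show "y * x \<in> I0" if "x \<in> I0" "y \<in> R" for x y
    proof -
      from that obtain p where p: "p \<in> R" "x = p * (a - (\<lambda>_. \<xi>))" by (auto simp: I0_def)
      then have "y * x = (y * p) * (a - (\<lambda>_. \<xi>))" by (simp only: mult.assoc)
      moreover have "y * p \<in> R" using p that falg_mult R_def by blast
      ultimately show ?thesis unfolding I0_def by blast
    qed
  qed
  then obtain I where I: "proper_ideal R I" "I0 \<subseteq> I" "\<And>J. proper_ideal R J \<Longrightarrow> I \<subseteq> J \<Longrightarrow> J = I"
    using maximal_ideal_exists by blast
  obtain ch where ch: "\<And>x. x \<in> R \<Longrightarrow> x - (\<lambda>_. ch x) \<in> I"
    using maximal_ideal_value[OF fin R_def I(1,3)] by metis
  have diffI: "x - y \<in> I" if "x \<in> I" "y \<in> I" for x y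
  proof -
    have "(\<lambda>_. -1) * y \<in> I" using that I(1) falg_const unfolding proper_ideal_def R_def by blast
    then have "x + (\<lambda>_. -1) * y \<in> I" using that I(1) unfolding proper_ideal_def by blast
    then show ?thesis by (simp add: times_fun_def plus_fun_def fun_diff_def)
  qed
  have uniq: "ch x = c" if "x \<in> R" "x - (\<lambda>_. c) \<in> I" for x c
  proof (rule ccontr)
    assume ne: "ch x \<noteq> c"
    have "x - (\<lambda>_. c) - (x - (\<lambda>_. ch x)) \<in> I" using diffI ch that by blast
    then have "(\<lambda>_. inverse (ch x - c)) * (x - (\<lambda>_. c) - (x - (\<lambda>_. ch x))) \<in> I"
      using I(1) falg_const unfolding proper_ideal_def R_def by blast
    also have "(\<lambda>_. inverse (ch x - c)) * (x - (\<lambda>_. c) - (x - (\<lambda>_. ch x))) = 1"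
      using ne by (auto simp: fun_eq_iff)
    finally show False using I(1) unfolding proper_ideal_def by blast
  qed
  have "character R ch"
    unfolding character_def
  proof (intro conjI allI ballI)
    fix c show "ch (\<lambda>_. c) = c"
    proof (rule uniq)
      show "(\<lambda>_. c) \<in> R" using falg_const R_def by blast
      have "(\<lambda>_. c) - (\<lambda>_. c) = (0 :: 'w \<Rightarrow> complex)" by simp
      then show "(\<lambda>_. c) - (\<lambda>_. c) \<in> I" using I(1) by (simp only: proper_ideal_def)
    qed
  next
    fix x y assume xy: "x \<in> R" "y \<in> R"
    show "ch (x + y) = ch x + ch y"
    proof (rule uniq)
      show "x + y \<in> R" using xy falg_add R_def by blast
      have "(x - (\<lambda>_. ch x)) + (y - (\<lambda>_. ch y)) \<in> I"
        using ch[OF xy(1)] ch[OF xy(2)] I(1) unfolding proper_ideal_def by blast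
      then show "x + y - (\<lambda>_. ch x + ch y) \<in> I" by (simp add: fun_diff_def plus_fun_def algebra_simps)
    qed
    show "ch (x * y) = ch x * ch y"
    proof (rule uniq)
      show "x * y \<in> R" using xy falg_mult R_def by blast
      have "y * (x - (\<lambda>_. ch x)) \<in> I" "(\<lambda>_. ch x) * (y - (\<lambda>_. ch y)) \<in> I"
        using ch[OF xy(1)] ch[OF xy(2)] I(1) xy falg_const unfolding proper_ideal_def R_def by blast+
      then have "y * (x - (\<lambda>_. ch x)) + (\<lambda>_. ch x) * (y - (\<lambda>_. ch y)) \<in> I"
        using I(1) unfolding proper_ideal_def by blast
      moreover have "y * (x - (\<lambda>_. ch x)) + (\<lambda>_. ch x) * (y - (\<lambda>_. ch y)) = x * y - (\<lambda>_. ch x * ch y)"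
        by (auto simp: fun_eq_iff algebra_simps)
      ultimately show "x * y - (\<lambda>_. ch x * ch y) \<in> I" by simp
    qed
  qed
  moreover have "ch a = \<xi>"
  proof (rule uniq)
    show "a \<in> R" using a R_def by simp
    have "1 * (a - (\<lambda>_. \<xi>)) \<in> I0"
      unfolding I0_def R_def using falg_const[of 1 S] by (intro imageI) (auto simp: one_fun_def)
    then show "a - (\<lambda>_. \<xi>) \<in> I" using I(2) by auto
  qed
  ultimately show ?thesis using \<xi>(1) R_def by blast
qed

section \<open>Quotients of solutions of the log-derivative equation\<close>

lemma zero_of_continuous_punctured:
  fixes f :: "complex \<Rightarrow> complex"
  assumes "continuous_on (ball z \<epsilon>) f" "\<epsilon> > 0" "\<And>w. w \<in> ball z \<epsilon> \<Longrightarrow> w \<noteq> z \<Longrightarrow> f w = 0"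
  shows "f z = 0"
proof -
  have "(f \<longlongrightarrow> f z) (at z)"
    using assms by (metis centre_in_ball continuous_on_eq_continuous_at isContD open_ball)
  moreover have "eventually (\<lambda>w. f w = 0) (at z)"
    unfolding eventually_at using assms by (auto simp: dist_commute intro!: exI[of _ \<epsilon>])
  then have "(f \<longlongrightarrow> 0) (at z)" by (rule tendsto_eventually)
  ultimately show ?thesis using tendsto_unique trivial_limit_at by blast
qed

lemma factor_out_zero:
  assumes f: "f holomorphic_on ball a r" and ne: "z0 \<in> ball a r" "f z0 \<noteq> 0" and z: "z \<in> ball a r"
  shows "\<exists>n g \<epsilon>. \<epsilon> > 0 \<and> ball z \<epsilon> \<subseteq> ball a r \<and> g holomorphic_on ball z \<epsilon> \<and>
    (\<forall>w\<in>ball z \<epsilon>. f w = (w - z) ^ n * g w \<and> g w \<noteq> 0) \<and> (f z = 0 \<longrightarrow> n > 0)"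
proof (cases "f z = 0")
  case False
  have "open {w \<in> ball a r. f w \<in> - {0}}"
    using continuous_open_preimage[OF holomorphic_on_imp_continuous_on[OF f] open_ball, of "- {0}"]
    by (simp add: vimage_def Int_def open_Compl)
  then obtain \<epsilon> where "\<epsilon> > 0" "ball z \<epsilon> \<subseteq> {w \<in> ball a r. f w \<in> - {0}}"
    using False z openE[of "{w \<in> ball a r. f w \<in> - {0}}" z] by auto
  then show ?thesis
    using False f holomorphic_on_subset[OF f, of "ball z \<epsilon>"]
    by (intro exI[of _ "0::nat"] exI[of _ f] exI[of _ \<epsilon>]) (auto simp: subset_eq)
next
  case True
  have "\<not> f constant_on ball a r"
    using True ne z unfolding constant_on_def by metis
  then obtain g \<epsilon> n where "0 < n" "0 < \<epsilon>" "ball z \<epsilon> \<subseteq> ball a r" "g holomorphic_on ball z \<epsilon>"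
      "\<And>w. w \<in> ball z \<epsilon> \<Longrightarrow> f w = (w - z) ^ n * g w" "\<And>w. w \<in> ball z \<epsilon> \<Longrightarrow> g w \<noteq> 0"
    by (rule holomorphic_factor_zero_nonconstant[OF f open_ball connected_ball z True]) blast
  then show ?thesis by blast
qed

text \<open>The logarithmic derivative of \<open>(w - z)^n g\<close>, with denominators cleared.\<close>

lemma deriv_factor:
  assumes "g holomorphic_on ball z \<epsilon>" "\<And>w. w \<in> ball z \<epsilon> \<Longrightarrow> f w = (w - z) ^ n * g w" "w \<in> ball z \<epsilon>"
  shows "(w - z) * deriv f w = (w - z) ^ n * (of_nat n * g w + (w - z) * deriv g w)"
proof -
  have g: "(g has_field_derivative deriv g w) (at w)"
    using assms holomorphic_derivI open_ball by blast
  have "((\<lambda>w. (w - z) ^ n * g w) has_field_derivative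
      (of_nat n * (w - z) ^ (n - 1) * g w + (w - z) ^ n * deriv g w)) (at w)"
    by (auto intro!: derivative_eq_intros g simp: mult.assoc)
  then have "(f has_field_derivative (of_nat n * (w - z) ^ (n - 1) * g w + (w - z) ^ n * deriv g w)) (at w)"
    by (rule has_field_derivative_transform_within_open[of _ _ _ "ball z \<epsilon>"]) (use assms in auto)
  then have "deriv f w = of_nat n * (w - z) ^ (n - 1) * g w + (w - z) ^ n * deriv g w"
    by (rule DERIV_imp_deriv)
  then have "(w - z) * deriv f w = of_nat n * ((w - z) * (w - z) ^ (n - 1)) * g w + (w - z) ^ n * ((w - z) * deriv g w)"
    by (simp only:) (simp add: algebra_simps)
  also have "of_nat n * ((w - z) * (w - z) ^ (n - 1)) = (of_nat n * (w - z) ^ n :: complex)"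
    by (cases n) simp_all
  finally show ?thesis by (simp add: algebra_simps)
qed

text \<open>If \<open>P' / P - s H' / H + (R / H)' = e\<close>, then \<open>(R / H)'\<close> has at most simple poles, because the
  logarithmic derivatives do. A derivative has no simple poles, so \<open>R / H\<close> has no poles.\<close>

lemma quotient_has_no_poles_locally:
  fixes s :: complex
  assumes P: "P holomorphic_on ball 0 r" and H: "H holomorphic_on ball 0 r" and R: "R holomorphic_on ball 0 r"
    and e: "e holomorphic_on ball 0 r" and ne: "P 0 \<noteq> 0" "H 0 \<noteq> 0" and r: "r > 0"
    and eq: "\<And>z. z \<in> ball 0 r \<Longrightarrow> deriv P z * (H z)\<^sup>2 - s * deriv H z * H z * P z
       + (deriv R z * H z - R z * deriv H z) * P z = e z * P z * (H z)\<^sup>2"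
    and z: "z \<in> ball 0 r"
  shows "\<exists>t \<epsilon>. \<epsilon> > 0 \<and> ball z \<epsilon> \<subseteq> ball 0 r \<and> t holomorphic_on ball z \<epsilon> \<and>
    (\<forall>w\<in>ball z \<epsilon>. R w = t w * H w) \<and> (\<forall>w\<in>ball z \<epsilon>. w \<noteq> z \<longrightarrow> H w \<noteq> 0)"
proof -
  have z0: "0 \<in> ball 0 r" using r by simp
  obtain l P1 \<epsilon>1 where P1: "\<epsilon>1 > 0" "ball z \<epsilon>1 \<subseteq> ball 0 r" "P1 holomorphic_on ball z \<epsilon>1"
      "\<And>w. w \<in> ball z \<epsilon>1 \<Longrightarrow> P w = (w - z) ^ l * P1 w" "\<And>w. w \<in> ball z \<epsilon>1 \<Longrightarrow> P1 w \<noteq> 0"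
    using factor_out_zero[OF P z0 ne(1) z] by blast
  obtain n H1 \<epsilon>2 where H1: "\<epsilon>2 > 0" "ball z \<epsilon>2 \<subseteq> ball 0 r" "H1 holomorphic_on ball z \<epsilon>2"
      "\<And>w. w \<in> ball z \<epsilon>2 \<Longrightarrow> H w = (w - z) ^ n * H1 w" "\<And>w. w \<in> ball z \<epsilon>2 \<Longrightarrow> H1 w \<noteq> 0"
    using factor_out_zero[OF H z0 ne(2) z] by blast
  show ?thesis
  proof (cases "\<forall>w\<in>ball 0 r. R w = 0")
    case True
    then show ?thesis using H1
      by (intro exI[of _ "\<lambda>_. 0"] exI[of _ \<epsilon>2]) (auto simp: subset_eq)
  next
    case False
    then obtain z1 where "z1 \<in> ball 0 r" "R z1 \<noteq> 0" by blast
    from factor_out_zero[OF R this z]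
    obtain j R1 \<epsilon>3 where R1: "\<epsilon>3 > 0" "ball z \<epsilon>3 \<subseteq> ball 0 r" "R1 holomorphic_on ball z \<epsilon>3"
      "\<And>w. w \<in> ball z \<epsilon>3 \<Longrightarrow> R w = (w - z) ^ j * R1 w" "\<And>w. w \<in> ball z \<epsilon>3 \<Longrightarrow> R1 w \<noteq> 0"
      by blast
    define \<epsilon> where "\<epsilon> = min \<epsilon>1 (min \<epsilon>2 \<epsilon>3)"
    have \<epsilon>: "\<epsilon> > 0" "ball z \<epsilon> \<subseteq> ball z \<epsilon>1" "ball z \<epsilon> \<subseteq> ball z \<epsilon>2" "ball z \<epsilon> \<subseteq> ball z \<epsilon>3"
      using P1(1) H1(1) R1(1) by (auto simp: \<epsilon>_def)
    have hol: "P1 holomorphic_on ball z \<epsilon>" "H1 holomorphic_on ball z \<epsilon>" "R1 holomorphic_on ball z \<epsilon>"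
        "e holomorphic_on ball z \<epsilon>"
      using P1(2,3) H1(3) R1(3) e \<epsilon> holomorphic_on_subset by blast+
    have fac: "P w = (w - z) ^ l * P1 w" "H w = (w - z) ^ n * H1 w" "R w = (w - z) ^ j * R1 w"
      if "w \<in> ball z \<epsilon>" for w
      using that P1(4) H1(4) R1(4) \<epsilon> by blast+
    have nz: "P1 z \<noteq> 0" "H1 z \<noteq> 0" "R1 z \<noteq> 0"
      using P1(1,5) H1(1,5) R1(1,5) by simp_all
    have jn: "j \<ge> n"
    proof (rule ccontr)
      assume "\<not> j \<ge> n"
      then have "j < n" by simp
      define F where "F w = (w - z) ^ (n - j) * ((of_nat l * P1 w + (w - z) * deriv P1 w) * (H1 w)\<^sup>2
          - s * (of_nat n * H1 w + (w - z) * deriv H1 w) * H1 w * P1 w - (w - z) * e w * P1 w * (H1 w)\<^sup>2)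
          + ((of_nat j * R1 w + (w - z) * deriv R1 w) * H1 w
             - R1 w * (of_nat n * H1 w + (w - z) * deriv H1 w)) * P1 w" for w
      have "F holomorphic_on ball z \<epsilon>"
        unfolding F_def by (intro holomorphic_intros hol holomorphic_deriv open_ball)
      then have cont: "continuous_on (ball z \<epsilon>) F" by (rule holomorphic_on_imp_continuous_on)
      have "F z = 0"
      proof (rule zero_of_continuous_punctured[OF cont \<epsilon>(1)])
        fix w assume w: "w \<in> ball z \<epsilon>" "w \<noteq> z"
        define u where "u = w - z"
        have u: "u \<noteq> 0" using w(2) by (simp add: u_def)
        have dP: "u * deriv P w = u ^ l * (of_nat l * P1 w + u * deriv P1 w)"
          unfolding u_def by (rule deriv_factor[OF hol(1) _ w(1)]) (use fac in auto)
        have dH: "u * deriv H w = u ^ n * (of_nat n * H1 w + u * deriv H1 w)"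
          unfolding u_def by (rule deriv_factor[OF hol(2) _ w(1)]) (use fac in auto)
        have dR: "u * deriv R w = u ^ j * (of_nat j * R1 w + u * deriv R1 w)"
          unfolding u_def by (rule deriv_factor[OF hol(3) _ w(1)]) (use fac in auto)
        have "w \<in> ball 0 r" using w(1) \<epsilon>(2) P1(2) by blast
        from eq[OF this]
        have "0 = u * deriv P w * (H w)\<^sup>2 - s * (u * deriv H w) * H w * P w
            + (u * deriv R w * H w - R w * (u * deriv H w)) * P w - u * e w * P w * (H w)\<^sup>2"
          by algebra
        also have "\<dots> = u ^ (j + n + l) * F w"
        proof -
          have un: "u ^ n = u ^ (n - j) * u ^ j"
            using \<open>j < n\<close> by (simp add: power_add[symmetric])
          show ?thesis
            unfolding dP dH dR unfolding fac[OF w(1)] F_def u_def[symmetric] power_add un by algebra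
        qed
        finally show "F w = 0" using u by simp
      qed
      then have "(of_nat j - of_nat n) * (R1 z * H1 z * P1 z) = 0"
        using \<open>j < n\<close> by (simp add: F_def algebra_simps zero_power)
      with nz \<open>j < n\<close> show False by simp
    qed
    show ?thesis
    proof (intro exI conjI ballI)
      show "(\<lambda>w. (w - z) ^ (j - n) * R1 w / H1 w) holomorphic_on ball z \<epsilon>"
        using H1(5) \<epsilon>(3) by (intro holomorphic_intros hol) auto
      show "ball z \<epsilon> \<subseteq> ball 0 r" using \<epsilon>(2) P1(2) by blast
      fix w assume w: "w \<in> ball z \<epsilon>"
      then have "H1 w \<noteq> 0" using H1(5) \<epsilon>(3) by blast
      then show "R w = (w - z) ^ (j - n) * R1 w / H1 w * H w" "w \<noteq> z \<longrightarrow> H w \<noteq> 0"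
        using fac[OF w] jn power_add[of "w - z" "j - n" n] by (auto simp: field_simps)
    qed (use \<epsilon> in auto)
  qed
qed

lemma quotient_has_no_poles:
  fixes s :: complex
  assumes P: "P holomorphic_on ball 0 r" and H: "H holomorphic_on ball 0 r" and R: "R holomorphic_on ball 0 r"
    and e: "e holomorphic_on ball 0 r" and ne: "P 0 \<noteq> 0" "H 0 \<noteq> 0" and r: "r > 0"
    and eq: "\<And>z. z \<in> ball 0 r \<Longrightarrow> deriv P z * (H z)\<^sup>2 - s * deriv H z * H z * P z
       + (deriv R z * H z - R z * deriv H z) * P z = e z * P z * (H z)\<^sup>2"
  shows "\<exists>T. T holomorphic_on ball 0 r \<and> (\<forall>z\<in>ball 0 r. R z = T z * H z)"
proof -
  have "\<forall>z\<in>ball 0 r. \<exists>t \<epsilon>. \<epsilon> > 0 \<and> ball z \<epsilon> \<subseteq> ball 0 r \<and> t holomorphic_on ball z \<epsilon> \<and>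
    (\<forall>w\<in>ball z \<epsilon>. R w = t w * H w) \<and> (\<forall>w\<in>ball z \<epsilon>. w \<noteq> z \<longrightarrow> H w \<noteq> 0)"
    using quotient_has_no_poles_locally[OF assms] by blast
  then obtain t \<epsilon> where t: "\<And>z. z \<in> ball 0 r \<Longrightarrow> \<epsilon> z > 0 \<and> ball z (\<epsilon> z) \<subseteq> ball 0 r \<and>
     t z holomorphic_on ball z (\<epsilon> z) \<and>
    (\<forall>w\<in>ball z (\<epsilon> z). R w = t z w * H w) \<and> (\<forall>w\<in>ball z (\<epsilon> z). w \<noteq> z \<longrightarrow> H w \<noteq> 0)"
    by metis
  define T where "T z = t z z" for z
  have T: "T w = t z w" if z: "z \<in> ball 0 r" and w: "w \<in> ball z (\<epsilon> z)" for z w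
  proof (cases "w = z")
    case False
    then have "H w \<noteq> 0" "R w = t z w * H w" using t[OF z] w by blast+
    moreover have "w \<in> ball 0 r" using t[OF z] w by blast
    then have "R w = t w w * H w" using t[of w] by (metis centre_in_ball)
    ultimately show ?thesis by (simp add: T_def)
  qed (simp add: T_def)
  have "T field_differentiable at z" if z: "z \<in> ball 0 r" for z
  proof -
    have "(t z has_field_derivative deriv (t z) z) (at z)"
      using t[OF z] by (intro holomorphic_derivI[of _ "ball z (\<epsilon> z)"]) auto
    then have "(T has_field_derivative deriv (t z) z) (at z)"
      by (rule has_field_derivative_transform_within_open[of _ _ _ "ball z (\<epsilon> z)"])
         (use t[OF z] T[OF z] in auto)
    then show ?thesis using field_differentiable_def by blast
  qed
  then have "T holomorphic_on ball 0 r"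
    by (simp add: holomorphic_on_def field_differentiable_at_within)
  moreover have "R z = T z * H z" if "z \<in> ball 0 r" for z
    using t[OF that] by (simp add: T_def)
  ultimately show ?thesis by blast
qed

section \<open>Limits of families of solutions\<close>

lemma convergent_subsequence_finite_family:
  fixes x :: "nat \<Rightarrow> nat \<Rightarrow> complex"
  assumes "\<And>n i. i < d \<Longrightarrow> norm (x n i) \<le> 1"
  shows "\<exists>\<rho> l. strict_mono \<rho> \<and> (\<forall>i<d. (\<lambda>n. x (\<rho> n) i) \<longlonglongrightarrow> l i)"
  using assms
proof (induction d)
  case 0
  show ?case by (intro exI[of _ id] exI) (auto simp: strict_mono_def)
next
  case (Suc d)
  then obtain \<rho> l where \<rho>: "strict_mono \<rho>" "\<forall>i<d. (\<lambda>n. x (\<rho> n) i) \<longlonglongrightarrow> l i"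
    by (metis less_SucI)
  have "bounded (range (\<lambda>n. x (\<rho> n) d))" unfolding bounded_iff using Suc.prems by blast
  then obtain c \<sigma> where \<sigma>: "strict_mono \<sigma>" "((\<lambda>n. x (\<rho> n) d) \<circ> \<sigma>) \<longlonglongrightarrow> c"
    using bounded_imp_convergent_subsequence by blast
  have "(\<lambda>n. x ((\<rho> \<circ> \<sigma>) n) i) \<longlonglongrightarrow> (if i < d then l i else c)" if "i < Suc d" for i
  proof (cases "i < d")
    case True
    then show ?thesis using LIMSEQ_subseq_LIMSEQ[OF _ \<sigma>(1), of "\<lambda>n. x (\<rho> n) i"] \<rho>(2) by (auto simp: o_def)
  next
    case False
    then have "i = d" using that by simp
    then show ?thesis using \<sigma>(2) by (simp add: o_def)
  qed
  then show ?case using strict_mono_o[OF \<rho>(1) \<sigma>(1)] by (intro exI[of _ "\<rho> \<circ> \<sigma>"] exI[of _ "\<lambda>i. if i < d then l i else c"]) blast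
qed

text \<open>Linear combinations of the first \<open>d\<close> members of a family. Solutions are represented by their
  coefficients, so that compactness is that of the unit ball of \<open>\<complex>\<^sup>d\<close>.\<close>

definition lc :: "(nat \<Rightarrow> complex \<Rightarrow> complex) \<Rightarrow> nat \<Rightarrow> (nat \<Rightarrow> complex) \<Rightarrow> complex \<Rightarrow> complex"
  where "lc e d c z = (\<Sum>i<d. c i * e i z)"

abbreviation cnorm :: "nat \<Rightarrow> (nat \<Rightarrow> complex) \<Rightarrow> real"
  where "cnorm d c \<equiv> (\<Sum>i<d. norm (c i))"

lemma lc_divide: "lc e d (\<lambda>i. c i / a) z = lc e d c z / a"
  by (simp add: lc_def sum_divide_distrib)

lemma lc_diff_scale: "lc e d (\<lambda>i. c i - a * b i) z = lc e d c z - a * lc e d b z"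
  by (simp add: lc_def sum_subtractf sum_distrib_left algebra_simps)

lemma lc_scale: "lc e d (\<lambda>i. a * b i) z = a * lc e d b z"
  by (simp add: lc_def sum_distrib_left algebra_simps)

lemma lc_tendsto: "(\<And>i. i < d \<Longrightarrow> (\<lambda>n. c n i) \<longlonglongrightarrow> l i) \<Longrightarrow> (\<lambda>n. lc e d (c n) z) \<longlonglongrightarrow> lc e d l z"
  unfolding lc_def by (intro tendsto_sum tendsto_mult tendsto_const) auto

lemma cnorm_tendsto: "(\<And>i. i < d \<Longrightarrow> (\<lambda>n. c n i) \<longlonglongrightarrow> l i) \<Longrightarrow> (\<lambda>n. cnorm d (c n)) \<longlonglongrightarrow> cnorm d l"
  by (intro tendsto_sum tendsto_norm) auto

lemma cnorm_divide: "cnorm d (\<lambda>i. c i / of_real a) = cnorm d c / \<bar>a\<bar>"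
  by (simp add: norm_divide sum_divide_distrib)

lemma norm_divide_le_one: "0 < a \<Longrightarrow> norm x \<le> a \<Longrightarrow> norm (x / complex_of_real a) \<le> 1"
  by (simp add: norm_divide)

lemma cnorm_normalised: "0 < cnorm d c \<Longrightarrow> cnorm d (\<lambda>i. c i / of_real (cnorm d c)) = 1"
  unfolding cnorm_divide by simp

lemma cnorm_normalised_limit:
  assumes "\<And>n. cnorm d (c n) > 0" "\<And>i. i < d \<Longrightarrow> (\<lambda>n. c n i / of_real (cnorm d (c n))) \<longlonglongrightarrow> l i"
  shows "cnorm d l = 1"
proof -
  have "(\<lambda>n. cnorm d (\<lambda>i. c n i / of_real (cnorm d (c n)))) \<longlonglongrightarrow> cnorm d l"
    by (rule cnorm_tendsto) (rule assms(2))
  then have "(\<lambda>n. 1::real) \<longlonglongrightarrow> cnorm d l" by (simp only: cnorm_normalised[OF assms(1)])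
  then show ?thesis using LIMSEQ_unique tendsto_const by metis
qed

lemma cnorm_pos: assumes "lc e d c z \<noteq> 0" shows "cnorm d c > 0"
proof -
  have "\<exists>i<d. c i \<noteq> 0"
  proof (rule ccontr)
    assume "\<not> ?thesis"
    then have "lc e d c z = 0" unfolding lc_def by (intro sum.neutral) auto
    with assms show False by simp
  qed
  then show ?thesis by (auto intro: sum_pos2)
qed

lemma norm_le_cnorm: "i < d \<Longrightarrow> norm (c i) \<le> cnorm d c"
  by (rule member_le_sum) auto

text \<open>How the equation changes under the normalisation of its limit: \<open>P\<close> is multiplied by \<open>a\<close>, \<open>H\<close> by \<open>q m\<close>
  and \<open>R\<close> is replaced by \<open>m G + \<kappa> H\<close>. The derivative of \<open>R / H\<close> is insensitive to the constant multiple of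
  \<open>H\<close>, which is what allows one coordinate of \<open>R\<close> to be removed.\<close>

lemma log_equation_scaling:
  fixes a q m \<kappa> s P P' H H' G G' :: complex
  shows "(q * m) * a * m * (P' * H\<^sup>2 * q - s * H' * H * P * q + (G' * H - G * H') * P) =
    (a * P') * ((q * m) * H)\<^sup>2 - s * ((q * m) * H') * ((q * m) * H) * (a * P)
    + ((m * G' + \<kappa> * ((q * m) * H')) * ((q * m) * H) - (m * G + \<kappa> * ((q * m) * H)) * ((q * m) * H')) * (a * P)"
  by algebra

locale holomorphic_basis =
  fixes e :: "nat \<Rightarrow> complex \<Rightarrow> complex" and d :: nat and r :: real
  assumes r: "r > 0" and hol: "\<And>i. i < d \<Longrightarrow> e i holomorphic_on ball 0 r"
    and indep: "\<And>c. (\<And>z. z \<in> ball 0 r \<Longrightarrow> lc e d c z = 0) \<Longrightarrow> \<forall>i<d. c i = 0"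
begin

abbreviation "de \<equiv> \<lambda>i. deriv (e i)"

lemma lc_holomorphic: "lc e d c holomorphic_on ball 0 r"
  unfolding lc_def using hol by (intro holomorphic_intros) auto

lemma lc_has_derivative:
  assumes "z \<in> ball 0 r" shows "(lc e d c has_field_derivative lc de d c z) (at z)"
  unfolding lc_def
  using assms by (intro DERIV_sum DERIV_cmult holomorphic_derivI[OF hol open_ball]) auto

lemma deriv_lc: "z \<in> ball 0 r \<Longrightarrow> deriv (lc e d c) z = lc de d c z"
  using lc_has_derivative DERIV_imp_deriv by blast

definition log_equation :: "complex \<Rightarrow> (complex \<Rightarrow> complex) \<Rightarrow> (nat \<Rightarrow> complex) \<Rightarrow> (nat \<Rightarrow> complex) \<Rightarrow> (nat \<Rightarrow> complex) \<Rightarrow> bool"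
  where "log_equation s E p h g \<longleftrightarrow> (\<forall>z\<in>ball 0 r.
     lc de d p z * (lc e d h z)\<^sup>2 - s * lc de d h z * lc e d h z * lc e d p z
       + (lc de d g z * lc e d h z - lc e d g z * lc de d h z) * lc e d p z
     = E z * lc e d p z * (lc e d h z)\<^sup>2)"

lemma lc_nonzero: "cnorm d c \<noteq> 0 \<Longrightarrow> \<exists>z\<in>ball 0 r. lc e d c z \<noteq> 0"
  using indep[of c] by (metis (no_types, lifting) lessThan_iff norm_zero sum.neutral)

text \<open>Normalise \<open>P\<close>, \<open>H\<close> and, after subtracting a multiple of \<open>H\<close>, also \<open>R\<close>, and pass to the limit along a
  subsequence. If \<open>R\<close> grows faster than \<open>H\<close>, the limit satisfies \<open>(R / H)' = 0\<close>, contrary to the choice of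
  \<open>R\<close>. Otherwise \<open>R / H\<close> is bounded on a circle on which the limit of \<open>H\<close> has no zeros, and by the Cauchy
  estimates so are its Taylor coefficients, although the limit of \<open>H\<close> may well vanish at the centre.\<close>

lemma quotient_derivatives_bounded:
  assumes h0: "\<And>n. lc e d (h n) 0 = 1" and p0: "\<And>n. lc e d (p n) 0 = 1"
    and eq: "\<And>n. log_equation s E (p n) (h n) (g n)"
    and T: "\<And>n. T n holomorphic_on ball 0 r" "\<And>n z. z \<in> ball 0 r \<Longrightarrow> lc e d (g n) z = T n z * lc e d (h n) z"
    and k: "k \<ge> 1"
  shows "\<exists>n. norm ((deriv ^^ k) (T n) 0) \<le> real n"
proof (rule ccontr)
  assume "\<not> ?thesis"
  then have large: "norm ((deriv ^^ k) (T n) 0) > real n" for n by (meson not_le)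
  define N where "N n = cnorm d (h n)" for n
  define Np where "Np n = cnorm d (p n)" for n
  have N: "N n > 0" for n unfolding N_def using cnorm_pos[of e d "h n" 0] h0 by simp
  have Np: "Np n > 0" for n unfolding Np_def using cnorm_pos[of e d "p n" 0] p0 by simp
  have "norm (h n i / of_real (N n)) \<le> 1" if "i < d" for n i
    using norm_divide_le_one[OF N[of n]] norm_le_cnorm[OF that, of "h n"] unfolding N_def by blast
  then obtain \<rho>1 hb where \<rho>1: "strict_mono \<rho>1"
      "\<forall>i<d. (\<lambda>n. h (\<rho>1 n) i / of_real (N (\<rho>1 n))) \<longlonglongrightarrow> hb i"
    using convergent_subsequence_finite_family[of d "\<lambda>n i. h n i / of_real (N n)"] by auto
  have "(\<lambda>n. cnorm d (\<lambda>i. h (\<rho>1 n) i / of_real (N (\<rho>1 n)))) \<longlonglongrightarrow> cnorm d hb"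
    using \<rho>1(2) by (intro cnorm_tendsto) auto
  then have "(\<lambda>n. 1::real) \<longlonglongrightarrow> cnorm d hb"
    using cnorm_normalised N unfolding N_def by (simp only:)
  then have hb1: "cnorm d hb = 1" using LIMSEQ_unique tendsto_const by metis
  then obtain i0 where i0: "i0 < d" "hb i0 \<noteq> 0"
    by (metis (no_types, lifting) lessThan_iff norm_zero sum.neutral zero_neq_one)
  \<comment> \<open>The multiple of \<open>H\<close> is chosen such that the coordinate \<open>i0\<close> of the remainder \<open>g'\<close> vanishes; the limit of
    \<open>H\<close> has a nonzero coordinate there, so the limit of \<open>g'\<close> is no multiple of it.\<close>
  define \<kappa> where "\<kappa> n = g n i0 / h n i0" for n
  define g' where "g' n i = g n i - \<kappa> n * h n i" for n i
  define M where "M n = N n + cnorm d (g' n)" for n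
  have M: "M n > 0" for n unfolding M_def using N[of n] by (simp add: add_pos_nonneg sum_nonneg)
  define y where "y n i = (if i < d then p n i / of_real (Np n)
       else if i < 2 * d then g' n (i - d) / of_real (M n) else of_real (N n / M n))" for n i
  have ybound: "norm (y (\<rho>1 n) i) \<le> 1" if "i < 2 * d + 1" for n i
  proof -
    have 1: "norm (p m i / of_real (Np m)) \<le> 1" if "i < d" for m i
      using norm_divide_le_one[OF Np[of m]] norm_le_cnorm[OF that, of "p m"] unfolding Np_def by blast
    have 2: "norm (g' m i / of_real (M m)) \<le> 1" if "i < d" for m i
    proof (rule norm_divide_le_one[OF M])
      show "norm (g' m i) \<le> M m" using norm_le_cnorm[OF that, of "g' m"] N[of m] by (simp add: M_def)
    qed
    have 3: "norm (of_real (N m / M m) :: complex) \<le> 1" for m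
    proof -
      have "N m \<le> M m" by (simp add: M_def sum_nonneg)
      then show ?thesis using M[of m] N[of m] unfolding norm_of_real by simp
    qed
    consider "i < d" | "\<not> i < d" "i < 2 * d" | "\<not> i < d" "\<not> i < 2 * d" by blast
    then show ?thesis
    proof cases
      case a: 1 then show ?thesis unfolding y_def using 1[OF a] by (simp only: if_True)
    next
      case b: 2 then have "i - d < d" by linarith
      from 2[OF this, of "\<rho>1 n"] b show ?thesis unfolding y_def by (simp only: if_True if_False)
    next
      case c: 3 then show ?thesis unfolding y_def using 3[of "\<rho>1 n"] by (simp only: if_False)
    qed
  qed
  then obtain \<rho>2 yb where \<rho>2: "strict_mono \<rho>2" "\<forall>i<2 * d + 1. (\<lambda>n. y (\<rho>1 (\<rho>2 n)) i) \<longlonglongrightarrow> yb i"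
    using convergent_subsequence_finite_family[of "2 * d + 1" "\<lambda>n. y (\<rho>1 n)"] by blast
  define \<psi> where "\<psi> n = \<rho>1 (\<rho>2 n)" for n
  have \<psi>mono: "strict_mono \<psi>" using \<rho>1(1) \<rho>2(1) by (simp add: \<psi>_def strict_mono_def)
  define pb where "pb = yb"
  define gb where "gb i = yb (i + d)" for i
  define \<theta> where "\<theta> = yb (2 * d)"
  have Lh: "(\<lambda>n. h (\<psi> n) i / of_real (N (\<psi> n))) \<longlonglongrightarrow> hb i" if "i < d" for i
    using LIMSEQ_subseq_LIMSEQ[OF _ \<rho>2(1), of "\<lambda>n. h (\<rho>1 n) i / of_real (N (\<rho>1 n))"] \<rho>1(2) that
    by (auto simp: o_def \<psi>_def)
  have Lp: "(\<lambda>n. p (\<psi> n) i / of_real (Np (\<psi> n))) \<longlonglongrightarrow> pb i" if "i < d" for i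
    using \<rho>2(2)[rule_format, of i] that by (simp add: y_def \<psi>_def pb_def)
  have Lg: "(\<lambda>n. g' (\<psi> n) i / of_real (M (\<psi> n))) \<longlonglongrightarrow> gb i" if "i < d" for i
    using \<rho>2(2)[rule_format, of "i + d"] that by (simp add: y_def \<psi>_def gb_def)
  have L\<theta>: "(\<lambda>n. of_real (N (\<psi> n) / M (\<psi> n))) \<longlonglongrightarrow> \<theta>"
    using \<rho>2(2)[rule_format, of "2 * d"] by (simp add: y_def \<psi>_def \<theta>_def)
  have pb1: "cnorm d pb = 1"
    by (rule cnorm_normalised_limit[where d = d and c = "\<lambda>n. p (\<psi> n)"]) (rule Np[unfolded Np_def] Lp[unfolded Np_def], assumption?)+
  have gb1: "cnorm d gb + norm \<theta> = 1"
  proof -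
    have "(\<lambda>n. cnorm d (\<lambda>i. g' (\<psi> n) i / of_real (M (\<psi> n))) + norm (of_real (N (\<psi> n) / M (\<psi> n)) :: complex))
        \<longlonglongrightarrow> cnorm d gb + norm \<theta>"
      using Lg by (intro tendsto_add cnorm_tendsto tendsto_norm[OF L\<theta>]) auto
    also have "(\<lambda>n. cnorm d (\<lambda>i. g' (\<psi> n) i / of_real (M (\<psi> n))) + norm (of_real (N (\<psi> n) / M (\<psi> n)) :: complex))
        = (\<lambda>n. 1)"
    proof
      fix n
      have "cnorm d (\<lambda>i. g' (\<psi> n) i / of_real (M (\<psi> n))) + norm (of_real (N (\<psi> n) / M (\<psi> n)) :: complex)
          = (cnorm d (g' (\<psi> n)) + N (\<psi> n)) / M (\<psi> n)"
        unfolding cnorm_divide norm_of_real using M[of "\<psi> n"] N[of "\<psi> n"] by (simp add: add_divide_distrib)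
      also have "\<dots> = 1" using M[of "\<psi> n"] by (simp add: M_def add.commute)
      finally show "cnorm d (\<lambda>i. g' (\<psi> n) i / of_real (M (\<psi> n))) + norm (of_real (N (\<psi> n) / M (\<psi> n)) :: complex) = 1" .
    qed
    finally show ?thesis using LIMSEQ_unique tendsto_const by metis
  qed
  have gb0: "gb i0 = 0"
  proof -
    have "eventually (\<lambda>n. h (\<psi> n) i0 / of_real (N (\<psi> n)) \<noteq> 0) sequentially"
      using tendsto_imp_eventually_ne[OF Lh[OF i0(1)] i0(2)] .
    then have "eventually (\<lambda>n. g' (\<psi> n) i0 / of_real (M (\<psi> n)) = 0) sequentially"
      by eventually_elim (auto simp: g'_def \<kappa>_def)
    then have "(\<lambda>n. g' (\<psi> n) i0 / of_real (M (\<psi> n))) \<longlonglongrightarrow> 0" by (rule tendsto_eventually)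
    from LIMSEQ_unique[OF Lg[OF i0(1)] this] show ?thesis .
  qed
  have limeq: "lc de d pb z * (lc e d hb z)\<^sup>2 * \<theta> - s * lc de d hb z * lc e d hb z * lc e d pb z * \<theta>
       + (lc de d gb z * lc e d hb z - lc e d gb z * lc de d hb z) * lc e d pb z
     = E z * lc e d pb z * (lc e d hb z)\<^sup>2 * \<theta>" if z: "z \<in> ball 0 r" for z
  proof -
    define P where "P f n = lc f d (\<lambda>i. p (\<psi> n) i / of_real (Np (\<psi> n))) z" for f n
    define H where "H f n = lc f d (\<lambda>i. h (\<psi> n) i / of_real (N (\<psi> n))) z" for f n
    define G where "G f n = lc f d (\<lambda>i. g' (\<psi> n) i / of_real (M (\<psi> n))) z" for f n
    define q where "q n = complex_of_real (N (\<psi> n) / M (\<psi> n))" for n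
    have lim: "P f \<longlonglongrightarrow> lc f d pb z" "H f \<longlonglongrightarrow> lc f d hb z" "G f \<longlonglongrightarrow> lc f d gb z" "q \<longlonglongrightarrow> \<theta>" for f
      unfolding P_def H_def G_def q_def using Lp Lh Lg L\<theta> by (auto intro!: lc_tendsto)
    have "P de n * (H e n)\<^sup>2 * q n - s * H de n * H e n * P e n * q n
       + (G de n * H e n - G e n * H de n) * P e n = E z * P e n * (H e n)\<^sup>2 * q n" for n
    proof -
      define a b m where "a = complex_of_real (Np (\<psi> n))" and "b = complex_of_real (N (\<psi> n))"
        and "m = complex_of_real (M (\<psi> n))"
      have nz: "a \<noteq> 0" "b \<noteq> 0" "m \<noteq> 0"
        using Np[of "\<psi> n"] N[of "\<psi> n"] M[of "\<psi> n"] by (auto simp: a_def b_def m_def)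
      have 1: "lc f d (p (\<psi> n)) z = a * P f n" "lc f d (h (\<psi> n)) z = b * H f n"
          "lc f d (g (\<psi> n)) z = m * G f n + \<kappa> (\<psi> n) * (b * H f n)" for f
        unfolding P_def H_def G_def lc_divide g'_def lc_diff_scale using nz by (auto simp: a_def b_def m_def)
      have qb: "b = q n * m" using nz by (simp add: q_def b_def m_def)
      have "(q n * m) * a * m * (P de n * (H e n)\<^sup>2 * q n - s * H de n * H e n * P e n * q n
       + (G de n * H e n - G e n * H de n) * P e n) = (q n * m) * a * m * (E z * P e n * (H e n)\<^sup>2 * q n)"
      proof (rule trans[OF log_equation_scaling trans])
        show "(a * P de n) * ((q n * m) * H e n)\<^sup>2 - s * ((q n * m) * H de n) * ((q n * m) * H e n) * (a * P e n)
            + ((m * G de n + \<kappa> (\<psi> n) * ((q n * m) * H de n)) * ((q n * m) * H e n)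
             - (m * G e n + \<kappa> (\<psi> n) * ((q n * m) * H e n)) * ((q n * m) * H de n)) * (a * P e n)
            = E z * (a * P e n) * ((q n * m) * H e n)\<^sup>2"
          using eq[of "\<psi> n", unfolded log_equation_def, rule_format, OF z] unfolding 1 qb[symmetric] .
        show "E z * (a * P e n) * ((q n * m) * H e n)\<^sup>2 = (q n * m) * a * m * (E z * P e n * (H e n)\<^sup>2 * q n)"
          by (simp add: power2_eq_square mult_ac)
      qed
      then have "b * a * m * (P de n * (H e n)\<^sup>2 * q n - s * H de n * H e n * P e n * q n
       + (G de n * H e n - G e n * H de n) * P e n) = b * a * m * (E z * P e n * (H e n)\<^sup>2 * q n)"
        unfolding qb[symmetric] .
      then show ?thesis using nz by simp
    qed
    moreover have "(\<lambda>n. P de n * (H e n)\<^sup>2 * q n - s * H de n * H e n * P e n * q n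
       + (G de n * H e n - G e n * H de n) * P e n) \<longlonglongrightarrow> lc de d pb z * (lc e d hb z)\<^sup>2 * \<theta> - s * lc de d hb z * lc e d hb z * lc e d pb z * \<theta>
       + (lc de d gb z * lc e d hb z - lc e d gb z * lc de d hb z) * lc e d pb z"
      by (intro tendsto_intros lim)
    moreover have "(\<lambda>n. E z * P e n * (H e n)\<^sup>2 * q n) \<longlonglongrightarrow> E z * lc e d pb z * (lc e d hb z)\<^sup>2 * \<theta>"
      by (intro tendsto_intros lim)
    ultimately show ?thesis using LIMSEQ_unique by fastforce
  qed
  show False
  proof (cases "\<theta> = 0")
    case True
    \<comment> \<open>The limit is a quotient \<open>R / H\<close> with vanishing derivative, although \<open>R\<close> is normalised not to
      be a multiple of \<open>H\<close>.\<close>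
    obtain zp where zp: "zp \<in> ball 0 r" "lc e d pb zp \<noteq> 0" using lc_nonzero[of pb] pb1 by auto
    have conn: "connected (ball 0 r :: complex set)" by (rule connected_ball)
    define W where "W z = lc de d gb z * lc e d hb z - lc e d gb z * lc de d hb z" for z
    have de_hol: "lc de d c holomorphic_on ball 0 r" for c
      unfolding lc_def using hol by (intro holomorphic_intros holomorphic_deriv) auto
    have Whol: "W holomorphic_on ball 0 r"
      unfolding W_def by (intro holomorphic_intros lc_holomorphic de_hol)
    have nbhd: "\<exists>\<epsilon>>0. ball z \<epsilon> \<subseteq> ball 0 r \<and> (\<forall>w\<in>ball z \<epsilon>. lc e d c w \<noteq> 0)"
      if z: "z \<in> ball 0 r" and nz: "lc e d c z \<noteq> 0" for z c
    proof -
      obtain n u \<epsilon> where u: "\<epsilon> > 0" "ball z \<epsilon> \<subseteq> ball 0 r"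
          "\<forall>w\<in>ball z \<epsilon>. lc e d c w = (w - z) ^ n * u w \<and> u w \<noteq> 0"
        using factor_out_zero[OF lc_holomorphic z nz z] by blast
      have "n = 0"
      proof (rule ccontr)
        assume "n \<noteq> 0"
        then show False using u(1,3) nz by (auto dest!: bspec[of _ _ z])
      qed
      then show ?thesis using u by auto
    qed
    have Wz: "W z = 0" if "z \<in> ball 0 r" for z
    proof -
      obtain \<epsilon> where \<epsilon>: "\<epsilon> > 0" "ball zp \<epsilon> \<subseteq> ball 0 r" "\<forall>w\<in>ball zp \<epsilon>. lc e d pb w \<noteq> 0"
        using nbhd[OF zp] by blast
      have "W w = 0" if "w \<in> ball zp \<epsilon>" for w
        using limeq[of w] True \<epsilon> that by (auto simp: W_def)
      then show ?thesis
        using analytic_continuation_open[of "ball zp \<epsilon>" "ball 0 r" W "\<lambda>_. 0" z] \<epsilon> Whol that conn by auto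
    qed
    obtain zh where zh: "zh \<in> ball 0 r" "lc e d hb zh \<noteq> 0" using lc_nonzero[of hb] hb1 by auto
    obtain \<epsilon> where \<epsilon>: "\<epsilon> > 0" "ball zh \<epsilon> \<subseteq> ball 0 r" "\<forall>w\<in>ball zh \<epsilon>. lc e d hb w \<noteq> 0"
      using nbhd[OF zh] by blast
    have "((\<lambda>w. lc e d gb w / lc e d hb w) has_field_derivative 0) (at w within ball zh \<epsilon>)" if "w \<in> ball zh \<epsilon>" for w
    proof -
      have wr: "w \<in> ball 0 r" using that \<epsilon> by blast
      have "((\<lambda>w. lc e d gb w / lc e d hb w) has_field_derivative
          (lc de d gb w * lc e d hb w - lc e d gb w * lc de d hb w) / (lc e d hb w * lc e d hb w)) (at w)"
        using \<epsilon>(3) that by (intro DERIV_divide lc_has_derivative[OF wr]) auto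
      then show ?thesis using Wz[OF wr] by (simp add: W_def has_field_derivative_at_within)
    qed
    then have "\<exists>c. \<forall>w\<in>ball zh \<epsilon>. lc e d gb w / lc e d hb w = c"
      by (intro has_field_derivative_zero_constant convex_ball)
    then obtain c where c: "\<And>w. w \<in> ball zh \<epsilon> \<Longrightarrow> lc e d gb w / lc e d hb w = c" by blast
    have "lc e d (\<lambda>i. gb i - c * hb i) w = 0" if "w \<in> ball zh \<epsilon>" for w
    proof -
      have "lc e d hb w \<noteq> 0" using that \<epsilon>(3) by blast
      then show ?thesis using c[OF that] unfolding lc_diff_scale by (simp add: field_simps)
    qed
    then have "lc e d (\<lambda>i. gb i - c * hb i) w = 0" if "w \<in> ball 0 r" for w
      using analytic_continuation_open[of "ball zh \<epsilon>" "ball 0 r" "lc e d (\<lambda>i. gb i - c * hb i)" "\<lambda>_. 0" w]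
        \<epsilon> lc_holomorphic that conn by auto
    then have gbc: "\<forall>i<d. gb i - c * hb i = 0" by (rule indep)
    have "gb i0 - c * hb i0 = 0" using gbc i0(1) by blast
    then have "c = 0" using gb0 i0(2) by simp
    then have "cnorm d gb = 0" using gbc by simp
    then show False using gb1 True by simp
  next
    case False
    \<comment> \<open>On a circle avoiding the zeros of the limit of \<open>H\<close> the quotients stay bounded.\<close>
    have "\<exists>\<rho>. 0 < \<rho> \<and> \<rho> < r \<and> (\<forall>z\<in>sphere 0 \<rho>. lc e d hb z \<noteq> 0)"
    proof -
      have "\<not> lc e d hb constant_on ball 0 r \<or> (\<forall>z\<in>ball 0 r. lc e d hb z \<noteq> 0)"
        using lc_nonzero[of hb] hb1 by (auto simp: constant_on_def)
      then show ?thesis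
      proof
        assume "\<forall>z\<in>ball 0 r. lc e d hb z \<noteq> 0"
        then show ?thesis using r by (intro exI[of _ "r / 2"]) auto
      next
        assume nc: "\<not> lc e d hb constant_on ball 0 r"
        have "finite {z \<in> cball 0 (r / 2). lc e d hb z = 0}"
          using r by (intro holomorphic_compact_finite_zeros[OF lc_holomorphic open_ball connected_ball _ _ nc]) auto
        then have "finite (norm ` {z \<in> cball 0 (r / 2). lc e d hb z = 0})" by (rule finite_imageI)
        moreover have "infinite {0<..<r / 2}" using r by simp
        ultimately have "\<not> {0<..<r / 2} \<subseteq> norm ` {z \<in> cball 0 (r / 2). lc e d hb z = 0}"
          using finite_subset by blast
        then obtain \<rho> where "\<rho> \<in> {0<..<r / 2}" and \<rho>3: "\<rho> \<notin> norm ` {z \<in> cball 0 (r / 2). lc e d hb z = 0}"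
          by blast
        then have \<rho>: "0 < \<rho>" "\<rho> < r / 2" by simp_all
        have "lc e d hb z \<noteq> 0" if "z \<in> sphere 0 \<rho>" for z
        proof
          assume "lc e d hb z = 0"
          then have "z \<in> {z \<in> cball 0 (r / 2). lc e d hb z = 0}" using that \<rho>(2) by simp
          then have "norm z \<in> norm ` {z \<in> cball 0 (r / 2). lc e d hb z = 0}" by (rule imageI)
          with \<rho>3 that show False by simp
        qed
        then show ?thesis using \<rho>(1,2) r by (intro exI[of _ \<rho>]) auto
      qed
    qed
    then obtain \<rho> where \<rho>: "0 < \<rho>" "\<rho> < r" "\<And>z. z \<in> sphere 0 \<rho> \<Longrightarrow> lc e d hb z \<noteq> 0" by blast
    have cb: "cball 0 \<rho> \<subseteq> ball (0::complex) r" using \<rho>(2) by auto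
    have "continuous_on (sphere 0 \<rho>) (\<lambda>z. norm (lc e d hb z))"
      using holomorphic_on_imp_continuous_on[OF lc_holomorphic] cb
      by (intro continuous_on_norm) (meson continuous_on_subset sphere_cball order_trans)
    moreover have "compact (sphere (0::complex) \<rho>)" "sphere (0::complex) \<rho> \<noteq> {}" using \<rho>(1) by auto
    ultimately obtain z1 where z1: "z1 \<in> sphere 0 \<rho>" "\<And>z. z \<in> sphere 0 \<rho> \<Longrightarrow> norm (lc e d hb z1) \<le> norm (lc e d hb z)"
      using continuous_attains_inf by metis
    define \<delta> where "\<delta> = norm (lc e d hb z1)"
    have \<delta>: "\<delta> > 0" using \<rho>(3) z1(1) by (simp add: \<delta>_def)
    have "\<exists>C. \<forall>i<d. \<forall>z\<in>sphere 0 \<rho>. norm (e i z) \<le> C"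
    proof -
      have "\<exists>C. \<forall>z\<in>sphere 0 \<rho>. norm (e i z) \<le> C" if "i < d" for i
      proof -
        have "continuous_on (sphere 0 \<rho>) (e i)"
          using holomorphic_on_imp_continuous_on[OF hol[OF that]] cb
          by (meson continuous_on_subset sphere_cball order_trans)
        then have "bounded (e i ` sphere 0 \<rho>)" by (intro compact_imp_bounded compact_continuous_image) auto
        then show ?thesis by (auto simp: bounded_iff)
      qed
      then obtain C where C: "\<And>i z. i < d \<Longrightarrow> z \<in> sphere 0 \<rho> \<Longrightarrow> norm (e i z) \<le> C i" by metis
      show ?thesis
      proof (intro exI allI impI ballI)
        fix i and z :: complex assume iz: "i < d" "z \<in> sphere 0 \<rho>"
        have "C i \<le> \<bar>C i\<bar>" by simp
        also have "\<dots> \<le> (\<Sum>i<d. \<bar>C i\<bar>)" using iz by (intro member_le_sum) auto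
        finally show "norm (e i z) \<le> (\<Sum>i<d. \<bar>C i\<bar>)" using C[OF iz] by linarith
      qed
    qed
    then obtain C where C: "\<And>i z. i < d \<Longrightarrow> z \<in> sphere 0 \<rho> \<Longrightarrow> norm (e i z) \<le> C" by blast
    have lcC: "norm (lc e d c z) \<le> cnorm d c * C" if "z \<in> sphere 0 \<rho>" for c z
    proof -
      have "norm (lc e d c z) \<le> (\<Sum>i<d. norm (c i * e i z))" unfolding lc_def by (rule norm_sum)
      also have "\<dots> \<le> (\<Sum>i<d. norm (c i) * C)"
        unfolding norm_mult using C that by (intro sum_mono mult_left_mono) auto
      finally show ?thesis by (simp only: sum_distrib_right)
    qed
    have "(\<lambda>n. cnorm d (\<lambda>i. h (\<psi> n) i / of_real (N (\<psi> n)) - 1 * hb i) * C) \<longlonglongrightarrow> cnorm d (\<lambda>i. hb i - 1 * hb i) * C"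
      using Lh by (intro tendsto_mult cnorm_tendsto tendsto_diff tendsto_const) auto
    then have ev1: "eventually (\<lambda>n. cnorm d (\<lambda>i. h (\<psi> n) i / of_real (N (\<psi> n)) - 1 * hb i) * C < \<delta> / 2) sequentially"
      using \<delta> by (intro order_tendstoD(2)) auto
    have ev2: "eventually (\<lambda>n. norm (complex_of_real (N (\<psi> n) / M (\<psi> n))) > norm \<theta> / 2) sequentially"
      using order_tendstoD(1)[OF tendsto_norm[OF L\<theta>], of "norm \<theta> / 2"] False by simp
    define B where "B = C / (norm \<theta> / 2 * (\<delta> / 2))"
    have ev3: "eventually (\<lambda>n. real n > fact k * B / \<rho> ^ k) sequentially"
      using filterlim_real_sequentially by (simp add: filterlim_at_top_dense)
    obtain n where elim: "cnorm d (\<lambda>i. h (\<psi> n) i / of_real (N (\<psi> n)) - 1 * hb i) * C < \<delta> / 2"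
        "norm (complex_of_real (N (\<psi> n) / M (\<psi> n))) > norm \<theta> / 2" "real n > fact k * B / \<rho> ^ k"
      using eventually_happens'[OF sequentially_bot eventually_conj[OF ev1 eventually_conj[OF ev2 ev3]]] by blast
      define m where "m = \<psi> n"
      have Tn: "norm (T m z - \<kappa> m) \<le> B" if z: "z \<in> sphere 0 \<rho>" for z
      proof -
        have zr: "z \<in> ball 0 r" using z cb sphere_cball by blast
        define Hz where "Hz = lc e d (\<lambda>i. h m i / of_real (N m)) z"
        define Gz where "Gz = lc e d (\<lambda>i. g' m i / of_real (M m)) z"
        define q where "q = complex_of_real (N m / M m)"
        have "norm (Hz - 1 * lc e d hb z) < \<delta> / 2"
          unfolding Hz_def lc_diff_scale[symmetric] using lcC[OF z] elim(1) unfolding m_def by (rule le_less_trans)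
        then have H: "norm Hz > \<delta> / 2"
          using z1(2)[OF z] norm_triangle_ineq2[of "lc e d hb z" "Hz"] by (simp add: \<delta>_def norm_minus_commute)
        have q: "norm q > norm \<theta> / 2" using elim(2) by (simp only: q_def m_def)
        have "cnorm d (\<lambda>i. g' m i / of_real (M m)) \<le> 1"
          unfolding cnorm_divide using M[of m] N[of m] by (simp add: M_def)
        moreover have "C \<ge> 0"
          using C[OF i0(1) z] norm_ge_zero order_trans by blast
        ultimately have G: "norm Gz \<le> C"
          using lcC[OF z, of "\<lambda>i. g' m i / of_real (M m)"] mult_right_mono[of _ 1 C] unfolding Gz_def
          by (metis (no_types, lifting) mult_1 order_trans)
        have nz: "N m \<noteq> 0" "M m \<noteq> 0" "Hz \<noteq> 0" "q \<noteq> 0" using N[of m] M[of m] H \<delta> q by auto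
        have "lc e d (g m) z = T m z * lc e d (h m) z" by (rule T(2)[OF zr])
        moreover have "lc e d (h m) z = of_real (N m) * Hz" using nz by (simp add: Hz_def lc_divide)
        moreover have "lc e d (g m) z = of_real (M m) * Gz + \<kappa> m * (of_real (N m) * Hz)"
          using nz unfolding Gz_def Hz_def g'_def lc_divide lc_diff_scale by simp
        moreover have "complex_of_real (N m) = q * of_real (M m)" using nz by (simp add: q_def)
        ultimately have "of_real (M m) * Gz + \<kappa> m * ((q * of_real (M m)) * Hz) = T m z * ((q * of_real (M m)) * Hz)"
          by simp
        then have "of_real (M m) * ((T m z - \<kappa> m) * (q * Hz)) = of_real (M m) * Gz" by (simp add: algebra_simps)
        then have "(T m z - \<kappa> m) * (q * Hz) = Gz" using nz by simp
        then have "T m z - \<kappa> m = Gz / (q * Hz)" using nz by (simp add: field_simps)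
        then have "norm (T m z - \<kappa> m) = norm Gz / (norm q * norm Hz)" by (simp add: norm_divide norm_mult)
        also have "\<dots> \<le> C / (norm \<theta> / 2 * (\<delta> / 2))"
          using G H q \<delta> False \<open>C \<ge> 0\<close> by (intro frac_le mult_mono mult_pos_pos) auto
        finally show ?thesis by (simp add: B_def)
      qed
      have Thol: "(\<lambda>z. T m z - \<kappa> m) holomorphic_on ball 0 r" by (intro holomorphic_intros T(1))
      have "norm ((deriv ^^ k) (\<lambda>z. T m z - \<kappa> m) 0) \<le> fact k * B / \<rho> ^ k"
      proof (rule Cauchy_inequality)
        show "(\<lambda>z. T m z - \<kappa> m) holomorphic_on ball 0 \<rho>"
          using Thol cb ball_subset_cball holomorphic_on_subset by (metis order_trans)
        show "continuous_on (cball 0 \<rho>) (\<lambda>z. T m z - \<kappa> m)"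
          using Thol cb holomorphic_on_imp_continuous_on continuous_on_subset by blast
        show "norm (T m z - \<kappa> m) \<le> B" if "norm (0 - z) = \<rho>" for z using Tn[of z] that by simp
      qed (rule \<rho>(1))
      moreover have "(deriv ^^ k) (\<lambda>z. T m z - \<kappa> m) 0 = (deriv ^^ k) (T m) 0 - (deriv ^^ k) (\<lambda>z. \<kappa> m) 0"
        using r by (intro higher_deriv_diff[OF T(1) holomorphic_on_const open_ball]) auto
      moreover have "(deriv ^^ k) (\<lambda>z. \<kappa> m) 0 = 0" using k by simp
      ultimately have "norm ((deriv ^^ k) (T m) 0) \<le> fact k * B / \<rho> ^ k" by simp
      moreover have "real n \<le> real m" using seq_suble[OF \<psi>mono, of n] by (simp add: m_def)
      ultimately show False using large[of m] elim(3) by linarith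
  qed
qed

text \<open>In a limit with \<open>H(0) = 0\<close> the equation \<open>P' / P - s H' / H = e\<close> compares the orders of vanishing
  of \<open>P\<close> and \<open>H\<close> at \<open>0\<close>.\<close>

lemma exponent_is_ratio_of_orders:
  assumes h0: "\<And>n. lc e d (h n) 0 = 1" and p0: "\<And>n. lc e d (p n) 0 = 1"
    and eq: "\<And>n. log_equation s E (p n) (h n) (\<lambda>_. 0)" and E: "E holomorphic_on ball 0 r"
    and large: "\<And>n. cnorm d (h n) \<ge> real n"
  shows "\<exists>l m. m > 0 \<and> of_nat l = s * of_nat m"
proof -
  define N where "N n = cnorm d (h n)" for n
  define Np where "Np n = cnorm d (p n)" for n
  have N: "N n > 0" for n unfolding N_def using cnorm_pos[of e d "h n" 0] h0 by simp
  have Np: "Np n > 0" for n unfolding Np_def using cnorm_pos[of e d "p n" 0] p0 by simp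
  define y where "y n i = (if i < d then p n i / of_real (Np n) else h n (i - d) / of_real (N n))" for n i
  have ybound: "norm (y n i) \<le> 1" if "i < 2 * d" for n i
  proof -
    have 1: "norm (p m i / of_real (Np m)) \<le> 1" if "i < d" for m i
      using norm_divide_le_one[OF Np[of m]] norm_le_cnorm[OF that, of "p m"] unfolding Np_def by blast
    have 2: "norm (h m i / of_real (N m)) \<le> 1" if "i < d" for m i
      using norm_divide_le_one[OF N[of m]] norm_le_cnorm[OF that, of "h m"] unfolding N_def by blast
    show ?thesis
    proof (cases "i < d")
      case True then show ?thesis unfolding y_def using 1[OF True] by (simp only: if_True)
    next
      case False then have "i - d < d" using that by linarith
      from 2[OF this] False show ?thesis unfolding y_def by (simp only: if_False)
    qed
  qed
  then obtain \<psi> yb where \<psi>: "strict_mono \<psi>" "\<forall>i<2 * d. (\<lambda>n. y (\<psi> n) i) \<longlonglongrightarrow> yb i"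
    using convergent_subsequence_finite_family[of "2 * d" y] by blast
  define pb where "pb = yb"
  define hb where "hb i = yb (i + d)" for i
  have Lh: "(\<lambda>n. h (\<psi> n) i / of_real (N (\<psi> n))) \<longlonglongrightarrow> hb i" if "i < d" for i
    using \<psi>(2)[rule_format, of "i + d"] that by (simp add: y_def hb_def)
  have Lp: "(\<lambda>n. p (\<psi> n) i / of_real (Np (\<psi> n))) \<longlonglongrightarrow> pb i" if "i < d" for i
    using \<psi>(2)[rule_format, of i] that by (simp add: y_def pb_def)
  have pb1: "cnorm d pb = 1"
    by (rule cnorm_normalised_limit[where d = d and c = "\<lambda>n. p (\<psi> n)"]) (rule Np[unfolded Np_def] Lp[unfolded Np_def], assumption?)+
  have hb1: "cnorm d hb = 1"
    by (rule cnorm_normalised_limit[where d = d and c = "\<lambda>n. h (\<psi> n)"]) (rule N[unfolded N_def] Lh[unfolded N_def], assumption?)+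
  have hb0: "lc e d hb 0 = 0"
  proof -
    have "filterlim (\<lambda>n. N (\<psi> n)) at_top sequentially"
    proof (rule filterlim_at_top_mono[OF filterlim_real_sequentially])
      have "real n \<le> N (\<psi> n)" for n
        using large[of "\<psi> n"] seq_suble[OF \<psi>(1), of n] unfolding N_def by (meson of_nat_le_iff order_trans)
      then show "eventually (\<lambda>n. real n \<le> N (\<psi> n)) sequentially" by simp
    qed
    then have "(\<lambda>n. inverse (N (\<psi> n))) \<longlonglongrightarrow> 0" by (rule tendsto_inverse_0_at_top)
    then have "(\<lambda>n. complex_of_real (inverse (N (\<psi> n)))) \<longlonglongrightarrow> of_real 0" by (rule tendsto_of_real)
    moreover have "lc e d (\<lambda>i. h (\<psi> n) i / of_real (N (\<psi> n))) 0 = complex_of_real (inverse (N (\<psi> n)))" for n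
      unfolding lc_divide h0 by (simp add: field_simps)
    moreover have "(\<lambda>n. lc e d (\<lambda>i. h (\<psi> n) i / of_real (N (\<psi> n))) 0) \<longlonglongrightarrow> lc e d hb 0"
      using Lh by (intro lc_tendsto) auto
    ultimately show ?thesis using LIMSEQ_unique by force
  qed
  have limeq: "lc de d pb z * (lc e d hb z)\<^sup>2 - s * lc de d hb z * lc e d hb z * lc e d pb z
     = E z * lc e d pb z * (lc e d hb z)\<^sup>2" if z: "z \<in> ball 0 r" for z
  proof -
    define P where "P f n = lc f d (\<lambda>i. p (\<psi> n) i / of_real (Np (\<psi> n))) z" for f n
    define H where "H f n = lc f d (\<lambda>i. h (\<psi> n) i / of_real (N (\<psi> n))) z" for f n
    have lim: "P f \<longlonglongrightarrow> lc f d pb z" "H f \<longlonglongrightarrow> lc f d hb z" for f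
      unfolding P_def H_def using Lp Lh by (auto intro!: lc_tendsto)
    have "P de n * (H e n)\<^sup>2 - s * H de n * H e n * P e n = E z * P e n * (H e n)\<^sup>2" for n
    proof -
      define a b where "a = complex_of_real (Np (\<psi> n))" and "b = complex_of_real (N (\<psi> n))"
      have nz: "a \<noteq> 0" "b \<noteq> 0" using Np[of "\<psi> n"] N[of "\<psi> n"] by (auto simp: a_def b_def)
      have 1: "lc f d (p (\<psi> n)) z = a * P f n" "lc f d (h (\<psi> n)) z = b * H f n" for f
        unfolding P_def H_def lc_divide using nz by (auto simp: a_def b_def)
      have 2: "lc f d (\<lambda>_. 0) z = 0" for f by (simp add: lc_def)
      have "b * b * a * (P de n * (H e n)\<^sup>2 - s * H de n * H e n * P e n) = b * b * a * (E z * P e n * (H e n)\<^sup>2)"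
      proof (rule trans[OF _ trans])
        show "(a * P de n) * (b * H e n)\<^sup>2 - s * (b * H de n) * (b * H e n) * (a * P e n)
           + (0 * (b * H e n) - 0 * (b * H de n)) * (a * P e n) = E z * (a * P e n) * (b * H e n)\<^sup>2"
          using eq[of "\<psi> n", unfolded log_equation_def, rule_format, OF z] unfolding 1 2 .
        show "b * b * a * (P de n * (H e n)\<^sup>2 - s * H de n * H e n * P e n) =
           (a * P de n) * (b * H e n)\<^sup>2 - s * (b * H de n) * (b * H e n) * (a * P e n)
           + (0 * (b * H e n) - 0 * (b * H de n)) * (a * P e n)"
          by (simp add: power2_eq_square algebra_simps)
        show "E z * (a * P e n) * (b * H e n)\<^sup>2 = b * b * a * (E z * P e n * (H e n)\<^sup>2)"
          by (simp add: power2_eq_square mult_ac)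
      qed
      then show ?thesis using nz by simp
    qed
    moreover have "(\<lambda>n. P de n * (H e n)\<^sup>2 - s * H de n * H e n * P e n) \<longlonglongrightarrow>
        lc de d pb z * (lc e d hb z)\<^sup>2 - s * lc de d hb z * lc e d hb z * lc e d pb z"
      by (intro tendsto_intros lim)
    moreover have "(\<lambda>n. E z * P e n * (H e n)\<^sup>2) \<longlonglongrightarrow> E z * lc e d pb z * (lc e d hb z)\<^sup>2"
      by (intro tendsto_intros lim)
    ultimately show ?thesis using LIMSEQ_unique by fastforce
  qed
  have z0: "0 \<in> ball (0::complex) r" using r by simp
  obtain zp where zp: "zp \<in> ball 0 r" "lc e d pb zp \<noteq> 0" using lc_nonzero[of pb] pb1 by auto
  obtain zh where zh: "zh \<in> ball 0 r" "lc e d hb zh \<noteq> 0" using lc_nonzero[of hb] hb1 by auto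
  obtain l P1 \<epsilon>1 where P1: "\<epsilon>1 > 0" "ball (0::complex) \<epsilon>1 \<subseteq> ball 0 r" "P1 holomorphic_on ball 0 \<epsilon>1"
      "\<And>w. w \<in> ball 0 \<epsilon>1 \<Longrightarrow> lc e d pb w = (w - 0) ^ l * P1 w" "\<And>w. w \<in> ball 0 \<epsilon>1 \<Longrightarrow> P1 w \<noteq> 0"
    using factor_out_zero[OF lc_holomorphic zp z0] by blast
  obtain m H1 \<epsilon>2 where H1: "\<epsilon>2 > 0" "ball (0::complex) \<epsilon>2 \<subseteq> ball 0 r" "H1 holomorphic_on ball 0 \<epsilon>2"
      "\<And>w. w \<in> ball 0 \<epsilon>2 \<Longrightarrow> lc e d hb w = (w - 0) ^ m * H1 w" "\<And>w. w \<in> ball 0 \<epsilon>2 \<Longrightarrow> H1 w \<noteq> 0" "m > 0"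
    using factor_out_zero[OF lc_holomorphic zh z0] hb0 by blast
  define \<epsilon> where "\<epsilon> = min \<epsilon>1 \<epsilon>2"
  have \<epsilon>: "\<epsilon> > 0" "ball (0::complex) \<epsilon> \<subseteq> ball 0 \<epsilon>1" "ball (0::complex) \<epsilon> \<subseteq> ball 0 \<epsilon>2"
    using P1(1) H1(1) by (auto simp: \<epsilon>_def)
  have hol: "P1 holomorphic_on ball 0 \<epsilon>" "H1 holomorphic_on ball 0 \<epsilon>" "E holomorphic_on ball 0 \<epsilon>"
    using P1(2,3) H1(3) E \<epsilon> holomorphic_on_subset by blast+
  \<comment> \<open>\<open>w\<close> times the equation, divided by the common power of \<open>w\<close>; its value at \<open>0\<close> compares the orders.\<close>
  define F where "F w = (of_nat l * P1 w + w * deriv P1 w) * (H1 w)\<^sup>2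
          - s * (of_nat m * H1 w + w * deriv H1 w) * H1 w * P1 w - w * E w * P1 w * (H1 w)\<^sup>2" for w
  have "F holomorphic_on ball 0 \<epsilon>"
    unfolding F_def by (intro holomorphic_intros hol holomorphic_deriv open_ball)
  then have cont: "continuous_on (ball 0 \<epsilon>) F" by (rule holomorphic_on_imp_continuous_on)
  have "F 0 = 0"
  proof (rule zero_of_continuous_punctured[OF cont \<epsilon>(1)])
    fix w :: complex assume w: "w \<in> ball 0 \<epsilon>" "w \<noteq> 0"
    have wr: "w \<in> ball 0 r" using w \<epsilon> P1(2) by blast
    have dP: "w * lc de d pb w = w ^ l * (of_nat l * P1 w + w * deriv P1 w)"
      using deriv_factor[OF hol(1) _ w(1), of "lc e d pb" l] P1(4) \<epsilon> unfolding deriv_lc[OF wr]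
      by (simp add: subset_iff)
    have dH: "w * lc de d hb w = w ^ m * (of_nat m * H1 w + w * deriv H1 w)"
      using deriv_factor[OF hol(2) _ w(1), of "lc e d hb" m] H1(4) \<epsilon> unfolding deriv_lc[OF wr]
      by (simp add: subset_iff)
    have v: "lc e d pb w = w ^ l * P1 w" "lc e d hb w = w ^ m * H1 w"
      using P1(4)[of w] H1(4)[of w] w(1) \<epsilon> by auto
    have "0 = w * lc de d pb w * (lc e d hb w)\<^sup>2 - s * (w * lc de d hb w) * lc e d hb w * lc e d pb w
        - w * E w * lc e d pb w * (lc e d hb w)\<^sup>2"
      using limeq[OF wr] by algebra
    also have "\<dots> = w ^ (l + m + m) * F w"
      unfolding dP dH unfolding v F_def power_add by algebra
    finally show "F w = 0" using w(2) by simp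
  qed
  then have "(of_nat l - s * of_nat m) * (H1 0 * H1 0 * P1 0) = 0" unfolding F_def by algebra
  moreover have "H1 0 \<noteq> 0" "P1 0 \<noteq> 0" using P1(1,5) H1(1,5) by auto
  ultimately have "of_nat l = s * of_nat m" by simp
  then show ?thesis using H1(6) by blast
qed

end

section \<open>Kernels of finite rank\<close>

lemma character_add: "character R ch \<Longrightarrow> x \<in> R \<Longrightarrow> y \<in> R \<Longrightarrow> ch (\<lambda>w. x w + y w) = ch x + ch y"
  by (simp add: character_def plus_fun_def)

lemma character_mult: "character R ch \<Longrightarrow> x \<in> R \<Longrightarrow> y \<in> R \<Longrightarrow> ch (\<lambda>w. x w * y w) = ch x * ch y"
  by (simp add: character_def times_fun_def)

lemma character_const: "character R ch \<Longrightarrow> ch (\<lambda>w. c) = c"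
  by (simp add: character_def)

lemma falg_mult': "x \<in> falg S \<Longrightarrow> y \<in> falg S \<Longrightarrow> (\<lambda>w. x w * y w) \<in> falg S"
  using falg_mult[of x S y] by (simp add: times_fun_def)

lemma falg_add': "x \<in> falg S \<Longrightarrow> y \<in> falg S \<Longrightarrow> (\<lambda>w. x w + y w) \<in> falg S"
  using falg_add[of x S y] by (simp add: plus_fun_def)

lemma falg_diff': "x \<in> falg S \<Longrightarrow> y \<in> falg S \<Longrightarrow> (\<lambda>w. x w - y w) \<in> falg S"
  using falg_diff[of x S y] by (simp add: fun_diff_def)

lemma character_scale: "character (falg S) ch \<Longrightarrow> x \<in> falg S \<Longrightarrow> ch (\<lambda>w. c * x w) = c * ch x"
  using character_mult[of "falg S" ch "\<lambda>_. c" x] falg_const character_const[of "falg S" ch c] by metis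

lemma character_diff:
  assumes "character (falg S) ch" "x \<in> falg S" "y \<in> falg S"
  shows "ch (\<lambda>w. x w - y w) = ch x - ch y"
proof -
  have "ch (\<lambda>w. x w + (-1) * y w) = ch x + ch (\<lambda>w. (-1) * y w)"
    by (rule character_add[OF assms(1,2) falg_scale[OF assms(3)]])
  also have "ch (\<lambda>w. (-1) * y w) = (-1) * ch y" by (rule character_scale[OF assms(1,3)])
  finally show ?thesis by simp
qed

lemma character_sum:
  assumes "character (falg S) ch" "\<And>i. i \<in> I \<Longrightarrow> x i \<in> falg S" "finite I"
  shows "ch (\<lambda>w. \<Sum>i\<in>I. x i w) = (\<Sum>i\<in>I. ch (x i))"
  using assms(3,2)
proof (induction I rule: finite_induct)
  case empty
  then show ?case using character_const[OF assms(1), of 0] by simp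
next
  case (insert i I)
  have "ch (\<lambda>w. x i w + (\<Sum>i\<in>I. x i w)) = ch (x i) + ch (\<lambda>w. \<Sum>i\<in>I. x i w)"
    using insert by (intro character_add[OF assms(1) _ falg_sum]) auto
  with insert show ?case by simp
qed

lemma character_evaluation: "character R (\<lambda>x. x w)"
  by (simp add: character_def)

lemma character_lc:
  assumes "character (falg S) ch" "\<And>i. i < d \<Longrightarrow> x i \<in> falg S"
  shows "ch (\<lambda>w. lc e d (\<lambda>i. x i w) z) = lc e d (\<lambda>i. ch (x i)) z"
proof -
  have "ch (\<lambda>w. \<Sum>i<d. e i z * x i w) = (\<Sum>i<d. ch (\<lambda>w. e i z * x i w))"
    by (rule character_sum[OF assms(1) falg_scale]) (use assms(2) in auto)
  also have "\<dots> = (\<Sum>i<d. e i z * ch (x i))"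
    by (rule sum.cong[OF refl character_scale[OF assms(1)]]) (use assms(2) in auto)
  finally show ?thesis by (simp add: lc_def mult.commute)
qed

lemma falg_lc: "(\<And>i. i < d \<Longrightarrow> x i \<in> falg S) \<Longrightarrow> (\<lambda>w. lc e d (\<lambda>i. x i w) z) \<in> falg S"
  using falg_sum[of "{..<d}" "\<lambda>i w. e i z * x i w" S] falg_scale[of _ S]
  by (simp add: lc_def mult.commute)

definition finite_rank :: "real \<Rightarrow> (complex \<Rightarrow> complex \<Rightarrow> complex) \<Rightarrow> bool" where
  "finite_rank r K \<longleftrightarrow> (\<exists>L. (\<forall>p\<in>set L. fst p holomorphic_on ball 0 r \<and> snd p holomorphic_on ball 0 r) \<and>
     (\<forall>z\<in>ball 0 r. \<forall>w\<in>ball 0 r. K z w = (\<Sum>p\<leftarrow>L. fst p z * snd p w)))"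

lemma finite_rank_cong:
  assumes "finite_rank r K" "\<And>z w. z \<in> ball 0 r \<Longrightarrow> w \<in> ball 0 r \<Longrightarrow> K' z w = K z w"
  shows "finite_rank r K'"
proof -
  obtain L where "\<forall>p\<in>set L. fst p holomorphic_on ball 0 r \<and> snd p holomorphic_on ball 0 r"
     "\<forall>z\<in>ball 0 r. \<forall>w\<in>ball 0 r. K z w = (\<Sum>p\<leftarrow>L. fst p z * snd p w)"
    using assms(1) unfolding finite_rank_def by blast
  then show ?thesis unfolding finite_rank_def using assms(2) by (intro exI[of _ L]) simp
qed

lemma finite_rank_tensor:
  "a holomorphic_on ball 0 r \<Longrightarrow> b holomorphic_on ball 0 r \<Longrightarrow> finite_rank r (\<lambda>z w. a z * b w)"
  unfolding finite_rank_def by (intro exI[of _ "[(a, b)]"]) simp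

lemma finite_rank_left: "a holomorphic_on ball 0 r \<Longrightarrow> finite_rank r (\<lambda>z w. a z)"
  using finite_rank_tensor[of a r "\<lambda>_. 1"] by simp

lemma finite_rank_right: "b holomorphic_on ball 0 r \<Longrightarrow> finite_rank r (\<lambda>z w. b w)"
  using finite_rank_tensor[of "\<lambda>_. 1" r b] by simp

lemma finite_rank_const: "finite_rank r (\<lambda>z w. c)"
  by (rule finite_rank_left) simp

lemma finite_rank_add:
  assumes "finite_rank r K" "finite_rank r K'" shows "finite_rank r (\<lambda>z w. K z w + K' z w)"
proof -
  obtain L L' where "\<forall>p\<in>set L. fst p holomorphic_on ball 0 r \<and> snd p holomorphic_on ball 0 r"
     "\<forall>z\<in>ball 0 r. \<forall>w\<in>ball 0 r. K z w = (\<Sum>p\<leftarrow>L. fst p z * snd p w)"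
     "\<forall>p\<in>set L'. fst p holomorphic_on ball 0 r \<and> snd p holomorphic_on ball 0 r"
     "\<forall>z\<in>ball 0 r. \<forall>w\<in>ball 0 r. K' z w = (\<Sum>p\<leftarrow>L'. fst p z * snd p w)"
    using assms unfolding finite_rank_def by blast
  then show ?thesis unfolding finite_rank_def by (intro exI[of _ "L @ L'"]) auto
qed

text \<open>The congruence case is needed because a kernel matters only on the product of the two discs.\<close>

lemma finite_rank_induct [consumes 1, case_names zero tensor cong]:
  assumes "finite_rank r K"
    and zero: "Q (\<lambda>z w. 0)"
    and step: "\<And>a b K. a holomorphic_on ball 0 r \<Longrightarrow> b holomorphic_on ball 0 r \<Longrightarrow> finite_rank r K \<Longrightarrow> Q K
       \<Longrightarrow> Q (\<lambda>z w. a z * b w + K z w)"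
    and cong: "\<And>K K'. Q K \<Longrightarrow> (\<And>z w. z \<in> ball 0 r \<Longrightarrow> w \<in> ball 0 r \<Longrightarrow> K' z w = K z w) \<Longrightarrow> Q K'"
  shows "Q K"
proof -
  obtain L where L: "\<forall>p\<in>set L. fst p holomorphic_on ball 0 r \<and> snd p holomorphic_on ball 0 r"
     "\<forall>z\<in>ball 0 r. \<forall>w\<in>ball 0 r. K z w = (\<Sum>p\<leftarrow>L. fst p z * snd p w)"
    using assms(1) unfolding finite_rank_def by blast
  have "Q (\<lambda>z w. \<Sum>p\<leftarrow>L. fst p z * snd p w)"
    using L(1)
  proof (induction L)
    case Nil
    then show ?case using zero by simp
  next
    case (Cons p L)
    have "finite_rank r (\<lambda>z w. \<Sum>p\<leftarrow>L. fst p z * snd p w)"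
      unfolding finite_rank_def using Cons.prems by (intro exI[of _ L]) simp
    then show ?case using step[of "fst p" "snd p"] Cons by simp
  qed
  then show ?thesis by (rule cong) (use L(2) in blast)
qed

lemma finite_rank_tensor_mult:
  assumes "a holomorphic_on ball 0 r" "b holomorphic_on ball 0 r" "finite_rank r K"
  shows "finite_rank r (\<lambda>z w. a z * b w * K z w)"
  using assms(3)
proof (induction rule: finite_rank_induct)
  case zero
  show ?case using finite_rank_const[of r 0] by simp
next
  case (tensor a' b' K)
  have "finite_rank r (\<lambda>z w. (\<lambda>z. a z * a' z) z * (\<lambda>w. b w * b' w) w + a z * b w * K z w)"
    using tensor assms(1,2) by (intro finite_rank_add finite_rank_tensor holomorphic_on_mult)
  then show ?case by (rule finite_rank_cong) (simp add: algebra_simps)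
next
  case (cong K K')
  show ?case by (rule finite_rank_cong[OF cong(1)]) (simp add: cong(2))
qed

lemma finite_rank_mult:
  assumes "finite_rank r K" "finite_rank r K'" shows "finite_rank r (\<lambda>z w. K z w * K' z w)"
  using assms(1)
proof (induction rule: finite_rank_induct)
  case zero
  show ?case using finite_rank_const[of r 0] by simp
next
  case (tensor a b K)
  have "finite_rank r (\<lambda>z w. a z * b w * K' z w + K z w * K' z w)"
    using tensor assms by (intro finite_rank_add finite_rank_tensor_mult)
  then show ?case by (rule finite_rank_cong) (simp add: algebra_simps)
next
  case (cong K K')
  show ?case by (rule finite_rank_cong[OF cong(1)]) (simp add: cong(2))
qed

lemma finite_rank_diff:
  assumes "finite_rank r K" "finite_rank r K'" shows "finite_rank r (\<lambda>z w. K z w - K' z w)"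
  using finite_rank_add[OF assms(1) finite_rank_mult[OF finite_rank_const[of r "-1"] assms(2)]] by simp

lemma finite_rank_power: "finite_rank r K \<Longrightarrow> finite_rank r (\<lambda>z w. K z w ^ n)"
  by (induction n) (auto intro: finite_rank_const finite_rank_mult)

lemma finite_rank_sum: "(\<And>i. i \<in> I \<Longrightarrow> finite_rank r (K i)) \<Longrightarrow> finite_rank r (\<lambda>z w. \<Sum>i\<in>I. K i z w)"
  by (induction I rule: infinite_finite_induct) (auto intro: finite_rank_const finite_rank_add)

lemma finite_rank_prod: "(\<And>i. i \<in> I \<Longrightarrow> finite_rank r (K i)) \<Longrightarrow> finite_rank r (\<lambda>z w. \<Prod>i\<in>I. K i z w)"
  by (induction I rule: infinite_finite_induct) (auto intro: finite_rank_const finite_rank_mult)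

lemma finite_rank_holomorphic:
  assumes "finite_rank r K" "w \<in> ball 0 r"
  shows "(\<lambda>z. K z w) holomorphic_on ball 0 r"
  using assms(1)
proof (induction rule: finite_rank_induct)
  case (cong K K')
  show ?case by (rule holomorphic_transform[OF cong(1)]) (metis cong(2) assms(2))
qed (auto intro!: holomorphic_intros)

lemma finite_rank_holomorphic_right:
  assumes "finite_rank r K" "z \<in> ball 0 r"
  shows "K z holomorphic_on ball 0 r"
  using assms(1)
proof (induction rule: finite_rank_induct)
  case (cong K K')
  show ?case by (rule holomorphic_transform[OF cong(1)]) (metis cong(2) assms(2))
qed (auto intro!: holomorphic_intros)

definition dz :: "(complex \<Rightarrow> complex \<Rightarrow> complex) \<Rightarrow> complex \<Rightarrow> complex \<Rightarrow> complex"
  where "dz K z w = deriv (\<lambda>z. K z w) z"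

lemma dz_has_derivative:
  "finite_rank r K \<Longrightarrow> z \<in> ball 0 r \<Longrightarrow> w \<in> ball 0 r \<Longrightarrow> ((\<lambda>z. K z w) has_field_derivative dz K z w) (at z)"
  unfolding dz_def by (rule holomorphic_derivI[OF finite_rank_holomorphic open_ball])

lemma dz_cong:
  assumes "z \<in> ball 0 r" "w \<in> ball 0 r" "\<And>z. z \<in> ball 0 r \<Longrightarrow> K' z w = K z w"
  shows "dz K' z w = dz K z w"
  unfolding dz_def
  by (intro deriv_cong_ev refl eventually_nhds_in_open[OF open_ball assms(1), THEN eventually_mono] assms(3))

lemma finite_rank_dz:
  assumes "finite_rank r K" shows "finite_rank r (dz K)"
  using assms
proof (induction rule: finite_rank_induct)
  case zero
  show ?case using finite_rank_const[of r 0] by (rule finite_rank_cong) (simp add: dz_def)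
next
  case (tensor a b K)
  have "finite_rank r (\<lambda>z w. deriv a z * b w + dz K z w)"
    using tensor by (intro finite_rank_add finite_rank_tensor holomorphic_deriv open_ball)
  moreover have "dz (\<lambda>z w. a z * b w + K z w) z w = deriv a z * b w + dz K z w"
    if "z \<in> ball 0 r" "w \<in> ball 0 r" for z w
  proof -
    have "((\<lambda>z. a z * b w + K z w) has_field_derivative deriv a z * b w + dz K z w) (at z)"
      using tensor that by (intro DERIV_add DERIV_cmult_right dz_has_derivative holomorphic_derivI[of a "ball 0 r"]) auto
    then show ?thesis unfolding dz_def[of "\<lambda>z w. a z * b w + K z w"] by (rule DERIV_imp_deriv)
  qed
  ultimately show ?case by (rule finite_rank_cong)
next
  case (cong K K')
  show ?case by (rule finite_rank_cong[OF cong(1)]) (use cong(2) in \<open>auto intro!: dz_cong[where r = r]\<close>)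
qed

lemma finite_rank_obtain:
  assumes "finite_rank r K"
  obtains k a b where "\<And>i. i < k \<Longrightarrow> a i holomorphic_on ball 0 r" "\<And>i. i < k \<Longrightarrow> b i holomorphic_on ball 0 r"
    "\<And>z w. z \<in> ball 0 r \<Longrightarrow> w \<in> ball 0 r \<Longrightarrow> K z w = (\<Sum>i<(k::nat). a i z * b i w)"
proof -
  obtain L where L: "\<forall>p\<in>set L. fst p holomorphic_on ball 0 r \<and> snd p holomorphic_on ball 0 r"
     "\<forall>z\<in>ball 0 r. \<forall>w\<in>ball 0 r. K z w = (\<Sum>p\<leftarrow>L. fst p z * snd p w)"
    using assms(1) unfolding finite_rank_def by blast
  show ?thesis
    by (rule that[of "length L" "\<lambda>i. fst (L ! i)" "\<lambda>i. snd (L ! i)"])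
       (use L in \<open>auto simp: sum_list_sum_nth atLeast0LessThan\<close>)
qed

lemma higher_deriv_combination:
  fixes a :: "nat \<Rightarrow> complex \<Rightarrow> complex"
  assumes "\<And>i. i < k \<Longrightarrow> a i holomorphic_on ball 0 r" "z \<in> ball 0 r"
  shows "(deriv ^^ m) (\<lambda>z. \<Sum>i<k. a i z * c i) z = (\<Sum>i<k. (deriv ^^ m) (a i) z * c i)"
  using assms
proof (induction k)
  case 0
  then show ?case by simp
next
  case (Suc k)
  have "(deriv ^^ m) (\<lambda>z. (\<Sum>i<k. a i z * c i) + a k z * c k) z
      = (deriv ^^ m) (\<lambda>z. \<Sum>i<k. a i z * c i) z + (deriv ^^ m) (\<lambda>z. a k z * c k) z"
    using Suc.prems by (intro higher_deriv_add[OF _ _ open_ball]) (auto intro!: holomorphic_intros)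
  also have "(deriv ^^ m) (\<lambda>z. a k z * c k) z = (deriv ^^ m) (a k) z * c k"
    using Suc.prems higher_deriv_cmult[of "a k" "ball 0 r" z m "c k"] by (simp add: mult.commute)
  finally show ?case using Suc by simp
qed

text \<open>A kernel that vanishes on \<open>w = cnj z\<close> vanishes identically: differentiating in real
  directions separates its derivatives in the two variables.\<close>

lemma polarisation:
  assumes "finite_rank r K" "r > 0" and 0: "\<And>z. z \<in> ball 0 r \<Longrightarrow> K z (cnj z) = 0"
    and zw: "z \<in> ball 0 r" "w \<in> ball 0 r"
  shows "K z w = 0"
proof -
  obtain k a b where a: "\<And>i. i < k \<Longrightarrow> a i holomorphic_on ball 0 r"
    and b: "\<And>i. i < k \<Longrightarrow> b i holomorphic_on ball 0 r"
    and K: "\<And>z w. z \<in> ball 0 r \<Longrightarrow> w \<in> ball 0 r \<Longrightarrow> K z w = (\<Sum>i<(k::nat). a i z * b i w)"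
    by (rule finite_rank_obtain[OF assms(1)]) blast
  define S where "S m n z = (\<Sum>i<k. (deriv ^^ m) (a i) z * (deriv ^^ n) (b i) (cnj z))" for m n z
  have der: "(S m n has_derivative (\<lambda>t. t * S (Suc m) n z + cnj t * S m (Suc n) z)) (at z)"
    if z: "z \<in> ball 0 r" for m n z
  proof -
    have ai: "((deriv ^^ m) (a i) has_derivative (\<lambda>t. (deriv ^^ Suc m) (a i) z * t)) (at z)" if "i < k" for i
      using z has_field_derivative_imp_has_derivative[OF holomorphic_derivI[OF holomorphic_higher_deriv[OF a[OF that] open_ball] open_ball z]]
      by simp
    have bi: "((\<lambda>z. (deriv ^^ n) (b i) (cnj z)) has_derivative (\<lambda>t. (deriv ^^ Suc n) (b i) (cnj z) * cnj t)) (at z)"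
      if "i < k" for i
    proof -
      have cz: "cnj z \<in> ball 0 r" using z by simp
      have 1: "((deriv ^^ n) (b i) has_derivative (\<lambda>t. (deriv ^^ Suc n) (b i) (cnj z) * t)) (at (cnj z))"
        using has_field_derivative_imp_has_derivative[OF holomorphic_derivI[OF holomorphic_higher_deriv[OF b[OF that] open_ball] open_ball cz]]
        by simp
      have "(cnj has_derivative cnj) (at z)" by (rule bounded_linear_imp_has_derivative[OF bounded_linear_cnj])
      from has_derivative_compose[OF this 1] show ?thesis .
    qed
    have "(S m n has_derivative (\<lambda>t. \<Sum>i<k. (deriv ^^ m) (a i) z * ((deriv ^^ Suc n) (b i) (cnj z) * cnj t)
        + (deriv ^^ Suc m) (a i) z * t * (deriv ^^ n) (b i) (cnj z))) (at z)"
      unfolding S_def[abs_def] using ai bi by (intro has_derivative_sum has_derivative_mult) auto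
    then show ?thesis
      by (rule has_derivative_eq_rhs) (simp add: S_def fun_eq_iff sum.distrib sum_distrib_left algebra_simps)
  qed
  have S0: "S m n z = 0" if "z \<in> ball 0 r" for m n z
    using that
  proof (induction "m + n" arbitrary: m n z)
    case 0
    have "cnj z \<in> ball 0 r" using 0(2) by simp
    then show ?case using 0(1,2) assms(3)[of z] K[of z "cnj z"] by (simp add: S_def)
  next
    case (Suc l)
    have step: "S (Suc m) n z = 0 \<and> S m (Suc n) z = 0" if "l = m + n" and z: "z \<in> ball 0 r" for m n z
    proof -
      have "(S m n has_derivative (\<lambda>t. 0)) (at z)"
        by (rule has_derivative_transform_within_open[OF has_derivative_const open_ball[of 0 r] z])
           (use Suc.hyps(1)[OF that(1)] in auto)
      from has_derivative_unique[OF der[OF z, of m n] this]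
      have eq: "t * S (Suc m) n z + cnj t * S m (Suc n) z = 0" for t by metis
      have "S (Suc m) n z + S m (Suc n) z = 0" using eq[of 1] by simp
      moreover have "\<i> * (S (Suc m) n z - S m (Suc n) z) = 0" using eq[of \<i>] by (simp add: algebra_simps)
      ultimately show ?thesis by (simp add: add_eq_0_iff)
    qed
    show ?case
    proof (cases m)
      case 0
      then obtain n' where "n = Suc n'" "l = m + n'" using Suc.hyps(2) by (cases n) auto
      then show ?thesis using step Suc.prems by blast
    next
      case (Suc m')
      then have "l = m' + n" using \<open>Suc l = m + n\<close> by simp
      then show ?thesis using step \<open>z \<in> ball 0 r\<close> \<open>m = Suc m'\<close> by blast
    qed
  qed
  have r0: "(0::complex) \<in> ball 0 r" using assms(2) by simp
  have 1: "(\<Sum>i<k. a i z * (deriv ^^ n) (b i) 0) = 0" for n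
  proof (rule holomorphic_fun_eq_0_on_ball[where f = "\<lambda>z. \<Sum>i<k. a i z * (deriv ^^ n) (b i) 0", OF _ zw(1)])
    show "(\<lambda>z. \<Sum>i<k. a i z * (deriv ^^ n) (b i) 0) holomorphic_on ball 0 r"
      using a by (intro holomorphic_intros) auto
    show "(deriv ^^ m) (\<lambda>z. \<Sum>i<k. a i z * (deriv ^^ n) (b i) 0) 0 = 0" for m
      using S0[OF r0, of m n] by (simp add: higher_deriv_combination[OF a r0] S_def)
  qed
  have "(\<Sum>i<k. b i w * a i z) = 0"
  proof (rule holomorphic_fun_eq_0_on_ball[where f = "\<lambda>w. \<Sum>i<k. b i w * a i z", OF _ zw(2)])
    show "(\<lambda>w. \<Sum>i<k. b i w * a i z) holomorphic_on ball 0 r"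
      using b by (intro holomorphic_intros) auto
    show "(deriv ^^ m) (\<lambda>w. \<Sum>i<k. b i w * a i z) 0 = 0" for m
    proof -
      have "(deriv ^^ m) (\<lambda>w. \<Sum>i<k. b i w * a i z) 0 = (\<Sum>i<k. (deriv ^^ m) (b i) 0 * a i z)"
        by (rule higher_deriv_combination[OF b r0])
      then show ?thesis using 1[of m] by (simp only: mult.commute)
    qed
  qed
  then show ?thesis using K[OF zw] by (simp add: mult.commute)
qed

section \<open>Rigidity of the kernel equation\<close>

text \<open>Independence makes the coefficients of a vanishing combination vanish, so that normalised coefficients
  cannot converge to those of the zero function.\<close>

lemma holomorphic_basis_exists:
  assumes r: "r > 0" and "\<And>a. a \<in> set L \<Longrightarrow> a holomorphic_on ball 0 r"
  shows "\<exists>e d. holomorphic_basis e d r \<and> (\<forall>a\<in>set L. \<exists>c. \<forall>z\<in>ball 0 r. a z = lc e d c z)"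
  using assms(2)
proof (induction L)
  case Nil
  have "holomorphic_basis (\<lambda>_ _. 0) 0 r" using r by unfold_locales auto
  then show ?case by auto
next
  case (Cons a L)
  then obtain e d where e: "holomorphic_basis e d r" "\<forall>a\<in>set L. \<exists>c. \<forall>z\<in>ball 0 r. a z = lc e d c z"
    by force
  interpret holomorphic_basis e d r by (rule e(1))
  show ?case
  proof (cases "\<exists>c. \<forall>z\<in>ball 0 r. a z = lc e d c z")
    case True
    then show ?thesis using e by (intro exI[of _ e] exI[of _ d]) simp
  next
    case False
    have split: "lc (e(d := a)) (Suc d) c z = lc e d c z + c d * a z" for c z by (simp add: lc_def)
    have "holomorphic_basis (e(d := a)) (Suc d) r"
    proof
      show "(e(d := a)) i holomorphic_on ball 0 r" if "i < Suc d" for i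
        using that hol Cons.prems by (cases "i = d") auto
      show "\<forall>i<Suc d. c i = 0" if c: "\<And>z. z \<in> ball 0 r \<Longrightarrow> lc (e(d := a)) (Suc d) c z = 0" for c
      proof -
        have "c d = 0"
        proof (rule ccontr)
          assume cd: "c d \<noteq> 0"
          have "a z = lc e d (\<lambda>i. (- 1 / c d) * c i) z" if "z \<in> ball 0 r" for z
            using c[OF that] cd unfolding split lc_scale by (simp add: field_simps add_eq_0_iff)
          with False show False by blast
        qed
        then have "lc e d c z = 0" if "z \<in> ball 0 r" for z using c[OF that] unfolding split by simp
        then have "\<forall>i<d. c i = 0" by (rule indep)
        with \<open>c d = 0\<close> show ?thesis by (simp add: less_Suc_eq)
      qed
    qed (rule r)
    moreover have "\<exists>c. \<forall>z\<in>ball 0 r. b z = lc (e(d := a)) (Suc d) c z" if "b \<in> set (a # L)" for b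
    proof (cases "b = a")
      case True
      have "lc e d (\<lambda>i. if i = d then 1 else 0) z = 0" for z by (simp add: lc_def)
      then show ?thesis using True by (intro exI[of _ "\<lambda>i. if i = d then 1 else 0"]) (simp add: split)
    next
      case False
      then obtain c where c: "\<forall>z\<in>ball 0 r. b z = lc e d c z" using e(2) \<open>b \<in> set (a # L)\<close> by auto
      have "lc e d (c(d := 0)) z = lc e d c z" for z by (simp add: lc_def)
      then show ?thesis using c by (intro exI[of _ "c(d := 0)"]) (simp add: split)
    qed
    ultimately show ?thesis by blast
  qed
qed

lemma kernel_coefficients:
  assumes "\<forall>p\<in>set L. fst p holomorphic_on ball 0 r \<and> snd p holomorphic_on ball 0 r"
    and "\<forall>p\<in>set L. \<exists>c. \<forall>z\<in>ball 0 r. fst p z = lc e d c z"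
  shows "\<exists>k. (\<forall>i<d. k i holomorphic_on ball 0 r) \<and>
     (\<forall>z\<in>ball 0 r. \<forall>w. (\<Sum>p\<leftarrow>L. fst p z * snd p w) = lc e d (\<lambda>i. k i w) z)"
  using assms
proof (induction L)
  case Nil
  show ?case by (intro exI[of _ "\<lambda>_ _. 0"]) (simp add: lc_def)
next
  case (Cons p L)
  then obtain k where k: "\<forall>i<d. k i holomorphic_on ball 0 r"
     "\<forall>z\<in>ball 0 r. \<forall>w. (\<Sum>p\<leftarrow>L. fst p z * snd p w) = lc e d (\<lambda>i. k i w) z" by auto
  obtain c where c: "\<forall>z\<in>ball 0 r. fst p z = lc e d c z" using Cons.prems(2) by auto
  have "lc e d (\<lambda>i. c i * snd p w + k i w) z = lc e d c z * snd p w + lc e d (\<lambda>i. k i w) z" for z w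
    by (simp add: lc_def sum_distrib_left sum.distrib algebra_simps)
  then show ?case using k c Cons.prems(1)
    by (intro exI[of _ "\<lambda>i w. c i * snd p w + k i w"]) (auto intro!: holomorphic_intros)
qed

text \<open>The coefficients of the power series quotient \<open>G / H\<close> for \<open>H = 1 + \<dots>\<close>.\<close>

fun quotient_coeff :: "(nat \<Rightarrow> complex) \<Rightarrow> (nat \<Rightarrow> complex) \<Rightarrow> nat \<Rightarrow> complex" where
  "quotient_coeff G H k = G k - (\<Sum>j<k. quotient_coeff G H j * H (k - j))"

declare quotient_coeff.simps [simp del]

abbreviation taylor :: "(complex \<Rightarrow> complex) \<Rightarrow> nat \<Rightarrow> complex"
  where "taylor f k \<equiv> (deriv ^^ k) f 0 / fact k"

text \<open>The Taylor coefficients of \<open>R / H\<close> are polynomials in those of \<open>R\<close> and \<open>H\<close> if \<open>H(0) = 1\<close>. Hence they are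
  elements of the algebra, and characters act on them.\<close>

lemma taylor_quotient:
  assumes T: "T holomorphic_on ball 0 r" and H: "H holomorphic_on ball 0 r" and r: "r > 0"
    and R: "\<And>z. z \<in> ball 0 r \<Longrightarrow> R z = T z * H z" and H0: "H 0 = 1"
  shows "taylor T k = quotient_coeff (taylor R) (taylor H) k"
proof (induction k rule: less_induct)
  case (less k)
  have z0: "0 \<in> ball (0::complex) r" using r by simp
  have "(deriv ^^ k) R 0 = (deriv ^^ k) (\<lambda>z. T z * H z) 0"
    by (intro higher_deriv_cong_ev refl eventually_nhds_in_open[OF open_ball z0, THEN eventually_mono] R)
  also have "\<dots> = (\<Sum>i = 0..k. of_nat (k choose i) * (deriv ^^ i) T 0 * (deriv ^^ (k - i)) H 0)"
    by (rule higher_deriv_mult[OF T H open_ball z0])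
  also have "\<dots> = (\<Sum>i = 0..k. fact k * (taylor T i * taylor H (k - i)))"
    by (intro sum.cong refl) (simp add: binomial_fact field_simps)
  also have "\<dots> = fact k * (\<Sum>i\<le>k. taylor T i * taylor H (k - i))"
    by (simp add: sum_distrib_left atLeast0AtMost)
  also have "(\<Sum>i\<le>k. taylor T i * taylor H (k - i)) = (\<Sum>i<k. taylor T i * taylor H (k - i)) + taylor T k"
    using H0 by (simp add: lessThan_Suc_atMost[symmetric])
  finally have "taylor R k = (\<Sum>i<k. taylor T i * taylor H (k - i)) + taylor T k" by simp
  then have "taylor T k = taylor R k - (\<Sum>i<k. taylor T i * taylor H (k - i))" by simp
  also have "(\<Sum>i<k. taylor T i * taylor H (k - i))
      = (\<Sum>i<k. quotient_coeff (taylor R) (taylor H) i * taylor H (k - i))"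
    by (intro sum.cong refl) (simp add: less)
  finally show ?case by (simp only: quotient_coeff.simps[of _ _ k])
qed

lemma quotient_coeff_falg:
  assumes "\<And>j. G j \<in> falg S" "\<And>j. H j \<in> falg S"
  shows "(\<lambda>w. quotient_coeff (\<lambda>j. G j w) (\<lambda>j. H j w) k) \<in> falg S"
proof (induction k rule: less_induct)
  case (less k)
  have "(\<lambda>w. G k w - (\<Sum>i<k. quotient_coeff (\<lambda>j. G j w) (\<lambda>j. H j w) i * H (k - i) w)) \<in> falg S"
    by (rule falg_diff'[OF assms(1) falg_sum[OF falg_mult'[OF less assms(2)]]]) simp
  then show ?case by (subst quotient_coeff.simps)
qed

lemma character_quotient_coeff:
  assumes ch: "character (falg S) ch" and GH: "\<And>j. G j \<in> falg S" "\<And>j. H j \<in> falg S"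
  shows "ch (\<lambda>w. quotient_coeff (\<lambda>j. G j w) (\<lambda>j. H j w) k) = quotient_coeff (\<lambda>j. ch (G j)) (\<lambda>j. ch (H j)) k"
proof (induction k rule: less_induct)
  case (less k)
  define q where "q i w = quotient_coeff (\<lambda>j. G j w) (\<lambda>j. H j w) i" for i w
  have q: "q i \<in> falg S" for i unfolding q_def[abs_def] by (rule quotient_coeff_falg[OF GH])
  have prod: "(\<lambda>w. q i w * H (k - i) w) \<in> falg S" for i by (rule falg_mult'[OF q GH(2)])
  have "ch (\<lambda>w. q k w) = ch (\<lambda>w. G k w - (\<Sum>i<k. q i w * H (k - i) w))"
    unfolding q_def by (subst quotient_coeff.simps) simp
  also have "\<dots> = ch (G k) - ch (\<lambda>w. \<Sum>i<k. q i w * H (k - i) w)"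
    by (rule character_diff[OF ch GH(1) falg_sum[OF prod]])
  also have "ch (\<lambda>w. \<Sum>i<k. q i w * H (k - i) w) = (\<Sum>i<k. ch (\<lambda>w. q i w * H (k - i) w))"
    by (rule character_sum[OF ch prod]) simp
  also have "\<dots> = (\<Sum>i<k. quotient_coeff (\<lambda>j. ch (G j)) (\<lambda>j. ch (H j)) i * ch (H (k - i)))"
  proof (intro sum.cong refl)
    fix i assume "i \<in> {..<k}"
    then have "i < k" by simp
    have "ch (\<lambda>w. q i w * H (k - i) w) = ch (q i) * ch (H (k - i))" by (rule character_mult[OF ch q GH(2)])
    then show "ch (\<lambda>w. q i w * H (k - i) w) = quotient_coeff (\<lambda>j. ch (G j)) (\<lambda>j. ch (H j)) i * ch (H (k - i))"
      using less[OF \<open>i < k\<close>] by (simp add: q_def[abs_def])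
  qed
  finally show ?case unfolding q_def by (simp only: quotient_coeff.simps[of _ _ k])
qed

lemma quotient_coeff_holomorphic:
  assumes "\<And>j. G j holomorphic_on A" "\<And>j. H j holomorphic_on A"
  shows "(\<lambda>w. quotient_coeff (\<lambda>j. G j w) (\<lambda>j. H j w) k) holomorphic_on A"
proof (induction k rule: less_induct)
  case (less k)
  have "(\<lambda>w. G k w - (\<Sum>i<k. quotient_coeff (\<lambda>j. G j w) (\<lambda>j. H j w) i * H (k - i) w)) holomorphic_on A"
    using less by (intro holomorphic_intros assms) auto
  then show ?case by (subst quotient_coeff.simps)
qed

text \<open>Under a character of the algebra generated by the coefficient functions in \<open>w\<close>, the kernels become
  solutions in the span of a fixed basis. The Taylor coefficients of \<open>R / H\<close> of positive order are elements
  of the algebra that are bounded on characters, so they have finite range, and being holomorphic in \<open>w\<close> they are constant. If \<open>H\<close> depends on \<open>w\<close>, one of its Taylor coefficients is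
  unbounded on characters; then \<open>R\<close> may be dropped from the equation because \<open>(R / H)'\<close> is a fixed function,
  and the orders of vanishing of a limit determine \<open>s\<close>.\<close>

theorem kernel_equation_rigidity:
  fixes s :: complex
  assumes r: "r > 0" and P: "finite_rank r P" and H: "finite_rank r H" and R: "finite_rank r R"
    and E: "E holomorphic_on ball 0 r"
    and P0: "\<And>w. w \<in> ball 0 r \<Longrightarrow> P 0 w = 1" and H0: "\<And>w. w \<in> ball 0 r \<Longrightarrow> H 0 w = 1"
    and eq: "\<And>z w. z \<in> ball 0 r \<Longrightarrow> w \<in> ball 0 r \<Longrightarrow>
      dz P z w * (H z w)\<^sup>2 - s * dz H z w * H z w * P z w
       + (dz R z w * H z w - R z w * dz H z w) * P z w = E z * P z w * (H z w)\<^sup>2"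
  shows "\<exists>D. D holomorphic_on ball 0 r \<and>
       (\<forall>z\<in>ball 0 r. \<forall>w\<in>ball 0 r. dz R z w * H z w - R z w * dz H z w = D z * (H z w)\<^sup>2)"
    and "(\<exists>z\<in>ball 0 r. \<exists>w\<in>ball 0 r. H z w \<noteq> H z 0) \<Longrightarrow> \<exists>l m. m > 0 \<and> of_nat l = s * of_nat m"
proof -
  obtain LP LH LR where L:
     "\<forall>p\<in>set LP. fst p holomorphic_on ball 0 r \<and> snd p holomorphic_on ball 0 r"
     "\<forall>z\<in>ball 0 r. \<forall>w\<in>ball 0 r. P z w = (\<Sum>p\<leftarrow>LP. fst p z * snd p w)"
     "\<forall>p\<in>set LH. fst p holomorphic_on ball 0 r \<and> snd p holomorphic_on ball 0 r"
     "\<forall>z\<in>ball 0 r. \<forall>w\<in>ball 0 r. H z w = (\<Sum>p\<leftarrow>LH. fst p z * snd p w)"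
     "\<forall>p\<in>set LR. fst p holomorphic_on ball 0 r \<and> snd p holomorphic_on ball 0 r"
     "\<forall>z\<in>ball 0 r. \<forall>w\<in>ball 0 r. R z w = (\<Sum>p\<leftarrow>LR. fst p z * snd p w)"
    using P H R unfolding finite_rank_def by blast
  have "\<exists>e d. holomorphic_basis e d r \<and>
      (\<forall>a\<in>set (map fst (LP @ LH @ LR)). \<exists>c. \<forall>z\<in>ball 0 r. a z = lc e d c z)"
    by (rule holomorphic_basis_exists[OF r]) (use L in auto)
  then obtain e d where basis: "holomorphic_basis e d r"
    and span': "\<forall>a\<in>set (map fst (LP @ LH @ LR)). \<exists>c. \<forall>z\<in>ball 0 r. a z = lc e d c z"
    by blast
  interpret holomorphic_basis e d r by (rule basis)
  have spans: "\<forall>p\<in>set LP. \<exists>c. \<forall>z\<in>ball 0 r. fst p z = lc e d c z"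
      "\<forall>p\<in>set LH. \<exists>c. \<forall>z\<in>ball 0 r. fst p z = lc e d c z"
      "\<forall>p\<in>set LR. \<exists>c. \<forall>z\<in>ball 0 r. fst p z = lc e d c z"
    using span' unfolding set_map set_append by blast+
  obtain p where p: "\<forall>i<d. p i holomorphic_on ball 0 r"
      "\<forall>z\<in>ball 0 r. \<forall>w. (\<Sum>p\<leftarrow>LP. fst p z * snd p w) = lc e d (\<lambda>i. p i w) z"
    using kernel_coefficients[OF L(1) spans(1)] by (elim exE conjE)
  obtain h where h: "\<forall>i<d. h i holomorphic_on ball 0 r"
      "\<forall>z\<in>ball 0 r. \<forall>w. (\<Sum>p\<leftarrow>LH. fst p z * snd p w) = lc e d (\<lambda>i. h i w) z"
    using kernel_coefficients[OF L(3) spans(2)] by (elim exE conjE)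
  obtain g where g: "\<forall>i<d. g i holomorphic_on ball 0 r"
      "\<forall>z\<in>ball 0 r. \<forall>w. (\<Sum>p\<leftarrow>LR. fst p z * snd p w) = lc e d (\<lambda>i. g i w) z"
    using kernel_coefficients[OF L(5) spans(3)] by (elim exE conjE)
  have z0: "0 \<in> ball (0::complex) r" using r by simp
  have PHR: "P z w = lc e d (\<lambda>i. p i w) z" "H z w = lc e d (\<lambda>i. h i w) z" "R z w = lc e d (\<lambda>i. g i w) z"
    if "z \<in> ball 0 r" "w \<in> ball 0 r" for z w
    using that L p h g by auto
  have dPHR: "dz P z w = lc de d (\<lambda>i. p i w) z" "dz H z w = lc de d (\<lambda>i. h i w) z"
      "dz R z w = lc de d (\<lambda>i. g i w) z" if z: "z \<in> ball 0 r" and w: "w \<in> ball 0 r" for z w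
  proof -
    have "dz K z w = lc de d (\<lambda>i. k i w) z" if "\<And>z. z \<in> ball 0 r \<Longrightarrow> K z w = lc e d (\<lambda>i. k i w) z" for K k
    proof -
      have "dz K z w = dz (\<lambda>z w. lc e d (\<lambda>i. k i w) z) z w" by (rule dz_cong[OF z w]) (rule that)
      then show ?thesis by (simp only: dz_def deriv_lc[OF z])
    qed
    then show "dz P z w = lc de d (\<lambda>i. p i w) z" "dz H z w = lc de d (\<lambda>i. h i w) z"
      "dz R z w = lc de d (\<lambda>i. g i w) z" using PHR w by blast+
  qed
  \<comment> \<open>Coefficient functions are extended by their values at \<open>0\<close>, so that relations that hold on the
    disc hold in the algebra.\<close>
  define \<phi> where "\<phi> w = (if w \<in> ball 0 r then w else 0)" for w :: complex
  have \<phi>: "\<phi> w \<in> ball 0 r" for w using z0 by (simp add: \<phi>_def)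
  define S where "S = (\<lambda>i w. p i (\<phi> w)) ` {..<d} \<union> (\<lambda>i w. h i (\<phi> w)) ` {..<d} \<union> (\<lambda>i w. g i (\<phi> w)) ` {..<d}"
  have fin: "finite S" by (simp add: S_def)
  have mem: "(\<lambda>w. p i (\<phi> w)) \<in> falg S" "(\<lambda>w. h i (\<phi> w)) \<in> falg S" "(\<lambda>w. g i (\<phi> w)) \<in> falg S" if "i < d" for i
    using that by (auto intro!: falg_base simp: S_def)
  have lcmem: "(\<lambda>w. lc f d (\<lambda>i. p i (\<phi> w)) z) \<in> falg S" "(\<lambda>w. lc f d (\<lambda>i. h i (\<phi> w)) z) \<in> falg S"
     "(\<lambda>w. lc f d (\<lambda>i. g i (\<phi> w)) z) \<in> falg S" for f z
    using falg_lc[of d "\<lambda>i w. p i (\<phi> w)" S] falg_lc[of d "\<lambda>i w. h i (\<phi> w)" S]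
      falg_lc[of d "\<lambda>i w. g i (\<phi> w)" S] mem by auto
  have lcch: "ch (\<lambda>w. lc f d (\<lambda>i. p i (\<phi> w)) z) = lc f d (\<lambda>i. ch (\<lambda>w. p i (\<phi> w))) z"
     "ch (\<lambda>w. lc f d (\<lambda>i. h i (\<phi> w)) z) = lc f d (\<lambda>i. ch (\<lambda>w. h i (\<phi> w))) z"
     "ch (\<lambda>w. lc f d (\<lambda>i. g i (\<phi> w)) z) = lc f d (\<lambda>i. ch (\<lambda>w. g i (\<phi> w))) z"
    if "character (falg S) ch" for ch f z
    by (rule character_lc[OF that], rule mem, assumption)+
  note ch_simps = character_add character_mult character_const character_diff
  have ch1: "lc e d (\<lambda>i. ch (\<lambda>w. p i (\<phi> w))) 0 = 1" "lc e d (\<lambda>i. ch (\<lambda>w. h i (\<phi> w))) 0 = 1"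
    if ch: "character (falg S) ch" for ch
  proof -
    have "(\<lambda>w. lc e d (\<lambda>i. p i (\<phi> w)) 0) = (\<lambda>_. 1)" "(\<lambda>w. lc e d (\<lambda>i. h i (\<phi> w)) 0) = (\<lambda>_. 1)"
      using P0[OF \<phi>] H0[OF \<phi>] PHR[OF z0 \<phi>] by (simp_all add: fun_eq_iff)
    then show "lc e d (\<lambda>i. ch (\<lambda>w. p i (\<phi> w))) 0 = 1" "lc e d (\<lambda>i. ch (\<lambda>w. h i (\<phi> w))) 0 = 1"
      using lcch[OF ch, of e 0] character_const[OF ch, of 1] by simp_all
  qed
  have cheq: "log_equation s E (\<lambda>i. ch (\<lambda>w. p i (\<phi> w))) (\<lambda>i. ch (\<lambda>w. h i (\<phi> w))) (\<lambda>i. ch (\<lambda>w. g i (\<phi> w)))"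
    if ch: "character (falg S) ch" for ch
    unfolding log_equation_def
  proof
    fix z :: complex assume z: "z \<in> ball 0 r"
    define A A' B B' C C' where "A = (\<lambda>w. lc e d (\<lambda>i. p i (\<phi> w)) z)" and "A' = (\<lambda>w. lc de d (\<lambda>i. p i (\<phi> w)) z)"
      and "B = (\<lambda>w. lc e d (\<lambda>i. h i (\<phi> w)) z)" and "B' = (\<lambda>w. lc de d (\<lambda>i. h i (\<phi> w)) z)"
      and "C = (\<lambda>w. lc e d (\<lambda>i. g i (\<phi> w)) z)" and "C' = (\<lambda>w. lc de d (\<lambda>i. g i (\<phi> w)) z)"
    note defs = A_def A'_def B_def B'_def C_def C'_def
    have m: "A \<in> falg S" "A' \<in> falg S" "B \<in> falg S" "B' \<in> falg S" "C \<in> falg S" "C' \<in> falg S"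
      unfolding defs by (rule lcmem)+
    have "(\<lambda>w. A' w * (B w * B w) - s * B' w * B w * A w + (C' w * B w - C w * B' w) * A w)
        = (\<lambda>w. E z * A w * (B w * B w))"
      using eq[OF z \<phi>] unfolding PHR[OF z \<phi>] dPHR[OF z \<phi>] defs power2_eq_square by (intro ext)
    then have "ch (\<lambda>w. A' w * (B w * B w) - s * B' w * B w * A w + (C' w * B w - C w * B' w) * A w)
        = ch (\<lambda>w. E z * A w * (B w * B w))" by (rule arg_cong)
    then have "ch A' * (ch B * ch B) - s * ch B' * ch B * ch A + (ch C' * ch B - ch C * ch B') * ch A
        = E z * ch A * (ch B * ch B)"
      by (simp add: character_add[OF ch] character_mult[OF ch] character_const[OF ch] character_diff[OF ch]
          falg_add' falg_mult' falg_diff' falg_const m)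
    then show "lc de d (\<lambda>i. ch (\<lambda>w. p i (\<phi> w))) z * (lc e d (\<lambda>i. ch (\<lambda>w. h i (\<phi> w))) z)\<^sup>2
        - s * lc de d (\<lambda>i. ch (\<lambda>w. h i (\<phi> w))) z * lc e d (\<lambda>i. ch (\<lambda>w. h i (\<phi> w))) z * lc e d (\<lambda>i. ch (\<lambda>w. p i (\<phi> w))) z
        + (lc de d (\<lambda>i. ch (\<lambda>w. g i (\<phi> w))) z * lc e d (\<lambda>i. ch (\<lambda>w. h i (\<phi> w))) z
         - lc e d (\<lambda>i. ch (\<lambda>w. g i (\<phi> w))) z * lc de d (\<lambda>i. ch (\<lambda>w. h i (\<phi> w))) z) * lc e d (\<lambda>i. ch (\<lambda>w. p i (\<phi> w))) z
        = E z * lc e d (\<lambda>i. ch (\<lambda>w. p i (\<phi> w))) z * (lc e d (\<lambda>i. ch (\<lambda>w. h i (\<phi> w))) z)\<^sup>2"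
      unfolding defs lcch[OF ch] power2_eq_square .
  qed
  have "\<exists>T. T holomorphic_on ball 0 r \<and> (\<forall>z\<in>ball 0 r. lc e d (\<lambda>i. ch (\<lambda>w. g i (\<phi> w))) z
      = T z * lc e d (\<lambda>i. ch (\<lambda>w. h i (\<phi> w))) z)" if ch: "character (falg S) ch" for ch
  proof (rule quotient_has_no_poles[OF lc_holomorphic lc_holomorphic lc_holomorphic E _ _ r])
    show "lc e d (\<lambda>i. ch (\<lambda>w. p i (\<phi> w))) 0 \<noteq> 0" "lc e d (\<lambda>i. ch (\<lambda>w. h i (\<phi> w))) 0 \<noteq> 0"
      using ch1[OF ch] by simp_all
    fix z :: complex assume z: "z \<in> ball 0 r"
    show "deriv (lc e d (\<lambda>i. ch (\<lambda>w. p i (\<phi> w)))) z * (lc e d (\<lambda>i. ch (\<lambda>w. h i (\<phi> w))) z)\<^sup>2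
        - s * deriv (lc e d (\<lambda>i. ch (\<lambda>w. h i (\<phi> w)))) z * lc e d (\<lambda>i. ch (\<lambda>w. h i (\<phi> w))) z * lc e d (\<lambda>i. ch (\<lambda>w. p i (\<phi> w))) z
        + (deriv (lc e d (\<lambda>i. ch (\<lambda>w. g i (\<phi> w)))) z * lc e d (\<lambda>i. ch (\<lambda>w. h i (\<phi> w))) z
         - lc e d (\<lambda>i. ch (\<lambda>w. g i (\<phi> w))) z * deriv (lc e d (\<lambda>i. ch (\<lambda>w. h i (\<phi> w)))) z) * lc e d (\<lambda>i. ch (\<lambda>w. p i (\<phi> w))) z
        = E z * lc e d (\<lambda>i. ch (\<lambda>w. p i (\<phi> w))) z * (lc e d (\<lambda>i. ch (\<lambda>w. h i (\<phi> w))) z)\<^sup>2"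
      using cheq[OF ch] z unfolding log_equation_def deriv_lc[OF z] by blast
  qed
  then obtain T where T: "\<And>ch. character (falg S) ch \<Longrightarrow> T ch holomorphic_on ball 0 r"
      "\<And>ch z. character (falg S) ch \<Longrightarrow> z \<in> ball 0 r \<Longrightarrow> lc e d (\<lambda>i. ch (\<lambda>w. g i (\<phi> w))) z
      = T ch z * lc e d (\<lambda>i. ch (\<lambda>w. h i (\<phi> w))) z" by metis
  \<comment> \<open>The Taylor coefficients of the kernels are elements of the algebra.\<close>
  define f where "f k i z = (deriv ^^ k) (e i) z / fact k" for k i z
  have taylor_lc: "taylor (lc e d c) k = lc (f k) d c 0" for c k
  proof -
    have "(deriv ^^ k) (lc e d c) 0 = (deriv ^^ k) (\<lambda>z. \<Sum>i<d. e i z * c i) 0"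
      by (simp add: lc_def[abs_def] mult.commute)
    also have "\<dots> = (\<Sum>i<d. (deriv ^^ k) (e i) 0 * c i)" by (rule higher_deriv_combination[OF hol z0])
    finally show ?thesis by (simp add: lc_def f_def sum_divide_distrib mult.commute)
  qed
  define Gc where "Gc k w = lc (f k) d (\<lambda>i. g i (\<phi> w)) 0" for k w
  define Hc where "Hc k w = lc (f k) d (\<lambda>i. h i (\<phi> w)) 0" for k w
  have GH: "Gc k \<in> falg S" "Hc k \<in> falg S" for k unfolding Gc_def[abs_def] Hc_def[abs_def] by (rule lcmem)+
  define \<tau> where "\<tau> k w = quotient_coeff (\<lambda>j. Gc j w) (\<lambda>j. Hc j w) k" for k w
  have \<tau>mem: "\<tau> k \<in> falg S" for k unfolding \<tau>_def[abs_def] by (rule quotient_coeff_falg[OF GH])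
  have \<tau>ch: "ch (\<tau> k) = taylor (T ch) k" if ch: "character (falg S) ch" for ch k
  proof -
    have "taylor (T ch) k = quotient_coeff (taylor (lc e d (\<lambda>i. ch (\<lambda>w. g i (\<phi> w)))))
        (taylor (lc e d (\<lambda>i. ch (\<lambda>w. h i (\<phi> w))))) k"
      by (rule taylor_quotient[OF T(1)[OF ch] lc_holomorphic r T(2)[OF ch] ch1(2)[OF ch]])
    also have "\<dots> = quotient_coeff (\<lambda>j. ch (Gc j)) (\<lambda>j. ch (Hc j)) k"
      unfolding taylor_lc Gc_def[abs_def] Hc_def[abs_def] by (simp only: lcch[OF ch])
    also have "\<dots> = ch (\<tau> k)" unfolding \<tau>_def[abs_def] by (rule character_quotient_coeff[OF ch GH, symmetric])
    finally show ?thesis ..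
  qed
  have const: "a w = a 0" if a: "finite (range a)" and hol: "a' holomorphic_on ball 0 r"
      and aa': "\<And>w. w \<in> ball 0 r \<Longrightarrow> a w = a' w" and w: "w \<in> ball 0 r" for a a' :: "complex \<Rightarrow> complex" and w
  proof -
    have "a' ` ball 0 r \<subseteq> range a" using aa' by (metis image_subsetI rangeI)
    then have fin: "finite (a' ` ball 0 r)" using a finite_subset by blast
    have "a' constant_on ball 0 r"
      by (rule continuous_finite_range_constant[OF connected_ball holomorphic_on_imp_continuous_on[OF hol] fin])
    then have "a' w = a' 0" using w z0 unfolding constant_on_def by metis
    then show ?thesis using aa' w z0 by simp
  qed
  have \<tau>const: "\<tau> k w = \<tau> k 0" if k: "k \<ge> 1" and w: "w \<in> ball 0 r" for k w
  proof (rule const[OF _ _ _ w])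
    show "finite (range (\<tau> k))"
    proof (rule ccontr)
      assume "infinite (range (\<tau> k))"
      then have "\<exists>ch. character (falg S) ch \<and> norm (ch (\<tau> k)) > real n" for n
        by (rule character_unbounded[OF fin \<tau>mem])
      then obtain ch where ch: "\<And>n. character (falg S) (ch n)" "\<And>n. norm (ch n (\<tau> k)) > real n" by metis
      have "\<exists>n. norm ((deriv ^^ k) (T (ch n)) 0) \<le> real n"
        by (rule quotient_derivatives_bounded[OF ch1(2)[OF ch(1)] ch1(1)[OF ch(1)] cheq[OF ch(1)]
              T(1)[OF ch(1)] T(2)[OF ch(1)] k])
      then obtain n where n: "norm ((deriv ^^ k) (T (ch n)) 0) \<le> real n" by blast
      have "norm (taylor (T (ch n)) k) \<le> norm ((deriv ^^ k) (T (ch n)) 0)"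
        by (simp add: norm_divide divide_le_eq mult_le_cancel_left1)
      with n ch(2)[of n] show False unfolding \<tau>ch[OF ch(1)] by linarith
    qed
    define lG where "lG j w = lc (f j) d (\<lambda>i. g i w) 0" for j w
    define lH where "lH j w = lc (f j) d (\<lambda>i. h i w) 0" for j w
    have "lG j holomorphic_on ball 0 r" "lH j holomorphic_on ball 0 r" for j
      unfolding lG_def[abs_def] lH_def[abs_def] lc_def using g h by (auto intro!: holomorphic_intros)
    then show "(\<lambda>w. quotient_coeff (\<lambda>j. lG j w) (\<lambda>j. lH j w) k) holomorphic_on ball 0 r"
      by (rule quotient_coeff_holomorphic)
    show "\<tau> k w = quotient_coeff (\<lambda>j. lG j w) (\<lambda>j. lH j w) k" if "w \<in> ball 0 r" for w
      using that by (simp add: \<tau>_def Gc_def Hc_def lG_def lH_def \<phi>_def)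
  qed
  define D where "D = deriv (T (\<lambda>x. x 0))"
  have Dhol: "D holomorphic_on ball 0 r"
    unfolding D_def by (intro holomorphic_deriv T(1) character_evaluation open_ball)
  have DT: "deriv (T (\<lambda>x. x w)) z = D z" if w: "w \<in> ball 0 r" and z: "z \<in> ball 0 r" for z w
    unfolding D_def
  proof (rule holomorphic_fun_eq_on_ball[OF _ _ z])
    show "deriv (T (\<lambda>x. x w)) holomorphic_on ball 0 r" "deriv (T (\<lambda>x. x 0)) holomorphic_on ball 0 r"
      by (intro holomorphic_deriv T(1) character_evaluation open_ball)+
    fix n
    have "taylor (T (\<lambda>x. x w)) (Suc n) = taylor (T (\<lambda>x. x 0)) (Suc n)"
    proof -
      have "\<tau> (Suc n) v = taylor (T (\<lambda>x. x v)) (Suc n)" for v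
        using \<tau>ch[where ch = "\<lambda>x. x v", OF character_evaluation] .
      moreover have "\<tau> (Suc n) w = \<tau> (Suc n) 0" by (rule \<tau>const[OF _ w]) simp
      ultimately show ?thesis by metis
    qed
    then have "(deriv ^^ Suc n) (T (\<lambda>x. x w)) 0 = (deriv ^^ Suc n) (T (\<lambda>x. x 0)) 0"
      using fact_nonzero[of "Suc n", where 'a = complex] by (metis divide_cancel_right)
    then show "(deriv ^^ n) (deriv (T (\<lambda>x. x w))) 0 = (deriv ^^ n) (deriv (T (\<lambda>x. x 0))) 0"
      by (simp only: funpow_Suc_right o_def)
  qed
  have main: "dz R z w * H z w - R z w * dz H z w = D z * (H z w)\<^sup>2" if z: "z \<in> ball 0 r" and w: "w \<in> ball 0 r" for z w
  proof -
    define t where "t = T (\<lambda>x. x w)"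
    have t: "t holomorphic_on ball 0 r" unfolding t_def by (rule T(1)[OF character_evaluation])
    have \<phi>w: "\<phi> w = w" using w by (simp add: \<phi>_def)
    have RT: "R z w = t z * H z w" if "z \<in> ball 0 r" for z
      using T(2)[OF character_evaluation that, of w] PHR[OF that w] by (simp add: t_def \<phi>w)
    have "((\<lambda>z. t z * H z w) has_field_derivative t z * dz H z w + deriv t z * H z w) (at z)"
      by (rule DERIV_mult'[OF holomorphic_derivI[OF t open_ball z] dz_has_derivative[OF H z w]])
    then have "((\<lambda>z. R z w) has_field_derivative t z * dz H z w + deriv t z * H z w) (at z)"
      by (rule has_field_derivative_transform_within_open[OF _ open_ball z]) (simp add: RT)
    then have "dz R z w = t z * dz H z w + deriv t z * H z w" unfolding dz_def by (rule DERIV_imp_deriv)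
    then show ?thesis using RT[OF z] DT[OF w z] by (simp add: t_def power2_eq_square algebra_simps)
  qed
  then show "\<exists>D. D holomorphic_on ball 0 r \<and>
       (\<forall>z\<in>ball 0 r. \<forall>w\<in>ball 0 r. dz R z w * H z w - R z w * dz H z w = D z * (H z w)\<^sup>2)"
    using Dhol by blast
  assume "\<exists>z\<in>ball 0 r. \<exists>w\<in>ball 0 r. H z w \<noteq> H z 0"
  then obtain z1 w1 where zw1: "z1 \<in> ball 0 r" "w1 \<in> ball 0 r" "H z1 w1 \<noteq> H z1 0" by blast
  have "\<exists>k. infinite (range (Hc k))"
  proof (rule ccontr)
    assume no: "\<not> ?thesis"
    have "Hc k w1 = Hc k 0" for k
    proof (rule const[OF _ _ _ zw1(2)])
      show "finite (range (Hc k))" using no by blast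
      show "(\<lambda>w. lc (f k) d (\<lambda>i. h i w) 0) holomorphic_on ball 0 r"
        unfolding lc_def using h by (auto intro!: holomorphic_intros)
      show "Hc k w = lc (f k) d (\<lambda>i. h i w) 0" if "w \<in> ball 0 r" for w
        using that by (simp add: Hc_def \<phi>_def)
    qed
    then have "taylor (lc e d (\<lambda>i. h i w1)) k = taylor (lc e d (\<lambda>i. h i 0)) k" for k
      using zw1(2) z0 unfolding taylor_lc by (simp add: Hc_def \<phi>_def)
    then have "lc e d (\<lambda>i. h i w1) z1 = lc e d (\<lambda>i. h i 0) z1"
      by (intro holomorphic_fun_eq_on_ball[OF lc_holomorphic lc_holomorphic zw1(1)]) simp
    with zw1 PHR z0 show False by simp
  qed
  then obtain k where k: "infinite (range (Hc k))" by blast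
  define C where "C = (\<Sum>i<d. norm (f k i 0)) + 1"
  have C: "C > 0" unfolding C_def by (intro add_nonneg_pos sum_nonneg) auto
  have "\<exists>ch. character (falg S) ch \<and> norm (ch (Hc k)) > real n * C" for n
    by (rule character_unbounded[OF fin GH(2) k])
  then obtain ch where ch: "\<And>n. character (falg S) (ch n)" "\<And>n. norm (ch n (Hc k)) > real n * C" by metis
  show "\<exists>l m. m > 0 \<and> of_nat l = s * of_nat m"
  proof (rule exponent_is_ratio_of_orders[OF ch1(2)[OF ch(1)] ch1(1)[OF ch(1)]])
    show "(\<lambda>z. E z - D z) holomorphic_on ball 0 r" by (intro holomorphic_intros E Dhol)
    fix n
    show "cnorm d (\<lambda>i. ch n (\<lambda>w. h i (\<phi> w))) \<ge> real n"
    proof -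
      define c where "c i = ch n (\<lambda>w. h i (\<phi> w))" for i
      have "ch n (Hc k) = lc (f k) d c 0"
        unfolding Hc_def[abs_def] c_def by (rule lcch[OF ch(1)])
      also have "norm \<dots> \<le> (\<Sum>i<d. norm (c i * f k i 0))" unfolding lc_def by (rule norm_sum)
      also have "\<dots> \<le> (\<Sum>i<d. norm (c i) * C)"
      proof (intro sum_mono)
        fix i assume "i \<in> {..<d}"
        then have "norm (f k i 0) \<le> (\<Sum>i<d. norm (f k i 0))" by (intro member_le_sum) auto
        then show "norm (c i * f k i 0) \<le> norm (c i) * C"
          unfolding norm_mult C_def by (intro mult_left_mono) auto
      qed
      also have "\<dots> = cnorm d c * C" by (simp only: sum_distrib_right)
      finally have "real n * C < cnorm d c * C" using ch(2)[of n] by linarith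
      then show ?thesis using C unfolding c_def by simp
    qed
    show "log_equation s (\<lambda>z. E z - D z) (\<lambda>i. ch n (\<lambda>w. p i (\<phi> w))) (\<lambda>i. ch n (\<lambda>w. h i (\<phi> w))) (\<lambda>_. 0)"
      unfolding log_equation_def
    proof
      fix z :: complex assume z: "z \<in> ball 0 r"
      define B B' C C' where
        "B = (\<lambda>w. lc e d (\<lambda>i. h i (\<phi> w)) z)" and "B' = (\<lambda>w. lc de d (\<lambda>i. h i (\<phi> w)) z)"
        and "C = (\<lambda>w. lc e d (\<lambda>i. g i (\<phi> w)) z)" and "C' = (\<lambda>w. lc de d (\<lambda>i. g i (\<phi> w)) z)"
      note defs = B_def B'_def C_def C'_def
      have m: "B \<in> falg S" "B' \<in> falg S" "C \<in> falg S" "C' \<in> falg S"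
        unfolding defs by (rule lcmem)+
      have "(\<lambda>w. C' w * B w - C w * B' w) = (\<lambda>w. D z * (B w * B w))"
        using main[OF z \<phi>] unfolding PHR[OF z \<phi>] dPHR[OF z \<phi>] defs power2_eq_square by (intro ext)
      then have "ch n (\<lambda>w. C' w * B w - C w * B' w) = ch n (\<lambda>w. D z * (B w * B w))" by (rule arg_cong)
      then have 1: "ch n C' * ch n B - ch n C * ch n B' = D z * (ch n B * ch n B)"
        by (simp add: character_add[OF ch(1)] character_mult[OF ch(1)] character_const[OF ch(1)]
            character_diff[OF ch(1)] falg_add' falg_mult' falg_diff' falg_const m)
      have 2: "lc v d (\<lambda>_. 0) z = 0" for v by (simp add: lc_def)
      show "lc de d (\<lambda>i. ch n (\<lambda>w. p i (\<phi> w))) z * (lc e d (\<lambda>i. ch n (\<lambda>w. h i (\<phi> w))) z)\<^sup>2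
        - s * lc de d (\<lambda>i. ch n (\<lambda>w. h i (\<phi> w))) z * lc e d (\<lambda>i. ch n (\<lambda>w. h i (\<phi> w))) z * lc e d (\<lambda>i. ch n (\<lambda>w. p i (\<phi> w))) z
        + (lc de d (\<lambda>_. 0) z * lc e d (\<lambda>i. ch n (\<lambda>w. h i (\<phi> w))) z
         - lc e d (\<lambda>_. 0) z * lc de d (\<lambda>i. ch n (\<lambda>w. h i (\<phi> w))) z) * lc e d (\<lambda>i. ch n (\<lambda>w. p i (\<phi> w))) z
        = (E z - D z) * lc e d (\<lambda>i. ch n (\<lambda>w. p i (\<phi> w))) z * (lc e d (\<lambda>i. ch n (\<lambda>w. h i (\<phi> w))) z)\<^sup>2"
        using cheq[OF ch(1), of n, unfolded log_equation_def, rule_format, OF z, unfolded 1[unfolded defs lcch[OF ch(1)]]]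
        unfolding 2 by (simp add: power2_eq_square algebra_simps)
    qed
  qed
qed

section \<open>Parallel frames of holomorphic connections on a disc\<close>

lemma primitive_vanishing_at_centre:
  assumes "f holomorphic_on ball 0 r" "r > 0"
  shows "\<exists>F. F 0 = 0 \<and> (\<forall>z\<in>ball 0 r. (F has_field_derivative f z) (at z))"
proof -
  obtain g where g: "\<And>x. x \<in> ball 0 r \<Longrightarrow> (g has_field_derivative f x) (at x within ball 0 r)"
    using holomorphic_convex_primitive'[OF convex_ball open_ball assms(1)] by blast
  have "((\<lambda>z. g z - g 0) has_field_derivative f z) (at z)" if "z \<in> ball 0 r" for z
    using DERIV_diff[OF g[OF that] DERIV_const] that by (simp add: at_within_open[OF _ open_ball])
  then show ?thesis by (intro exI[of _ "\<lambda>z. g z - g 0"]) simp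
qed

text \<open>Picard iteration, written as a series: every increment is the primitive of \<open>A\<close> applied to the preceding one.
  On a disc of radius \<open>1 / (2 M)\<close>, with \<open>M\<close> a bound for the rows of \<open>A\<close>, the increments decay like \<open>2\<^sup>-\<^sup>n\<close>.\<close>

lemma holomorphic_linear_ode:
  fixes A :: "complex \<Rightarrow> complex^'m^'m"
  assumes r: "r > 0" and A: "\<And>i j. (\<lambda>z. A z $ i $ j) holomorphic_on ball 0 r"
  shows "\<exists>\<rho>. 0 < \<rho> \<and> \<rho> \<le> r \<and> (\<forall>y0. \<exists>Y. Y 0 = y0 \<and>
     (\<forall>z\<in>ball 0 \<rho>. \<forall>i. ((\<lambda>z. Y z $ i) has_field_derivative (A z *v Y z) $ i) (at z)))"
proof -
  have "\<exists>C. \<forall>z\<in>cball 0 (r / 2). norm (A z $ i $ j) \<le> C" for i j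
  proof -
    have "continuous_on (cball 0 (r / 2)) (\<lambda>z. A z $ i $ j)"
      by (rule continuous_on_subset[OF holomorphic_on_imp_continuous_on[OF A]]) (use r in auto)
    then have "bounded ((\<lambda>z. A z $ i $ j) ` cball 0 (r / 2))"
      by (intro compact_imp_bounded compact_continuous_image) auto
    then show ?thesis by (auto simp: bounded_iff)
  qed
  then obtain C where C: "\<And>i j z. z \<in> cball 0 (r / 2) \<Longrightarrow> norm (A z $ i $ j) \<le> C i j" by metis
  define M where "M = (\<Sum>i\<in>UNIV. \<Sum>j\<in>UNIV. \<bar>C i j\<bar>) + 1"
  have M: "M > 0" unfolding M_def by (intro add_nonneg_pos sum_nonneg) auto
  have row: "(\<Sum>j\<in>UNIV. norm (A z $ i $ j)) \<le> M" if "z \<in> cball 0 (r / 2)" for z i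
  proof -
    have "(\<Sum>j\<in>UNIV. norm (A z $ i $ j)) \<le> (\<Sum>j\<in>UNIV. \<bar>C i j\<bar>)"
      using C[OF that] by (intro sum_mono) (meson abs_ge_self order_trans)
    also have "\<dots> \<le> (\<Sum>i\<in>UNIV. \<Sum>j\<in>UNIV. \<bar>C i j\<bar>)"
      by (rule member_le_sum[of i UNIV "\<lambda>i. \<Sum>j\<in>UNIV. \<bar>C i j\<bar>"]) (auto intro: sum_nonneg)
    finally show ?thesis by (simp add: M_def)
  qed
  define \<rho> where "\<rho> = min (r / 2) (1 / (2 * M))"
  have \<rho>: "0 < \<rho>" "\<rho> \<le> r / 2" "M * \<rho> \<le> 1 / 2"
    using r M by (auto simp: \<rho>_def min_def field_simps)
  have sub: "ball (0::complex) \<rho> \<subseteq> cball 0 (r / 2)" "ball (0::complex) \<rho> \<subseteq> ball 0 r"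
    using \<rho> r by auto
  have Ahol: "(\<lambda>z. A z $ i $ j) holomorphic_on ball 0 \<rho>" for i j
    by (rule holomorphic_on_subset[OF A sub(2)])
  have "\<exists>Y. Y 0 = y0 \<and> (\<forall>z\<in>ball 0 \<rho>. \<forall>i. ((\<lambda>z. Y z $ i) has_field_derivative (A z *v Y z) $ i) (at z))" for y0
  proof -
    define prim where "prim f = (SOME F. F 0 = 0 \<and> (\<forall>z\<in>ball 0 \<rho>. (F has_field_derivative f z) (at z)))"
      for f :: "complex \<Rightarrow> complex"
    have prim: "prim f 0 = 0" "\<And>z. z \<in> ball 0 \<rho> \<Longrightarrow> (prim f has_field_derivative f z) (at z)"
      if "f holomorphic_on ball 0 \<rho>" for f
      using someI_ex[OF primitive_vanishing_at_centre[OF that \<rho>(1)]] unfolding prim_def by blast+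
    define \<Delta> where "\<Delta> = rec_nat (\<lambda>i z. y0 $ i) (\<lambda>n D i. prim (\<lambda>z. \<Sum>j\<in>UNIV. A z $ i $ j * D j z))"
    have \<Delta>0: "\<Delta> 0 = (\<lambda>i z. y0 $ i)" and \<Delta>S: "\<Delta> (Suc n) = (\<lambda>i. prim (\<lambda>z. \<Sum>j\<in>UNIV. A z $ i $ j * \<Delta> n j z))" for n
      by (simp_all add: \<Delta>_def)
    have hol: "\<Delta> n i holomorphic_on ball 0 \<rho>" for n i
    proof (induction n arbitrary: i)
      case 0
      show ?case unfolding \<Delta>0 by simp
    next
      case (Suc n)
      have "(\<lambda>z. \<Sum>j\<in>UNIV. A z $ i $ j * \<Delta> n j z) holomorphic_on ball 0 \<rho>"
        using Suc Ahol by (intro holomorphic_intros)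
      from prim(2)[OF this] show ?case
        unfolding \<Delta>S by (meson field_differentiable_at_within field_differentiable_def holomorphic_on_def)
    qed
    have sumhol: "(\<lambda>z. \<Sum>j\<in>UNIV. A z $ i $ j * \<Delta> n j z) holomorphic_on ball 0 \<rho>" for n i
      using hol Ahol by (intro holomorphic_intros)
    have der: "(\<Delta> (Suc n) i has_field_derivative (\<Sum>j\<in>UNIV. A z $ i $ j * \<Delta> n j z)) (at z)"
      if "z \<in> ball 0 \<rho>" for n i z
      unfolding \<Delta>S by (rule prim(2)[OF sumhol that])
    have at0: "\<Delta> (Suc n) i 0 = 0" for n i unfolding \<Delta>S by (rule prim(1)[OF sumhol])
    define c where "c = (\<Sum>i\<in>UNIV. norm (y0 $ i))"
    have bound: "norm (\<Delta> n i z) \<le> c * (1 / 2) ^ n" if "z \<in> ball 0 \<rho>" for n i z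
      using that
    proof (induction n arbitrary: i z)
      case 0
      show ?case unfolding \<Delta>0 c_def using member_le_sum[of i UNIV "\<lambda>i. norm (y0 $ i)"] by simp
    next
      case (Suc n)
      have le: "norm (\<Sum>j\<in>UNIV. A w $ i $ j * \<Delta> n j w) \<le> M * (c * (1 / 2) ^ n)" if w: "w \<in> ball 0 \<rho>" for w
      proof -
        have "norm (\<Sum>j\<in>UNIV. A w $ i $ j * \<Delta> n j w) \<le> (\<Sum>j\<in>UNIV. norm (A w $ i $ j * \<Delta> n j w))"
          by (rule norm_sum)
        also have "\<dots> \<le> (\<Sum>j\<in>UNIV. norm (A w $ i $ j) * (c * (1 / 2) ^ n))"
          unfolding norm_mult using Suc.IH[OF w] by (intro sum_mono mult_left_mono) auto
        also have "\<dots> = (\<Sum>j\<in>UNIV. norm (A w $ i $ j)) * (c * (1 / 2) ^ n)" by (simp only: sum_distrib_right)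
        also have "\<dots> \<le> M * (c * (1 / 2) ^ n)"
          using row[of w i] w sub by (intro mult_right_mono) (auto simp: c_def sum_nonneg)
        finally show ?thesis .
      qed
      have "norm (\<Delta> (Suc n) i z - \<Delta> (Suc n) i 0) \<le> M * (c * (1 / 2) ^ n) * norm (z - 0)"
        by (rule field_differentiable_bound[OF convex_ball[of 0 \<rho>], where f' = "\<lambda>w. \<Sum>j\<in>UNIV. A w $ i $ j * \<Delta> n j w"])
           (use der le Suc.prems \<rho>(1) in \<open>auto intro: has_field_derivative_at_within\<close>)
      also have "\<dots> \<le> M * (c * (1 / 2) ^ n) * \<rho>"
        using Suc.prems M by (intro mult_left_mono) (auto simp: c_def sum_nonneg)
      also have "\<dots> = (M * \<rho>) * (c * (1 / 2) ^ n)" by (simp only: mult_ac)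
      also have "\<dots> \<le> (1 / 2) * (c * (1 / 2) ^ n)"
        using \<rho>(3) by (intro mult_right_mono) (auto simp: c_def sum_nonneg)
      finally show ?case unfolding at0 by (simp add: mult_ac)
    qed
    define Q where "Q i g g' \<longleftrightarrow> (\<forall>x\<in>ball 0 \<rho>. (\<lambda>n. \<Delta> n i x) sums g x \<and>
        (\<lambda>n. (if n = 0 then 0 else (\<Sum>j\<in>UNIV. A x $ i $ j * \<Delta> (n - 1) j x))) sums g' x \<and>
        (g has_field_derivative g' x) (at x))" for i g g'
    have "\<exists>g g'. Q i g g'" for i
      unfolding Q_def
    proof (rule series_and_derivative_comparison_complex[OF open_ball])
      show "(\<Delta> n i has_field_derivative (if n = 0 then 0 else (\<Sum>j\<in>UNIV. A x $ i $ j * \<Delta> (n - 1) j x))) (at x)"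
        if "x \<in> ball 0 \<rho>" for n x
        using der[OF that, of "n - 1" i] by (cases n) (auto simp: \<Delta>0)
      show "\<exists>d h. 0 < d \<and> summable h \<and> range h \<subseteq> \<real>\<^sub>\<ge>\<^sub>0 \<and>
          (\<forall>\<^sub>F n in sequentially. \<forall>y\<in>ball x d \<inter> ball 0 \<rho>. cmod (\<Delta> n i y) \<le> cmod (h n))" for x
      proof (intro exI conjI)
        define h where "h n = complex_of_real (c * (1 / 2) ^ n)" for n
        have c0: "c \<ge> 0" by (simp add: c_def sum_nonneg)
        show "(0::real) < 1" by simp
        show "summable h" unfolding h_def by (intro summable_of_real summable_mult summable_geometric) simp
        show "range h \<subseteq> \<real>\<^sub>\<ge>\<^sub>0" using c0 by (auto simp: h_def simp del: of_real_mult of_real_power)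
        have "cmod (h n) = c * (1 / 2) ^ n" for n
          using c0 unfolding h_def norm_of_real by simp
        then show "\<forall>\<^sub>F n in sequentially. \<forall>y\<in>ball x 1 \<inter> ball 0 \<rho>. cmod (\<Delta> n i y) \<le> cmod (h n)"
          using bound by simp
      qed
    qed
    then obtain g g' where gg': "\<And>i. Q i (g i) (g' i)" by metis
    have g: "\<And>i x. x \<in> ball 0 \<rho> \<Longrightarrow> (\<lambda>n. \<Delta> n i x) sums g i x"
        "\<And>i x. x \<in> ball 0 \<rho> \<Longrightarrow> (\<lambda>n. (if n = 0 then 0 else (\<Sum>j\<in>UNIV. A x $ i $ j * \<Delta> (n - 1) j x))) sums g' i x"
        "\<And>i x. x \<in> ball 0 \<rho> \<Longrightarrow> (g i has_field_derivative g' i x) (at x)"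
      using gg' unfolding Q_def by blast+
    have g'eq: "g' i x = (\<Sum>j\<in>UNIV. A x $ i $ j * g j x)" if "x \<in> ball 0 \<rho>" for i x
    proof -
      have "(\<lambda>n. (\<Sum>j\<in>UNIV. A x $ i $ j * \<Delta> n j x)) sums g' i x"
        using g(2)[OF that, of i] sums_Suc_iff[of "\<lambda>n. (if n = 0 then 0 else (\<Sum>j\<in>UNIV. A x $ i $ j * \<Delta> (n - 1) j x))" "g' i x"]
        by simp
      moreover have "(\<lambda>n. (\<Sum>j\<in>UNIV. A x $ i $ j * \<Delta> n j x)) sums (\<Sum>j\<in>UNIV. A x $ i $ j * g j x)"
        using g(1)[OF that] by (intro sums_sum sums_mult)
      ultimately show ?thesis using sums_unique2 by blast
    qed
    have g0: "g i 0 = y0 $ i" for i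
    proof -
      have "(\<lambda>n. \<Delta> n i 0) sums (\<Sum>n\<in>{0}. \<Delta> n i 0)"
        by (rule sums_finite) (use at0 in \<open>auto simp: gr0_conv_Suc\<close>)
      then show ?thesis using g(1)[of 0 i] \<rho>(1) sums_unique2 by (force simp: \<Delta>0)
    qed
    show ?thesis
    proof (intro exI[of _ "\<lambda>z. \<chi> i. g i z"] conjI ballI allI)
      show "(\<chi> i. g i 0) = y0" by (simp add: g0 vec_eq_iff)
      show "((\<lambda>z. (\<chi> i. g i z) $ i) has_field_derivative (A z *v (\<chi> i. g i z)) $ i) (at z)"
        if "z \<in> ball 0 \<rho>" for z i
        using g(3)[OF that, of i] by (simp add: g'eq[OF that] matrix_vector_mult_def)
    qed
  qed
  moreover have "\<rho> \<le> r" using \<rho>(2) r by simp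
  ultimately show ?thesis using \<rho>(1) by blast
qed

text \<open>A holomorphic connection \<open>d + A\<close> along a disc is trivialised by a parallel frame. A form that is
  compatible with the connection becomes constant in that frame.\<close>

lemma parallel_frame:
  fixes A :: "complex \<Rightarrow> complex^'m^'m" and L :: "complex \<Rightarrow> complex^'m \<Rightarrow> complex^'m \<Rightarrow> complex"
  assumes r: "r > 0" and A: "\<And>i j. (\<lambda>z. A z $ i $ j) holomorphic_on ball 0 r"
    and L_expand: "\<And>z u v. z \<in> ball 0 r \<Longrightarrow> L z u v = (\<Sum>i\<in>UNIV. \<Sum>j\<in>UNIV. u $ i * cnj (v $ j) * L z (axis i 1) (axis j 1))"
    and L_deriv: "\<And>z u v. z \<in> ball 0 r \<Longrightarrow>
      ((\<lambda>z. L z u v) has_derivative (\<lambda>t. t * L z (A z *v u) v + cnj t * L z u (A z *v v))) (at z)"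
  shows "\<exists>\<rho> \<Psi>. 0 < \<rho> \<and> \<rho> \<le> r \<and> (\<forall>i j. (\<lambda>z. \<Psi> z $ i $ j) holomorphic_on ball 0 \<rho>) \<and>
    (\<forall>z\<in>ball 0 \<rho>. \<forall>u v. L z u v = L 0 (\<Psi> z *v u) (\<Psi> z *v v))"
proof -
  have "(\<lambda>z. (- A z) $ i $ j) holomorphic_on ball 0 r" for i j
    using holomorphic_on_minus[OF A] by simp
  from holomorphic_linear_ode[OF r this]
  obtain \<rho>1 where \<rho>1: "0 < \<rho>1" "\<rho>1 \<le> r" "\<And>y0. \<exists>Y. Y 0 = y0 \<and>
     (\<forall>z\<in>ball 0 \<rho>1. \<forall>i. ((\<lambda>z. Y z $ i) has_field_derivative ((- A z) *v Y z) $ i) (at z))"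
    by blast
  have "(\<lambda>z. transpose (A z) $ i $ j) holomorphic_on ball 0 r" for i j
    using A by (simp add: transpose_def)
  from holomorphic_linear_ode[OF r this]
  obtain \<rho>2 where \<rho>2: "0 < \<rho>2" "\<rho>2 \<le> r" "\<And>y0. \<exists>Y. Y 0 = y0 \<and>
     (\<forall>z\<in>ball 0 \<rho>2. \<forall>i. ((\<lambda>z. Y z $ i) has_field_derivative (transpose (A z) *v Y z) $ i) (at z))"
    by blast
  define \<rho> where "\<rho> = min \<rho>1 \<rho>2"
  have \<rho>: "0 < \<rho>" "\<rho> \<le> r" "ball (0::complex) \<rho> \<subseteq> ball 0 \<rho>1" "ball (0::complex) \<rho> \<subseteq> ball 0 \<rho>2" "ball (0::complex) \<rho> \<subseteq> ball 0 r"
    using \<rho>1 \<rho>2 by (auto simp: \<rho>_def)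
  obtain F where F: "\<And>a. F a 0 = axis a 1" "\<And>a z i. z \<in> ball 0 \<rho>1 \<Longrightarrow> ((\<lambda>z. F a z $ i) has_field_derivative ((- A z) *v F a z) $ i) (at z)"
    using \<rho>1(3)[of "axis _ 1"] by metis
  obtain G where G: "\<And>a. G a 0 = axis a 1" "\<And>a z i. z \<in> ball 0 \<rho>2 \<Longrightarrow> ((\<lambda>z. G a z $ i) has_field_derivative (transpose (A z) *v G a z) $ i) (at z)"
    using \<rho>2(3)[of "axis _ 1"] by metis
  define \<Phi> where "\<Phi> z = (\<chi> i a. F a z $ i)" for z
  define \<Psi> where "\<Psi> z = (\<chi> a i. G a z $ i)" for z
  have d\<Phi>: "((\<lambda>z. \<Phi> z $ i $ a) has_field_derivative - (A z ** \<Phi> z) $ i $ a) (at z)" if "z \<in> ball 0 \<rho>" for z i a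
    using F(2)[of z a i] that \<rho> by (simp add: \<Phi>_def matrix_vector_mult_def matrix_matrix_mult_def sum_negf subset_iff)
  have d\<Psi>: "((\<lambda>z. \<Psi> z $ a $ i) has_field_derivative (\<Psi> z ** A z) $ a $ i) (at z)" if "z \<in> ball 0 \<rho>" for z i a
    using G(2)[of z a i] that \<rho>
    by (simp add: \<Psi>_def matrix_vector_mult_def matrix_matrix_mult_def transpose_def mult.commute subset_iff)
  have inv: "\<Psi> z ** \<Phi> z = mat 1" if z: "z \<in> ball 0 \<rho>" for z
  proof -
    have "(\<Psi> z ** \<Phi> z) $ a $ b = (mat 1 :: complex^'m^'m) $ a $ b" for a b
    proof -
      have "((\<lambda>z. (\<Psi> z ** \<Phi> z) $ a $ b) has_field_derivative 0) (at w within ball 0 \<rho>)" if w: "w \<in> ball 0 \<rho>" for w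
      proof -
        have "((\<lambda>z. \<Sum>k\<in>UNIV. \<Psi> z $ a $ k * \<Phi> z $ k $ b) has_field_derivative
            (\<Sum>k\<in>UNIV. \<Psi> w $ a $ k * - (A w ** \<Phi> w) $ k $ b + (\<Psi> w ** A w) $ a $ k * \<Phi> w $ k $ b)) (at w)"
          by (intro DERIV_sum DERIV_mult' d\<Phi>[OF w] d\<Psi>[OF w])
        also have "(\<Sum>k\<in>UNIV. \<Psi> w $ a $ k * - (A w ** \<Phi> w) $ k $ b + (\<Psi> w ** A w) $ a $ k * \<Phi> w $ k $ b)
            = - (\<Psi> w ** (A w ** \<Phi> w)) $ a $ b + ((\<Psi> w ** A w) ** \<Phi> w) $ a $ b"
          by (simp add: matrix_matrix_mult_def sum.distrib sum_negf sum_subtractf)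
        also have "\<dots> = 0" by (simp add: matrix_mul_assoc)
        finally show ?thesis by (simp add: matrix_matrix_mult_def has_field_derivative_at_within)
      qed
      then obtain c where c: "\<And>w. w \<in> ball 0 \<rho> \<Longrightarrow> (\<Psi> w ** \<Phi> w) $ a $ b = c"
        using has_field_derivative_zero_constant[OF convex_ball, of 0 \<rho> "\<lambda>z. (\<Psi> z ** \<Phi> z) $ a $ b"] by blast
      have "\<Psi> 0 = mat 1" "\<Phi> 0 = mat 1"
        by (auto simp: \<Psi>_def \<Phi>_def F(1) G(1) mat_def axis_def vec_eq_iff)
      then show ?thesis using c[OF z] c[of 0] \<rho>(1) by simp
    qed
    then show ?thesis by (simp add: vec_eq_iff)
  qed
  have const: "L z (\<Phi> z *v u) (\<Phi> z *v v) = L 0 u v" if z: "z \<in> ball 0 \<rho>" for z u v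
  proof -
    define U where "U z = \<Phi> z *v u" for z
    define V where "V z = \<Phi> z *v v" for z
    have exp: "L z a b = (\<Sum>i\<in>UNIV. \<Sum>j\<in>UNIV. a $ i * cnj (b $ j) * L z (axis i 1) (axis j 1))"
      if "z \<in> ball 0 \<rho>" for z a b by (rule L_expand) (use that \<rho> in blast)
    have dU: "((\<lambda>z. (\<Phi> z *v u) $ i) has_derivative (\<lambda>t. - (A z *v (\<Phi> z *v u)) $ i * t)) (at z)"
      if z: "z \<in> ball 0 \<rho>" for z i u
    proof -
      have "((\<lambda>z. \<Sum>k\<in>UNIV. \<Phi> z $ i $ k * u $ k) has_field_derivative
          (\<Sum>k\<in>UNIV. - (A z ** \<Phi> z) $ i $ k * u $ k)) (at z)"
        by (intro DERIV_sum DERIV_cmult_right d\<Phi>[OF z])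
      also have "(\<Sum>k\<in>UNIV. - (A z ** \<Phi> z) $ i $ k * u $ k) = - ((A z ** \<Phi> z) *v u) $ i"
        by (simp add: matrix_vector_mult_def sum_negf)
      finally have "((\<lambda>z. (\<Phi> z *v u) $ i) has_field_derivative - ((A z ** \<Phi> z) *v u) $ i) (at z)"
        by (simp add: matrix_vector_mult_def[of "\<Phi> _"])
      then show ?thesis
        unfolding has_field_derivative_def matrix_vector_mul_assoc
        by (rule has_derivative_eq_rhs) (simp add: fun_eq_iff)
    qed
    have zero: "((\<lambda>z. L z (U z) (V z)) has_derivative (\<lambda>t. 0)) (at w within ball 0 \<rho>)" if w: "w \<in> ball 0 \<rho>" for w
    proof -
      have wr: "w \<in> ball 0 r" using w \<rho> by blast
      define l where "l i j z = L z (axis i 1) (axis j 1)" for i j z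
      have dl: "(l i j has_derivative (\<lambda>t. t * L w (A w *v axis i 1) (axis j 1) + cnj t * L w (axis i 1) (A w *v axis j 1))) (at w)" for i j
        unfolding l_def[abs_def] by (rule L_deriv[OF wr])
      have dV: "((\<lambda>z. cnj (V z $ j)) has_derivative (\<lambda>t. cnj (- (A w *v V w) $ j * t))) (at w)" for j
        unfolding V_def by (rule bounded_linear.has_derivative[OF bounded_linear_cnj dU[OF w]])
      have dU': "((\<lambda>z. U z $ i) has_derivative (\<lambda>t. - (A w *v U w) $ i * t)) (at w)" for i
        unfolding U_def by (rule dU[OF w])
      have "((\<lambda>z. \<Sum>i\<in>UNIV. \<Sum>j\<in>UNIV. U z $ i * cnj (V z $ j) * l i j z) has_derivative
         (\<lambda>t. \<Sum>i\<in>UNIV. \<Sum>j\<in>UNIV. U w $ i * cnj (V w $ j) *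
              (t * L w (A w *v axis i 1) (axis j 1) + cnj t * L w (axis i 1) (A w *v axis j 1))
            + (U w $ i * cnj (- (A w *v V w) $ j * t) + - (A w *v U w) $ i * t * cnj (V w $ j)) * l i j w)) (at w)"
        by (intro has_derivative_sum has_derivative_mult dU' dV dl)
      moreover have "(\<Sum>i\<in>UNIV. \<Sum>j\<in>UNIV. U w $ i * cnj (V w $ j) *
              (t * L w (A w *v axis i 1) (axis j 1) + cnj t * L w (axis i 1) (A w *v axis j 1))
            + (U w $ i * cnj (- (A w *v V w) $ j * t) + - (A w *v U w) $ i * t * cnj (V w $ j)) * l i j w) = 0" for t
      proof -
        have sesq: "(\<Sum>i\<in>UNIV. \<Sum>j\<in>UNIV. U w $ i * cnj (V w $ j) * L w (A w *v axis i 1) (axis j 1)) = L w (A w *v U w) (V w)"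
           "(\<Sum>i\<in>UNIV. \<Sum>j\<in>UNIV. U w $ i * cnj (V w $ j) * L w (axis i 1) (A w *v axis j 1)) = L w (U w) (A w *v V w)"
        proof -
          have ax: "(A w *v axis i 1) $ k = A w $ k $ i" for i k
            by (simp add: matrix_vector_mult_def axis_def if_distrib cong: if_cong)
          have mv: "(A w *v x) $ k = (\<Sum>i\<in>UNIV. A w $ k $ i * x $ i)" for x k
            by (simp add: matrix_vector_mult_def)
          have e1: "L w (A w *v axis i 1) (axis j 1) = (\<Sum>k\<in>UNIV. A w $ k $ i * l k j w)" for i j
            unfolding exp[OF w, of "A w *v axis i 1"] ax l_def
            by (intro sum.cong refl) (simp add: axis_def if_distrib if_distribR cong: if_cong)
          have e2: "L w (axis i 1) (A w *v axis j 1) = (\<Sum>k\<in>UNIV. cnj (A w $ k $ j) * l i k w)" for i j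
          proof -
            have "L w (axis i 1) (A w *v axis j 1) = (\<Sum>i'\<in>UNIV. if i' = i then \<Sum>k\<in>UNIV. cnj (A w $ k $ j) * l i k w else 0)"
              unfolding exp[OF w, of "axis i 1" "A w *v axis j 1"] ax l_def
              by (intro sum.cong refl) (simp add: axis_def)
            then show ?thesis by simp
          qed
          have "(\<Sum>i\<in>UNIV. \<Sum>j\<in>UNIV. U w $ i * cnj (V w $ j) * L w (A w *v axis i 1) (axis j 1))
              = (\<Sum>i\<in>UNIV. \<Sum>j\<in>UNIV. \<Sum>k\<in>UNIV. A w $ k $ i * U w $ i * cnj (V w $ j) * l k j w)"
            unfolding e1 by (simp add: sum_distrib_left mult_ac)
          also have "\<dots> = (\<Sum>k\<in>UNIV. \<Sum>j\<in>UNIV. \<Sum>i\<in>UNIV. A w $ k $ i * U w $ i * cnj (V w $ j) * l k j w)"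
            by (subst sum.swap, subst sum.swap[of _ UNIV UNIV]) (intro sum.cong refl sum.swap)
          also have "\<dots> = L w (A w *v U w) (V w)"
            unfolding exp[OF w, of "A w *v U w"] mv l_def by (simp add: sum_distrib_right)
          finally show "(\<Sum>i\<in>UNIV. \<Sum>j\<in>UNIV. U w $ i * cnj (V w $ j) * L w (A w *v axis i 1) (axis j 1)) = L w (A w *v U w) (V w)" .
          have "(\<Sum>i\<in>UNIV. \<Sum>j\<in>UNIV. U w $ i * cnj (V w $ j) * L w (axis i 1) (A w *v axis j 1))
              = (\<Sum>i\<in>UNIV. \<Sum>j\<in>UNIV. \<Sum>k\<in>UNIV. U w $ i * (cnj (A w $ k $ j) * cnj (V w $ j)) * l i k w)"
            unfolding e2 by (simp add: sum_distrib_left mult_ac)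
          also have "\<dots> = (\<Sum>i\<in>UNIV. \<Sum>k\<in>UNIV. \<Sum>j\<in>UNIV. U w $ i * (cnj (A w $ k $ j) * cnj (V w $ j)) * l i k w)"
            by (intro sum.cong refl sum.swap)
          also have "\<dots> = L w (U w) (A w *v V w)"
            unfolding exp[OF w, of "U w" "A w *v V w"] mv l_def by (simp add: sum_distrib_right sum_distrib_left)
          finally show "(\<Sum>i\<in>UNIV. \<Sum>j\<in>UNIV. U w $ i * cnj (V w $ j) * L w (axis i 1) (A w *v axis j 1)) = L w (U w) (A w *v V w)" .
        qed
        define x1 where "x1 i j = U w $ i * cnj (V w $ j) * L w (A w *v axis i 1) (axis j 1)" for i j
        define x2 where "x2 i j = U w $ i * cnj (V w $ j) * L w (axis i 1) (A w *v axis j 1)" for i j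
        define x3 where "x3 i j = (A w *v U w) $ i * cnj (V w $ j) * L w (axis i 1) (axis j 1)" for i j
        define x4 where "x4 i j = U w $ i * cnj ((A w *v V w) $ j) * L w (axis i 1) (axis j 1)" for i j
        have "U w $ i * cnj (V w $ j) *
              (t * L w (A w *v axis i 1) (axis j 1) + cnj t * L w (axis i 1) (A w *v axis j 1))
            + (U w $ i * cnj (- (A w *v V w) $ j * t) + - (A w *v U w) $ i * t * cnj (V w $ j)) * l i j w
            = t * (x1 i j - x3 i j) + cnj t * (x2 i j - x4 i j)" for i j
          by (simp add: x1_def x2_def x3_def x4_def l_def algebra_simps)
        then have "(\<Sum>i\<in>UNIV. \<Sum>j\<in>UNIV. U w $ i * cnj (V w $ j) *
              (t * L w (A w *v axis i 1) (axis j 1) + cnj t * L w (axis i 1) (A w *v axis j 1))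
            + (U w $ i * cnj (- (A w *v V w) $ j * t) + - (A w *v U w) $ i * t * cnj (V w $ j)) * l i j w)
            = (\<Sum>i\<in>UNIV. \<Sum>j\<in>UNIV. t * (x1 i j - x3 i j) + cnj t * (x2 i j - x4 i j))"
          by (simp only:)
        also have "\<dots> = t * ((\<Sum>i\<in>UNIV. \<Sum>j\<in>UNIV. x1 i j) - (\<Sum>i\<in>UNIV. \<Sum>j\<in>UNIV. x3 i j))
            + cnj t * ((\<Sum>i\<in>UNIV. \<Sum>j\<in>UNIV. x2 i j) - (\<Sum>i\<in>UNIV. \<Sum>j\<in>UNIV. x4 i j))"
          by (simp only: sum.distrib sum_subtractf sum_distrib_left[symmetric])
        also have "\<dots> = 0"
        proof -
          have "(\<Sum>i\<in>UNIV. \<Sum>j\<in>UNIV. x1 i j) = L w (A w *v U w) (V w)" unfolding x1_def by (rule sesq(1))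
          moreover have "(\<Sum>i\<in>UNIV. \<Sum>j\<in>UNIV. x2 i j) = L w (U w) (A w *v V w)" unfolding x2_def by (rule sesq(2))
          moreover have "(\<Sum>i\<in>UNIV. \<Sum>j\<in>UNIV. x3 i j) = L w (A w *v U w) (V w)"
            unfolding x3_def by (rule exp[OF w, symmetric])
          moreover have "(\<Sum>i\<in>UNIV. \<Sum>j\<in>UNIV. x4 i j) = L w (U w) (A w *v V w)"
            unfolding x4_def by (rule exp[OF w, symmetric])
          ultimately show ?thesis by simp
        qed
        finally show ?thesis .
      qed
      ultimately have "((\<lambda>z. \<Sum>i\<in>UNIV. \<Sum>j\<in>UNIV. U z $ i * cnj (V z $ j) * l i j z) has_derivative (\<lambda>t. 0)) (at w)"
        by simp
      then have "((\<lambda>z. L z (U z) (V z)) has_derivative (\<lambda>t. 0)) (at w)"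
        by (rule has_derivative_transform_within_open[OF _ open_ball w]) (unfold l_def, rule exp[symmetric])
      then show ?thesis by (rule has_derivative_at_withinI)
    qed
    obtain c where c: "\<And>w. w \<in> ball 0 \<rho> \<Longrightarrow> L w (U w) (V w) = c"
      using has_derivative_zero_constant[OF convex_ball zero] by blast
    have "\<Phi> 0 = mat 1" by (auto simp: \<Phi>_def F(1) mat_def axis_def vec_eq_iff)
    then show ?thesis using c[OF z] c[of 0] \<rho>(1) by (simp add: U_def V_def)
  qed
  show ?thesis
  proof (intro exI conjI allI ballI)
    show "(\<lambda>z. \<Psi> z $ i $ j) holomorphic_on ball 0 \<rho>" for i j
      using d\<Psi> by (meson field_differentiable_at_within field_differentiable_def holomorphic_on_def)
    fix z :: complex and u v assume z: "z \<in> ball 0 \<rho>"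
    have "\<Phi> z ** \<Psi> z = mat 1" using inv[OF z] matrix_left_right_inverse by blast
    then have "\<Phi> z *v (\<Psi> z *v x) = x" for x by (simp add: matrix_vector_mul_assoc)
    then show "L z u v = L 0 (\<Psi> z *v u) (\<Psi> z *v v)" using const[OF z, of "\<Psi> z *v u" "\<Psi> z *v v"] by simp
  qed (use \<rho> in auto)
qed

section \<open>Smooth functions\<close>

lemma ddir_eq: "(f has_derivative f') (at x) \<Longrightarrow> ddir f x v = f' v"
  by (simp add: frechet_derivative_at[symmetric])

lemma differentiable_has_ddir: "f differentiable (at x) \<Longrightarrow> (f has_derivative ddir f x) (at x)"
  by (simp add: frechet_derivative_works[symmetric])

lemma ddir_cong:
  assumes "open S" "x \<in> S" "\<And>y. y \<in> S \<Longrightarrow> f y = g y"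
  shows "frechet_derivative f (at x) = frechet_derivative g (at x)"
proof -
  have "(f has_derivative D) (at x) \<longleftrightarrow> (g has_derivative D) (at x)" for D
    using has_derivative_transform_within_open[OF _ assms(1,2), of f D UNIV g]
      has_derivative_transform_within_open[OF _ assms(1,2), of g D UNIV f] assms(3) by auto
  then show ?thesis unfolding frechet_derivative_def by simp
qed

lemma differentiable_cong_open:
  assumes "open S" "x \<in> S" "\<And>y. y \<in> S \<Longrightarrow> f y = g y" "f differentiable (at x)"
  shows "g differentiable (at x)"
  using has_derivative_transform_within_open[OF _ assms(1,2), of f _ UNIV g] assms(3,4)
  unfolding differentiable_def by auto

lemma Ck_on_cong:
  assumes "open S" "\<And>x. x \<in> S \<Longrightarrow> f x = g x" "Ck_on k f S" shows "Ck_on k g S"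
  using assms(2,3)
proof (induction k arbitrary: f g)
  case 0
  then show ?case using continuous_on_cong by fastforce
next
  case (Suc k)
  have "g differentiable (at x)" if "x \<in> S" for x
    using differentiable_cong_open[OF assms(1) that Suc.prems(1)] Suc.prems(2) that by simp
  moreover have "Ck_on k (\<lambda>x. ddir g x v) S" for v
  proof (rule Suc.IH)
    show "ddir f x v = ddir g x v" if "x \<in> S" for x
      using ddir_cong[OF assms(1) that Suc.prems(1)] by simp
    show "Ck_on k (\<lambda>x. ddir f x v) S" using Suc.prems(2) by simp
  qed
  ultimately show ?case by simp
qed

lemma Ck_on_Suc_imp: "Ck_on (Suc k) f S \<Longrightarrow> Ck_on k f S"
proof (induction k arbitrary: f)
  case 0
  then show ?case
    by (auto intro!: continuous_at_imp_continuous_on differentiable_imp_continuous_within)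
next
  case (Suc k)
  from Suc.prems have "\<forall>x\<in>S. f differentiable at x" "\<And>v. Ck_on (Suc k) (\<lambda>x. ddir f x v) S" by simp_all
  with Suc.IH show ?case by simp
qed

lemma Ck_on_const: "Ck_on k (\<lambda>x. c) S"
  by (induction k arbitrary: c) (simp_all add: frechet_derivative_const)

lemma Ck_on_add:
  assumes "open S" "Ck_on k f S" "Ck_on k g S" shows "Ck_on k (\<lambda>x. f x + g x) S"
  using assms(2,3)
proof (induction k arbitrary: f g)
  case 0
  then show ?case by (simp add: continuous_on_add)
next
  case (Suc k)
  have "Ck_on k (\<lambda>x. ddir (\<lambda>x. f x + g x) x v) S" for v
  proof (rule Ck_on_cong[OF assms(1)])
    show "Ck_on k (\<lambda>x. ddir f x v + ddir g x v) S" using Suc by simp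
    show "ddir f x v + ddir g x v = ddir (\<lambda>x. f x + g x) x v" if "x \<in> S" for x
      using Suc.prems that by (intro ddir_eq[symmetric] has_derivative_add differentiable_has_ddir) auto
  qed
  then show ?case using Suc.prems by (simp add: differentiable_add)
qed

lemma Ck_on_bounded_linear:
  assumes "open S" "bounded_linear L" "Ck_on k f S" shows "Ck_on k (\<lambda>x. L (f x)) S"
  using assms(3)
proof (induction k arbitrary: f)
  case 0
  then show ?case using assms(2) by (simp add: bounded_linear.continuous_on)
next
  case (Suc k)
  have der: "((\<lambda>x. L (f x)) has_derivative (\<lambda>v. L (ddir f x v))) (at x)" if "x \<in> S" for x
    using Suc.prems that by (intro bounded_linear.has_derivative[OF assms(2)] differentiable_has_ddir) auto
  have "Ck_on k (\<lambda>x. ddir (\<lambda>x. L (f x)) x v) S" for v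
  proof (rule Ck_on_cong[OF assms(1)])
    show "Ck_on k (\<lambda>x. L (ddir f x v)) S" using Suc by simp
    show "L (ddir f x v) = ddir (\<lambda>x. L (f x)) x v" if "x \<in> S" for x
      using ddir_eq[OF der[OF that]] by simp
  qed
  then show ?case using der differentiableI by fastforce
qed

lemma Ck_on_mult:
  fixes f g :: "'a::real_normed_vector \<Rightarrow> 'b::real_normed_algebra"
  assumes "open S" "Ck_on k f S" "Ck_on k g S" shows "Ck_on k (\<lambda>x. f x * g x) S"
  using assms(2,3)
proof (induction k arbitrary: f g)
  case 0
  then show ?case by (simp add: continuous_on_mult)
next
  case (Suc k)
  have der: "((\<lambda>x. f x * g x) has_derivative (\<lambda>v. f x * ddir g x v + ddir f x v * g x)) (at x)" if "x \<in> S" for x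
    using Suc.prems that by (intro has_derivative_mult differentiable_has_ddir) auto
  have "Ck_on k (\<lambda>x. ddir (\<lambda>x. f x * g x) x v) S" for v
  proof (rule Ck_on_cong[OF assms(1)])
    show "Ck_on k (\<lambda>x. f x * ddir g x v + ddir f x v * g x) S"
    proof (intro Ck_on_add assms(1) Suc.IH)
      show "Ck_on k f S" "Ck_on k g S" using Suc.prems by (blast intro: Ck_on_Suc_imp)+
      show "Ck_on k (\<lambda>x. ddir f x v) S" "Ck_on k (\<lambda>x. ddir g x v) S" using Suc.prems by simp_all
    qed
    show "f x * ddir g x v + ddir f x v * g x = ddir (\<lambda>x. f x * g x) x v" if "x \<in> S" for x
      using ddir_eq[OF der[OF that]] by simp
  qed
  then show ?case using der differentiableI by fastforce
qed

lemma Ck_on_inverse: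
  fixes f :: "'a::real_normed_vector \<Rightarrow> complex"
  assumes "open S" "Ck_on k f S" "\<And>x. x \<in> S \<Longrightarrow> f x \<noteq> 0" shows "Ck_on k (\<lambda>x. inverse (f x)) S"
  using assms(2)
proof (induction k)
  case 0
  then show ?case using assms(3) by (simp add: continuous_on_inverse)
next
  case (Suc k)
  have der: "((\<lambda>x. inverse (f x)) has_derivative (\<lambda>v. - (inverse (f x) * ddir f x v * inverse (f x)))) (at x)"
    if "x \<in> S" for x
    using Suc.prems that assms(3) by (intro Deriv.has_derivative_inverse differentiable_has_ddir) auto
  have "Ck_on k (\<lambda>x. ddir (\<lambda>x. inverse (f x)) x v) S" for v
  proof (rule Ck_on_cong[OF assms(1)])
    have "Ck_on k (\<lambda>x. inverse (f x)) S" using Suc Ck_on_Suc_imp by blast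
    then show "Ck_on k (\<lambda>x. (-1) * (inverse (f x) * ddir f x v * inverse (f x))) S"
      using Suc.prems by (intro Ck_on_mult Ck_on_const assms(1)) auto
    show "(-1) * (inverse (f x) * ddir f x v * inverse (f x)) = ddir (\<lambda>x. inverse (f x)) x v" if "x \<in> S" for x
      using ddir_eq[OF der[OF that]] by simp
  qed
  then show ?case using der differentiableI by fastforce
qed

lemma smooth_on_add: "open S \<Longrightarrow> smooth_on f S \<Longrightarrow> smooth_on g S \<Longrightarrow> smooth_on (\<lambda>x. f x + g x) S"
  by (simp add: smooth_on_def Ck_on_add)

lemma smooth_on_mult:
  fixes f g :: "'a::real_normed_vector \<Rightarrow> 'b::real_normed_algebra"
  shows "open S \<Longrightarrow> smooth_on f S \<Longrightarrow> smooth_on g S \<Longrightarrow> smooth_on (\<lambda>x. f x * g x) S"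
  by (simp add: smooth_on_def Ck_on_mult)

lemma smooth_on_const: "smooth_on (\<lambda>x. c) S"
  by (simp add: smooth_on_def Ck_on_const)

lemma smooth_on_bounded_linear: "open S \<Longrightarrow> bounded_linear L \<Longrightarrow> smooth_on f S \<Longrightarrow> smooth_on (\<lambda>x. L (f x)) S"
  by (simp add: smooth_on_def Ck_on_bounded_linear)

lemma smooth_on_divide:
  fixes f g :: "'a::real_normed_vector \<Rightarrow> complex"
  assumes "open S" "smooth_on f S" "smooth_on g S" "\<And>x. x \<in> S \<Longrightarrow> g x \<noteq> 0"
  shows "smooth_on (\<lambda>x. f x / g x) S"
  using assms unfolding divide_inverse smooth_on_def by (auto intro!: Ck_on_mult Ck_on_inverse)

lemma smooth_on_sum:
  "open S \<Longrightarrow> (\<And>i. i \<in> I \<Longrightarrow> smooth_on (f i) S) \<Longrightarrow> smooth_on (\<lambda>x. \<Sum>i\<in>I. f i x) S"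
  by (induction I rule: infinite_finite_induct) (auto intro: smooth_on_const smooth_on_add)

lemma smooth_on_prod:
  fixes f :: "'i \<Rightarrow> 'a::real_normed_vector \<Rightarrow> complex"
  shows "open S \<Longrightarrow> (\<And>i. i \<in> I \<Longrightarrow> smooth_on (f i) S) \<Longrightarrow> smooth_on (\<lambda>x. \<Prod>i\<in>I. f i x) S"
  by (induction I rule: infinite_finite_induct) (auto intro: smooth_on_const smooth_on_mult)

lemma smooth_on_cong: "open S \<Longrightarrow> smooth_on f S \<Longrightarrow> (\<And>x. x \<in> S \<Longrightarrow> f x = g x) \<Longrightarrow> smooth_on g S"
  unfolding smooth_on_def using Ck_on_cong by blast

lemma smooth_on_ddir: "smooth_on f S \<Longrightarrow> smooth_on (\<lambda>x. ddir f x v) S"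
  unfolding smooth_on_def by (metis Ck_on.simps(2))

lemma smooth_on_differentiable: "smooth_on f S \<Longrightarrow> x \<in> S \<Longrightarrow> f differentiable (at x)"
  unfolding smooth_on_def by (metis Ck_on.simps(2))

lemma smooth_on_has_ddir: "smooth_on f S \<Longrightarrow> x \<in> S \<Longrightarrow> (f has_derivative ddir f x) (at x)"
  using smooth_on_differentiable differentiable_has_ddir by blast

text \<open>The second difference \<open>f(x+tu+tv) - f(x+tu) - f(x+tv) + f(x)\<close> is \<open>t\<^sup>2\<close> times the second
  derivative up to \<open>o(t\<^sup>2)\<close>, and it is symmetric in \<open>u\<close> and \<open>v\<close>.\<close>

lemma second_difference:
  fixes f :: "'a::real_normed_vector \<Rightarrow> 'b::real_normed_vector"
  assumes S: "open S" "x \<in> S" and f: "\<And>y. y \<in> S \<Longrightarrow> f differentiable (at y)"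
    and G: "(\<lambda>y. ddir f y u) differentiable (at x)" and \<epsilon>: "\<epsilon> > 0"
  shows "\<exists>\<delta>>0. \<forall>t. 0 < t \<and> t < \<delta> \<longrightarrow>
    norm (f (x + t *\<^sub>R u + t *\<^sub>R v) - f (x + t *\<^sub>R u) - f (x + t *\<^sub>R v) + f x - t\<^sup>2 *\<^sub>R ddir (\<lambda>y. ddir f y u) x v) \<le> \<epsilon> * t\<^sup>2"
proof -
  define g where "g y = ddir f y u" for y
  define g' where "g' = ddir g x"
  have g': "(g has_derivative g') (at x)" unfolding g'_def using G by (intro differentiable_has_ddir) (simp add: g_def[abs_def])
  have lin: "linear g'" using g' has_derivative_linear by blast
  define K where "K = 2 * norm u + norm v + 1"
  have K: "K > 0" unfolding K_def by (simp add: add_nonneg_pos)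
  obtain d where d: "d > 0" "\<And>y. norm (y - x) < d \<Longrightarrow> norm (g y - g x - g' (y - x)) \<le> \<epsilon> / K * norm (y - x)"
    using g' \<epsilon> K unfolding has_derivative_at_alt by (metis divide_pos_pos)
  obtain d' where d': "d' > 0" "ball x d' \<subseteq> S" using S openE by blast
  define \<delta> where "\<delta> = min d d' / K"
  have \<delta>: "\<delta> > 0" using d(1) d'(1) K by (simp add: \<delta>_def)
  have "norm (f (x + t *\<^sub>R u + t *\<^sub>R v) - f (x + t *\<^sub>R u) - f (x + t *\<^sub>R v) + f x - t\<^sup>2 *\<^sub>R g' v) \<le> \<epsilon> * t\<^sup>2"
    if t: "0 < t" "t < \<delta>" for t
  proof -
    have small: "norm (s *\<^sub>R u + t *\<^sub>R v) + norm (s *\<^sub>R u) \<le> t * K" "norm (s *\<^sub>R u + t *\<^sub>R v) < min d d'" "norm (s *\<^sub>R u) < min d d'"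
      if s: "s \<in> {0..t}" for s
    proof -
      have 1: "norm (s *\<^sub>R u) = s * norm u" and 2: "norm (t *\<^sub>R v) = t * norm v" and 3: "s * norm u \<le> t * norm u"
        using s t by (auto intro: mult_right_mono)
      have "norm (s *\<^sub>R u + t *\<^sub>R v) + norm (s *\<^sub>R u) \<le> t * norm u + t * norm v + t * norm u"
        using norm_triangle_ineq[of "s *\<^sub>R u" "t *\<^sub>R v"] 1 2 3 by linarith
      also have "\<dots> = t * K - t" by (simp add: K_def algebra_simps)
      finally have "norm (s *\<^sub>R u + t *\<^sub>R v) + norm (s *\<^sub>R u) \<le> t * K - t" .
      moreover have "t * K < min d d'" using t K by (simp add: \<delta>_def pos_less_divide_eq)
      ultimately show "norm (s *\<^sub>R u + t *\<^sub>R v) + norm (s *\<^sub>R u) \<le> t * K" "norm (s *\<^sub>R u + t *\<^sub>R v) < min d d'" "norm (s *\<^sub>R u) < min d d'"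
        using t norm_ge_zero[of "s *\<^sub>R u + t *\<^sub>R v"] norm_ge_zero[of "s *\<^sub>R u"] by linarith+
    qed
    define \<psi> where "\<psi> s = f (x + s *\<^sub>R u + t *\<^sub>R v) - f (x + s *\<^sub>R u) - s *\<^sub>R (t *\<^sub>R g' v)" for s
    define \<psi>' where "\<psi>' s = g (x + s *\<^sub>R u + t *\<^sub>R v) - g (x + s *\<^sub>R u) - t *\<^sub>R g' v" for s
    have der: "(\<psi> has_derivative (\<lambda>h. h *\<^sub>R \<psi>' s)) (at s within {0..t})" if s: "s \<in> {0..t}" for s
    proof -
      have inS: "x + s *\<^sub>R u + t *\<^sub>R v \<in> S" "x + s *\<^sub>R u \<in> S"
        using small(2,3)[OF s] d'(2) by (auto simp: subset_iff dist_norm norm_minus_commute add.assoc)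
      have c: "((\<lambda>s. f (y + s *\<^sub>R u)) has_derivative (\<lambda>h. h *\<^sub>R g (y + s *\<^sub>R u))) (at s)" if y: "y + s *\<^sub>R u \<in> S" for y
      proof -
        have 1: "((\<lambda>s. y + s *\<^sub>R u) has_derivative (\<lambda>h. h *\<^sub>R u)) (at s)" by (auto intro!: derivative_eq_intros)
        have 2: "(f has_derivative ddir f (y + s *\<^sub>R u)) (at (y + s *\<^sub>R u))" using f[OF y] differentiable_has_ddir by blast
        have "((\<lambda>s. f (y + s *\<^sub>R u)) has_derivative (\<lambda>h. ddir f (y + s *\<^sub>R u) (h *\<^sub>R u))) (at s)"
          by (rule has_derivative_compose[OF 1 2])
        then show ?thesis using linear_scale[OF has_derivative_linear[OF 2]] by (simp add: g_def)
      qed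
      have "((\<lambda>s. f ((x + t *\<^sub>R v) + s *\<^sub>R u) - f (x + s *\<^sub>R u) - s *\<^sub>R (t *\<^sub>R g' v)) has_derivative
          (\<lambda>h. h *\<^sub>R g ((x + t *\<^sub>R v) + s *\<^sub>R u) - h *\<^sub>R g (x + s *\<^sub>R u) - h *\<^sub>R (t *\<^sub>R g' v))) (at s)"
        using inS by (intro has_derivative_diff c) (auto simp: algebra_simps intro!: derivative_eq_intros)
      then have "(\<psi> has_derivative (\<lambda>h. h *\<^sub>R \<psi>' s)) (at s)"
        by (simp add: \<psi>_def[abs_def] \<psi>'_def algebra_simps)
      then show ?thesis by (rule has_derivative_at_withinI)
    qed
    have bnd: "onorm (\<lambda>h. h *\<^sub>R \<psi>' s) \<le> \<epsilon> * t" if s: "s \<in> {0..t}" for s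
    proof (rule onorm_le)
      fix h :: real
      define w1 where "w1 = s *\<^sub>R u + t *\<^sub>R v"
      define w2 where "w2 = s *\<^sub>R u"
      have w: "norm w1 < d" "norm w2 < d" "norm w1 + norm w2 \<le> t * K" using small[OF s] by (auto simp: w1_def w2_def)
      have "\<psi>' s = (g (x + w1) - g x - g' w1) - (g (x + w2) - g x - g' w2)"
        using linear_add[OF lin] linear_scale[OF lin] by (simp add: \<psi>'_def w1_def w2_def add.assoc)
      then have "norm (\<psi>' s) \<le> norm (g (x + w1) - g x - g' w1) + norm (g (x + w2) - g x - g' w2)"
        by (simp only: norm_triangle_ineq4)
      also have "\<dots> \<le> \<epsilon> / K * norm w1 + \<epsilon> / K * norm w2"
        using d(2)[of "x + w1"] d(2)[of "x + w2"] w by (intro add_mono) auto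
      also have "\<dots> = \<epsilon> / K * (norm w1 + norm w2)" by (simp add: algebra_simps)
      also have "\<dots> \<le> \<epsilon> / K * (t * K)" using w \<epsilon> K by (intro mult_left_mono) auto
      also have "\<dots> = \<epsilon> * t" using K by simp
      finally have "norm (\<psi>' s) \<le> \<epsilon> * t" .
      from mult_left_mono[OF this, of "\<bar>h\<bar>"] show "norm (h *\<^sub>R \<psi>' s) \<le> \<epsilon> * t * norm h" by (simp add: mult.commute)
    qed
    have "norm (\<psi> t - \<psi> 0) \<le> \<epsilon> * t * norm (t - 0)"
      using t by (intro differentiable_bound[of "{0..t}", OF _ der bnd]) auto
    moreover have "\<psi> t - \<psi> 0 = f (x + t *\<^sub>R u + t *\<^sub>R v) - f (x + t *\<^sub>R u) - f (x + t *\<^sub>R v) + f x - t\<^sup>2 *\<^sub>R g' v"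
      by (simp add: \<psi>_def power2_eq_square)
    ultimately show ?thesis using t by (simp add: power2_eq_square mult.assoc)
  qed
  then show ?thesis using \<delta> by (auto simp: g'_def g_def[abs_def])
qed

text \<open>Both mixed derivatives are limits of the same second difference quotient.\<close>

lemma ddir_commute:
  fixes f :: "'a::real_normed_vector \<Rightarrow> 'b::real_normed_vector"
  assumes S: "open S" "x \<in> S" and f: "\<And>y. y \<in> S \<Longrightarrow> f differentiable (at y)"
    and G: "(\<lambda>y. ddir f y u) differentiable (at x)" "(\<lambda>y. ddir f y v) differentiable (at x)"
  shows "ddir (\<lambda>y. ddir f y u) x v = ddir (\<lambda>y. ddir f y v) x u"
proof -
  have "norm (ddir (\<lambda>y. ddir f y u) x v - ddir (\<lambda>y. ddir f y v) x u) \<le> \<epsilon>" if \<epsilon>: "\<epsilon> > 0" for \<epsilon>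
  proof -
    define A where "A = ddir (\<lambda>y. ddir f y u) x v"
    define B where "B = ddir (\<lambda>y. ddir f y v) x u"
    obtain \<delta>1 where 1: "\<delta>1 > 0" "\<And>t. 0 < t \<Longrightarrow> t < \<delta>1 \<Longrightarrow>
      norm (f (x + t *\<^sub>R u + t *\<^sub>R v) - f (x + t *\<^sub>R u) - f (x + t *\<^sub>R v) + f x - t\<^sup>2 *\<^sub>R A) \<le> \<epsilon> / 2 * t\<^sup>2"
      using second_difference[OF S f G(1), of "\<epsilon> / 2" v] \<epsilon> unfolding A_def by auto
    obtain \<delta>2 where 2: "\<delta>2 > 0" "\<And>t. 0 < t \<Longrightarrow> t < \<delta>2 \<Longrightarrow>
      norm (f (x + t *\<^sub>R v + t *\<^sub>R u) - f (x + t *\<^sub>R v) - f (x + t *\<^sub>R u) + f x - t\<^sup>2 *\<^sub>R B) \<le> \<epsilon> / 2 * t\<^sup>2"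
      using second_difference[OF S f G(2), of "\<epsilon> / 2" u] \<epsilon> unfolding B_def by auto
    define t where "t = min \<delta>1 \<delta>2 / 2"
    have t: "0 < t" "t < \<delta>1" "t < \<delta>2" using 1(1) 2(1) by (auto simp: t_def)
    define D where "D = f (x + t *\<^sub>R u + t *\<^sub>R v) - f (x + t *\<^sub>R u) - f (x + t *\<^sub>R v) + f x"
    have "norm (D - t\<^sup>2 *\<^sub>R A) \<le> \<epsilon> / 2 * t\<^sup>2" using 1(2)[OF t(1,2)] by (simp add: D_def)
    moreover have "norm (D - t\<^sup>2 *\<^sub>R B) \<le> \<epsilon> / 2 * t\<^sup>2" using 2(2)[OF t(1,3)] by (simp add: D_def algebra_simps)
    moreover have "norm (t\<^sup>2 *\<^sub>R (A - B)) \<le> norm (D - t\<^sup>2 *\<^sub>R B) + norm (D - t\<^sup>2 *\<^sub>R A)"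
      using norm_triangle_ineq4[of "D - t\<^sup>2 *\<^sub>R B" "D - t\<^sup>2 *\<^sub>R A"] by (simp add: scaleR_diff_right)
    moreover have "norm (t\<^sup>2 *\<^sub>R (A - B)) = t\<^sup>2 * norm (A - B)" by simp
    ultimately have "t\<^sup>2 * norm (A - B) \<le> \<epsilon> / 2 * t\<^sup>2 + \<epsilon> / 2 * t\<^sup>2" by linarith
    also have "\<dots> = t\<^sup>2 * \<epsilon>" by simp
    finally have "t\<^sup>2 * norm (A - B) \<le> t\<^sup>2 * \<epsilon>" .
    then show ?thesis using t(1) by (simp add: A_def B_def)
  qed
  then show ?thesis
    by (metis field_le_epsilon add_0 norm_le_zero_iff eq_iff_diff_eq_0)
qed

section \<open>Holomorphic functions of several variables\<close>

definition holo :: "(complex^'n \<Rightarrow> complex) \<Rightarrow> (complex^'n) set \<Rightarrow> bool" where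
  "holo f S \<longleftrightarrow> (\<forall>x\<in>S. f differentiable (at x) \<and> (\<forall>v. ddir f x (cJ v) = \<i> * ddir f x v))"

lemma cJ_nth [simp]: "cJ v $ i = \<i> * v $ i"
  by (simp add: cJ_def)

lemma cJ_add: "cJ (u + v) = cJ u + cJ v"
  by (simp add: vec_eq_iff algebra_simps)

lemma cJ_cJ [simp]: "cJ (cJ v) = - v"
  by (simp add: vec_eq_iff)

lemma cJ_scaleR: "cJ (a *\<^sub>R v) = a *\<^sub>R cJ v"
  by (simp add: vec_eq_iff)

lemma complex_scale_split: "(c::complex) *s v = Re c *\<^sub>R v + Im c *\<^sub>R cJ v"
  by (simp add: vec_eq_iff) (simp add: complex_eq_iff)

lemma linear_complex_linear:
  assumes "linear f" "\<And>v. f (cJ v) = \<i> * f v" shows "f (c *s v) = c * (f v :: complex)"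
  unfolding complex_scale_split linear_add[OF assms(1)] linear_scale[OF assms(1)] assms(2)
  by (simp add: complex_eq_iff)

lemma linear_complex_linear_vec:
  assumes "linear f" "\<And>v. f (cJ v) = cJ (f v)" shows "f (c *s v) = c *s (f v)"
  unfolding complex_scale_split linear_add[OF assms(1)] linear_scale[OF assms(1)] assms(2) ..

lemma linear_complex_antilinear:
  assumes "linear f" "\<And>v. f (cJ v) = - \<i> * f v" shows "f (c *s v) = cnj c * (f v :: complex)"
  unfolding complex_scale_split linear_add[OF assms(1)] linear_scale[OF assms(1)] assms(2)
  by (simp add: complex_eq_iff)

lemma line_has_derivative: "((\<lambda>z::complex. x + z *s v) has_derivative (\<lambda>t. t *s v)) (at z)"
proof -
  have "bounded_linear (\<lambda>t::complex. t *s v)"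
    by (rule linear_conv_bounded_linear[THEN iffD1], rule linearI) (auto simp: vec_eq_iff algebra_simps)
  then have "((\<lambda>z. z *s v) has_derivative (\<lambda>t. t *s v)) (at z)" by (rule bounded_linear_imp_has_derivative)
  then show ?thesis by (auto intro!: derivative_eq_intros)
qed

lemma norm_complex_scale: "norm (c *s (v :: complex^'n)) = norm c * norm v"
  by (simp add: norm_vec_def L2_set_def norm_mult power_mult_distrib sum_distrib_left[symmetric] real_sqrt_mult)

lemma holo_has_ddir: "holo f S \<Longrightarrow> x \<in> S \<Longrightarrow> (f has_derivative ddir f x) (at x)"
  unfolding holo_def by (rule differentiable_has_ddir) blast

lemma holo_cJ: "holo f S \<Longrightarrow> x \<in> S \<Longrightarrow> ddir f x (cJ v) = \<i> * ddir f x v"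
  unfolding holo_def by blast

lemma holo_line:
  assumes "holo f S" "x + z *s v \<in> S"
  shows "((\<lambda>z. f (x + z *s v)) has_field_derivative ddir f (x + z *s v) v) (at z)"
proof -
  have 1: "(f has_derivative ddir f (x + z *s v)) (at (x + z *s v))"
    using assms by (rule holo_has_ddir)
  have "((\<lambda>z. f (x + z *s v)) has_derivative (\<lambda>t. ddir f (x + z *s v) (t *s v))) (at z)"
    by (rule has_derivative_compose[OF line_has_derivative 1])
  moreover have "ddir f (x + z *s v) (t *s v) = ddir f (x + z *s v) v * t" for t
    using linear_complex_linear[OF has_derivative_linear[OF 1]] assms by (simp add: holo_def mult.commute)
  ultimately show ?thesis by (simp add: has_field_derivative_def)
qed

lemma holo_diff_scale:
  assumes "open S" "holo f S" "holo g S" shows "holo (\<lambda>x. c * (f x - g x)) S"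
    and "x \<in> S \<Longrightarrow> ddir (\<lambda>x. c * (f x - g x)) x v = c * (ddir f x v - ddir g x v)"
proof -
  have der: "((\<lambda>x. c * (f x - g x)) has_derivative (\<lambda>v. c * (ddir f x v - ddir g x v))) (at x)" if "x \<in> S" for x
    using assms that by (intro has_derivative_mult_right has_derivative_diff holo_has_ddir)
  show "x \<in> S \<Longrightarrow> ddir (\<lambda>x. c * (f x - g x)) x v = c * (ddir f x v - ddir g x v)" using ddir_eq[OF der] .
  show "holo (\<lambda>x. c * (f x - g x)) S"
    unfolding holo_def
  proof (intro ballI conjI allI)
    fix x assume x: "x \<in> S"
    show "(\<lambda>x. c * (f x - g x)) differentiable (at x)" using der[OF x] by (rule differentiableI)
    show "ddir (\<lambda>x. c * (f x - g x)) x (cJ v) = \<i> * ddir (\<lambda>x. c * (f x - g x)) x v" for v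
      unfolding ddir_eq[OF der[OF x]] holo_cJ[OF assms(2) x] holo_cJ[OF assms(3) x] by (simp add: algebra_simps)
  qed
qed

text \<open>Cauchy's estimate along complex lines.\<close>

lemma holo_derivative_bound:
  assumes f: "holo f S" and S: "ball x r \<subseteq> S" and r: "r > 0" and B: "\<And>y. y \<in> ball x r \<Longrightarrow> norm (f y) \<le> B"
  shows "norm (ddir f x v) \<le> 2 * B / r * norm v"
proof (cases "v = 0")
  case True
  have "x \<in> S" using S r by auto
  then have "linear (ddir f x)" using holo_has_ddir[OF f] has_derivative_linear by blast
  then show ?thesis using True linear_0 by auto
next
  case False
  define \<rho> where "\<rho> = r / (2 * norm v)"
  have \<rho>: "\<rho> > 0" using r False by (simp add: \<rho>_def)
  have inb: "x + z *s v \<in> ball x r" if "norm z \<le> \<rho>" for z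
  proof -
    have "norm z * norm v \<le> r / 2" using that False by (simp add: \<rho>_def field_simps)
    then show ?thesis using r by (simp add: dist_norm norm_complex_scale)
  qed
  have der: "((\<lambda>z. f (x + z *s v)) has_field_derivative ddir f (x + z *s v) v) (at z)" if "norm z \<le> \<rho>" for z
    using holo_line[OF f] inb[OF that] S by blast
  have hol: "(\<lambda>z. f (x + z *s v)) holomorphic_on cball 0 \<rho>"
    unfolding holomorphic_on_def using der field_differentiable_at_within field_differentiable_def
    by (metis mem_cball_0)
  have "norm ((deriv ^^ 1) (\<lambda>z. f (x + z *s v)) 0) \<le> fact 1 * B / \<rho> ^ 1"
  proof (rule Cauchy_inequality[OF _ _ \<rho>])
    show "(\<lambda>z. f (x + z *s v)) holomorphic_on ball 0 \<rho>"
      by (rule holomorphic_on_subset[OF hol]) auto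
    show "continuous_on (cball 0 \<rho>) (\<lambda>z. f (x + z *s v))" by (rule holomorphic_on_imp_continuous_on[OF hol])
    show "norm (f (x + z *s v)) \<le> B" if "norm (0 - z) = \<rho>" for z using B[OF inb[of z]] that by simp
  qed
  moreover have "deriv (\<lambda>z. f (x + z *s v)) 0 = ddir f x v"
    using DERIV_imp_deriv[OF der[of 0]] \<rho> by simp
  ultimately show ?thesis by (simp add: \<rho>_def field_simps)
qed

text \<open>Weierstrass' theorem in several variables.\<close>

lemma holo_uniform_limit:
  assumes f: "\<And>n. holo (f n) (ball x0 r)" and r: "r > 0"
    and lim: "uniform_limit (ball x0 r) f g sequentially"
  shows "holo g (ball x0 (r / 2))"
proof -
  define S where "S = ball x0 (r / 2)"
  have sub: "ball x (r / 2) \<subseteq> ball x0 r" if "x \<in> S" for x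
    using that unfolding S_def by (intro ball_subset_ball_iff[THEN iffD2]) (auto simp: dist_commute)
  have SS: "S \<subseteq> ball x0 r" using r by (auto simp: S_def)
  have cauchy: "\<exists>N. \<forall>m\<ge>N. \<forall>n\<ge>N. \<forall>x\<in>S. \<forall>v. norm (ddir (f m) x v - ddir (f n) x v) \<le> \<epsilon> * norm v" if \<epsilon>: "\<epsilon> > 0" for \<epsilon>
  proof -
    have "uniformly_Cauchy_on (ball x0 r) f" using lim uniformly_convergent_Cauchy uniformly_convergent_on_def by blast
    then obtain N where N: "\<And>m n x. m \<ge> N \<Longrightarrow> n \<ge> N \<Longrightarrow> x \<in> ball x0 r \<Longrightarrow> dist (f m x) (f n x) < \<epsilon> * r / 4"
      using \<epsilon> r unfolding uniformly_Cauchy_on_def by (metis divide_pos_pos mult_pos_pos zero_less_numeral)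
    have "norm (ddir (f m) x v - ddir (f n) x v) \<le> \<epsilon> * norm v" if mn: "m \<ge> N" "n \<ge> N" and x: "x \<in> S" for m n x v
    proof -
      have h: "holo (\<lambda>x. 1 * (f m x - f n x)) (ball x0 r)" by (rule holo_diff_scale(1)[OF open_ball f f])
      have "norm (ddir (\<lambda>x. 1 * (f m x - f n x)) x v) \<le> 2 * (\<epsilon> * r / 4) / (r / 2) * norm v"
        by (rule holo_derivative_bound[OF h sub[OF x]])
           (use r N[OF mn] sub[OF x] in \<open>auto simp: dist_norm subset_iff intro: less_imp_le\<close>)
      moreover have "ddir (\<lambda>x. 1 * (f m x - f n x)) x v = 1 * (ddir (f m) x v - ddir (f n) x v)"
        using x SS by (intro holo_diff_scale(2)[OF open_ball f f]) auto
      ultimately show ?thesis using r by simp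
    qed
    then show ?thesis by blast
  qed
  define g' where "g' x v = lim (\<lambda>n. ddir (f n) x v)" for x v
  have conv: "(\<lambda>n. ddir (f n) x v) \<longlonglongrightarrow> g' x v" if x: "x \<in> S" for x v
  proof -
    have "Cauchy (\<lambda>n. ddir (f n) x v)"
    proof (rule metric_CauchyI)
      fix e :: real assume e: "e > 0"
      have "e / (norm v + 1) > 0" using e by (simp add: add_nonneg_pos)
      from cauchy[OF this] obtain N where N: "\<And>m n. m \<ge> N \<Longrightarrow> n \<ge> N \<Longrightarrow>
          norm (ddir (f m) x v - ddir (f n) x v) \<le> e / (norm v + 1) * norm v" using x by blast
      have vp: "0 < norm v + 1" by (simp add: add_nonneg_pos)
      have "e * norm v < e * (norm v + 1)" using e by (simp add: distrib_left)
      then have "e * norm v / (norm v + 1) < e" using pos_divide_less_eq[OF vp] by blast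
      then have "e / (norm v + 1) * norm v < e" by simp
      then show "\<exists>M. \<forall>m\<ge>M. \<forall>n\<ge>M. dist (ddir (f m) x v) (ddir (f n) x v) < e"
        unfolding dist_norm using N order_le_less_trans by blast
    qed
    then show ?thesis unfolding g'_def using Cauchy_convergent_iff convergent_LIMSEQ_iff by blast
  qed
  have nle: "\<forall>\<^sub>F n in sequentially. \<forall>x\<in>S. \<forall>h. norm (ddir (f n) x h - g' x h) \<le> e * norm h" if e: "e > 0" for e
  proof -
    obtain N where N: "\<And>m n x v. m \<ge> N \<Longrightarrow> n \<ge> N \<Longrightarrow> x \<in> S \<Longrightarrow> norm (ddir (f m) x v - ddir (f n) x v) \<le> e * norm v"
      using cauchy[OF e] by blast
    have "norm (ddir (f n) x h - g' x h) \<le> e * norm h" if n: "n \<ge> N" and x: "x \<in> S" for n x h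
    proof (rule tendsto_upperbound)
      show "(\<lambda>m. norm (ddir (f n) x h - ddir (f m) x h)) \<longlonglongrightarrow> norm (ddir (f n) x h - g' x h)"
        by (intro tendsto_intros conv x)
      show "\<forall>\<^sub>F m in sequentially. norm (ddir (f n) x h - ddir (f m) x h) \<le> e * norm h"
        using N[OF n _ x] eventually_at_top_linorder by blast
    qed simp
    then show ?thesis unfolding eventually_at_top_linorder by blast
  qed
  have x0: "x0 \<in> S" using r by (simp add: S_def)
  have limx: "(\<lambda>n. f n x) \<longlonglongrightarrow> g x" if "x \<in> ball x0 r" for x
    by (rule tendsto_uniform_limitI[OF lim that])
  have "\<exists>G. \<forall>x\<in>S. (\<lambda>n. f n x) \<longlonglongrightarrow> G x \<and> (G has_derivative g' x) (at x within S)"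
  proof (rule has_derivative_sequence[OF _ _ nle x0 limx])
    show "convex S" by (simp add: S_def)
    show "(f n has_derivative ddir (f n) x) (at x within S)" if "x \<in> S" for n x
      by (rule has_derivative_at_withinI[OF holo_has_ddir[OF f]]) (use that SS in blast)
  qed (use r in auto)
  then obtain G where G: "\<And>x. x \<in> S \<Longrightarrow> (\<lambda>n. f n x) \<longlonglongrightarrow> G x" "\<And>x. x \<in> S \<Longrightarrow> (G has_derivative g' x) (at x within S)"
    by blast
  have Gg: "G x = g x" if "x \<in> S" for x using LIMSEQ_unique[OF G(1)[OF that] limx] that SS by blast
  have der: "(g has_derivative g' x) (at x)" if x: "x \<in> S" for x
  proof -
    have "(G has_derivative g' x) (at x)" using G(2)[OF x] x by (simp add: S_def at_within_open[OF _ open_ball])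
    then show ?thesis
      by (rule has_derivative_transform_within_open[where s = S]) (use x Gg in \<open>auto simp: S_def\<close>)
  qed
  have "g' x (cJ v) = \<i> * g' x v" if x: "x \<in> S" for x v
  proof (rule LIMSEQ_unique[OF conv[OF x]])
    have "(\<lambda>n. \<i> * ddir (f n) x v) \<longlonglongrightarrow> \<i> * g' x v" by (intro tendsto_intros conv x)
    moreover have "ddir (f n) x (cJ v) = \<i> * ddir (f n) x v" for n using f[of n] x SS by (auto simp: holo_def)
    ultimately show "(\<lambda>n. ddir (f n) x (cJ v)) \<longlonglongrightarrow> \<i> * g' x v" by simp
  qed
  then show ?thesis
    unfolding holo_def S_def[symmetric] using der ddir_eq[OF der] by (auto intro: differentiableI)
qed

lemma holo_subset: "holo f S \<Longrightarrow> T \<subseteq> S \<Longrightarrow> holo f T"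
  by (auto simp: holo_def)

lemma holo_cong:
  assumes S: "open S" and f: "holo f S" and eq: "\<And>x. x \<in> S \<Longrightarrow> g x = f x" shows "holo g S"
  unfolding holo_def
proof (intro ballI conjI allI)
  fix x assume x: "x \<in> S"
  show "g differentiable (at x)"
    by (rule differentiable_cong_open[OF S x]) (use f x eq in \<open>auto simp: holo_def\<close>)
  have "frechet_derivative g (at x) = frechet_derivative f (at x)" by (rule ddir_cong[OF S x eq])
  then show "ddir g x (cJ v) = \<i> * ddir g x v" for v using f x by (simp add: holo_def)
qed

lemma holo_translate:
  assumes "holo f S" "\<And>x. x \<in> T \<Longrightarrow> x + a \<in> S" shows "holo (\<lambda>x. f (x + a)) T"
proof -
  have der: "((\<lambda>x. f (x + a)) has_derivative ddir f (x + a)) (at x)" if "x \<in> T" for x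
  proof -
    have "(f has_derivative ddir f (x + a)) (at (x + a))"
      by (rule holo_has_ddir[OF assms(1) assms(2)[OF that]])
    moreover have "((\<lambda>x. x + a) has_derivative (\<lambda>h. h)) (at x)" by (auto intro!: derivative_eq_intros)
    ultimately show ?thesis using has_derivative_compose by fastforce
  qed
  show ?thesis
    unfolding holo_def
  proof (intro ballI conjI allI)
    fix x assume x: "x \<in> T"
    show "(\<lambda>x. f (x + a)) differentiable (at x)" by (rule differentiableI[OF der[OF x]])
    show "ddir (\<lambda>x. f (x + a)) x (cJ v) = \<i> * ddir (\<lambda>x. f (x + a)) x v" for v
      unfolding ddir_eq[OF der[OF x]] by (rule holo_cJ[OF assms(1) assms(2)[OF x]])
  qed
qed

text \<open>On complex lines Cauchy's estimate bounds the error of the difference quotient by \<open>C |z|\<close> with \<open>C\<close> uniform in the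
  base point. The derivative is therefore a locally uniform limit of holomorphic functions.\<close>

lemma holo_ddir:
  assumes S: "open S" and f: "holo f S" shows "holo (\<lambda>x. ddir f x v) S"
proof -
  have "\<exists>\<epsilon>>0. holo (\<lambda>x. ddir f x v) (ball x0 \<epsilon>)" if x0: "x0 \<in> S" for x0
  proof -
    obtain \<delta> where \<delta>: "\<delta> > 0" "cball x0 \<delta> \<subseteq> S" using S x0 open_contains_cball by blast
    have "continuous_on (cball x0 \<delta>) f"
      using f \<delta>(2) by (intro continuous_at_imp_continuous_on ballI differentiable_imp_continuous_within) (auto simp: holo_def)
    then have "bounded (f ` cball x0 \<delta>)" by (intro compact_imp_bounded compact_continuous_image) auto
    then obtain M where M: "\<And>y. y \<in> cball x0 \<delta> \<Longrightarrow> norm (f y) \<le> M" unfolding bounded_iff by blast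
    define \<rho> where "\<rho> = \<delta> / (2 * (norm v + 1))"
    have v1: "norm v + 1 > 0" by (simp add: add_nonneg_pos)
    have \<rho>: "\<rho> > 0" using \<delta>(1) v1 by (simp add: \<rho>_def)
    have inb: "x + z *s v \<in> cball x0 \<delta>" if "x \<in> ball x0 (\<delta> / 2)" "norm z \<le> \<rho>" for x z
    proof -
      have "norm z * norm v \<le> \<rho> * (norm v + 1)" using that(2) \<rho> by (intro mult_mono) auto
      also have "\<dots> = \<delta> / 2"
      proof -
        have "\<delta> / (2 * V) * V = \<delta> / 2" if "V > 0" for V :: real using that by simp
        from this[OF v1] show ?thesis unfolding \<rho>_def .
      qed
      finally have "norm (z *s v) \<le> \<delta> / 2" by (simp add: norm_complex_scale)
      moreover have "dist x0 (x + z *s v) \<le> dist x0 x + norm (z *s v)"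
        using dist_triangle[of x0 "x + z *s v" x] by (simp add: dist_norm)
      ultimately show ?thesis using that(1) by simp
    qed
    define C where "C = 2 * M / (\<rho> / 2) ^ 2"
    have est: "norm (f (x + z *s v) - f x - z * ddir f x v) \<le> C * (norm z)\<^sup>2"
      if x: "x \<in> ball x0 (\<delta> / 2)" and z: "norm z < \<rho> / 2" for x z
    proof -
      define \<phi> where "\<phi> z = f (x + z *s v)" for z
      have der: "(\<phi> has_field_derivative ddir f (x + z *s v) v) (at z)" if "norm z \<le> \<rho>" for z
        unfolding \<phi>_def using holo_line[OF f] inb[OF x that] \<delta>(2) by blast
      have hol: "\<phi> holomorphic_on cball 0 \<rho>"
        unfolding holomorphic_on_def using der field_differentiable_at_within field_differentiable_def by (metis mem_cball_0)
      have holb: "\<phi> holomorphic_on ball 0 \<rho>" by (rule holomorphic_on_subset[OF hol]) auto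
      have 2: "norm ((deriv ^^ 2) \<phi> w) \<le> fact 2 * M / (\<rho> / 2) ^ 2" if w: "w \<in> ball 0 (\<rho> / 2)" for w
      proof (rule Cauchy_inequality)
        have sub: "cball w (\<rho> / 2) \<subseteq> cball 0 \<rho>" using w \<rho> by (intro cball_subset_cball_iff[THEN iffD2]) auto
        show "\<phi> holomorphic_on ball w (\<rho> / 2)"
          by (rule holomorphic_on_subset[OF hol]) (use sub ball_subset_cball in blast)
        show "continuous_on (cball w (\<rho> / 2)) \<phi>"
          by (rule continuous_on_subset[OF holomorphic_on_imp_continuous_on[OF hol] sub])
        show "norm (\<phi> y) \<le> M" if "norm (w - y) = \<rho> / 2" for y
        proof -
          have "y \<in> cball w (\<rho> / 2)" using that by (simp add: dist_norm)
          then have "norm y \<le> \<rho>" using sub by auto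
          then show ?thesis unfolding \<phi>_def using M inb[OF x] by blast
        qed
      qed (use \<rho> in simp)
      have "norm ((deriv ^^ 0) \<phi> z - (\<Sum>i\<le>1. (deriv ^^ i) \<phi> 0 * (z - 0) ^ i / fact i)) \<le> C * norm (z - 0) ^ Suc 1 / fact 1"
      proof (rule complex_Taylor[where S = "ball 0 (\<rho> / 2)"])
        show "((deriv ^^ i) \<phi> has_field_derivative (deriv ^^ Suc i) \<phi> w) (at w within ball 0 (\<rho> / 2))"
          if "w \<in> ball 0 (\<rho> / 2)" for w i
        proof -
          have "(deriv ^^ i) \<phi> holomorphic_on ball 0 \<rho>" by (rule holomorphic_higher_deriv[OF holb open_ball])
          then have "((deriv ^^ i) \<phi> has_field_derivative deriv ((deriv ^^ i) \<phi>) w) (at w)"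
            by (rule holomorphic_derivI[OF _ open_ball]) (use that \<rho> in auto)
          then show ?thesis by (simp add: has_field_derivative_at_within)
        qed
        show "norm ((deriv ^^ Suc 1) \<phi> w) \<le> C" if "w \<in> ball 0 (\<rho> / 2)" for w
          using 2[OF that] by (simp add: C_def numeral_2_eq_2)
      qed (use z \<rho> in auto)
      moreover have "(\<Sum>i\<le>1. (deriv ^^ i) \<phi> 0 * (z - 0) ^ i / fact i) = \<phi> 0 + deriv \<phi> 0 * z" by simp
      moreover have "deriv \<phi> 0 = ddir f x v" using DERIV_imp_deriv[OF der[of 0]] \<rho> by simp
      ultimately show ?thesis by (simp add: \<phi>_def power2_eq_square algebra_simps)
    qed
    define G where "G n x = of_nat (Suc n) * (f (x + inverse (of_nat (Suc n)) *s v) - f x)" for n x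
    obtain N0 where N0: "inverse (real (Suc N0)) < \<rho> / 2" using reals_Archimedean[of "\<rho> / 2"] \<rho> by auto
    have small: "norm (inverse (of_nat (Suc (N0 + n))) :: complex) < \<rho> / 2" for n
    proof -
      have "inverse (real (Suc (N0 + n))) \<le> inverse (real (Suc N0))" by (intro le_imp_inverse_le) auto
      moreover have "norm (inverse (of_nat (Suc (N0 + n))) :: complex) = inverse (real (Suc (N0 + n)))"
        by (simp only: norm_inverse norm_of_nat)
      ultimately show ?thesis using N0 by linarith
    qed
    have "holo (\<lambda>x. ddir f x v) (ball x0 (\<delta> / 2 / 2))"
    proof (rule holo_uniform_limit[where f = "\<lambda>n. G (N0 + n)"])
      show "holo (G (N0 + n)) (ball x0 (\<delta> / 2))" for n
        unfolding G_def
      proof (rule holo_diff_scale(1)[OF open_ball])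
        have sb: "ball x0 (\<delta> / 2) \<subseteq> S" using \<delta> by (auto simp: subset_iff)
        show "holo f (ball x0 (\<delta> / 2))" by (rule holo_subset[OF f sb])
        show "holo (\<lambda>x. f (x + inverse (of_nat (Suc (N0 + n))) *s v)) (ball x0 (\<delta> / 2))"
        proof (rule holo_translate[OF f])
          fix x assume "x \<in> ball x0 (\<delta> / 2)"
          from inb[OF this, of "inverse (of_nat (Suc (N0 + n)))"] small[of n] \<rho>
          have "x + inverse (of_nat (Suc (N0 + n))) *s v \<in> cball x0 \<delta>" by linarith
          then show "x + inverse (of_nat (Suc (N0 + n))) *s v \<in> S" using \<delta>(2) by blast
        qed
      qed
      show "uniform_limit (ball x0 (\<delta> / 2)) (\<lambda>n. G (N0 + n)) (\<lambda>x. ddir f x v) sequentially"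
      proof (rule uniform_limitI)
        fix e :: real assume e: "e > 0"
        have bound: "dist (G (N0 + n) x) (ddir f x v) \<le> C * inverse (real (Suc (N0 + n)))" if x: "x \<in> ball x0 (\<delta> / 2)" for n x
        proof -
          define k where "k = (of_nat (Suc (N0 + n)) :: complex)"
          have k: "k \<noteq> 0" "norm k = real (Suc (N0 + n))" by (simp_all add: k_def del: of_nat_Suc)
          have "G (N0 + n) x - ddir f x v = k * (f (x + inverse k *s v) - f x - inverse k * ddir f x v)"
          proof -
            have "G (N0 + n) x = k * (f (x + inverse k *s v) - f x)" by (simp only: G_def k_def)
            then show ?thesis using k(1) by (simp only:) (simp add: algebra_simps)
          qed
          then have "norm (G (N0 + n) x - ddir f x v) \<le> norm k * (C * (norm (inverse k))\<^sup>2)"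
            unfolding norm_mult[of k]
            using est[OF x small[of n]] by (simp add: norm_mult k_def mult_left_mono del: of_nat_Suc)
          also have "\<dots> = C * inverse (norm k)" using k(1) by (simp add: norm_inverse power2_eq_square)
          finally show ?thesis by (simp add: dist_norm k(2))
        qed
        have "(\<lambda>n. C * inverse (real (Suc (N0 + n)))) \<longlonglongrightarrow> C * 0"
        proof (intro tendsto_mult tendsto_const)
          have "(\<lambda>n. inverse (real (Suc n))) \<longlonglongrightarrow> 0" by (rule LIMSEQ_inverse_real_of_nat)
          then have "(\<lambda>n. inverse (real (Suc (n + N0)))) \<longlonglongrightarrow> 0" by (rule LIMSEQ_ignore_initial_segment)
          then show "(\<lambda>n. inverse (real (Suc (N0 + n)))) \<longlonglongrightarrow> 0" by (simp only: add.commute)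
        qed
        then have "eventually (\<lambda>n. C * inverse (real (Suc (N0 + n))) < e) sequentially"
          using e by (intro order_tendstoD(2)) auto
        then show "\<forall>\<^sub>F n in sequentially. \<forall>x\<in>ball x0 (\<delta> / 2). dist (G (N0 + n) x) (ddir f x v) < e"
          by eventually_elim (use bound le_less_trans in blast)
      qed
    qed (use \<delta> in auto)
    then show ?thesis using \<delta>(1) by (intro exI[of _ "\<delta> / 2 / 2"]) auto
  qed
  then show ?thesis unfolding holo_def by (meson centre_in_ball)
qed

lemma ddir_nth:
  assumes "F differentiable (at x)" shows "ddir F x v $ k = ddir (\<lambda>x. F x $ k) x v"
    and "(\<lambda>x. F x $ k) differentiable (at x)"
proof -
  have "((\<lambda>x. F x $ k) has_derivative (\<lambda>v. ddir F x v $ k)) (at x)"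
    by (rule bounded_linear.has_derivative[OF bounded_linear_vec_nth differentiable_has_ddir[OF assms]])
  then show "ddir F x v $ k = ddir (\<lambda>x. F x $ k) x v" "(\<lambda>x. F x $ k) differentiable (at x)"
    by (rule ddir_eq[symmetric], rule differentiableI)
qed

lemma has_derivative_vec:
  fixes F :: "'a::real_normed_vector \<Rightarrow> 'b::euclidean_space^'k"
  assumes "\<And>k. ((\<lambda>x. F x $ k) has_derivative (\<lambda>v. F' v $ k)) (at x)"
  shows "(F has_derivative F') (at x)"
  unfolding has_derivative_componentwise_within[of F F']
proof
  fix b :: "'b^'k" assume "b \<in> Basis"
  then obtain k c where "b = axis k c" by (auto simp: Basis_vec_def)
  then show "((\<lambda>x. F x \<bullet> b) has_derivative (\<lambda>v. F' v \<bullet> b)) (at x)"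
    using bounded_linear.has_derivative[OF bounded_linear_inner_left assms[of k], of c] by (simp add: inner_axis)
qed

lemma hol_map_on_iff:
  assumes "open S" shows "hol_map_on F S \<longleftrightarrow> (\<forall>k. holo (\<lambda>x. F x $ k) S)"
proof
  assume F: "hol_map_on F S"
  show "\<forall>k. holo (\<lambda>x. F x $ k) S"
    unfolding holo_def
  proof (intro allI ballI conjI)
    fix k x assume x: "x \<in> S"
    then have d: "F differentiable (at x)" using F by (simp add: hol_map_on_def)
    show "(\<lambda>x. F x $ k) differentiable (at x)" by (rule ddir_nth(2)[OF d])
    show "ddir (\<lambda>x. F x $ k) x (cJ v) = \<i> * ddir (\<lambda>x. F x $ k) x v" for v
      using F x by (simp add: ddir_nth(1)[OF d, symmetric] hol_map_on_def)
  qed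
next
  assume h: "\<forall>k. holo (\<lambda>x. F x $ k) S"
  show "hol_map_on F S"
    unfolding hol_map_on_def
  proof (intro ballI conjI allI)
    fix x assume x: "x \<in> S"
    have "(F has_derivative (\<lambda>v. \<chi> k. ddir (\<lambda>x. F x $ k) x v)) (at x)"
      by (rule has_derivative_vec) (use h x in \<open>auto simp: holo_def intro: differentiable_has_ddir\<close>)
    then have d: "F differentiable (at x)" by (rule differentiableI)
    then show "F differentiable (at x)" .
    show "ddir F x (cJ v) = cJ (ddir F x v)" for v
      using h x by (simp add: vec_eq_iff ddir_nth(1)[OF d] holo_def)
  qed
qed

theorem hol_map_on_ddir:
  assumes S: "open S" and F: "hol_map_on F S" shows "hol_map_on (\<lambda>x. ddir F x v) S"
  unfolding hol_map_on_iff[OF S]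
proof
  fix k
  have "holo (\<lambda>x. ddir (\<lambda>x. F x $ k) x v) S" using holo_ddir[OF S] F hol_map_on_iff[OF S] by blast
  moreover have "ddir F x v $ k = ddir (\<lambda>x. F x $ k) x v" if "x \<in> S" for x
    using F that by (intro ddir_nth(1)) (simp add: hol_map_on_def)
  ultimately show "holo (\<lambda>x. ddir F x v $ k) S"
    by (rule holo_cong[OF S])
qed

section \<open>Determinants and Hermitian forms\<close>

text \<open>The determinant as a sum over permutations, differentiated factor by factor.\<close>

lemma det_has_derivative_rows:
  fixes A :: "'a::real_normed_vector \<Rightarrow> complex^'n^'n"
  assumes "\<And>i j. ((\<lambda>x. A x $ i $ j) has_derivative (\<lambda>t. A' t $ i $ j)) (at x)"
  shows "((\<lambda>x. det (A x)) has_derivative (\<lambda>t. \<Sum>i\<in>UNIV. det (\<chi> k. if k = i then A' t $ i else A x $ k))) (at x)"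
proof -
  have "((\<lambda>x. det (A x)) has_derivative (\<lambda>t. \<Sum>p\<in>{p. p permutes (UNIV::'n set)}. of_int (sign p) *
      (\<Sum>i\<in>UNIV. A' t $ i $ p i * (\<Prod>j\<in>UNIV - {i}. A x $ j $ p j)))) (at x)"
    unfolding det_def using assms by (intro has_derivative_sum has_derivative_mult_right has_derivative_prod)
  moreover have "(\<Sum>p\<in>{p. p permutes (UNIV::'n set)}. of_int (sign p) *
      (\<Sum>i\<in>UNIV. A' t $ i $ p i * (\<Prod>j\<in>UNIV - {i}. A x $ j $ p j)))
      = (\<Sum>i\<in>UNIV. det (\<chi> k. if k = i then A' t $ i else A x $ k))" for t
  proof -
    have "(\<Prod>k\<in>UNIV. (\<chi> k. if k = i then A' t $ i else A x $ k) $ k $ p k)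
        = A' t $ i $ p i * (\<Prod>j\<in>UNIV - {i}. A x $ j $ p j)" for i p
      by (subst prod.remove[of UNIV i]) (auto intro!: prod.cong)
    then have "(\<Sum>i\<in>UNIV. det (\<chi> k. if k = i then A' t $ i else A x $ k))
      = (\<Sum>i\<in>UNIV. \<Sum>p\<in>{p. p permutes (UNIV::'n set)}. of_int (sign p) * (A' t $ i $ p i * (\<Prod>j\<in>UNIV - {i}. A x $ j $ p j)))"
      unfolding det_def by (simp only:)
    also have "\<dots> = (\<Sum>p\<in>{p. p permutes (UNIV::'n set)}. \<Sum>i\<in>UNIV. of_int (sign p) * (A' t $ i $ p i * (\<Prod>j\<in>UNIV - {i}. A x $ j $ p j)))"
      by (rule sum.swap)
    finally show ?thesis by (simp only: sum_distrib_left)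
  qed
  ultimately show ?thesis by simp
qed

lemma det_row_sum_left:
  fixes A :: "complex^'n^'n"
  shows "(\<Sum>i\<in>UNIV. det (\<chi> k. if k = i then (C ** A) $ i else A $ k)) = trace C * det A"
proof -
  have "det (\<chi> k. if k = i then (C ** A) $ i else A $ k) = C $ i $ i * det A" for i
  proof -
    have "(\<chi> k. if k = i then (C ** A) $ i else A $ k)
        = (\<chi> k. if k = i then sum (\<lambda>l. (C $ i) $ l *s row l A) UNIV else row k A)"
      by (simp add: vec_eq_iff row_def matrix_matrix_mult_def)
    then show ?thesis by (simp only: cramer_lemma_transpose)
  qed
  then show ?thesis by (simp only: trace_def sum_distrib_right)
qed

lemma det_row_sum_right:
  fixes A :: "complex^'n^'n"
  shows "(\<Sum>i\<in>UNIV. det (\<chi> k. if k = i then (A ** D) $ i else A $ k)) = trace D * det A"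
proof -
  define F where "F s = A + s *\<^sub>R (A ** D)" for s :: real
  have F0: "F 0 = A" by (simp add: F_def)
  have "((\<lambda>s. F s $ i $ j) has_derivative (\<lambda>t. (t *\<^sub>R (A ** D)) $ i $ j)) (at 0)" for i j
    unfolding F_def by (auto intro!: derivative_eq_intros)
  from det_has_derivative_rows[of F "\<lambda>t. t *\<^sub>R (A ** D)", OF this]
  have 1: "((\<lambda>s. det (F s)) has_derivative (\<lambda>t. \<Sum>i\<in>UNIV. det (\<chi> k. if k = i then (t *\<^sub>R (A ** D)) $ i else A $ k))) (at 0)"
    unfolding F0 .
  have "((\<lambda>s. transpose (F s) $ i $ j) has_derivative (\<lambda>t. (t *\<^sub>R (transpose D ** transpose A)) $ i $ j)) (at 0)" for i j
    unfolding F_def transpose_def by (auto intro!: derivative_eq_intros simp: matrix_matrix_mult_def mult.commute)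
  from det_has_derivative_rows[of "\<lambda>s. transpose (F s)" "\<lambda>t. t *\<^sub>R (transpose D ** transpose A)", OF this]
  have 2: "((\<lambda>s. det (F s)) has_derivative (\<lambda>t. \<Sum>i\<in>UNIV. det (\<chi> k. if k = i then (t *\<^sub>R (transpose D ** transpose A)) $ i else transpose A $ k))) (at 0)"
    unfolding F0 by (simp only: det_transpose)
  have "(\<Sum>i\<in>UNIV. det (\<chi> k. if k = i then (1 *\<^sub>R (A ** D)) $ i else A $ k))
      = (\<Sum>i\<in>UNIV. det (\<chi> k. if k = i then (1 *\<^sub>R (transpose D ** transpose A)) $ i else transpose A $ k))"
    using has_derivative_unique[OF 1 2] by (rule fun_cong)
  also have "\<dots> = trace (transpose D) * det (transpose A)" unfolding scaleR_one by (rule det_row_sum_left)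
  finally show ?thesis unfolding scaleR_one by (simp add: trace_def transpose_def[of D])
qed

text \<open>Jacobi's formula in the form in which a connection produces it: the derivative of a Gram matrix
  has a part from each of the two arguments.\<close>

lemma det_has_derivative_two_sided:
  fixes A :: "'a::real_normed_vector \<Rightarrow> complex^'n^'n"
  assumes "\<And>i j. ((\<lambda>x. A x $ i $ j) has_derivative (\<lambda>t. (C t ** A x + A x ** D t) $ i $ j)) (at x)"
  shows "((\<lambda>x. det (A x)) has_derivative (\<lambda>t. (trace (C t) + trace (D t)) * det (A x))) (at x)"
proof -
  have "(\<Sum>i\<in>UNIV. det (\<chi> k. if k = i then (C t ** A x + A x ** D t) $ i else A x $ k))
      = (trace (C t) + trace (D t)) * det (A x)" for t
    by (simp only: vector_add_component det_row_add[of _ "\<lambda>i. (C t ** A x) $ _" "\<lambda>i. (A x ** D t) $ _"]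
        sum.distrib det_row_sum_left det_row_sum_right distrib_right)
  with det_has_derivative_rows[OF assms] show ?thesis by simp
qed

text \<open>The determinant of a perturbation of rank one is affine in the perturbation.\<close>

lemma det_rank_one_update:
  fixes L :: "complex^'n^'n" and b :: "complex^'n"
  shows "det (\<chi> k. L $ k + a k *s b) = det L + (\<Sum>i\<in>UNIV. a i * det (\<chi> k. if k = i then b else L $ k))"
proof -
  have clear: "det (\<chi> k. if k = i then b else if k \<in> S then L $ k + a k *s b else L $ k)
      = det (\<chi> k. if k = i then b else L $ k)" if "finite S" "i \<notin> S" for S i
    using that
  proof (induction S rule: finite_induct)
    case empty
    show ?case by (simp only: empty_iff if_False)
  next
    case (insert j S)
    then have ij: "j \<noteq> i" by auto
    define A where "A = (\<chi> k. if k = i then b else if k \<in> S then L $ k + a k *s b else L $ k)"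
    have "(\<chi> k. if k = i then b else if k \<in> insert j S then L $ k + a k *s b else L $ k)
        = (\<chi> k. if k = j then row j A + a j *s row i A else row k A)"
      using insert ij by (auto simp: A_def vec_eq_iff row_def)
    then have "det (\<chi> k. if k = i then b else if k \<in> insert j S then L $ k + a k *s b else L $ k) = det A"
      using det_row_operation[OF ij, of A "a j"] by simp
    then show ?case using insert by (simp add: A_def)
  qed
  have "det (\<chi> k. if k \<in> S then L $ k + a k *s b else L $ k)
      = det L + (\<Sum>i\<in>S. a i * det (\<chi> k. if k = i then b else L $ k))" if "finite S" for S
    using that
  proof (induction S rule: finite_induct)
    case empty
    have "(\<chi> k. L $ k) = L" by simp
    then show ?case by simp
  next
    case (insert i S)
    define c where "c k = (if k \<in> S then L $ k + a k *s b else L $ k)" for k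
    have "(\<chi> k. if k \<in> insert i S then L $ k + a k *s b else L $ k) = (\<chi> k. if k = i then L $ i + a i *s b else c k)"
      by (auto simp: vec_eq_iff c_def)
    also have "det \<dots> = det (\<chi> k. if k = i then L $ i else c k) + det (\<chi> k. if k = i then a i *s b else c k)"
      using det_row_add[of i "\<lambda>i. L $ i" "\<lambda>i. a i *s b" c] by (simp cong: if_cong)
    also have "(\<chi> k. if k = i then L $ i else c k) = (\<chi> k. if k \<in> S then L $ k + a k *s b else L $ k)"
      using insert by (auto simp: vec_eq_iff c_def)
    also have "det (\<chi> k. if k = i then a i *s b else c k) = a i * det (\<chi> k. if k = i then b else c k)"
      using det_row_mul[of i "a i" "\<lambda>i. b" c] by simp
    also have "det (\<chi> k. if k = i then b else c k) = det (\<chi> k. if k = i then b else L $ k)"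
      using clear[OF insert(1,2)] by (simp only: c_def)
    finally show ?case using insert by simp
  qed
  from this[of UNIV] show ?thesis by simp
qed

lemma linear_expand_vec:
  fixes T :: "complex^'k \<Rightarrow> complex^'l"
  assumes "\<And>u v. T (u + v) = T u + T v" "\<And>c u. T (c *s u) = c *s T u"
  shows "T u = (\<Sum>k\<in>UNIV. u $ k *s T (axis k 1))"
proof -
  have "T u = T (\<Sum>k\<in>UNIV. u $ k *s axis k 1)" by (simp only: basis_expansion)
  also have "\<dots> = (\<Sum>k\<in>UNIV. u $ k *s T (axis k 1))"
    by (simp only: additive.sum[OF additive.intro[OF assms(1)]] assms(2))
  finally show ?thesis .
qed

lemma linear_expand:
  fixes T :: "complex^'k \<Rightarrow> complex"
  assumes "\<And>u v. T (u + v) = T u + T v" "\<And>c u. T (c *s u) = c * T u"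
  shows "T u = (\<Sum>k\<in>UNIV. u $ k * T (axis k 1))"
proof -
  have "T u = T (\<Sum>k\<in>UNIV. u $ k *s axis k 1)" by (simp only: basis_expansion)
  also have "\<dots> = (\<Sum>k\<in>UNIV. u $ k * T (axis k 1))"
    by (simp only: additive.sum[OF additive.intro[OF assms(1)]] assms(2))
  finally show ?thesis .
qed

locale sesquilinear =
  fixes q :: "complex^'n \<Rightarrow> complex^'n \<Rightarrow> complex"
  assumes add_left: "q (u + v) w = q u w + q v w" and scale_left: "q (c *s u) w = c * q u w"
    and cnj: "cnj (q u v) = q v u"
begin

lemma add_right: "q w (u + v) = q w u + q w v"
  by (metis add_left cnj complex_cnj_add)

lemma scale_right: "q w (c *s u) = cnj c * q w u"
  by (metis scale_left cnj complex_cnj_mult)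

lemma zero_left [simp]: "q 0 w = 0" using scale_left[of 0 0 w] by simp
lemma zero_right [simp]: "q w 0 = 0" using scale_right[of w 0 0] by simp

lemma minus_left: "q (- u) w = - q u w" using scale_left[of "-1" u w] by simp
lemma diff_left: "q (u - v) w = q u w - q v w" using add_left[of u "-v" w] by (simp add: minus_left)

lemma sum_left: "q (\<Sum>i\<in>I. f i) w = (\<Sum>i\<in>I. q (f i) w)"
  by (induction I rule: infinite_finite_induct) (simp_all add: add_left)

lemma self_real: "Im (q u u) = 0"
  using cnj[of u u] by (simp add: complex_eq_iff)

lemma expand_left: "q u w = (\<Sum>k\<in>UNIV. u $ k * q (axis k 1) w)"
  by (rule linear_expand) (rule add_left scale_left)+

lemma expand_right: "q w u = (\<Sum>k\<in>UNIV. cnj (u $ k) * q w (axis k 1))"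
  using arg_cong[OF expand_left[of u w], of cnj] by (simp add: cnj)

lemma expand: "q u v = (\<Sum>i\<in>UNIV. \<Sum>j\<in>UNIV. u $ i * cnj (v $ j) * q (axis i 1) (axis j 1))"
  unfolding expand_left[of u v] by (subst expand_right) (simp add: sum_distrib_left mult.assoc)

end

locale hermitian_product = sesquilinear q for q :: "complex^'n \<Rightarrow> complex^'n \<Rightarrow> complex" +
  assumes pos: "u \<noteq> 0 \<Longrightarrow> Re (q u u) > 0"
begin

lemma eq_zero: "(\<And>w. q u w = 0) \<Longrightarrow> u = 0"
  using pos[of u] by (metis less_irrefl zero_complex.simps(1))

lemma eqI: "(\<And>w. q u w = q v w) \<Longrightarrow> u = v"
  using eq_zero[of "u - v"] by (simp add: diff_left)

definition gram :: "complex^'n^'n" where "gram = (\<chi> i j. q (axis i 1) (axis j 1))"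

lemma det_gram_nonzero: "det gram \<noteq> 0"
proof -
  have "x = 0" if "transpose gram *v x = 0" for x
  proof (rule eq_zero)
    fix w
    have "q x (axis j 1) = (transpose gram *v x) $ j" for j
      unfolding expand_left[of x] by (simp add: gram_def matrix_vector_mult_def transpose_def mult.commute)
    then have "q x (axis j 1) = 0" for j using that by simp
    then show "q x w = 0" unfolding expand_right[of x w] by simp
  qed
  then have "invertible (transpose gram)"
    unfolding invertible_left_inverse matrix_left_invertible_ker by blast
  then show ?thesis by (simp add: invertible_det_nz)
qed

lemma orthonormal_frame: "\<exists>E::'n \<Rightarrow> complex^'n. \<forall>i j. q (E i) (E j) = (if i = j then 1 else 0)"
proof -
  have "\<exists>E. \<forall>i\<in>I. \<forall>j\<in>I. q (E i) (E j) = (if i = j then 1 else 0)" if "finite I" for I :: "'n set"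
    using that
  proof (induction I rule: finite_induct)
    case empty
    show ?case by simp
  next
    case (insert a I)
    then obtain E where E: "\<And>i j. i \<in> I \<Longrightarrow> j \<in> I \<Longrightarrow> q (E i) (E j) = (if i = j then 1 else 0)" by blast
    have "card I < CARD('n)" using insert by (metis card_seteq finite top.extremum UNIV_I not_le)
    then have "vec.dim (vec.span (E ` I)) < CARD('n)"
      using vec.dim_le_card'[of "E ` I"] card_image_le[OF insert(1), of E] insert(1) by simp
    then have "vec.span (E ` I) \<noteq> UNIV" using vec.dim_UNIV vec_dim_card by (metis less_irrefl)
    then obtain v where v: "v \<notin> vec.span (E ` I)" by blast
    define w where "w = v - (\<Sum>j\<in>I. q v (E j) *s E j)"
    have "(\<Sum>j\<in>I. q v (E j) *s E j) \<in> vec.span (E ` I)"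
      by (intro vec.span_sum vec.span_scale vec.span_base) auto
    then have "w \<noteq> 0" using v by (auto simp: w_def)
    have orth: "q w (E j) = 0" if "j \<in> I" for j
      using that insert(1) by (simp add: w_def diff_left sum_left scale_left E if_distrib sum.delta cong: if_cong)
    define s where "s = Re (q w w)"
    have s: "s > 0" "q w w = of_real s" using pos[OF \<open>w \<noteq> 0\<close>] self_real[of w] by (auto simp: s_def complex_eq_iff)
    define e where "e = of_real (1 / sqrt s) *s w"
    have "of_real (1 / sqrt s) * (of_real (1 / sqrt s) * of_real s) = (1 :: complex)"
      using s(1) by (simp add: field_simps power2_eq_square[symmetric] of_real_power[symmetric] del: of_real_power)
    then have ee: "q e e = 1" by (simp add: e_def scale_left scale_right s(2))
    have eE: "q e (E j) = 0" "q (E j) e = 0" if "j \<in> I" for j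
    proof -
      show "q e (E j) = 0" using orth[OF that] by (simp add: e_def scale_left)
      then show "q (E j) e = 0" using cnj[of e "E j"] by simp
    qed
    show ?case
      by (intro exI[of _ "E(a := e)"]) (use insert(2) E ee eE in auto)
  qed
  from this[of UNIV] show ?thesis by simp
qed

lemma orthonormal_expansion:
  fixes E :: "'n \<Rightarrow> complex^'n"
  assumes E: "\<And>i j. q (E i) (E j) = (if i = j then 1 else 0)"
  shows "x = (\<Sum>i\<in>UNIV. q x (E i) *s E i)"
proof -
  define M :: "complex^'n^'n" where "M = (\<chi> i k. E i $ k)"
  define N :: "complex^'n^'n" where "N = (\<chi> k i. q (axis k 1) (E i))"
  have "M ** N = mat 1"
    by (simp add: vec_eq_iff M_def N_def matrix_matrix_mult_def mat_def expand_left[of "E _" "E _", symmetric] E)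
  then have NM: "N ** M = mat 1" by (rule matrix_left_right_inverse1)
  have "x $ l = (\<Sum>i\<in>UNIV. q x (E i) *s E i) $ l" for l
  proof -
    have "(\<Sum>i\<in>UNIV. q x (E i) *s E i) $ l = (\<Sum>i\<in>UNIV. \<Sum>k\<in>UNIV. x $ k * (N $ k $ i * M $ i $ l))"
      by (simp add: expand_left[of x] sum_distrib_right N_def M_def mult.assoc)
    also have "\<dots> = (\<Sum>k\<in>UNIV. x $ k * (N ** M) $ k $ l)"
      by (subst sum.swap) (simp add: matrix_matrix_mult_def sum_distrib_left)
    also have "\<dots> = x $ l" unfolding NM by (simp add: mat_def if_distrib cong: if_cong)
    finally show ?thesis by simp
  qed
  then show ?thesis by (simp add: vec_eq_iff)
qed

text \<open>The trace is computed in coordinates on one side and in an orthonormal frame on the other; only the latter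
  is compatible with the Gauss equation.\<close>

lemma trace_orthonormal:
  fixes E :: "'n \<Rightarrow> complex^'n" and C :: "complex^'n \<Rightarrow> complex^'n"
  assumes E: "\<And>i j. q (E i) (E j) = (if i = j then 1 else 0)"
    and C: "\<And>u v. C (u + v) = C u + C v" "\<And>c u. C (c *s u) = c *s C u"
  shows "(\<Sum>k\<in>UNIV. C (axis k 1) $ k) = (\<Sum>i\<in>UNIV. q (C (E i)) (E i))"
proof -
  have "C (E i) = (\<Sum>k\<in>UNIV. E i $ k *s C (axis k 1))" for i
    by (rule linear_expand_vec) (rule C)+
  then have "(\<Sum>i\<in>UNIV. q (C (E i)) (E i)) = (\<Sum>i\<in>UNIV. \<Sum>k\<in>UNIV. E i $ k * q (C (axis k 1)) (E i))"
    by (simp only: sum_left scale_left)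
  also have "\<dots> = (\<Sum>k\<in>UNIV. \<Sum>i\<in>UNIV. q (C (axis k 1)) (E i) * E i $ k)"
    by (subst sum.swap) (simp only: mult.commute)
  also have "\<dots> = (\<Sum>k\<in>UNIV. (\<Sum>i\<in>UNIV. q (C (axis k 1)) (E i) *s E i) $ k)" by simp
  also have "\<dots> = (\<Sum>k\<in>UNIV. C (axis k 1) $ k)" by (simp only: orthonormal_expansion[OF E, symmetric])
  finally show ?thesis by simp
qed

end

section \<open>Wirtinger derivatives\<close>

text \<open>The part of the derivative that is complex linear in the direction; \<open>delbar\<close> is the antilinear part.\<close>

definition del :: "(complex^'n \<Rightarrow> complex) \<Rightarrow> complex^'n \<Rightarrow> complex^'n \<Rightarrow> complex" where
  "del f x t = (ddir f x t - \<i> * ddir f x (cJ t)) / 2"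

definition delbar :: "(complex^'n \<Rightarrow> complex) \<Rightarrow> complex^'n \<Rightarrow> complex^'n \<Rightarrow> complex" where
  "delbar f x t = (ddir f x t + \<i> * ddir f x (cJ t)) / 2"

lemma ddir_split: "ddir f x t = del f x t + delbar f x t"
  by (simp add: del_def delbar_def field_simps)

lemma del_delbar_eq:
  assumes "(f has_derivative (\<lambda>t. a t + b t)) (at x)" "\<And>t. a (cJ t) = \<i> * a t" "\<And>t. b (cJ t) = - \<i> * b t"
  shows "del f x t = a t" "delbar f x t = b t"
  unfolding del_def delbar_def ddir_eq[OF assms(1)] assms(2,3) by (simp_all add: algebra_simps)

lemma linear_ddir: "f differentiable (at x) \<Longrightarrow> linear (ddir f x)"
  by (rule has_derivative_linear, rule differentiable_has_ddir)

lemma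
  assumes "f differentiable (at x)"
  shows del_scale: "del f x (c *s t) = c * del f x t"
    and delbar_scale: "delbar f x (c *s t) = cnj c * delbar f x t"
    and del_add: "del f x (s + t) = del f x s + del f x t"
    and delbar_add: "delbar f x (s + t) = delbar f x s + delbar f x t"
    and del_cJ: "del f x (cJ t) = \<i> * del f x t"
    and delbar_cJ: "delbar f x (cJ t) = - \<i> * delbar f x t"
proof -
  note l = linear_ddir[OF assms]
  have n: "ddir f x (- t) = - ddir f x t" for t by (rule linear_neg[OF l])
  have a: "ddir f x (s + t) = ddir f x s + ddir f x t" for s t by (rule linear_add[OF l])
  have r: "ddir f x (c *\<^sub>R t) = c *\<^sub>R ddir f x t" for c t by (rule linear_scale[OF l])
  show da: "del f x (s + t) = del f x s + del f x t" for s t by (simp add: del_def cJ_add a field_simps)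
  show ba: "delbar f x (s + t) = delbar f x s + delbar f x t" for s t by (simp add: delbar_def cJ_add a field_simps)
  show dJ: "del f x (cJ t) = \<i> * del f x t" for t by (simp add: del_def n field_simps)
  show bJ: "delbar f x (cJ t) = - \<i> * delbar f x t" for t by (simp add: delbar_def n field_simps)
  have dl: "linear (del f x)"
    by (rule linearI, rule da) (simp only: del_def cJ_scaleR r scaleR_conv_of_real[where 'a = complex], simp add: algebra_simps)
  show "del f x (c *s t) = c * del f x t" by (rule linear_complex_linear[OF dl dJ])
  have bl: "linear (delbar f x)"
    by (rule linearI, rule ba) (simp only: delbar_def cJ_scaleR r scaleR_conv_of_real[where 'a = complex], simp add: algebra_simps)
  show "delbar f x (c *s t) = cnj c * delbar f x t" by (rule linear_complex_antilinear[OF bl bJ])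
qed

lemma has_derivative_del:
  assumes "f differentiable (at x)" shows "(f has_derivative (\<lambda>t. del f x t + delbar f x t)) (at x)"
  using differentiable_has_ddir[OF assms] by (simp only: ddir_split[symmetric])

lemma del_cong:
  assumes "open S" "x \<in> S" "\<And>y. y \<in> S \<Longrightarrow> f y = g y"
  shows "del f x t = del g x t" "delbar f x t = delbar g x t"
proof -
  have "frechet_derivative f (at x) = frechet_derivative g (at x)" by (rule ddir_cong[OF assms])
  then show "del f x t = del g x t" "delbar f x t = delbar g x t"
    unfolding del_def delbar_def by simp_all
qed

lemma del_cnj:
  assumes "f differentiable (at x)"
  shows "del (\<lambda>y. cnj (f y)) x t = cnj (delbar f x t)" "delbar (\<lambda>y. cnj (f y)) x t = cnj (del f x t)"
proof -
  have "((\<lambda>y. cnj (f y)) has_derivative (\<lambda>t. cnj (ddir f x t))) (at x)"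
    by (rule bounded_linear.has_derivative[OF bounded_linear_cnj differentiable_has_ddir[OF assms]])
  then show "del (\<lambda>y. cnj (f y)) x t = cnj (delbar f x t)" "delbar (\<lambda>y. cnj (f y)) x t = cnj (del f x t)"
    by (simp_all add: del_def delbar_def ddir_eq)
qed

lemma
  assumes "f differentiable (at x)"
  shows del_cmult: "del (\<lambda>y. c * f y) x t = c * del f x t"
    and delbar_cmult: "delbar (\<lambda>y. c * f y) x t = c * delbar f x t"
proof -
  have "((\<lambda>y. c * f y) has_derivative (\<lambda>t. c * ddir f x t)) (at x)"
    by (intro has_derivative_mult_right differentiable_has_ddir[OF assms])
  then show "del (\<lambda>y. c * f y) x t = c * del f x t" "delbar (\<lambda>y. c * f y) x t = c * delbar f x t"
    by (simp_all add: del_def delbar_def ddir_eq algebra_simps)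
qed

lemma
  assumes "f differentiable (at x)" "g differentiable (at x)"
  shows del_plus: "del (\<lambda>y. f y + g y) x t = del f x t + del g x t"
    and delbar_plus: "delbar (\<lambda>y. f y + g y) x t = delbar f x t + delbar g x t"
proof -
  have "((\<lambda>y. f y + g y) has_derivative (\<lambda>t. ddir f x t + ddir g x t)) (at x)"
    by (intro has_derivative_add differentiable_has_ddir assms)
  then show "del (\<lambda>y. f y + g y) x t = del f x t + del g x t" "delbar (\<lambda>y. f y + g y) x t = delbar f x t + delbar g x t"
    by (simp_all add: del_def delbar_def ddir_eq field_simps)
qed

lemma smooth_on_cmult:
  fixes f :: "'a::real_normed_vector \<Rightarrow> complex"
  shows "open S \<Longrightarrow> smooth_on f S \<Longrightarrow> smooth_on (\<lambda>x. c * f x) S"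
  by (intro smooth_on_mult smooth_on_const)

lemma smooth_on_del:
  assumes "open S" "smooth_on f S"
  shows "smooth_on (\<lambda>x. del f x t) S" "smooth_on (\<lambda>x. delbar f x t) S"
proof -
  have "smooth_on (\<lambda>x. (1/2) * (ddir f x t + (-\<i>) * ddir f x (cJ t))) S"
    "smooth_on (\<lambda>x. (1/2) * (ddir f x t + \<i> * ddir f x (cJ t))) S"
    by (intro smooth_on_cmult smooth_on_add smooth_on_ddir assms)+
  then show "smooth_on (\<lambda>x. del f x t) S" "smooth_on (\<lambda>x. delbar f x t) S"
    by (simp_all add: del_def[abs_def] delbar_def[abs_def])
qed

lemma
  assumes S: "open S" "x \<in> S" and f: "smooth_on f S"
  shows delbar_del_commute: "delbar (\<lambda>y. del f y u) x v = del (\<lambda>y. delbar f y v) x u"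
    and del_del_commute: "del (\<lambda>y. del f y u) x v = del (\<lambda>y. del f y v) x u"
proof -
  have d: "(\<lambda>y. ddir f y t) differentiable (at x)" for t
    by (rule smooth_on_differentiable[OF smooth_on_ddir[OF f] S(2)])
  have c: "ddir (\<lambda>y. ddir f y s) x t = ddir (\<lambda>y. ddir f y t) x s" for s t
    by (rule ddir_commute[OF S smooth_on_differentiable[OF f] d d])
  have "((\<lambda>y. (ddir f y s - \<i> * ddir f y (cJ s)) / 2) has_derivative
      (\<lambda>t. (ddir (\<lambda>y. ddir f y s) x t - \<i> * ddir (\<lambda>y. ddir f y (cJ s)) x t) / 2)) (at x)" for s
    unfolding divide_inverse by (intro has_derivative_mult_left has_derivative_diff has_derivative_mult_right differentiable_has_ddir d)
  then have 1: "ddir (\<lambda>y. del f y s) x t = (ddir (\<lambda>y. ddir f y s) x t - \<i> * ddir (\<lambda>y. ddir f y (cJ s)) x t) / 2" for s t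
    unfolding del_def by (rule ddir_eq)
  have "((\<lambda>y. (ddir f y s + \<i> * ddir f y (cJ s)) / 2) has_derivative
      (\<lambda>t. (ddir (\<lambda>y. ddir f y s) x t + \<i> * ddir (\<lambda>y. ddir f y (cJ s)) x t) / 2)) (at x)" for s
    unfolding divide_inverse by (intro has_derivative_mult_left has_derivative_add has_derivative_mult_right differentiable_has_ddir d)
  then have 2: "ddir (\<lambda>y. delbar f y s) x t = (ddir (\<lambda>y. ddir f y s) x t + \<i> * ddir (\<lambda>y. ddir f y (cJ s)) x t) / 2" for s t
    unfolding delbar_def by (rule ddir_eq)
  show "delbar (\<lambda>y. del f y u) x v = del (\<lambda>y. delbar f y v) x u"
    unfolding delbar_def[of "\<lambda>y. del f y u"] del_def[of "\<lambda>y. delbar f y v"] 1 2 c[of u] c[of "cJ u"] by (simp add: field_simps)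
  show "del (\<lambda>y. del f y u) x v = del (\<lambda>y. del f y v) x u"
    unfolding del_def[of "\<lambda>y. del f y u"] del_def[of "\<lambda>y. del f y v"] 1 c[of u] c[of "cJ u"] by (simp add: field_simps)
qed

text \<open>The components of a tensor in constant directions determine its derivative along moving vector
  fields. All product rules for metrics and connections below are instances.\<close>

lemma has_derivative_open_preimage:
  assumes "(F has_derivative F') (at p)" "open U" "F p \<in> U"
  shows "\<exists>S. open S \<and> p \<in> S \<and> (\<forall>x\<in>S. F x \<in> U)"
  by (rule continuous_at_open[THEN iffD1, rule_format, OF has_derivative_continuous[OF assms(1)]])
    (use assms in auto)

lemma linear_field_has_derivative:
  fixes T :: "complex^'n \<Rightarrow> complex^'m \<Rightarrow> complex"
  assumes U: "open U" "F p \<in> U"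
    and T: "\<And>y u. y \<in> U \<Longrightarrow> T y u = (\<Sum>i\<in>UNIV. u $ i * T y (axis i 1))"
    and dT: "\<And>i. (\<lambda>y. T y (axis i 1)) differentiable (at (F p))"
    and F: "(F has_derivative F') (at p)" and V: "(V has_derivative V') (at p)"
  shows "((\<lambda>p. T (F p) (V p)) has_derivative (\<lambda>t. ddir (\<lambda>y. T y (V p)) (F p) (F' t) + T (F p) (V' t))) (at p)"
proof -
  obtain S where S: "open S" "p \<in> S" "\<And>p. p \<in> S \<Longrightarrow> F p \<in> U"
    using has_derivative_open_preimage[OF F U] by blast
  have V_i: "((\<lambda>p. V p $ i) has_derivative (\<lambda>t. V' t $ i)) (at p)" for i
    by (rule bounded_linear.has_derivative[OF bounded_linear_vec_nth V])
  have "((\<lambda>y. T y (axis i 1)) has_derivative ddir (\<lambda>y. T y (axis i 1)) (F p)) (at (F p))" for i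
    by (rule differentiable_has_ddir[OF dT])
  from has_derivative_compose[OF F this]
  have T_i: "((\<lambda>p. T (F p) (axis i 1)) has_derivative (\<lambda>t. ddir (\<lambda>y. T y (axis i 1)) (F p) (F' t))) (at p)" for i .
  have "((\<lambda>y. \<Sum>i\<in>UNIV. V p $ i * T y (axis i 1)) has_derivative
      (\<lambda>t. \<Sum>i\<in>UNIV. V p $ i * ddir (\<lambda>y. T y (axis i 1)) (F p) t)) (at (F p))"
    by (intro has_derivative_sum has_derivative_mult_right differentiable_has_ddir dT)
  then have "((\<lambda>y. T y (V p)) has_derivative (\<lambda>t. \<Sum>i\<in>UNIV. V p $ i * ddir (\<lambda>y. T y (axis i 1)) (F p) t)) (at (F p))"
    by (rule has_derivative_transform_within_open[OF _ U]) (simp only: T[symmetric])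
  then have dd: "ddir (\<lambda>y. T y (V p)) (F p) t = (\<Sum>i\<in>UNIV. V p $ i * ddir (\<lambda>y. T y (axis i 1)) (F p) t)" for t
    by (rule ddir_eq)
  have "((\<lambda>p. \<Sum>i\<in>UNIV. V p $ i * T (F p) (axis i 1)) has_derivative
      (\<lambda>t. \<Sum>i\<in>UNIV. V p $ i * ddir (\<lambda>y. T y (axis i 1)) (F p) (F' t) + V' t $ i * T (F p) (axis i 1))) (at p)"
    by (intro has_derivative_sum has_derivative_mult V_i T_i)
  then have "((\<lambda>p. \<Sum>i\<in>UNIV. V p $ i * T (F p) (axis i 1)) has_derivative
      (\<lambda>t. ddir (\<lambda>y. T y (V p)) (F p) (F' t) + T (F p) (V' t))) (at p)"
    by (simp only: sum.distrib dd T[OF U(2), of "V' _"])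
  then show ?thesis
    by (rule has_derivative_transform_within_open[OF _ S(1,2)]) (simp only: T[OF S(3), symmetric])
qed

lemma bilinear_field_has_derivative:
  fixes B :: "complex^'n \<Rightarrow> complex^'m \<Rightarrow> complex^'k \<Rightarrow> complex"
  assumes U: "open U" "F p \<in> U"
    and B1: "\<And>y u v. y \<in> U \<Longrightarrow> B y u v = (\<Sum>i\<in>UNIV. u $ i * B y (axis i 1) v)"
    and B2: "\<And>y u v. y \<in> U \<Longrightarrow> B y u v = (\<Sum>j\<in>UNIV. v $ j * B y u (axis j 1))"
    and dB: "\<And>i j. (\<lambda>y. B y (axis i 1) (axis j 1)) differentiable (at (F p))"
    and F: "(F has_derivative F') (at p)" and V: "(V has_derivative V') (at p)" and Z: "(Z has_derivative Z') (at p)"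
  shows "((\<lambda>p. B (F p) (V p) (Z p)) has_derivative
    (\<lambda>t. ddir (\<lambda>y. B y (V p) (Z p)) (F p) (F' t) + B (F p) (V' t) (Z p) + B (F p) (V p) (Z' t))) (at p)"
proof -
  obtain S where S: "open S" "p \<in> S" "\<And>p. p \<in> S \<Longrightarrow> F p \<in> U"
    using has_derivative_open_preimage[OF F U] by blast
  have Z_j: "((\<lambda>p. Z p $ j) has_derivative (\<lambda>t. Z' t $ j)) (at p)" for j
    by (rule bounded_linear.has_derivative[OF bounded_linear_vec_nth Z])
  have B_j: "((\<lambda>p. B (F p) (V p) (axis j 1)) has_derivative
      (\<lambda>t. ddir (\<lambda>y. B y (V p) (axis j 1)) (F p) (F' t) + B (F p) (V' t) (axis j 1))) (at p)" for j
    by (rule linear_field_has_derivative[where U = U and T = "\<lambda>y u. B y u (axis j 1)"]) (fact U B1 dB F V)+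
  have dBj: "(\<lambda>y. B y (V p) (axis j 1)) differentiable (at (F p))" for j
  proof (rule differentiable_cong_open[OF U])
    show "(\<lambda>y. \<Sum>i\<in>UNIV. V p $ i * B y (axis i 1) (axis j 1)) differentiable (at (F p))"
      by (intro differentiable_sum differentiable_mult differentiable_const dB ballI finite)
  qed (simp only: B1[symmetric])
  have "((\<lambda>y. \<Sum>j\<in>UNIV. Z p $ j * B y (V p) (axis j 1)) has_derivative
      (\<lambda>t. \<Sum>j\<in>UNIV. Z p $ j * ddir (\<lambda>y. B y (V p) (axis j 1)) (F p) t)) (at (F p))"
    by (intro has_derivative_sum has_derivative_mult_right differentiable_has_ddir dBj)
  then have "((\<lambda>y. B y (V p) (Z p)) has_derivative (\<lambda>t. \<Sum>j\<in>UNIV. Z p $ j * ddir (\<lambda>y. B y (V p) (axis j 1)) (F p) t)) (at (F p))"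
    by (rule has_derivative_transform_within_open[OF _ U]) (simp only: B2[symmetric])
  then have dd: "ddir (\<lambda>y. B y (V p) (Z p)) (F p) t = (\<Sum>j\<in>UNIV. Z p $ j * ddir (\<lambda>y. B y (V p) (axis j 1)) (F p) t)" for t
    by (rule ddir_eq)
  have "((\<lambda>p. \<Sum>j\<in>UNIV. Z p $ j * B (F p) (V p) (axis j 1)) has_derivative
      (\<lambda>t. \<Sum>j\<in>UNIV. Z p $ j * (ddir (\<lambda>y. B y (V p) (axis j 1)) (F p) (F' t) + B (F p) (V' t) (axis j 1))
          + Z' t $ j * B (F p) (V p) (axis j 1))) (at p)"
    by (intro has_derivative_sum has_derivative_mult Z_j B_j)
  then have "((\<lambda>p. \<Sum>j\<in>UNIV. Z p $ j * B (F p) (V p) (axis j 1)) has_derivative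
      (\<lambda>t. ddir (\<lambda>y. B y (V p) (Z p)) (F p) (F' t) + B (F p) (V' t) (Z p) + B (F p) (V p) (Z' t))) (at p)"
    by (simp only: sum.distrib distrib_left dd B2[OF U(2), of "V' _" "Z p"] B2[OF U(2), of "V p" "Z' _"])
  then show ?thesis
    by (rule has_derivative_transform_within_open[OF _ S(1,2)]) (simp only: B2[OF S(3), symmetric])
qed

section \<open>The connection of a Kaehler metric\<close>

text \<open>Cramer's rule makes the vector that represents a functional an explicit rational expression in the
  components of the metric, whence the smoothness of the connection.\<close>

lemma (in hermitian_product) representation:
  assumes add: "\<And>u v. \<phi> (u + v) = \<phi> u + \<phi> v" and scale: "\<And>c u. \<phi> (c *s u) = cnj c * \<phi> u"
  shows "q (\<chi> k. det (\<chi> i j. if j = k then \<phi> (axis i 1) else q (axis j 1) (axis i 1)) /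
      det (\<chi> i j. q (axis j 1) (axis i 1))) w = \<phi> w" (is "q ?x w = _")
proof -
  define A :: "complex^'n^'n" where "A = (\<chi> i j. q (axis j 1) (axis i 1))"
  define b :: "complex^'n" where "b = (\<chi> i. \<phi> (axis i 1))"
  have "A = transpose gram" by (simp add: A_def gram_def transpose_def vec_eq_iff)
  then have "det A \<noteq> 0" using det_gram_nonzero by simp
  moreover have "?x = (\<chi> k. det (\<chi> i j. if j = k then b $ i else A $ i $ j) / det A)"
    by (simp add: A_def b_def cong: if_cong)
  ultimately have "A *v ?x = b" using cramer by blast
  then have "(A *v ?x) $ i = b $ i" for i by simp
  moreover have "(A *v ?x) $ i = q ?x (axis i 1)" for i
    unfolding expand_left[of ?x] by (simp only: A_def matrix_vector_mult_def vec_lambda_beta mult.commute)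
  ultimately have i: "q ?x (axis i 1) = \<phi> (axis i 1)" for i by (simp only: b_def vec_lambda_beta)
  have "cnj (\<phi> w) = (\<Sum>k\<in>UNIV. w $ k * cnj (\<phi> (axis k 1)))"
    by (rule linear_expand) (simp_all add: add scale)
  from arg_cong[OF this, of cnj] have "\<phi> w = (\<Sum>k\<in>UNIV. cnj (w $ k) * \<phi> (axis k 1))" by simp
  then show ?thesis unfolding expand_right[of ?x w] i by simp
qed

lemma smooth_on_det:
  assumes "open S" "\<And>i j. smooth_on (\<lambda>x. A x $ i $ j) S"
  shows "smooth_on (\<lambda>x. det (A x) :: complex) S"
  unfolding det_def
  by (intro smooth_on_sum smooth_on_mult smooth_on_const smooth_on_prod assms)

locale kaehler_domain =
  fixes U :: "(complex^'n) set" and h :: "complex^'n \<Rightarrow> complex^'n \<Rightarrow> complex^'n \<Rightarrow> real"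
  assumes open_U: "open U"
    and smooth_h: "\<And>u v. smooth_on (\<lambda>x. h x u v) U"
    and bilinear_h: "\<And>x. x \<in> U \<Longrightarrow> bilinear (h x)"
    and h_commute: "\<And>x u v. x \<in> U \<Longrightarrow> h x u v = h x v u"
    and h_pos: "\<And>x u. x \<in> U \<Longrightarrow> u \<noteq> 0 \<Longrightarrow> h x u u > 0"
    and h_cJ: "\<And>x u v. x \<in> U \<Longrightarrow> h x (cJ u) (cJ v) = h x u v"
    and closed: "\<And>x u v w. x \<in> U \<Longrightarrow> ddir (\<lambda>y. h y (cJ v) w) x u + ddir (\<lambda>y. h y (cJ w) u) x v
                 + ddir (\<lambda>y. h y (cJ u) v) x w = 0"
begin

abbreviation \<Gamma> where "\<Gamma> \<equiv> christoffel h"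

text \<open>The Hermitian form whose real part is the metric. It is linear in the first argument because
  \<open>h(u, Jv) = - h(Ju, v)\<close>.\<close>

definition q :: "complex^'n \<Rightarrow> complex^'n \<Rightarrow> complex^'n \<Rightarrow> complex" where
  "q x u v = Complex (h x u v) (h x u (cJ v))"

lemma
  assumes "x \<in> U"
  shows h_add_left: "h x (u + v) w = h x u w + h x v w"
    and h_scale_left: "h x (r *\<^sub>R u) w = r * h x u w" and h_minus_left: "h x (- u) w = - h x u w"
    and h_minus_right: "h x w (- u) = - h x w u"
  using bilinear_ladd[OF bilinear_h[OF assms]]
    bilinear_lmul[OF bilinear_h[OF assms]] bilinear_lneg[OF bilinear_h[OF assms]] bilinear_rneg[OF bilinear_h[OF assms]]
  by auto

lemma h_cJ_left: "x \<in> U \<Longrightarrow> h x (cJ u) v = - h x u (cJ v)"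
  using h_cJ[of x u "cJ v"] by (simp add: h_minus_right)

lemma hermitian: "x \<in> U \<Longrightarrow> hermitian_product (q x)"
proof
  fix u v w and c :: complex assume x: "x \<in> U"
  show a: "q x (u + v) w = q x u w + q x v w" for u v w using x by (simp add: q_def h_add_left complex_eq_iff)
  have "linear (\<lambda>u. q x u w)"
    by (rule linearI) (use x in \<open>simp_all add: a\<close>, simp add: q_def h_scale_left complex_eq_iff)
  moreover have "q x (cJ u) w = \<i> * q x u w" for u
    using x by (simp add: q_def h_cJ_left h_minus_right complex_eq_iff)
  ultimately show "q x (c *s u) w = c * q x u w" by (rule linear_complex_linear)
  show "cnj (q x u v) = q x v u"
    using x h_commute[OF x, of u v] h_commute[OF x, of u "cJ v"] h_cJ_left[OF x, of v u] by (simp add: q_def complex_eq_iff)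
  show "0 < Re (q x u u)" if "u \<noteq> 0" using h_pos[OF x that] by (simp add: q_def)
qed

lemma sesquilinear_q: "x \<in> U \<Longrightarrow> sesquilinear (q x)"
  using hermitian by (simp add: hermitian_product_def)

lemma smooth_q: "smooth_on (\<lambda>x. q x u v) U"
proof -
  have "smooth_on (\<lambda>x. of_real (h x u v) + \<i> * of_real (h x u (cJ v))) U"
    by (intro smooth_on_add smooth_on_mult smooth_on_const smooth_on_bounded_linear[OF open_U bounded_linear_of_real] smooth_h open_U)
  then show ?thesis by (simp only: q_def Complex_eq)
qed

lemma q_differentiable: "x \<in> U \<Longrightarrow> (\<lambda>x. q x u v) differentiable (at x)"
  by (rule smooth_on_differentiable[OF smooth_q])

lemma ddir_q:
  assumes "x \<in> U"
  shows "ddir (\<lambda>y. q y u v) x t = Complex (ddir (\<lambda>y. h y u v) x t) (ddir (\<lambda>y. h y u (cJ v)) x t)"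
proof -
  note d = smooth_on_has_ddir[OF smooth_h assms]
  have "((\<lambda>x. of_real (h x u v) + \<i> * of_real (h x u (cJ v))) has_derivative
      (\<lambda>t. of_real (ddir (\<lambda>y. h y u v) x t) + \<i> * of_real (ddir (\<lambda>y. h y u (cJ v)) x t))) (at x)"
    by (intro has_derivative_add has_derivative_mult_right has_derivative_of_real d)
  then show ?thesis by (simp only: q_def Complex_eq ddir_eq)
qed

text \<open>Closedness of the Kaehler form turns the term \<open>D\<^sub>J\<^sub>u Im q(v, w)\<close> of the derivative of type \<open>(1, 0)\<close> into the two
  remaining terms of the Koszul formula: the Levi-Civita connection is the Chern connection.\<close>

lemma christoffel_koszul:
  assumes x: "x \<in> U"
  shows q_christoffel: "q x (\<Gamma> x u v) w = del (\<lambda>y. q y v w) x u"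
    and koszul: "2 * h x (\<Gamma> x u v) w =
      ddir (\<lambda>y. h y v w) x u + ddir (\<lambda>y. h y u w) x v - ddir (\<lambda>y. h y u v) x w"
proof -
  interpret X: hermitian_product "q x" by (rule hermitian[OF x])
  define \<phi> where "\<phi> w = del (\<lambda>y. q y v w) x u" for w
  have "\<phi> (w + w') = \<phi> w + \<phi> w'" for w w'
  proof -
    have "\<phi> (w + w') = del (\<lambda>y. q y v w + q y v w') x u"
      unfolding \<phi>_def by (rule del_cong(1)[OF open_U x]) (simp add: sesquilinear.add_right[OF sesquilinear_q])
    then show ?thesis by (simp add: \<phi>_def del_plus q_differentiable x)
  qed
  moreover have "\<phi> (c *s w) = cnj c * \<phi> w" for c w
  proof -
    have "\<phi> (c *s w) = del (\<lambda>y. cnj c * q y v w) x u"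
      unfolding \<phi>_def by (rule del_cong(1)[OF open_U x]) (simp add: sesquilinear.scale_right[OF sesquilinear_q])
    then show ?thesis by (simp add: \<phi>_def del_cmult q_differentiable x)
  qed
  ultimately have "\<exists>z. \<forall>w. q x z w = \<phi> w" using X.representation[of \<phi>] by blast
  then obtain z where z: "\<And>w. q x z w = \<phi> w" by blast
  have neg: "ddir (\<lambda>y. - h y v w) x t = - ddir (\<lambda>y. h y v w) x t" for v w t
    by (intro ddir_eq has_derivative_minus smooth_on_has_ddir[OF smooth_h x])
  have k: "2 * h x z w = ddir (\<lambda>y. h y v w) x u + ddir (\<lambda>y. h y u w) x v - ddir (\<lambda>y. h y u v) x w" for w
  proof -
    have "2 * h x z w = 2 * Re (q x z w)" by (simp add: q_def)
    also have "\<dots> = ddir (\<lambda>y. h y v w) x u + ddir (\<lambda>y. h y v (cJ w)) x (cJ u)"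
      unfolding z \<phi>_def by (simp add: del_def ddir_q[OF x])
    also have "ddir (\<lambda>y. h y v (cJ w)) x (cJ u) = - ddir (\<lambda>y. h y (cJ v) w) x (cJ u)"
      unfolding neg[symmetric] by (rule fun_cong[OF ddir_cong[OF open_U x]]) (simp add: h_cJ_left)
    also have "\<dots> = ddir (\<lambda>y. h y (cJ w) (cJ u)) x v + ddir (\<lambda>y. h y (cJ (cJ u)) v) x w"
      using closed[OF x, of v w "cJ u"] by simp
    also have "ddir (\<lambda>y. h y (cJ w) (cJ u)) x v = ddir (\<lambda>y. h y u w) x v"
      by (rule fun_cong[OF ddir_cong[OF open_U x]]) (simp add: h_cJ, rule h_commute)
    also have "ddir (\<lambda>y. h y (cJ (cJ u)) v) x w = - ddir (\<lambda>y. h y u v) x w"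
      unfolding neg[symmetric] by (rule fun_cong[OF ddir_cong[OF open_U x]]) (simp add: h_minus_left)
    finally show ?thesis by simp
  qed
  have "z' = z" if "\<forall>w. 2 * h x z' w = ddir (\<lambda>y. h y v w) x u + ddir (\<lambda>y. h y u w) x v - ddir (\<lambda>y. h y u v) x w" for z'
  proof (rule ccontr)
    assume "z' \<noteq> z"
    then have "h x (z' - z) (z' - z) > 0" using h_pos[OF x] by simp
    moreover have "h x (z' - z) w = h x z' w - h x z w" for w
      using h_add_left[OF x, of z' "-z" w] by (simp add: h_minus_left[OF x])
    moreover have "h x z' w = h x z w" for w using that[rule_format, of w] k[of w] by simp
    ultimately show False by simp
  qed
  then have "\<Gamma> x u v = z" unfolding christoffel_def using k by (intro the_equality) auto
  then show "q x (\<Gamma> x u v) w = del (\<lambda>y. q y v w) x u"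
    and "2 * h x (\<Gamma> x u v) w = ddir (\<lambda>y. h y v w) x u + ddir (\<lambda>y. h y u w) x v - ddir (\<lambda>y. h y u v) x w"
    using z k by (simp_all add: \<phi>_def)
qed

lemma christoffel_commute:
  assumes x: "x \<in> U" shows "\<Gamma> x u v = \<Gamma> x v u"
proof -
  interpret X: hermitian_product "q x" by (rule hermitian[OF x])
  have "ddir (\<lambda>y. h y u v) x = ddir (\<lambda>y. h y v u) x"
    by (rule ddir_cong[OF open_U x]) (rule h_commute)
  then have "h x (\<Gamma> x u v) w = h x (\<Gamma> x v u) w" for w
    using koszul[OF x, of u v w] koszul[OF x, of v u w] by simp
  then show ?thesis by (intro X.eqI) (simp add: q_def)
qed

lemma
  assumes x: "x \<in> U"
  shows christoffel_add_left: "\<Gamma> x (u + v) w = \<Gamma> x u w + \<Gamma> x v w"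
    and christoffel_add_right: "\<Gamma> x w (u + v) = \<Gamma> x w u + \<Gamma> x w v"
    and christoffel_scale_left: "\<Gamma> x (c *s u) w = c *s \<Gamma> x u w"
    and christoffel_scale_right: "\<Gamma> x w (c *s u) = c *s \<Gamma> x w u"
proof -
  interpret X: hermitian_product "q x" by (rule hermitian[OF x])
  show a: "\<Gamma> x (u + v) w = \<Gamma> x u w + \<Gamma> x v w" for u v w
    by (rule X.eqI) (simp add: X.add_left q_christoffel[OF x] del_add q_differentiable[OF x])
  show b: "\<Gamma> x (c *s u) w = c *s \<Gamma> x u w" for u w
    by (rule X.eqI) (simp add: X.scale_left q_christoffel[OF x] del_scale q_differentiable[OF x])
  show "\<Gamma> x w (u + v) = \<Gamma> x w u + \<Gamma> x w v" using a[of u v w] by (simp only: christoffel_commute[OF x, of w])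
  show "\<Gamma> x w (c *s u) = c *s \<Gamma> x w u" using b[of u w] by (simp only: christoffel_commute[OF x, of w])
qed

lemma
  assumes x: "x \<in> U"
  shows del_q: "del (\<lambda>y. q y v w) x t = q x (\<Gamma> x t v) w"
    and delbar_q: "delbar (\<lambda>y. q y v w) x t = q x v (\<Gamma> x t w)"
    and ddir_q_christoffel: "ddir (\<lambda>y. q y v w) x t = q x (\<Gamma> x t v) w + q x v (\<Gamma> x t w)"
proof -
  show 1: "del (\<lambda>y. q y v w) x t = q x (\<Gamma> x t v) w" for v w by (simp add: q_christoffel[OF x])
  have "delbar (\<lambda>y. q y v w) x t = delbar (\<lambda>y. cnj (q y w v)) x t"
    by (rule del_cong(2)[OF open_U x]) (simp add: sesquilinear.cnj[OF sesquilinear_q])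
  also have "\<dots> = cnj (q x (\<Gamma> x t w) v)" by (simp add: del_cnj q_differentiable[OF x] 1)
  finally show 2: "delbar (\<lambda>y. q y v w) x t = q x v (\<Gamma> x t w)" by (simp add: sesquilinear.cnj[OF sesquilinear_q[OF x]])
  show "ddir (\<lambda>y. q y v w) x t = q x (\<Gamma> x t v) w + q x v (\<Gamma> x t w)" by (simp only: ddir_split 1 2)
qed

lemma smooth_christoffel: "smooth_on (\<lambda>x. \<Gamma> x u v $ k) U"
proof -
  define A where "A x = (\<chi> i j. if j = k then del (\<lambda>y. q y v (axis i 1)) x u else q x (axis j 1) (axis i 1))" for x
  define B where "B x = (\<chi> i j. q x (axis j 1) (axis i 1))" for x
  have B: "det (B x) \<noteq> 0" if "x \<in> U" for x
  proof -
    interpret X: hermitian_product "q x" by (rule hermitian[OF that])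
    have "B x = transpose X.gram" by (simp add: B_def X.gram_def transpose_def vec_eq_iff)
    then show ?thesis using X.det_gram_nonzero by simp
  qed
  have "smooth_on (\<lambda>x. A x $ i $ j) U" for i j
    by (cases "j = k") (simp_all add: A_def smooth_q smooth_on_del(1)[OF open_U smooth_q])
  then have "smooth_on (\<lambda>x. det (A x)) U" by (rule smooth_on_det[OF open_U])
  moreover have "smooth_on (\<lambda>x. det (B x)) U"
    by (rule smooth_on_det[OF open_U]) (simp add: B_def smooth_q)
  ultimately have "smooth_on (\<lambda>x. det (A x) / det (B x)) U" using B by (intro smooth_on_divide open_U)
  moreover have "det (A x) / det (B x) = \<Gamma> x u v $ k" if x: "x \<in> U" for x
  proof -
    interpret X: hermitian_product "q x" by (rule hermitian[OF x])
    have "q x (\<Gamma> x u v) w = q x (\<chi> k. det (\<chi> i j. if j = k then q x (\<Gamma> x u v) (axis i 1) else q x (axis j 1) (axis i 1)) /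
      det (\<chi> i j. q x (axis j 1) (axis i 1))) w" for w
      by (rule X.representation[symmetric]) (simp_all add: X.add_right X.scale_right)
    then have "\<Gamma> x u v = (\<chi> k. det (\<chi> i j. if j = k then q x (\<Gamma> x u v) (axis i 1) else q x (axis j 1) (axis i 1)) /
      det (\<chi> i j. q x (axis j 1) (axis i 1)))" by (rule X.eqI)
    then have "\<Gamma> x u v $ k = det (\<chi> i j. if j = k then q x (\<Gamma> x u v) (axis i 1) else q x (axis j 1) (axis i 1)) /
      det (\<chi> i j. q x (axis j 1) (axis i 1))" by (metis (lifting) vec_lambda_beta)
    then show ?thesis by (simp only: A_def B_def q_christoffel[OF x])
  qed
  ultimately show ?thesis by (rule smooth_on_cong[OF open_U])
qed

lemma christoffel_differentiable: "x \<in> U \<Longrightarrow> (\<lambda>x. \<Gamma> x u v $ k) differentiable (at x)"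
  by (rule smooth_on_differentiable[OF smooth_christoffel])

text \<open>The version for vector fields along a map serves for fields on the domain itself, for fields
  along an immersion and for fields along a complex line.\<close>

lemma metric_compatible:
  assumes Fp: "F p \<in> U"
    and F: "(F has_derivative F') (at p)" and V: "(V has_derivative V') (at p)" and Z: "(Z has_derivative Z') (at p)"
  shows "((\<lambda>p. q (F p) (V p) (Z p)) has_derivative
    (\<lambda>t. q (F p) (\<Gamma> (F p) (F' t) (V p) + V' t) (Z p) + q (F p) (V p) (\<Gamma> (F p) (F' t) (Z p) + Z' t))) (at p)"
proof -
  interpret X: hermitian_product "q (F p)" by (rule hermitian[OF Fp])
  define c where "c v = (\<chi> j. cnj (v $ j))" for v :: "complex^'n"
  have cc: "c (c v) = v" for v by (simp add: c_def vec_eq_iff)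
  define B where "B y u v = q y u (c v)" for y u v
  have axis: "c (axis j 1) = axis j 1" for j by (simp add: c_def vec_eq_iff axis_def)
  have Zc: "((\<lambda>p. c (Z p)) has_derivative (\<lambda>t. c (Z' t))) (at p)"
  proof (rule has_derivative_vec)
    fix k
    have "((\<lambda>p. cnj (Z p $ k)) has_derivative (\<lambda>t. cnj (Z' t $ k))) (at p)"
      by (rule bounded_linear.has_derivative[OF bounded_linear_cnj bounded_linear.has_derivative[OF bounded_linear_vec_nth Z]])
    then show "((\<lambda>x. c (Z x) $ k) has_derivative (\<lambda>v. c (Z' v) $ k)) (at p)" by (simp add: c_def)
  qed
  have "((\<lambda>p. B (F p) (V p) (c (Z p))) has_derivative
    (\<lambda>t. ddir (\<lambda>y. B y (V p) (c (Z p))) (F p) (F' t) + B (F p) (V' t) (c (Z p)) + B (F p) (V p) (c (Z' t)))) (at p)"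
  proof (rule bilinear_field_has_derivative[OF open_U Fp _ _ _ F V Zc])
    fix y u v assume y: "y \<in> U"
    interpret Y: hermitian_product "q y" by (rule hermitian[OF y])
    show "B y u v = (\<Sum>i\<in>UNIV. u $ i * B y (axis i 1) v)" unfolding B_def by (rule Y.expand_left)
    show "B y u v = (\<Sum>j\<in>UNIV. v $ j * B y u (axis j 1))"
      unfolding B_def axis by (subst Y.expand_right) (simp add: c_def)
  next
    show "(\<lambda>y. B y (axis i 1) (axis j 1)) differentiable (at (F p))" for i j
      unfolding B_def by (rule q_differentiable[OF Fp])
  qed
  then show ?thesis
    unfolding B_def cc ddir_q_christoffel[OF Fp] X.add_left X.add_right by (simp add: add_ac)
qed

text \<open>The curvature: \<open>cv x v w u\<close> is \<open>(\<partial>bar\<^sub>u \<Gamma>)(v,w)\<close>.\<close>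

definition cv :: "complex^'n \<Rightarrow> complex^'n \<Rightarrow> complex^'n \<Rightarrow> complex^'n \<Rightarrow> complex^'n" where
  "cv x v w u = (\<chi> k. delbar (\<lambda>y. \<Gamma> y v w $ k) x u)"

definition dv :: "complex^'n \<Rightarrow> complex^'n \<Rightarrow> complex^'n \<Rightarrow> complex^'n \<Rightarrow> complex^'n" where
  "dv x v w u = (\<chi> k. del (\<lambda>y. \<Gamma> y v w $ k) x u)"

lemma christoffel_has_derivative:
  assumes "x \<in> U" shows "((\<lambda>x. \<Gamma> x v w) has_derivative (\<lambda>t. dv x v w t + cv x v w t)) (at x)"
  by (rule has_derivative_vec)
    (simp add: cv_def dv_def has_derivative_del christoffel_differentiable assms)

lemma
  assumes x: "x \<in> U"
  shows cv_cJ: "cv x v w (cJ u) = - cJ (cv x v w u)" and dv_cJ: "dv x v w (cJ u) = cJ (dv x v w u)"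
    and cv_scale: "cv x v w (c *s u) = cnj c *s cv x v w u" and cv_add: "cv x v w (u + u') = cv x v w u + cv x v w u'"
  by (simp_all add: cv_def dv_def vec_eq_iff del_cJ delbar_cJ delbar_scale delbar_add christoffel_differentiable x)

lemma
  assumes x: "x \<in> U"
  shows del_q_christoffel: "del (\<lambda>y. q y (\<Gamma> y v w) z) x u = q x (dv x v w u + \<Gamma> x u (\<Gamma> x v w)) z"
    and delbar_q_christoffel: "delbar (\<lambda>y. q y (\<Gamma> y v w) z) x u = q x (cv x v w u) z + q x (\<Gamma> x v w) (\<Gamma> x u z)"
proof -
  interpret X: hermitian_product "q x" by (rule hermitian[OF x])
  have scJ: "q x (cJ a) b = \<i> * q x a b" "q x a (cJ b) = - \<i> * q x a b" "\<Gamma> x (cJ a) b = cJ (\<Gamma> x a b)" for a b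
    by (simp_all add: cJ_def X.scale_left X.scale_right christoffel_scale_left[OF x])
  have "((\<lambda>y. q y (\<Gamma> y v w) z) has_derivative
      (\<lambda>t. q x (\<Gamma> x t (\<Gamma> x v w) + (dv x v w t + cv x v w t)) z + q x (\<Gamma> x v w) (\<Gamma> x t z + 0))) (at x)"
    by (rule metric_compatible[where F = "\<lambda>x. x" and p = x, OF x has_derivative_ident christoffel_has_derivative[OF x] has_derivative_const])
  then have d: "((\<lambda>y. q y (\<Gamma> y v w) z) has_derivative
      (\<lambda>t. q x (dv x v w t + \<Gamma> x t (\<Gamma> x v w)) z + (q x (cv x v w t) z + q x (\<Gamma> x v w) (\<Gamma> x t z)))) (at x)"
    by (simp add: X.add_left add_ac)
  show "del (\<lambda>y. q y (\<Gamma> y v w) z) x u = q x (dv x v w u + \<Gamma> x u (\<Gamma> x v w)) z"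
    "delbar (\<lambda>y. q y (\<Gamma> y v w) z) x u = q x (cv x v w u) z + q x (\<Gamma> x v w) (\<Gamma> x u z)"
    by (rule del_delbar_eq[OF d]; simp add: X.add_left X.minus_left scJ cv_cJ[OF x] dv_cJ[OF x] algebra_simps)+
qed

end

section \<open>Curvature of Kaehler metrics\<close>

text \<open>The form is quartic in \<open>a + s b\<close>. Real and imaginary multiples \<open>s\<close> separate the terms that are linear
  in \<open>s\<close> from those that are antilinear, and three real values separate the orders in \<open>|s|\<close>.\<close>

lemma curvature_form_polarisation:
  fixes S :: "complex^'n \<Rightarrow> complex^'n \<Rightarrow> complex^'n \<Rightarrow> complex^'n \<Rightarrow> complex"
  assumes add1: "\<And>a a' b c d. S (a + a') b c d = S a b c d + S a' b c d"
    and scale1: "\<And>s a b c d. S (s *s a) b c d = s * S a b c d"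
    and sym1: "\<And>a b c d. S a b c d = S b a c d"
    and add3: "\<And>a b c c' d. S a b (c + c') d = S a b c d + S a b c' d"
    and scale3: "\<And>s a b c d. S a b (s *s c) d = cnj s * S a b c d"
    and sym3: "\<And>a b c d. S a b c d = S a b d c"
    and zero: "\<And>a. S a a a a = 0"
  shows "S a b c d = 0"
proof -
  have add2: "S a (b + b') c d = S a b c d + S a b' c d" for a b b' c d
    using add1[of b b' a c d] by (simp only: sym1[of a])
  have add4: "S a b c (d + d') = S a b c d + S a b c d'" for a b c d d'
    using add3[of a b d d' c] by (simp only: sym3[of a b c])
  have scale2: "S a (s *s b) c d = s * S a b c d" for s a b c d
    using scale1[of s b a c d] by (simp only: sym1[of a])
  have scale4: "S a b c (s *s d) = cnj s * S a b c d" for s a b c d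
    using scale3[of a b s d c] by (simp only: sym3[of a b c])
  note rules = add1 add2 add3 add4 scale1 scale2 scale3 scale4
  have one: "2 * S a b a a + 2 * S a a a b = 0" for a b
  proof -
    define c2 where "c2 = S b b a a + 4 * S a b a b + S a a b b"
    have e: "of_real t * (2 * S a b a a + 2 * S a a a b) + of_real t ^ 2 * c2
        + of_real t ^ 3 * (2 * S a b b b + 2 * S b b a b) = 0" for t :: real
    proof -
      have "S (a + s *s b) (a + s *s b) (a + s *s b) (a + s *s b)
          = S a a a a + (s * cnj s)\<^sup>2 * S b b b b + s * (2 * S a b a a) + cnj s * (2 * S a a a b) + (s\<^sup>2 * S b b a a + 4 * s * cnj s * S a b a b + (cnj s)\<^sup>2 * S a a b b)
            + s\<^sup>2 * cnj s * (2 * S b b a b) + s * (cnj s)\<^sup>2 * (2 * S a b b b)" for s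
        by (simp only: rules sym1[of b a] sym3[of _ _ b a]) algebra
      from this[of "of_real t"] show ?thesis
        unfolding zero c2_def complex_cnj_complex_of_real by algebra
    qed
    show ?thesis using e[of 1] e[of "-1"] e[of 2] by (simp add: algebra_simps) algebra
  qed
  have two: "S a b a a = 0" for a b
  proof -
    have "S a b a a + S a a a b = 0" using one[of a b] by (simp add: distrib_left[symmetric] del: distrib_left_numeral)
    moreover have "\<i> * S a b a a - \<i> * S a a a b = 0"
      using one[of a "\<i> *s b"] by (simp add: rules algebra_simps)
    then have "S a b a a = S a a a b" by simp
    ultimately show ?thesis by simp
  qed
  have three: "S c b a a + 2 * S a b a c = 0" for a b c
  proof -
    have e: "S (a + s *s c) b (a + s *s c) (a + s *s c) = S a b a a + s * cnj s * cnj s * S c b c c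
        + s * S c b a a + cnj s * (2 * S a b a c) + s * cnj s * (2 * S c b a c) + (cnj s)\<^sup>2 * S a b c c" for s
      by (simp only: rules sym3[of _ _ c a]) algebra
    have "S c b a a + 2 * S a b a c + (2 * S c b a c + S a b c c) = 0"
      using e[of 1] by (simp add: two add_ac)
    moreover have "- (S c b a a + 2 * S a b a c) + (2 * S c b a c + S a b c c) = 0"
      using e[of "-1"] by (simp add: two add_ac)
    ultimately show ?thesis by (simp add: add_eq_0_iff)
  qed
  have four: "S c b a a = 0" for a b c
  proof -
    have "\<i> * (S c b a a - 2 * S a b a c) = 0"
      using three[of "\<i> *s c" b a] by (simp add: rules algebra_simps)
    then have "S c b a a - 2 * S a b a c = 0" by simp
    with three[of c b a] have "2 * S c b a a = 0" by (simp add: algebra_simps)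
    then show ?thesis by simp
  qed
  have "2 * S a b c d = 0"
    using four[of a b "c + d"] unfolding rules sym3[of _ _ d c] by (simp only: four mult_2 add_0_left add_0_right)
  then show ?thesis by simp
qed

text \<open>A real trace sees twice the real part of a complex linear map and nothing of an antilinear one; the two
  parts of the Riemann tensor are of these types.\<close>

lemma real_trace_complex:
  fixes f :: "complex^'n \<Rightarrow> complex^'n"
  shows "(\<Sum>b\<in>Basis. f b \<bullet> b) = (\<Sum>k\<in>UNIV. Re (f (axis k 1) $ k) + Im (f (axis k \<i>) $ k))"
proof -
  have "(\<Sum>b\<in>Basis. f b \<bullet> b) = (\<Sum>k\<in>UNIV. \<Sum>b\<in>{1, \<i>}. f (axis k b) \<bullet> axis k b)"
    unfolding Basis_vec_def
    by (subst sum.UNION_disjoint) (auto simp: axis_eq_axis Basis_complex_def add.commute intro!: sum.cong)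
  moreover have "(\<Sum>b\<in>{1, \<i>}. f (axis k b) \<bullet> axis k b) = Re (f (axis k 1) $ k) + Im (f (axis k \<i>) $ k)" for k
    by (subst sum.insert) (auto simp: inner_axis)
  ultimately show ?thesis by (simp only:)
qed

context kaehler_domain
begin

lemma cv_commute: "x \<in> U \<Longrightarrow> cv x v w u = cv x w v u"
  unfolding cv_def vec_eq_iff vec_lambda_beta
  by (intro allI del_cong(2)[OF open_U]) (simp_all add: christoffel_commute)

lemma
  assumes x: "x \<in> U"
  shows cv_scale1: "cv x (c *s v) w u = c *s cv x v w u" and cv_add1: "cv x (v + v') w u = cv x v w u + cv x v' w u"
proof -
  note d = christoffel_differentiable[OF x]
  have "delbar (\<lambda>y. \<Gamma> y (c *s v) w $ k) x u = delbar (\<lambda>y. c * \<Gamma> y v w $ k) x u" for k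
    by (rule del_cong(2)[OF open_U x]) (simp add: christoffel_scale_left)
  then show "cv x (c *s v) w u = c *s cv x v w u" by (simp add: cv_def vec_eq_iff delbar_cmult d)
  have "delbar (\<lambda>y. \<Gamma> y (v + v') w $ k) x u = delbar (\<lambda>y. \<Gamma> y v w $ k + \<Gamma> y v' w $ k) x u" for k
    by (rule del_cong(2)[OF open_U x]) (simp add: christoffel_add_left)
  then show "cv x (v + v') w u = cv x v w u + cv x v' w u" by (simp add: cv_def vec_eq_iff delbar_plus d)
qed

lemma q_cv:
  assumes x: "x \<in> U"
  shows "q x (cv x v w u) z = delbar (\<lambda>y. del (\<lambda>y. q y w z) y v) x u - q x (\<Gamma> x v w) (\<Gamma> x u z)"
proof -
  have "delbar (\<lambda>y. del (\<lambda>y. q y w z) y v) x u = delbar (\<lambda>y. q y (\<Gamma> y v w) z) x u"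
    by (rule del_cong(2)[OF open_U x]) (rule del_q)
  then show ?thesis by (simp add: delbar_q_christoffel[OF x])
qed

text \<open>Mixed derivatives of the metric commute, and the connection is torsion free.\<close>

lemma cv_swap:
  assumes x: "x \<in> U" shows "q x (cv x v w u) z = q x (cv x v w z) u"
proof -
  have 1: "delbar (\<lambda>y. del (\<lambda>y. q y w z) y v) x u = del (\<lambda>y. q y w (\<Gamma> y u z)) x v" for u z
    unfolding delbar_del_commute[OF open_U x smooth_q]
    by (rule del_cong(1)[OF open_U x]) (rule delbar_q)
  have "del (\<lambda>y. q y w (\<Gamma> y u z)) x v = del (\<lambda>y. q y w (\<Gamma> y z u)) x v"
    by (rule del_cong(1)[OF open_U x]) (simp add: christoffel_commute)
  then show ?thesis by (simp add: q_cv[OF x] 1 christoffel_commute[OF x, of u z])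
qed

lemma cv_hermitian:
  assumes x: "x \<in> U" shows "cnj (q x (cv x v w u) z) = q x (cv x u z v) w"
proof -
  have "cnj (delbar (\<lambda>y. del (\<lambda>y. q y w z) y v) x u) = del (\<lambda>y. cnj (del (\<lambda>y. q y w z) y v)) x u"
    by (rule del_cnj(1)[symmetric], rule smooth_on_differentiable[OF smooth_on_del(1)[OF open_U smooth_q] x])
  also have "\<dots> = del (\<lambda>y. delbar (\<lambda>y. q y z w) y v) x u"
  proof (rule del_cong(1)[OF open_U x])
    fix y assume y: "y \<in> U"
    have "cnj (del (\<lambda>y. q y w z) y v) = delbar (\<lambda>y. cnj (q y w z)) y v"
      by (simp add: del_cnj q_differentiable[OF y])
    also have "\<dots> = delbar (\<lambda>y. q y z w) y v"
      by (rule del_cong(2)[OF open_U y]) (simp add: sesquilinear.cnj[OF sesquilinear_q])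
    finally show "cnj (del (\<lambda>y. q y w z) y v) = delbar (\<lambda>y. q y z w) y v" .
  qed
  also have "\<dots> = delbar (\<lambda>y. del (\<lambda>y. q y z w) y u) x v"
    by (rule delbar_del_commute[OF open_U x smooth_q, symmetric])
  finally show ?thesis by (simp add: q_cv[OF x] sesquilinear.cnj[OF sesquilinear_q[OF x]])
qed

text \<open>The \<open>(1, 0)\<close> derivatives of the connection cancel, because second derivatives of type \<open>(2, 0)\<close> of the metric
  commute.\<close>

lemma riemann_cv:
  assumes x: "x \<in> U" shows "riemann h x u v w = cv x v w u - cv x u w v"
proof -
  interpret X: hermitian_product "q x" by (rule hermitian[OF x])
  have "dv x v w u + \<Gamma> x u (\<Gamma> x v w) = dv x u w v + \<Gamma> x v (\<Gamma> x u w)"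
  proof (rule X.eqI)
    fix z
    have "q x (dv x v w u + \<Gamma> x u (\<Gamma> x v w)) z = del (\<lambda>y. del (\<lambda>y. q y w z) y v) x u" for u v
      unfolding del_q_christoffel[OF x, symmetric] by (rule del_cong(1)[OF open_U x]) (simp add: del_q)
    then show "q x (dv x v w u + \<Gamma> x u (\<Gamma> x v w)) z = q x (dv x u w v + \<Gamma> x v (\<Gamma> x u w)) z"
      using del_del_commute[OF open_U x smooth_q, of w z v u] by simp
  qed
  then show ?thesis
    unfolding riemann_def ddir_eq[OF christoffel_has_derivative[OF x]] by (simp add: algebra_simps)
qed

text \<open>The holomorphic sectional curvature gives the diagonal values of the curvature form, and polarisation
  all others.\<close>

theorem constant_holomorphic_curvature:
  assumes x: "x \<in> U" and c: "\<And>u. u \<noteq> 0 \<Longrightarrow> sectional_curvature h x u (cJ u) = 2 * c"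
  shows "cv x v w u = (of_real (- c / 2) * q x w u) *s v + (of_real (- c / 2) * q x v u) *s w"
proof -
  interpret X: hermitian_product "q x" by (rule hermitian[OF x])
  define k :: complex where "k = of_real (- c / 2)"
  define S where "S v w u z = q x (cv x v w u) z - k * (q x v u * q x w z + q x w u * q x v z)" for v w u z
  have diag: "q x (cv x u u u) u = 2 * k * (q x u u)\<^sup>2" for u
  proof (cases "u = 0")
    case True
    then show ?thesis by simp
  next
    case False
    have quu: "q x u u = of_real (h x u u)" using X.self_real[of u] by (simp add: complex_eq_iff) (simp add: q_def)
    then have huJ: "h x u (cJ u) = 0" by (simp add: q_def complex_eq_iff)
    have "riemann h x u (cJ u) (cJ u) = - 2 *s cv x u u u"
    proof -
      have 1: "cv x (cJ u) (cJ u) u = - cv x u u u"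
        by (simp only: cJ_def cv_scale1[OF x] cv_commute[OF x, of u "\<i> *s u"]) (simp add: vec_eq_iff)
      have 2: "cv x u (cJ u) (cJ u) = cv x u u u"
        by (simp only: cv_cJ[OF x]) (simp only: cJ_def cv_scale1[OF x] cv_commute[OF x, of u "\<i> *s u"], simp add: vec_eq_iff)
      show ?thesis unfolding riemann_cv[OF x] 1 2 by (simp add: vec_eq_iff)
    qed
    then have "h x (riemann h x u (cJ u) (cJ u)) u = - 2 * Re (q x (cv x u u u) u)"
      using X.scale_left[of "-2" "cv x u u u" u] by (simp add: q_def complex_eq_iff)
    with c[OF False] have A: "- 2 * Re (q x (cv x u u u) u) / (h x u u)\<^sup>2 = 2 * c"
      by (simp add: sectional_curvature_def h_cJ[OF x] huJ power2_eq_square)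
    have "(h x u u)\<^sup>2 \<noteq> 0" using h_pos[OF x False] by simp
    from nonzero_divide_eq_eq[OF this] A have "- 2 * Re (q x (cv x u u u) u) = 2 * c * (h x u u)\<^sup>2" by blast
    then have "Re (q x (cv x u u u) u) = - c * (h x u u)\<^sup>2" by linarith
    moreover have "Im (q x (cv x u u u) u) = 0" using cv_hermitian[OF x, of u u u u] by (simp add: complex_eq_iff)
    ultimately show ?thesis by (simp add: quu k_def complex_eq_iff power2_eq_square)
  qed
  have S0: "S v w u z = 0" for v w u z
    by (rule curvature_form_polarisation[of S])
      (simp_all add: S_def diag cv_scale1[OF x] cv_add1[OF x] cv_scale[OF x] cv_add[OF x] X.add_left X.add_right
        X.scale_left X.scale_right algebra_simps power2_eq_square,
        simp_all add: cv_swap[OF x, of _ _ _ u for u] cv_commute[OF x, of w v for v w])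
  show ?thesis
  proof (rule X.eqI)
    fix z
    show "q x (cv x v w u) z = q x ((of_real (- c / 2) * q x w u) *s v + (of_real (- c / 2) * q x v u) *s w) z"
      using S0[of v w u z] unfolding X.add_left X.scale_left S_def k_def[symmetric] by (simp add: algebra_simps)
  qed
qed

text \<open>The trace of the connection is the logarithmic derivative of the volume form; its
  antiholomorphic derivative is the Ricci form.\<close>

definition tr :: "complex^'n \<Rightarrow> complex^'n \<Rightarrow> complex" where
  "tr x v = (\<Sum>k\<in>UNIV. \<Gamma> x (axis k 1) v $ k)"

lemma
  assumes "x \<in> U" shows tr_add: "tr x (u + v) = tr x u + tr x v" and tr_scale: "tr x (c *s u) = c * tr x u"
  by (simp_all add: tr_def christoffel_add_right christoffel_scale_right assms sum.distrib sum_distrib_left)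

lemma smooth_tr: "smooth_on (\<lambda>x. tr x v) U"
  unfolding tr_def by (intro smooth_on_sum smooth_christoffel open_U)

lemma tr_differentiable: "x \<in> U \<Longrightarrow> (\<lambda>x. tr x v) differentiable (at x)"
  by (rule smooth_on_differentiable[OF smooth_tr])

lemma delbar_tr:
  assumes x: "x \<in> U" shows "delbar (\<lambda>y. tr y v) x u = (\<Sum>k\<in>UNIV. cv x (axis k 1) v u $ k)"
proof -
  have "((\<lambda>y. tr y v) has_derivative (\<lambda>t. \<Sum>k\<in>UNIV. ddir (\<lambda>y. \<Gamma> y (axis k 1) v $ k) x t)) (at x)"
    unfolding tr_def by (intro has_derivative_sum differentiable_has_ddir christoffel_differentiable x)
  then show ?thesis
    by (simp add: delbar_def ddir_eq cv_def sum_divide_distrib[symmetric] sum.distrib[symmetric] sum_distrib_left)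
qed

lemma ricci_eq:
  assumes x: "x \<in> U" shows "ricci h x v v = - 2 * Re (delbar (\<lambda>y. tr y v) x v)"
proof -
  have i: "axis k \<i> = \<i> *s axis k (1::complex)" for k :: 'n by (simp add: vec_eq_iff axis_def)
  have "Re (riemann h x (axis k 1) v v $ k) + Im (riemann h x (axis k \<i>) v v $ k) = - 2 * Re (cv x (axis k 1) v v $ k)" for k
    by (simp only: riemann_cv[OF x] i cv_scale1[OF x] cv_scale[OF x]) simp
  then show ?thesis
    unfolding ricci_def real_trace_complex delbar_tr[OF x] by (simp add: sum_distrib_left)
qed

text \<open>The derivative of the metric along the field and the two terms with its differential combine to a covariant
  derivative, since the connection is symmetric and preserves the metric.\<close>

lemma lie_metric_eq:
  assumes x: "x \<in> U" and X: "X differentiable (at x)"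
  shows "lie_metric X h x v v = 2 * Re (q x (\<Gamma> x v (X x) + ddir X x v) v)"
proof -
  interpret X: hermitian_product "q x" by (rule hermitian[OF x])
  have "ddir (\<lambda>y. h y v v) x (X x) = Re (ddir (\<lambda>y. q y v v) x (X x))" by (simp add: ddir_q[OF x])
  also have "\<dots> = Re (q x (\<Gamma> x (X x) v) v) + Re (q x v (\<Gamma> x (X x) v))" by (simp add: ddir_q_christoffel[OF x])
  also have "Re (q x v (\<Gamma> x (X x) v)) = Re (q x (\<Gamma> x (X x) v) v)"
    using arg_cong[OF X.cnj[of v "\<Gamma> x (X x) v"], of Re] by simp
  finally have 1: "ddir (\<lambda>y. h y v v) x (X x) = 2 * Re (q x (\<Gamma> x v (X x)) v)"
    by (simp add: christoffel_commute[OF x, of v])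
  have "h x v (ddir X x v) = h x (ddir X x v) v" by (rule h_commute[OF x])
  then show ?thesis unfolding lie_metric_def 1 by (simp add: X.add_left) (simp add: q_def)
qed

definition detq :: "complex^'n \<Rightarrow> complex" where "detq x = det (\<chi> i j. q x (axis i 1) (axis j 1))"

lemma detq_nonzero: "x \<in> U \<Longrightarrow> detq x \<noteq> 0"
  using hermitian_product.det_gram_nonzero[OF hermitian] hermitian_product.gram_def[OF hermitian] by (simp add: detq_def)

end

section \<open>Space forms and the Gauss equation\<close>

lemma delbar_zero_imp_holo:
  assumes "\<And>x. x \<in> S \<Longrightarrow> f differentiable (at x)" "\<And>x t. x \<in> S \<Longrightarrow> delbar f x t = 0"
  shows "holo f S"
  unfolding holo_def
proof (intro ballI conjI allI)
  fix x v assume x: "x \<in> S"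
  show "f differentiable at x" by (rule assms(1)[OF x])
  have "ddir f x v + \<i> * ddir f x (cJ v) = 0" using assms(2)[OF x, of v] by (simp add: delbar_def)
  then have "\<i> * (ddir f x v + \<i> * ddir f x (cJ v)) = 0" by simp
  then show "ddir f x (cJ v) = \<i> * ddir f x v" by (simp add: algebra_simps)
qed

context kaehler_domain
begin

lemma expand_christoffel:
  assumes "y \<in> U"
  shows "\<Gamma> y u v = (\<Sum>i\<in>UNIV. u $ i *s \<Gamma> y (axis i 1) v)" "\<Gamma> y u v = (\<Sum>i\<in>UNIV. v $ i *s \<Gamma> y u (axis i 1))"
  by (rule linear_expand_vec[of "\<lambda>u. \<Gamma> y u v"], rule christoffel_add_left[OF assms], rule christoffel_scale_left[OF assms])
    (rule linear_expand_vec[of "\<Gamma> y u"], rule christoffel_add_right[OF assms], rule christoffel_scale_right[OF assms])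

lemma christoffel_along:
  assumes Fp: "F p \<in> U"
    and F: "(F has_derivative F') (at p)" and V: "(V has_derivative V') (at p)" and Z: "(Z has_derivative Z') (at p)"
  shows "((\<lambda>p. \<Gamma> (F p) (V p) (Z p)) has_derivative (\<lambda>t. dv (F p) (V p) (Z p) (F' t) + cv (F p) (V p) (Z p) (F' t)
      + \<Gamma> (F p) (V' t) (Z p) + \<Gamma> (F p) (V p) (Z' t))) (at p)"
proof (rule has_derivative_vec)
  fix k
  have "((\<lambda>p. \<Gamma> (F p) (V p) (Z p) $ k) has_derivative (\<lambda>t. ddir (\<lambda>y. \<Gamma> y (V p) (Z p) $ k) (F p) (F' t)
      + \<Gamma> (F p) (V' t) (Z p) $ k + \<Gamma> (F p) (V p) (Z' t) $ k)) (at p)"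
  proof (rule bilinear_field_has_derivative[OF open_U Fp _ _ _ F V Z])
    fix y u v assume y: "y \<in> U"
    show "\<Gamma> y u v $ k = (\<Sum>i\<in>UNIV. u $ i * \<Gamma> y (axis i 1) v $ k)"
      using arg_cong[OF expand_christoffel(1)[OF y, of u v], of "\<lambda>v. v $ k"] by simp
    show "\<Gamma> y u v $ k = (\<Sum>i\<in>UNIV. v $ i * \<Gamma> y u (axis i 1) $ k)"
      using arg_cong[OF expand_christoffel(2)[OF y, of u v], of "\<lambda>v. v $ k"] by simp
  qed (rule christoffel_differentiable[OF Fp])
  then show "((\<lambda>p. \<Gamma> (F p) (V p) (Z p) $ k) has_derivative (\<lambda>t. (dv (F p) (V p) (Z p) (F' t) + cv (F p) (V p) (Z p) (F' t)
      + \<Gamma> (F p) (V' t) (Z p) + \<Gamma> (F p) (V p) (Z' t)) $ k)) (at p)"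
    by (simp add: ddir_split dv_def cv_def)
qed

lemma expand_tr: assumes "y \<in> U" shows "tr y u = (\<Sum>i\<in>UNIV. u $ i * tr y (axis i 1))"
  by (rule linear_expand) (simp_all only: tr_add[OF assms] tr_scale[OF assms])

lemma detq_has_derivative:
  assumes x: "x \<in> U" shows "(detq has_derivative (\<lambda>t. (tr x t + cnj (tr x t)) * detq x)) (at x)"
proof -
  interpret X: hermitian_product "q x" by (rule hermitian[OF x])
  define A :: "complex^'n \<Rightarrow> complex^'n^'n" where "A x = (\<chi> i j. q x (axis i 1) (axis j 1))" for x
  define C :: "complex^'n \<Rightarrow> complex^'n^'n" where "C t = (\<chi> i l. \<Gamma> x t (axis i 1) $ l)" for t
  define D :: "complex^'n \<Rightarrow> complex^'n^'n" where "D t = (\<chi> l j. cnj (\<Gamma> x t (axis j 1) $ l))" for t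
  have "((\<lambda>x. A x $ i $ j) has_derivative (\<lambda>t. (C t ** A x + A x ** D t) $ i $ j)) (at x)" for i j
  proof -
    have "(C t ** A x) $ i $ j = q x (\<Gamma> x t (axis i 1)) (axis j 1)" for t
      unfolding X.expand_left[of "\<Gamma> x t (axis i 1)"] by (simp add: matrix_matrix_mult_def C_def A_def)
    moreover have "(A x ** D t) $ i $ j = q x (axis i 1) (\<Gamma> x t (axis j 1))" for t
      by (subst X.expand_right) (simp add: matrix_matrix_mult_def D_def A_def mult.commute)
    ultimately show ?thesis
      using differentiable_has_ddir[OF q_differentiable[OF x, of "axis i 1" "axis j 1"]]
      by (simp add: A_def ddir_q_christoffel[OF x])
  qed
  from det_has_derivative_two_sided[OF this]
  have "((\<lambda>x. det (A x)) has_derivative (\<lambda>t. (trace (C t) + trace (D t)) * det (A x))) (at x)" .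
  moreover have "trace (C t) = tr x t" "trace (D t) = cnj (tr x t)" for t
    by (simp_all add: trace_def C_def D_def tr_def christoffel_commute[OF x, of t])
  ultimately show ?thesis by (simp add: A_def detq_def[abs_def])
qed

end

locale kaehler_space_form = kaehler_domain U h for U h +
  fixes \<kappa> :: real
  assumes cv_const: "x \<in> U \<Longrightarrow> cv x v w u = (of_real \<kappa> * q x w u) *s v + (of_real \<kappa> * q x v u) *s w"
begin

text \<open>The trace of the connection, normalised so that its curvature is \<open>\<kappa>\<close> times the metric. The
  projectively normalised connection \<open>\<Theta>\<close> and the form \<open>\<rho>\<close> are holomorphic: they are the
  ingredients of the flat holomorphic projective connection of a space form.\<close>

definition \<mu> where "\<mu> x v = tr x v / of_nat (CARD('a) + 1)"

definition \<rho> where "\<rho> x u v = - (del (\<lambda>y. \<mu> y v) x u - \<mu> x (\<Gamma> x u v) + \<mu> x u * \<mu> x v)"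

definition \<Theta> where "\<Theta> x u v = \<Gamma> x u v - \<mu> x u *s v - \<mu> x v *s u"

lemma card_nonzero: "(of_nat (CARD('a) + 1) :: complex) \<noteq> 0"
  unfolding of_nat_eq_0_iff by simp

lemma
  assumes "x \<in> U" shows \<mu>_add: "\<mu> x (u + v) = \<mu> x u + \<mu> x v" and \<mu>_scale: "\<mu> x (c *s u) = c * \<mu> x u"
  by (simp_all add: \<mu>_def tr_add tr_scale assms add_divide_distrib)

lemma smooth_\<mu>: "smooth_on (\<lambda>x. \<mu> x v) U"
  unfolding \<mu>_def by (rule smooth_on_divide[OF open_U smooth_tr smooth_on_const card_nonzero])

lemma \<mu>_differentiable: "x \<in> U \<Longrightarrow> (\<lambda>x. \<mu> x v) differentiable (at x)"
  by (rule smooth_on_differentiable[OF smooth_\<mu>])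

lemma \<mu>_along:
  assumes Fp: "F p \<in> U" and F: "(F has_derivative F') (at p)" and V: "(V has_derivative V') (at p)"
  shows "((\<lambda>p. \<mu> (F p) (V p)) has_derivative
    (\<lambda>t. del (\<lambda>y. \<mu> y (V p)) (F p) (F' t) + delbar (\<lambda>y. \<mu> y (V p)) (F p) (F' t) + \<mu> (F p) (V' t))) (at p)"
proof -
  have "\<mu> y u = (\<Sum>i\<in>UNIV. u $ i * \<mu> y (axis i 1))" if "y \<in> U" for y u
    unfolding \<mu>_def expand_tr[OF that, of u] by (simp add: sum_divide_distrib)
  from linear_field_has_derivative[OF open_U Fp this \<mu>_differentiable[OF Fp] F V]
  show ?thesis by (simp add: ddir_split)
qed

lemma delbar_\<mu>:
  assumes x: "x \<in> U" shows "delbar (\<lambda>y. \<mu> y v) x u = of_real \<kappa> * q x v u"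
proof -
  interpret X: hermitian_product "q x" by (rule hermitian[OF x])
  have "(\<Sum>k\<in>UNIV. cv x (axis k 1) v u $ k) = of_nat (CARD('a) + 1) * (of_real \<kappa> * q x v u)"
    by (simp add: cv_const[OF x] sum.distrib X.expand_left[of v u] sum_distrib_left algebra_simps axis_def)
  moreover have "delbar (\<lambda>y. \<mu> y v) x u = delbar (\<lambda>y. inverse (of_nat (CARD('a) + 1)) * tr y v) x u"
    by (simp add: \<mu>_def divide_inverse mult.commute)
  ultimately show ?thesis
    by (simp only: delbar_cmult[OF tr_differentiable[OF x]] delbar_tr[OF x]) (use card_nonzero in \<open>simp add: field_simps\<close>)
qed

text \<open>The antiholomorphic derivatives of the three terms are multiples of the metric by \<open>delbar_\<mu>\<close>, and they cancel.\<close>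

lemma holo_\<rho>: "holo (\<lambda>x. \<rho> x u v) U"
proof (rule delbar_zero_imp_holo)
  fix x assume x: "x \<in> U"
  interpret X: hermitian_product "q x" by (rule hermitian[OF x])
  have d1: "(\<lambda>y. del (\<lambda>y. \<mu> y v) y u) differentiable (at x)"
    by (rule smooth_on_differentiable[OF smooth_on_del(1)[OF open_U smooth_\<mu>] x])
  have D2: "((\<lambda>y. \<mu> y (\<Gamma> y u v)) has_derivative (\<lambda>t. (del (\<lambda>y. \<mu> y (\<Gamma> x u v)) x t + \<mu> x (dv x u v t))
      + (of_real \<kappa> * q x (\<Gamma> x u v) t + \<mu> x (cv x u v t)))) (at x)"
    using \<mu>_along[where F = "\<lambda>x. x" and p = x, OF x has_derivative_ident christoffel_has_derivative[OF x, of u v]]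
    by (simp add: \<mu>_add[OF x] delbar_\<mu>[OF x] add_ac)
  have d2: "(\<lambda>y. \<mu> y (\<Gamma> y u v)) differentiable (at x)" by (rule differentiableI[OF D2])
  have b2: "delbar (\<lambda>y. \<mu> y (\<Gamma> y u v)) x t = of_real \<kappa> * q x (\<Gamma> x u v) t + \<mu> x (cv x u v t)" for t
  proof (rule del_delbar_eq(2)[OF D2])
    fix t
    have m: "\<mu> x (cJ a) = \<i> * \<mu> x a" "\<mu> x (- a) = - \<mu> x a" for a
      using \<mu>_scale[OF x, of \<i> a] \<mu>_scale[OF x, of "-1" a] by (simp_all add: cJ_def)
    show "del (\<lambda>y. \<mu> y (\<Gamma> x u v)) x (cJ t) + \<mu> x (dv x u v (cJ t)) = \<i> * (del (\<lambda>y. \<mu> y (\<Gamma> x u v)) x t + \<mu> x (dv x u v t))"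
      by (simp add: del_cJ[OF \<mu>_differentiable[OF x]] dv_cJ[OF x] m distrib_left)
    have qJ: "q x (\<Gamma> x u v) (cJ t) = - \<i> * q x (\<Gamma> x u v) t" unfolding cJ_def X.scale_right by simp
    show "of_real \<kappa> * q x (\<Gamma> x u v) (cJ t) + \<mu> x (cv x u v (cJ t)) = - \<i> * (of_real \<kappa> * q x (\<Gamma> x u v) t + \<mu> x (cv x u v t))"
      unfolding qJ cv_cJ[OF x] m by (simp add: algebra_simps)
  qed
  have d3: "(\<lambda>y. \<mu> y u * \<mu> y v) differentiable (at x)"
    by (intro differentiable_mult \<mu>_differentiable x)
  have "((\<lambda>y. \<mu> y u * \<mu> y v) has_derivative (\<lambda>t. (\<mu> x u * del (\<lambda>y. \<mu> y v) x t + del (\<lambda>y. \<mu> y u) x t * \<mu> x v)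
      + (\<mu> x u * delbar (\<lambda>y. \<mu> y v) x t + delbar (\<lambda>y. \<mu> y u) x t * \<mu> x v))) (at x)"
    using has_derivative_mult[OF has_derivative_del has_derivative_del, OF \<mu>_differentiable \<mu>_differentiable, OF x x, of u v]
    by (simp add: algebra_simps)
  then have b3: "delbar (\<lambda>y. \<mu> y u * \<mu> y v) x t = \<mu> x u * (of_real \<kappa> * q x v t) + of_real \<kappa> * q x u t * \<mu> x v" for t
    unfolding delbar_\<mu>[OF x, symmetric]
    by (rule del_delbar_eq(2)) (simp_all add: del_cJ delbar_cJ \<mu>_differentiable x algebra_simps)
  have b1: "delbar (\<lambda>y. del (\<lambda>y. \<mu> y v) y u) x t = of_real \<kappa> * q x (\<Gamma> x u v) t" for t
  proof -
    have "delbar (\<lambda>y. del (\<lambda>y. \<mu> y v) y u) x t = del (\<lambda>y. of_real \<kappa> * q y v t) x u"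
      unfolding delbar_del_commute[OF open_U x smooth_\<mu>]
      by (rule del_cong(1)[OF open_U x]) (rule delbar_\<mu>)
    then show ?thesis by (simp add: del_cmult q_differentiable[OF x] del_q[OF x])
  qed
  have \<rho>: "(\<lambda>x. \<rho> x u v) = (\<lambda>y. - 1 * (del (\<lambda>y. \<mu> y v) y u + (- 1 * \<mu> y (\<Gamma> y u v) + \<mu> y u * \<mu> y v)))"
    by (simp add: \<rho>_def fun_eq_iff)
  show "(\<lambda>x. \<rho> x u v) differentiable (at x)"
    unfolding \<rho> by (intro differentiable_mult differentiable_add differentiable_const d1 d2 d3)
  show "delbar (\<lambda>x. \<rho> x u v) x t = 0" for t
    unfolding \<rho> by (simp only: delbar_cmult delbar_plus d1 d2 d3 differentiable_mult differentiable_add differentiable_const)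
      (simp add: b1 b2 b3 cv_const[OF x] \<mu>_add[OF x] \<mu>_scale[OF x] algebra_simps)
qed

lemma holo_\<Theta>: "holo (\<lambda>x. \<Theta> x u v $ k) U"
proof (rule delbar_zero_imp_holo)
  fix x assume x: "x \<in> U"
  have \<Theta>: "(\<lambda>x. \<Theta> x u v $ k) = (\<lambda>y. \<Gamma> y u v $ k + (- v $ k * \<mu> y u + - u $ k * \<mu> y v))"
    by (simp add: \<Theta>_def fun_eq_iff algebra_simps)
  note d = \<mu>_differentiable[OF x] christoffel_differentiable[OF x]
  show "(\<lambda>x. \<Theta> x u v $ k) differentiable (at x)"
    unfolding \<Theta> by (intro differentiable_mult differentiable_add differentiable_const d)
  have "delbar (\<lambda>y. \<Gamma> y u v $ k) x t = cv x u v t $ k" for t by (simp add: cv_def)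
  then show "delbar (\<lambda>x. \<Theta> x u v $ k) x t = 0" for t
    unfolding \<Theta> by (simp only: delbar_cmult delbar_plus d differentiable_mult differentiable_add differentiable_const)
      (simp add: delbar_\<mu>[OF x] cv_const[OF x])
qed

end

locale kaehler_map = G: kaehler_domain U g + H: kaehler_domain W h
  for U :: "(complex^'n) set" and g and W :: "(complex^'m) set" and h +
  fixes F :: "complex^'n \<Rightarrow> complex^'m"
  assumes hol: "hol_map_on F U" and maps: "x \<in> U \<Longrightarrow> F x \<in> W"
    and isometric: "x \<in> U \<Longrightarrow> g x u v = h (F x) (ddir F x u) (ddir F x v)"
begin

lemma F_has_derivative: "x \<in> U \<Longrightarrow> (F has_derivative ddir F x) (at x)"
  using hol by (auto simp: hol_map_on_def intro: differentiable_has_ddir)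

lemma dF_cJ: "x \<in> U \<Longrightarrow> ddir F x (cJ v) = cJ (ddir F x v)"
  using hol by (auto simp: hol_map_on_def)

lemma
  assumes "x \<in> U"
  shows dF_add: "ddir F x (u + v) = ddir F x u + ddir F x v" and dF_scale: "ddir F x (c *s u) = c *s ddir F x u"
proof -
  have l: "linear (ddir F x)" using F_has_derivative[OF assms] by (rule has_derivative_linear)
  show "ddir F x (u + v) = ddir F x u + ddir F x v" by (rule linear_add[OF l])
  show "ddir F x (c *s u) = c *s ddir F x u" by (rule linear_complex_linear_vec[OF l dF_cJ[OF assms]])
qed

lemma hol_dF: "hol_map_on (\<lambda>x. ddir F x v) U"
  by (rule hol_map_on_ddir[OF G.open_U hol])

lemma dF_has_derivative: "x \<in> U \<Longrightarrow> ((\<lambda>x. ddir F x v) has_derivative ddir (\<lambda>x. ddir F x v) x) (at x)"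
  using hol_dF[of v] by (auto simp: hol_map_on_def intro: differentiable_has_ddir)

lemma ddF_cJ: "x \<in> U \<Longrightarrow> ddir (\<lambda>x. ddir F x v) x (cJ t) = cJ (ddir (\<lambda>x. ddir F x v) x t)"
  using hol_dF[of v] by (auto simp: hol_map_on_def)

lemma q_isometric: "x \<in> U \<Longrightarrow> G.q x u v = H.q (F x) (ddir F x u) (ddir F x v)"
  by (simp add: G.q_def H.q_def isometric dF_cJ)

definition \<sigma> where "\<sigma> = second_fundamental_form g h F"

definition cd where "cd x u v = H.\<Gamma> (F x) (ddir F x u) (ddir F x v) + ddir (\<lambda>y. ddir F y v) x u"

lemma cd_eq: "cd x u v = \<sigma> x u v + ddir F x (G.\<Gamma> x u v)"
  by (simp add: cd_def \<sigma>_def second_fundamental_form_def)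

lemma cd_cJ: "x \<in> U \<Longrightarrow> cd x (cJ u) v = cJ (cd x u v)"
  using H.christoffel_scale_left[OF maps, of x \<i>] by (simp add: cd_def dF_cJ ddF_cJ cJ_add) (simp add: cJ_def)

lemma del_q_isometric:
  assumes x: "x \<in> U" shows "del (\<lambda>y. G.q y v w) x t = H.q (F x) (cd x t v) (ddir F x w)"
proof -
  interpret Y: hermitian_product "H.q (F x)" by (rule H.hermitian[OF maps[OF x]])
  have "((\<lambda>x. H.q (F x) (ddir F x v) (ddir F x w)) has_derivative
      (\<lambda>t. H.q (F x) (cd x t v) (ddir F x w) + H.q (F x) (ddir F x v) (cd x t w))) (at x)"
    using H.metric_compatible[where F = F and p = x, OF maps[OF x] F_has_derivative[OF x] dF_has_derivative[OF x] dF_has_derivative[OF x]]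
    by (simp only: cd_def)
  then have "del (\<lambda>x. H.q (F x) (ddir F x v) (ddir F x w)) x t = H.q (F x) (cd x t v) (ddir F x w)"
    by (rule del_delbar_eq(1)) (simp_all only: cd_cJ[OF x], simp_all add: cJ_def Y.scale_left Y.scale_right)
  moreover have "del (\<lambda>y. G.q y v w) x t = del (\<lambda>x. H.q (F x) (ddir F x v) (ddir F x w)) x t"
    by (rule del_cong(1)[OF G.open_U x]) (rule q_isometric)
  ultimately show ?thesis by simp
qed

text \<open>The tangential part of the ambient derivative is the connection of the induced metric, since both are
  determined by derivatives of type \<open>(1, 0)\<close> of the metric.\<close>

lemma \<sigma>_normal:
  assumes x: "x \<in> U" shows "H.q (F x) (\<sigma> x u v) (ddir F x w) = 0" "H.q (F x) (ddir F x w) (\<sigma> x u v) = 0"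
proof -
  interpret Y: hermitian_product "H.q (F x)" by (rule H.hermitian[OF maps[OF x]])
  have "H.q (F x) (cd x u v) (ddir F x w) = H.q (F x) (ddir F x (G.\<Gamma> x u v)) (ddir F x w)"
    by (simp only: del_q_isometric[OF x, symmetric] G.del_q[OF x] q_isometric[OF x])
  then show 1: "H.q (F x) (\<sigma> x u v) (ddir F x w) = 0" by (simp add: cd_eq Y.add_left)
  show "H.q (F x) (ddir F x w) (\<sigma> x u v) = 0" using Y.cnj[of "\<sigma> x u v" "ddir F x w"] by (simp add: 1)
qed

text \<open>Differentiate \<open>\<langle>\<nabla>\<^sub>v dF w, dF z\<rangle>\<close> in an antiholomorphic direction: the holomorphic fields \<open>dF w\<close> and \<open>dF z\<close> contribute
  only curvature and the product of two covariant derivatives, which splits orthogonally.\<close>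

theorem gauss:
  assumes x: "x \<in> U"
  shows "G.q x (G.cv x v w u) z =
    H.q (F x) (H.cv (F x) (ddir F x v) (ddir F x w) (ddir F x u)) (ddir F x z) + H.q (F x) (\<sigma> x v w) (\<sigma> x u z)"
proof -
  interpret Y: hermitian_product "H.q (F x)" by (rule H.hermitian[OF maps[OF x]])
  define a where "a t = H.dv (F x) (ddir F x v) (ddir F x w) (ddir F x t) + H.\<Gamma> (F x) (ddir (\<lambda>x. ddir F x v) x t) (ddir F x w)
      + H.\<Gamma> (F x) (ddir F x v) (ddir (\<lambda>x. ddir F x w) x t) + ddir (\<lambda>y. ddir (\<lambda>y. ddir F y w) y v) x t" for t
  define b where "b t = H.cv (F x) (ddir F x v) (ddir F x w) (ddir F x t)" for t
  have hol2: "hol_map_on (\<lambda>y. ddir (\<lambda>y. ddir F y w) y v) U" by (rule hol_map_on_ddir[OF G.open_U hol_dF])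
  have "((\<lambda>y. ddir (\<lambda>y. ddir F y w) y v) has_derivative ddir (\<lambda>y. ddir (\<lambda>y. ddir F y w) y v) x) (at x)"
    using hol2 x by (auto simp: hol_map_on_def intro: differentiable_has_ddir)
  from has_derivative_add[OF H.christoffel_along[where F = F and p = x, OF maps[OF x] F_has_derivative[OF x] dF_has_derivative[OF x] dF_has_derivative[OF x]] this]
  have cd: "((\<lambda>x. cd x v w) has_derivative (\<lambda>t. a t + b t)) (at x)"
    unfolding cd_def a_def b_def by (rule has_derivative_eq_rhs) (simp add: fun_eq_iff add_ac)
  have aJ: "a (cJ t) = cJ (a t)" for t
  proof -
    have "ddir (\<lambda>y. ddir (\<lambda>y. ddir F y w) y v) x (cJ t) = cJ (ddir (\<lambda>y. ddir (\<lambda>y. ddir F y w) y v) x t)"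
      using hol2 x by (auto simp: hol_map_on_def)
    moreover have "H.\<Gamma> (F x) (cJ p) q = cJ (H.\<Gamma> (F x) p q)" "H.\<Gamma> (F x) q (cJ p) = cJ (H.\<Gamma> (F x) q p)" for p q
      by (simp_all add: cJ_def H.christoffel_scale_left[OF maps[OF x]] H.christoffel_scale_right[OF maps[OF x]])
    ultimately show ?thesis
      by (simp add: a_def dF_cJ[OF x] ddF_cJ[OF x] H.dv_cJ[OF maps[OF x]] cJ_add)
  qed
  have bJ: "b (cJ t) = - cJ (b t)" for t by (simp add: b_def dF_cJ[OF x] H.cv_cJ[OF maps[OF x]])
  have qJ: "H.q (F x) (cJ p) r = \<i> * H.q (F x) p r" "H.q (F x) p (cJ r) = - \<i> * H.q (F x) p r" for p r
    by (simp_all add: cJ_def Y.scale_left Y.scale_right)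
  have "((\<lambda>x. H.q (F x) (cd x v w) (ddir F x z)) has_derivative
      (\<lambda>t. H.q (F x) (H.\<Gamma> (F x) (ddir F x t) (cd x v w) + (a t + b t)) (ddir F x z) + H.q (F x) (cd x v w) (cd x t z))) (at x)"
    using H.metric_compatible[where F = F and p = x, OF maps[OF x] F_has_derivative[OF x] cd dF_has_derivative[OF x]]
    by (simp only: cd_def[of _ _ z])
  then have d: "((\<lambda>x. H.q (F x) (cd x v w) (ddir F x z)) has_derivative
      (\<lambda>t. H.q (F x) (H.\<Gamma> (F x) (ddir F x t) (cd x v w) + a t) (ddir F x z)
        + (H.q (F x) (b t) (ddir F x z) + H.q (F x) (cd x v w) (cd x t z)))) (at x)"
    by (rule has_derivative_eq_rhs) (simp add: fun_eq_iff Y.add_left add_ac)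
  have "delbar (\<lambda>x. H.q (F x) (cd x v w) (ddir F x z)) x u = H.q (F x) (b u) (ddir F x z) + H.q (F x) (cd x v w) (cd x u z)"
  proof (rule del_delbar_eq(2)[OF d])
    fix t
    have GJ: "H.\<Gamma> (F x) (ddir F x (cJ t)) p = cJ (H.\<Gamma> (F x) (ddir F x t) p)" for p
      unfolding dF_cJ[OF x] by (simp add: cJ_def H.christoffel_scale_left[OF maps[OF x]])
    show "H.q (F x) (H.\<Gamma> (F x) (ddir F x (cJ t)) (cd x v w) + a (cJ t)) (ddir F x z) =
         \<i> * H.q (F x) (H.\<Gamma> (F x) (ddir F x t) (cd x v w) + a t) (ddir F x z)"
      unfolding GJ aJ cJ_add[symmetric] by (rule qJ)
    show "H.q (F x) (b (cJ t)) (ddir F x z) + H.q (F x) (cd x v w) (cd x (cJ t) z) =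
         - \<i> * (H.q (F x) (b t) (ddir F x z) + H.q (F x) (cd x v w) (cd x t z))"
      unfolding bJ cd_cJ[OF x] Y.minus_left qJ by (simp add: algebra_simps)
  qed
  moreover have "delbar (\<lambda>y. del (\<lambda>y. G.q y w z) y v) x u = delbar (\<lambda>x. H.q (F x) (cd x v w) (ddir F x z)) x u"
    by (rule del_cong(2)[OF G.open_U x]) (rule del_q_isometric)
  ultimately show ?thesis
    unfolding G.q_cv[OF x] cd_eq q_isometric[OF x, of "G.\<Gamma> x v w"] b_def
    by (simp add: Y.add_left Y.add_right \<sigma>_normal[OF x])
qed

end

section \<open>The kernel equation on the diagonal\<close>

lemma finite_rank_subset:
  assumes "finite_rank r K" "r' \<le> r" shows "finite_rank r' K"
proof -
  have sub: "ball 0 r' \<subseteq> ball (0::complex) r" using assms(2) by (simp add: subset_ball)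
  obtain L where L: "\<forall>p\<in>set L. fst p holomorphic_on ball 0 r \<and> snd p holomorphic_on ball 0 r"
     "\<forall>z\<in>ball 0 r. \<forall>w\<in>ball 0 r. K z w = (\<Sum>p\<leftarrow>L. fst p z * snd p w)"
    using assms(1) unfolding finite_rank_def by blast
  show ?thesis
    unfolding finite_rank_def
  proof (intro exI[of _ L] conjI ballI)
    fix p assume "p \<in> set L"
    then show "fst p holomorphic_on ball 0 r'" "snd p holomorphic_on ball 0 r'"
      using L(1) holomorphic_on_subset[OF _ sub] by blast+
  next
    fix z w :: complex assume "z \<in> ball 0 r'" "w \<in> ball 0 r'"
    then show "K z w = (\<Sum>p\<leftarrow>L. fst p z * snd p w)" using L(2) sub by blast
  qed
qed

lemma nonzero_near_centre:
  assumes "f holomorphic_on ball 0 r" "r > 0" "f 0 \<noteq> (0::complex)"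
  shows "\<exists>\<rho>. 0 < \<rho> \<and> \<rho> \<le> r \<and> (\<forall>z\<in>ball 0 \<rho>. f z \<noteq> 0)"
proof -
  have "continuous_on (ball 0 r) f" by (rule holomorphic_on_imp_continuous_on[OF assms(1)])
  then have "open (ball 0 r \<inter> f -` (- {0}))" by (rule continuous_open_preimage) auto
  moreover have "0 \<in> ball 0 r \<inter> f -` (- {0})" using assms by simp
  ultimately obtain e where e: "e > 0" "ball 0 e \<subseteq> ball 0 r \<inter> f -` (- {0})"
    unfolding open_contains_ball by blast
  show ?thesis
    by (intro exI[of _ "min e r"]) (use e assms(2) in auto)
qed

text \<open>The equation is homogeneous in \<open>P\<close>, and jointly in \<open>H\<close> and \<open>R\<close>, with respect to factors that depend on \<open>w\<close>
  only. So after polarisation \<open>P\<close> and \<open>H\<close> can be normalised to be \<open>1\<close> at \<open>z = 0\<close>. If the normalised \<open>H\<close> is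
  independent of \<open>w\<close>, the logarithmic derivative of \<open>H\<close> is a function \<open>C\<close> of \<open>z\<close> alone.\<close>

theorem diagonal_equation_rigidity:
  fixes s :: complex
  assumes r: "r > 0" and P: "finite_rank r P" and H: "finite_rank r H" and R: "finite_rank r R"
    and E: "E holomorphic_on ball 0 r" and P0: "P 0 0 \<noteq> 0" and H0: "H 0 0 \<noteq> 0"
    and eq: "\<And>z. z \<in> ball 0 r \<Longrightarrow>
      dz P z (cnj z) * (H z (cnj z))\<^sup>2 - s * dz H z (cnj z) * H z (cnj z) * P z (cnj z)
       + (dz R z (cnj z) * H z (cnj z) - R z (cnj z) * dz H z (cnj z)) * P z (cnj z) = E z * P z (cnj z) * (H z (cnj z))\<^sup>2"
  shows "\<exists>\<rho> D. 0 < \<rho> \<and> \<rho> \<le> r \<and> D holomorphic_on ball 0 \<rho> \<and>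
       (\<forall>z\<in>ball 0 \<rho>. \<forall>w\<in>ball 0 \<rho>. dz R z w * H z w - R z w * dz H z w = D z * (H z w)\<^sup>2) \<and>
       ((\<exists>l m. m > 0 \<and> of_nat l = s * of_nat m) \<or>
        (\<exists>C. C holomorphic_on ball 0 \<rho> \<and> (\<forall>z\<in>ball 0 \<rho>. \<forall>w\<in>ball 0 \<rho>. dz H z w = C z * H z w)))"
proof -
  define K where "K z w = dz P z w * (H z w)\<^sup>2 - s * dz H z w * H z w * P z w
       + (dz R z w * H z w - R z w * dz H z w) * P z w - E z * P z w * (H z w)\<^sup>2" for z w
  have K: "finite_rank r K"
    unfolding K_def
    by (intro finite_rank_add finite_rank_diff finite_rank_mult finite_rank_power finite_rank_dz finite_rank_const
        finite_rank_left[OF E] P H R)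
  have K0: "K z w = 0" if "z \<in> ball 0 r" "w \<in> ball 0 r" for z w
    by (rule polarisation[OF K r _ that]) (simp add: K_def eq)
  have hol: "(\<lambda>w. P 0 w) holomorphic_on ball 0 r" "(\<lambda>w. H 0 w) holomorphic_on ball 0 r" "(\<lambda>z. H z 0) holomorphic_on ball 0 r"
    using r by (auto intro: finite_rank_holomorphic_right[OF P] finite_rank_holomorphic_right[OF H] finite_rank_holomorphic[OF H])
  obtain \<rho>1 where \<rho>1: "0 < \<rho>1" "\<rho>1 \<le> r" "\<And>w. w \<in> ball 0 \<rho>1 \<Longrightarrow> P 0 w \<noteq> 0"
    using nonzero_near_centre[OF hol(1) r P0] by blast
  obtain \<rho>2 where \<rho>2: "0 < \<rho>2" "\<rho>2 \<le> r" "\<And>w. w \<in> ball 0 \<rho>2 \<Longrightarrow> H 0 w \<noteq> 0"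
    using nonzero_near_centre[OF hol(2) r H0] by blast
  obtain \<rho>3 where \<rho>3: "0 < \<rho>3" "\<rho>3 \<le> r" "\<And>z. z \<in> ball 0 \<rho>3 \<Longrightarrow> H z 0 \<noteq> 0"
    using nonzero_near_centre[OF hol(3) r H0] by blast
  define \<rho> where "\<rho> = min \<rho>1 (min \<rho>2 \<rho>3)"
  have \<rho>: "0 < \<rho>" "\<rho> \<le> r" using \<rho>1 \<rho>2 \<rho>3 by (auto simp: \<rho>_def)
  have sub: "ball 0 \<rho> \<subseteq> ball (0::complex) r" using \<rho> by (simp add: subset_ball)
  have nz: "P 0 w \<noteq> 0" "H 0 w \<noteq> 0" "H w 0 \<noteq> 0" if "w \<in> ball 0 \<rho>" for w
    using that \<rho>1(3)[of w] \<rho>2(3)[of w] \<rho>3(3)[of w] by (auto simp: \<rho>_def)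
  define p where "p w = inverse (P 0 w)" for w
  define c where "c w = inverse (H 0 w)" for w
  have p: "p holomorphic_on ball 0 \<rho>" and c: "c holomorphic_on ball 0 \<rho>"
    unfolding p_def c_def by (intro holomorphic_on_inverse holomorphic_on_subset[OF hol(1) sub] holomorphic_on_subset[OF hol(2) sub] nz; assumption)+
  have c_nz: "c w \<noteq> 0" if "w \<in> ball 0 \<rho>" for w using nz[OF that] by (simp add: c_def)
  have fr: "finite_rank \<rho> (\<lambda>z w. g w * M z w)" if "g holomorphic_on ball 0 \<rho>" "finite_rank r M" for g M
    using finite_rank_mult[OF finite_rank_right[OF that(1)] finite_rank_subset[OF that(2) \<rho>(2)]] .
  have dz: "dz (\<lambda>z w. g w * M z w) z w = g w * dz M z w" if "finite_rank r M" "z \<in> ball 0 \<rho>" "w \<in> ball 0 \<rho>" for g M z w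
  proof -
    have "((\<lambda>z. M z w) has_field_derivative dz M z w) (at z)"
      using dz_has_derivative[OF that(1)] that(2,3) sub by blast
    then have "((\<lambda>z. g w * M z w) has_field_derivative g w * dz M z w) (at z)" by (rule DERIV_cmult)
    then show ?thesis unfolding dz_def by (rule DERIV_imp_deriv)
  qed
  have eq': "dz (\<lambda>z w. p w * P z w) z w * (c w * H z w)\<^sup>2
         - s * dz (\<lambda>z w. c w * H z w) z w * (c w * H z w) * (p w * P z w)
         + (dz (\<lambda>z w. c w * R z w) z w * (c w * H z w) - (c w * R z w) * dz (\<lambda>z w. c w * H z w) z w) * (p w * P z w)
        = E z * (p w * P z w) * (c w * H z w)\<^sup>2" if zw: "z \<in> ball 0 \<rho>" "w \<in> ball 0 \<rho>" for z w
  proof -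
    have "K z w = 0" using K0 zw sub by blast
    then have "p w * (c w)\<^sup>2 * K z w = 0" by simp
    then show ?thesis
      unfolding dz[OF P zw] dz[OF H zw] dz[OF R zw] K_def by (simp add: algebra_simps power2_eq_square)
  qed
  have P1: "p w * P 0 w = 1" and H1: "c w * H 0 w = 1" if "w \<in> ball 0 \<rho>" for w
    using nz[OF that] by (simp_all add: p_def c_def)
  note rigid = kernel_equation_rigidity[OF \<rho>(1) fr[OF p P] fr[OF c H] fr[OF c R] holomorphic_on_subset[OF E sub] P1 H1 eq']
  obtain D where D: "D holomorphic_on ball 0 \<rho>" "\<forall>z\<in>ball 0 \<rho>. \<forall>w\<in>ball 0 \<rho>. dz (\<lambda>z w. c w * R z w) z w * (c w * H z w)
          - (c w * R z w) * dz (\<lambda>z w. c w * H z w) z w = D z * (c w * H z w)\<^sup>2"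
    using rigid(1) by blast
  have D': "dz R z w * H z w - R z w * dz H z w = D z * (H z w)\<^sup>2" if zw: "z \<in> ball 0 \<rho>" "w \<in> ball 0 \<rho>" for z w
  proof -
    have "(c w)\<^sup>2 * (dz R z w * H z w - R z w * dz H z w) = (c w)\<^sup>2 * (D z * (H z w)\<^sup>2)"
      using D(2)[rule_format, OF zw] unfolding dz[OF H zw] dz[OF R zw] by (simp add: algebra_simps power2_eq_square)
    then show ?thesis using c_nz[OF zw(2)] by simp
  qed
  have "(\<exists>l m. m > 0 \<and> of_nat l = s * of_nat m) \<or>
        (\<exists>C. C holomorphic_on ball 0 \<rho> \<and> (\<forall>z\<in>ball 0 \<rho>. \<forall>w\<in>ball 0 \<rho>. dz H z w = C z * H z w))"
  proof (cases "\<exists>z\<in>ball 0 \<rho>. \<exists>w\<in>ball 0 \<rho>. c w * H z w \<noteq> c 0 * H z 0")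
    case True
    then show ?thesis using rigid(2) by blast
  next
    case False
    define C where "C z = dz H z 0 / H z 0" for z
    have 0: "0 \<in> ball (0::complex) \<rho>" using \<rho> by simp
    have "(\<lambda>z. dz H z 0) holomorphic_on ball 0 r" "(\<lambda>z. H z 0) holomorphic_on ball 0 r"
      using finite_rank_holomorphic[OF finite_rank_dz[OF H], of 0] hol(3) r by auto
    then have "C holomorphic_on ball 0 \<rho>"
      unfolding C_def by (intro holomorphic_on_divide nz holomorphic_on_subset[OF _ sub])
    moreover have "dz H z w = C z * H z w" if zw: "z \<in> ball 0 \<rho>" "w \<in> ball 0 \<rho>" for z w
    proof -
      have d: "((\<lambda>z. c w * H z w) has_field_derivative c w * dz H z w) (at z)" if "w \<in> ball 0 \<rho>" for w
        using DERIV_cmult[OF dz_has_derivative[OF H]] zw(1) that sub by blast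
      have "((\<lambda>z. c 0 * H z 0) has_field_derivative c w * dz H z w) (at z)"
        by (rule has_field_derivative_transform_within_open[OF d[OF zw(2)] open_ball zw(1)]) (use False zw in auto)
      then have "c w * dz H z w = c 0 * dz H z 0" using d[OF 0] DERIV_unique by blast
      also have "\<dots> = C z * (c 0 * H z 0)" using nz(3)[OF zw(1)] by (simp add: C_def)
      also have "c 0 * H z 0 = c w * H z w" using False zw by auto
      finally have "c w * dz H z w = c w * (C z * H z w)" by simp
      then show ?thesis using c_nz[OF zw(2)] by simp
    qed
    ultimately show ?thesis by blast
  qed
  then show ?thesis using \<rho> D(1) D' by blast
qed

text \<open>Wirtinger derivatives in one variable, given together: \<open>a\<close> is the holomorphic and \<open>b\<close> the antiholomorphic one.\<close>

definition wirt :: "(complex \<Rightarrow> complex) \<Rightarrow> complex \<Rightarrow> complex \<Rightarrow> complex \<Rightarrow> bool" where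
  "wirt f a b z \<longleftrightarrow> (f has_derivative (\<lambda>t. t * a + cnj t * b)) (at z)"

lemma wirt_unique:
  assumes "wirt f a b z" "wirt f a' b' z" shows "a = a'" "b = b'"
proof -
  have e: "t * a + cnj t * b = t * a' + cnj t * b'" for t
    using has_derivative_unique[OF assms[unfolded wirt_def]] by (rule fun_cong)
  have 1: "a + b = a' + b'" using e[of 1] by simp
  have "\<i> * (a - b) = \<i> * (a' - b')" using e[of \<i>] by (simp add: algebra_simps)
  then have 2: "a - b = a' - b'" by simp
  have "2 * a = (a + b) + (a - b)" by simp
  also have "\<dots> = 2 * a'" unfolding 1 2 by simp
  finally show "a = a'" by simp
  with 1 show "b = b'" by simp
qed

lemma wirt_cong: "wirt f a b z \<Longrightarrow> open S \<Longrightarrow> z \<in> S \<Longrightarrow> (\<And>x. x \<in> S \<Longrightarrow> f x = g x) \<Longrightarrow> wirt g a b z"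
  unfolding wirt_def by (rule has_derivative_transform_within_open)

lemma wirt_eq_rhs: "wirt f a b z \<Longrightarrow> a = a' \<Longrightarrow> b = b' \<Longrightarrow> wirt f a' b' z" by simp

lemma wirt_field: "wirt f a 0 z \<longleftrightarrow> (f has_field_derivative a) (at z)"
proof -
  have "(\<lambda>t. t * a + cnj t * 0) = (*) a" by (simp add: fun_eq_iff mult.commute)
  then show ?thesis by (simp only: wirt_def has_field_derivative_def)
qed

lemma wirt_const: "wirt (\<lambda>z. c) 0 0 z"
  unfolding wirt_def by (rule has_derivative_eq_rhs[OF has_derivative_const]) simp

lemma wirt_add: "wirt f a b z \<Longrightarrow> wirt g a' b' z \<Longrightarrow> wirt (\<lambda>z. f z + g z) (a + a') (b + b') z"
  unfolding wirt_def by (rule has_derivative_eq_rhs, rule has_derivative_add) (assumption | simp add: fun_eq_iff algebra_simps)+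

lemma wirt_diff: "wirt f a b z \<Longrightarrow> wirt g a' b' z \<Longrightarrow> wirt (\<lambda>z. f z - g z) (a - a') (b - b') z"
  unfolding wirt_def by (rule has_derivative_eq_rhs, rule has_derivative_diff) (assumption | simp add: fun_eq_iff algebra_simps)+

lemma wirt_mult: "wirt f a b z \<Longrightarrow> wirt g a' b' z \<Longrightarrow> wirt (\<lambda>z. f z * g z) (f z * a' + a * g z) (f z * b' + b * g z) z"
  unfolding wirt_def by (rule has_derivative_eq_rhs, rule has_derivative_mult) (assumption | simp add: fun_eq_iff algebra_simps)+

lemma wirt_cmult: "wirt f a b z \<Longrightarrow> wirt (\<lambda>z. c * f z) (c * a) (c * b) z"
  using wirt_mult[OF wirt_const[of c]] by simp

lemma wirt_cnj: "wirt f a b z \<Longrightarrow> wirt (\<lambda>z. cnj (f z)) (cnj b) (cnj a) z"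
  unfolding wirt_def
  by (rule has_derivative_eq_rhs, rule bounded_linear.has_derivative[OF bounded_linear_cnj]) (assumption | simp add: fun_eq_iff algebra_simps)+

lemma wirt_sum: "(\<And>i. i \<in> I \<Longrightarrow> wirt (f i) (a i) (b i) z) \<Longrightarrow> wirt (\<lambda>z. \<Sum>i\<in>I. f i z) (\<Sum>i\<in>I. a i) (\<Sum>i\<in>I. b i) z"
  by (induction I rule: infinite_finite_induct) (auto intro: wirt_add wirt_const)

lemma wirt_power:
  assumes "wirt f (a * f z) b z" shows "\<exists>b'. wirt (\<lambda>z. f z ^ n) (of_nat n * a * f z ^ n) b' z"
proof (induction n)
  case 0
  show ?case using wirt_const[of 1] by auto
next
  case (Suc n)
  then obtain b' where "wirt (\<lambda>z. f z ^ n) (of_nat n * a * f z ^ n) b' z" by blast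
  from wirt_mult[OF assms this] have "wirt (\<lambda>z. f z ^ Suc n) (of_nat (Suc n) * a * f z ^ Suc n) (f z * b' + b * f z ^ n) z"
    by (simp add: algebra_simps)
  then show ?case by blast
qed

lemma wirt_holomorphic:
  assumes "open S" "\<And>z. z \<in> S \<Longrightarrow> \<exists>a. wirt f a 0 z" shows "f holomorphic_on S"
  unfolding holomorphic_on_open[OF assms(1)] using assms(2) unfolding wirt_field by blast

lemma holomorphic_wirt: "f holomorphic_on S \<Longrightarrow> open S \<Longrightarrow> z \<in> S \<Longrightarrow> wirt f (deriv f z) 0 z"
  unfolding wirt_field by (rule holomorphic_derivI)

lemma finite_rank_diagonal:
  assumes "finite_rank r K" "z \<in> ball 0 r"
  shows "\<exists>b. wirt (\<lambda>z. K z (cnj z)) (dz K z (cnj z)) b z"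
  using assms(1)
proof (induction rule: finite_rank_induct)
  case zero
  have "dz (\<lambda>z w. 0) z (cnj z) = 0" by (simp add: dz_def)
  then show ?case using wirt_const[of 0] by auto
next
  case (tensor a b K)
  have cz: "cnj z \<in> ball 0 r" using assms(2) by simp
  have da: "(a has_field_derivative deriv a z) (at z)" by (rule holomorphic_derivI[OF tensor(1) open_ball assms(2)])
  obtain c where c: "wirt (\<lambda>z. K z (cnj z)) (dz K z (cnj z)) c z" using tensor by blast
  have "((\<lambda>z. a z * b (cnj z')) has_field_derivative deriv a z * b (cnj z')) (at z)" for z' by (rule DERIV_cmult_right[OF da])
  then have "((\<lambda>z. a z * b (cnj z') + K z (cnj z')) has_field_derivative deriv a z * b (cnj z') + dz K z (cnj z')) (at z)" if "z' \<in> ball 0 r" for z'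
    using dz_has_derivative[OF tensor(3) assms(2)] that by (intro DERIV_add) auto
  from DERIV_imp_deriv[OF this[OF assms(2)]]
  have e: "dz (\<lambda>z w. a z * b w + K z w) z (cnj z) = deriv a z * b (cnj z) + dz K z (cnj z)" by (simp add: dz_def)
  have "(b has_derivative (\<lambda>t. deriv b (cnj z) * t)) (at (cnj z))"
    using holomorphic_derivI[OF tensor(2) open_ball cz] by (simp add: has_field_derivative_def)
  from has_derivative_compose[OF bounded_linear_imp_has_derivative[OF bounded_linear_cnj] this]
  have "wirt (\<lambda>z. b (cnj z)) 0 (deriv b (cnj z)) z" by (simp add: wirt_def mult.commute)
  from wirt_add[OF wirt_mult[OF da[folded wirt_field] this] c] show ?case unfolding e by auto
next
  case (cong K K')
  have "(\<lambda>z. K' z (cnj z)) = (\<lambda>z. K' z (cnj z))" ..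
  obtain b where b: "wirt (\<lambda>z. K z (cnj z)) (dz K z (cnj z)) b z" using cong by blast
  have "dz K' z (cnj z) = dz K z (cnj z)" by (rule dz_cong) (use assms(2) cong in auto)
  moreover have "wirt (\<lambda>z. K' z (cnj z)) (dz K z (cnj z)) b z"
    by (rule wirt_cong[OF b open_ball assms(2)]) (use cong in auto)
  ultimately show ?case by auto
qed

text \<open>The derivative of a kernel in its first variable can be read off from the diagonal, where the geometric
  quantities live.\<close>

lemma finite_rank_diagonal_unique:
  assumes "finite_rank r K" "z \<in> ball 0 r" "wirt f a b z" "\<And>z. z \<in> ball 0 r \<Longrightarrow> K z (cnj z) = f z"
  shows "dz K z (cnj z) = a"
proof -
  obtain c where "wirt (\<lambda>z. K z (cnj z)) (dz K z (cnj z)) c z" using finite_rank_diagonal[OF assms(1,2)] by blast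
  moreover have "wirt (\<lambda>z. K z (cnj z)) a b z"
    by (rule wirt_cong[OF assms(3) open_ball assms(2)]) (simp add: assms(4))
  ultimately show ?thesis by (rule wirt_unique(1))
qed

lemma finite_rank_det:
  fixes K :: "'k::finite \<Rightarrow> 'k \<Rightarrow> complex \<Rightarrow> complex \<Rightarrow> complex"
  assumes "\<And>i j. finite_rank r (K i j)" shows "finite_rank r (\<lambda>z w. det (\<chi> i j. K i j z w))"
  unfolding det_def vec_lambda_beta
  by (intro finite_rank_sum finite_rank_mult finite_rank_const finite_rank_prod assms)

lemma matrix_of_linear:
  fixes T :: "complex^'k \<Rightarrow> complex^'l"
  assumes "\<And>u v. T (u + v) = T u + T v" "\<And>c u. T (c *s u) = c *s T u"
  shows "(\<chi> i j. T (axis j 1) $ i) *v u = T u"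
  by (simp add: linear_expand_vec[of T u, OF assms] vec_eq_iff matrix_vector_mult_def mult.commute)

context sesquilinear
begin

text \<open>The conjugation of \<open>w\<close> makes the kernel holomorphic in \<open>w\<close>; the form itself is its restriction to
  \<open>w = cnj z\<close>.\<close>

definition kernel :: "(complex \<Rightarrow> complex^'n) \<Rightarrow> (complex \<Rightarrow> complex^'n) \<Rightarrow> complex \<Rightarrow> complex \<Rightarrow> complex" where
  "kernel a b z w = (\<Sum>i\<in>UNIV. \<Sum>j\<in>UNIV. a z $ i * cnj (b (cnj w) $ j) * q (axis i 1) (axis j 1))"

lemma kernel_diagonal: "kernel a b z (cnj z) = q (a z) (b z)"
  by (simp add: kernel_def expand[of "a z" "b z"])

lemma finite_rank_kernel:
  assumes "\<And>i. (\<lambda>z. a z $ i) holomorphic_on ball 0 r" "\<And>i. (\<lambda>z. b z $ i) holomorphic_on ball 0 r"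
  shows "finite_rank r (kernel a b)"
proof -
  have "(\<lambda>w. cnj (b (cnj w) $ j)) holomorphic_on ball 0 r" for j
  proof -
    have ball: "cnj ` ball (0::complex) r = ball 0 r"
    proof
      have "x \<in> cnj ` ball 0 r" if "x \<in> ball 0 r" for x
        using that by (intro image_eqI[of x cnj "cnj x"]) auto
      then show "ball 0 r \<subseteq> cnj ` ball (0::complex) r" by blast
    qed auto
    have "cnj \<circ> (\<lambda>z. b z $ j) \<circ> cnj holomorphic_on ball 0 r"
      by (rule holomorphic_on_compose_cnj_cnj) (simp_all only: ball assms(2) open_ball)
    then show ?thesis by (simp add: o_def)
  qed
  then show ?thesis
    unfolding kernel_def[abs_def]
    by (intro finite_rank_sum finite_rank_mult finite_rank_const finite_rank_tensor assms)
qed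

lemma wirt_form:
  assumes "\<And>i. ((\<lambda>z. a z $ i) has_field_derivative a' $ i) (at z)" "\<And>i. ((\<lambda>z. b z $ i) has_field_derivative b' $ i) (at z)"
  shows "wirt (\<lambda>z. q (a z) (b z)) (q a' (b z)) (q (a z) b') z"
proof -
  have 1: "wirt (\<lambda>z. a z $ i * cnj (b z $ j) * q (axis i 1) (axis j 1)) (a' $ i * cnj (b z $ j) * q (axis i 1) (axis j 1))
      (a z $ i * cnj (b' $ j) * q (axis i 1) (axis j 1)) z" for i j
    using wirt_cmult[OF wirt_mult[OF assms(1)[of i, folded wirt_field] wirt_cnj[OF assms(2)[of j, folded wirt_field]]], of "q (axis i 1) (axis j 1)"]
    by (simp add: algebra_simps)
  have "wirt (\<lambda>z. \<Sum>i\<in>UNIV. \<Sum>j\<in>UNIV. a z $ i * cnj (b z $ j) * q (axis i 1) (axis j 1))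
    (\<Sum>i\<in>UNIV. \<Sum>j\<in>UNIV. a' $ i * cnj (b z $ j) * q (axis i 1) (axis j 1))
    (\<Sum>i\<in>UNIV. \<Sum>j\<in>UNIV. a z $ i * cnj (b' $ j) * q (axis i 1) (axis j 1)) z"
    by (intro wirt_sum 1)
  then show ?thesis by (simp only: expand[symmetric])
qed

end

section \<open>Complex lines mapped into a flat space form\<close>

lemma has_derivative_scale_nth:
  assumes "(V has_derivative (\<lambda>t. t *s V')) (at z)" shows "((\<lambda>z. V z $ i) has_field_derivative V' $ i) (at z)"
proof -
  have "((\<lambda>z. V z $ i) has_derivative (\<lambda>t. (t *s V') $ i)) (at z)"
    by (rule bounded_linear.has_derivative[OF bounded_linear_vec_nth assms])
  moreover have "(\<lambda>t. (t *s V') $ i) = (*) (V' $ i)" by (simp add: fun_eq_iff mult.commute)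
  ultimately show ?thesis unfolding has_field_derivative_def by (simp only:)
qed

lemma nth_holomorphic:
  assumes "\<And>z. z \<in> ball 0 r \<Longrightarrow> (V has_derivative (\<lambda>t. t *s V' z)) (at z)" shows "(\<lambda>z. V z $ i) holomorphic_on ball 0 r"
  unfolding holomorphic_on_open[OF open_ball] using has_derivative_scale_nth[OF assms] by blast

lemma has_derivative_scale_vec:
  fixes V :: "complex \<Rightarrow> complex^'k"
  assumes "\<And>i. ((\<lambda>z. V z $ i) has_field_derivative V' $ i) (at z)"
  shows "(V has_derivative (\<lambda>t. t *s V')) (at z)"
proof (rule has_derivative_vec)
  fix i
  have "(\<lambda>t. (t *s V') $ i) = (*) (V' $ i)" by (simp add: fun_eq_iff mult.commute)
  then show "((\<lambda>z. V z $ i) has_derivative (\<lambda>t. (t *s V') $ i)) (at z)"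
    using assms[of i] unfolding has_field_derivative_def by (simp only:)
qed

lemma matrix_vector_holomorphic:
  assumes "\<And>i j. (\<lambda>z. \<Psi> z $ i $ j) holomorphic_on S" "\<And>j. (\<lambda>z. u z $ j) holomorphic_on S"
  shows "(\<lambda>z. (\<Psi> z *v u z) $ i) holomorphic_on S"
  unfolding matrix_vector_mult_def vec_lambda_beta by (intro holomorphic_on_sum holomorphic_on_mult assms)

lemma vector_primitive:
  fixes u :: "complex \<Rightarrow> complex^'k"
  assumes "\<And>i. (\<lambda>z. u z $ i) holomorphic_on ball 0 r" "r > 0"
  shows "\<exists>f. \<forall>z\<in>ball 0 r. \<forall>i. ((\<lambda>z. f z $ i) has_field_derivative u z $ i) (at z)"
proof -
  have "\<forall>i. \<exists>F. \<forall>z\<in>ball 0 r. (F has_field_derivative u z $ i) (at z)"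
    using primitive_vanishing_at_centre[OF assms] by blast
  then obtain F where F: "\<And>i z. z \<in> ball 0 r \<Longrightarrow> (F i has_field_derivative u z $ i) (at z)" by metis
  show ?thesis
    by (rule exI[of _ "\<lambda>z. \<chi> i. F i z"]) (simp add: F)
qed

text \<open>What remains of the immersion on a complex line: the curve \<open>y\<close> with velocity \<open>y1\<close>, the image \<open>\<xi>\<close> of the soliton
  field, the images \<open>G i\<close> of the coordinate fields, and the logarithmic derivative \<open>\<tau>\<close> of the volume form. The
  soliton equation enters as the antiholomorphic derivative of \<open>\<tau>\<close>.\<close>

locale line_data = kaehler_space_form W h \<kappa>
  for W :: "(complex^'m) set" and h \<kappa> +
  fixes r :: real and y y1 y2 \<xi> \<xi>1 :: "complex \<Rightarrow> complex^'m"
    and G G1 :: "'n::finite \<Rightarrow> complex \<Rightarrow> complex^'m" and \<tau> :: "complex \<Rightarrow> complex" and l :: real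
  assumes r: "r > 0" and yW: "z \<in> ball 0 r \<Longrightarrow> y z \<in> W"
    and dy: "z \<in> ball 0 r \<Longrightarrow> (y has_derivative (\<lambda>t. t *s y1 z)) (at z)"
    and dy1: "z \<in> ball 0 r \<Longrightarrow> (y1 has_derivative (\<lambda>t. t *s y2 z)) (at z)"
    and d\<xi>: "z \<in> ball 0 r \<Longrightarrow> (\<xi> has_derivative (\<lambda>t. t *s \<xi>1 z)) (at z)"
    and dG: "z \<in> ball 0 r \<Longrightarrow> (G i has_derivative (\<lambda>t. t *s G1 i z)) (at z)"
    and d\<tau>: "z \<in> ball 0 r \<Longrightarrow> \<exists>a. wirt \<tau> a (- (of_real (l / 2) * q (y z) (y1 z) (y1 z))
        - of_real (Re (q (y z) (\<Gamma> (y z) (y1 z) (\<xi> z) + \<xi>1 z) (y1 z)))) z"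
    and ddet: "z \<in> ball 0 r \<Longrightarrow> \<exists>b. wirt (\<lambda>z. det (\<chi> i j. q (y z) (G i z) (G j z)))
        (\<tau> z * det (\<chi> i j. q (y z) (G i z) (G j z))) b z"
    and det0: "det (\<chi> i j. q (y 0) (G i 0) (G j 0)) \<noteq> 0"
begin

definition \<gamma> where "\<gamma> z = q (y z) (y1 z) (y1 z)"

definition \<beta> where "\<beta> z = q (y z) (\<Gamma> (y z) (y1 z) (\<xi> z) + \<xi>1 z) (y1 z)"

lemma wirt_q:
  assumes z: "z \<in> ball 0 r" and V: "(V has_derivative (\<lambda>t. t *s V')) (at z)" and Z: "(Z has_derivative (\<lambda>t. t *s Z')) (at z)"
  shows "wirt (\<lambda>z. q (y z) (V z) (Z z)) (q (y z) (\<Gamma> (y z) (y1 z) (V z) + V') (Z z)) (q (y z) (V z) (\<Gamma> (y z) (y1 z) (Z z) + Z')) z"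
proof -
  interpret Y: hermitian_product "q (y z)" by (rule hermitian[OF yW[OF z]])
  show ?thesis
    unfolding wirt_def
    by (rule has_derivative_eq_rhs[OF metric_compatible[OF yW[OF z] dy[OF z] V Z]])
      (simp add: fun_eq_iff christoffel_scale_left[OF yW[OF z]] Y.scale_left Y.scale_right Y.add_left Y.add_right algebra_simps)
qed

lemma dv_scale: "x \<in> W \<Longrightarrow> dv x v w (c *s u) = c *s dv x v w u"
  by (simp add: dv_def vec_eq_iff del_scale christoffel_differentiable)

lemma christoffel_line:
  assumes z: "z \<in> ball 0 r" and V: "(V has_derivative (\<lambda>t. t *s V')) (at z)" and Z: "(Z has_derivative (\<lambda>t. t *s Z')) (at z)"
  shows "((\<lambda>z. \<Gamma> (y z) (V z) (Z z)) has_derivative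
    (\<lambda>t. t *s (dv (y z) (V z) (Z z) (y1 z) + \<Gamma> (y z) V' (Z z) + \<Gamma> (y z) (V z) Z') + cnj t *s cv (y z) (V z) (Z z) (y1 z))) (at z)"
  by (rule has_derivative_eq_rhs[OF christoffel_along[OF yW[OF z] dy[OF z] V Z]])
    (simp add: fun_eq_iff christoffel_scale_left[OF yW[OF z]] christoffel_scale_right[OF yW[OF z]] cv_scale[OF yW[OF z]]
      dv_scale[OF yW[OF z]] vec_eq_iff algebra_simps)

lemma vec_const: "((\<lambda>z. v) has_derivative (\<lambda>t. t *s 0)) (at z)" for v :: "complex^'k"
  by (rule has_derivative_scale_vec) simp

text \<open>The connection is holomorphic and its parallel frame makes the metric constant. With \<open>f' = \<Psi> y1\<close>, the function
  \<open>(l |f|\<^sup>2 + 2 Re \<langle>\<Psi> \<xi>, f\<rangle>) / 2\<close> has \<open>- \<partial>bar \<tau>\<close> as its complex Hessian, by the soliton equation.\<close>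

theorem flat_case:
  assumes \<kappa>: "\<kappa> = 0" shows "of_real (l / 2) * \<gamma> 0 + of_real (Re (\<beta> 0)) = 0"
proof -
  define A :: "complex \<Rightarrow> complex^'m^'m" where "A z = (\<chi> i j. \<Gamma> (y z) (y1 z) (axis j 1) $ i)" for z
  have A: "A z *v u = \<Gamma> (y z) (y1 z) u" if "z \<in> ball 0 r" for z u
    unfolding A_def
    by (rule matrix_of_linear) (simp_all add: christoffel_add_right christoffel_scale_right yW[OF that])
  have "cv x v w u = 0" if "x \<in> W" for x v w u using cv_const[OF that] \<kappa> by (simp add: vec_eq_iff)
  then have "((\<lambda>z. \<Gamma> (y z) (y1 z) (axis j 1)) has_derivative
    (\<lambda>t. t *s (dv (y z) (y1 z) (axis j 1) (y1 z) + \<Gamma> (y z) (y2 z) (axis j 1) + \<Gamma> (y z) (y1 z) 0))) (at z)"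
    if z: "z \<in> ball 0 r" for z j
    using christoffel_line[OF z dy1[OF z] vec_const[of "axis j 1"]] yW[OF z] by simp
  from nth_holomorphic[OF this] have A_hol: "(\<lambda>z. A z $ i $ j) holomorphic_on ball 0 r" for i j
    by (simp add: A_def)
  define L where "L z = q (y z)" for z
  have L: "hermitian_product (L z)" if "z \<in> ball 0 r" for z unfolding L_def by (rule hermitian[OF yW[OF that]])
  have "\<exists>\<rho> \<Psi>. 0 < \<rho> \<and> \<rho> \<le> r \<and> (\<forall>i j. (\<lambda>z. \<Psi> z $ i $ j) holomorphic_on ball 0 \<rho>) \<and>
    (\<forall>z\<in>ball 0 \<rho>. \<forall>u v. L z u v = L 0 (\<Psi> z *v u) (\<Psi> z *v v))"
  proof (rule parallel_frame[OF r A_hol])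
    fix z u v assume z: "z \<in> ball (0::complex) r"
    show "L z u v = (\<Sum>i\<in>UNIV. \<Sum>j\<in>UNIV. u $ i * cnj (v $ j) * L z (axis i 1) (axis j 1))"
      unfolding L_def by (rule sesquilinear.expand[OF sesquilinear_q[OF yW[OF z]]])
    show "((\<lambda>z. L z u v) has_derivative (\<lambda>t. t * L z (A z *v u) v + cnj t * L z u (A z *v v))) (at z)"
      using wirt_q[OF z vec_const[of u] vec_const[of v]] by (simp add: A[OF z] L_def wirt_def)
  qed
  then obtain \<rho> \<Psi> where \<rho>: "0 < \<rho>" "\<rho> \<le> r" and \<Psi>: "\<And>i j. (\<lambda>z. \<Psi> z $ i $ j) holomorphic_on ball 0 \<rho>"
    and L\<Psi>: "\<And>z u v. z \<in> ball 0 \<rho> \<Longrightarrow> L z u v = L 0 (\<Psi> z *v u) (\<Psi> z *v v)" by blast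
  have sub: "z \<in> ball 0 r" if "z \<in> ball 0 \<rho>" for z using that \<rho> by simp
  interpret Q: hermitian_product "L 0" by (rule L) (simp add: r)
  define Y where "Y z = \<Psi> z *v y1 z" for z
  define T where "T z = \<Psi> z *v \<xi> z" for z
  define g where "g i z = \<Psi> z *v G i z" for i z
  have hol\<Psi>: "(\<lambda>z. (\<Psi> z *v u z) $ i) holomorphic_on ball 0 \<rho>"
    if "\<And>z. z \<in> ball 0 r \<Longrightarrow> (u has_derivative (\<lambda>t. t *s u' z)) (at z)" for u u' i
    by (rule matrix_vector_holomorphic[OF \<Psi>]) (rule nth_holomorphic, rule that, rule sub)
  have Y: "(\<lambda>z. Y z $ i) holomorphic_on ball 0 \<rho>" for i unfolding Y_def by (rule hol\<Psi>[OF dy1])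
  have T: "(\<lambda>z. T z $ i) holomorphic_on ball 0 \<rho>" for i unfolding T_def by (rule hol\<Psi>[OF d\<xi>])
  have g: "(\<lambda>z. g k z $ i) holomorphic_on ball 0 \<rho>" for k i unfolding g_def by (rule hol\<Psi>[OF dG])
  obtain f where f: "\<And>z i. z \<in> ball 0 \<rho> \<Longrightarrow> ((\<lambda>z. f z $ i) has_field_derivative Y z $ i) (at z)"
    using vector_primitive[OF Y \<rho>(1)] by blast
  have f_hol: "(\<lambda>z. f z $ i) holomorphic_on ball 0 \<rho>" for i
    unfolding holomorphic_on_open[OF open_ball] using f by blast
  define T1 where "T1 z = (\<chi> i. deriv (\<lambda>z. T z $ i) z)" for z
  define Y1 where "Y1 z = (\<chi> i. deriv (\<lambda>z. Y z $ i) z)" for z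
  have T1: "((\<lambda>z. T z $ i) has_field_derivative T1 z $ i) (at z)" if "z \<in> ball 0 \<rho>" for z i
    using holomorphic_derivI[OF T open_ball that] by (simp add: T1_def)
  have Y1: "((\<lambda>z. Y z $ i) has_field_derivative Y1 z $ i) (at z)" if "z \<in> ball 0 \<rho>" for z i
    using holomorphic_derivI[OF Y open_ball that] by (simp add: Y1_def)
  have \<beta>: "L 0 (T1 z) (Y z) = \<beta> z" if z: "z \<in> ball 0 \<rho>" for z
  proof (rule wirt_unique(1))
    show "wirt (\<lambda>z. L 0 (T z) (Y z)) (L 0 (T1 z) (Y z)) (L 0 (T z) (Y1 z)) z" by (rule Q.wirt_form[OF T1[OF z] Y1[OF z]])
    show "wirt (\<lambda>z. L 0 (T z) (Y z)) (\<beta> z) (q (y z) (\<xi> z) (\<Gamma> (y z) (y1 z) (y1 z) + y2 z)) z"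
      by (rule wirt_cong[OF wirt_q[OF sub[OF z] d\<xi>[OF sub[OF z]] dy1[OF sub[OF z]], folded \<beta>_def] open_ball z])
        (simp add: T_def Y_def L\<Psi>[symmetric], simp add: L_def)
  qed
  have \<gamma>: "L 0 (Y z) (Y z) = \<gamma> z" if z: "z \<in> ball 0 \<rho>" for z
    by (simp add: Y_def L\<Psi>[OF z, symmetric]) (simp add: L_def \<gamma>_def)
  define P where "P z w = det (\<chi> i j. Q.kernel (g i) (g j) z w)" for z w
  define R where "R z w = (1/2) * (of_real l * Q.kernel f f z w + (Q.kernel T f z w + Q.kernel f T z w))" for z w
  define Rz where "Rz z = (1/2) * (of_real l * L 0 (Y z) (f z) + (L 0 (T1 z) (f z) + L 0 (Y z) (T z)))" for z
  have P: "finite_rank \<rho> P" unfolding P_def by (intro finite_rank_det Q.finite_rank_kernel g)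
  have R: "finite_rank \<rho> R" unfolding R_def
    by (intro finite_rank_mult finite_rank_const finite_rank_add Q.finite_rank_kernel T f_hol)
  have P_diag: "P z (cnj z) = det (\<chi> i j. q (y z) (G i z) (G j z))" if "z \<in> ball 0 \<rho>" for z
    by (simp add: P_def Q.kernel_diagonal g_def L\<Psi>[OF that, symmetric]) (simp add: L_def)
  have Pz: "dz P z (cnj z) = \<tau> z * P z (cnj z)" if z: "z \<in> ball 0 \<rho>" for z
    using ddet[OF sub[OF z]] finite_rank_diagonal_unique[OF P z _ P_diag] by (auto simp: P_diag[OF z])
  have Rz: "dz R z (cnj z) = Rz z" if z: "z \<in> ball 0 \<rho>" for z
  proof (rule finite_rank_diagonal_unique[OF R z])
    show "wirt (\<lambda>z. (1/2) * (of_real l * L 0 (f z) (f z) + (L 0 (T z) (f z) + L 0 (f z) (T z)))) (Rz z)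
      ((1/2) * (of_real l * L 0 (f z) (Y z) + (L 0 (T z) (Y z) + L 0 (f z) (T1 z)))) z"
      unfolding Rz_def by (intro wirt_cmult wirt_add Q.wirt_form f T1 z)
  qed (simp add: R_def Q.kernel_diagonal)
  have Rzbar: "\<exists>a. wirt Rz a (of_real (l / 2) * \<gamma> z + of_real (Re (\<beta> z))) z" if z: "z \<in> ball 0 \<rho>" for z
  proof -
    define T2 where "T2 z = (\<chi> i. deriv (\<lambda>z. T1 z $ i) z)" for z
    have "(\<lambda>z. T1 z $ i) holomorphic_on ball 0 \<rho>" for i
      unfolding T1_def vec_lambda_beta by (rule holomorphic_deriv[OF T open_ball])
    then have T2: "((\<lambda>z. T1 z $ i) has_field_derivative T2 z $ i) (at z)" for i
      using holomorphic_derivI[OF _ open_ball z] by (simp add: T2_def)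
    have w: "wirt Rz ((1/2) * (of_real l * L 0 (Y1 z) (f z) + (L 0 (T2 z) (f z) + L 0 (Y1 z) (T z))))
      ((1/2) * (of_real l * L 0 (Y z) (Y z) + (L 0 (T1 z) (Y z) + L 0 (Y z) (T1 z)))) z"
      unfolding Rz_def by (intro wirt_cmult wirt_add Q.wirt_form f T1 Y1 T2 z)
    have c: "L 0 (Y z) (T1 z) = cnj (\<beta> z)" unfolding \<beta>[OF z, symmetric] by (simp add: Q.cnj)
    have e: "(1/2) * (of_real l * \<gamma> z + (\<beta> z + cnj (\<beta> z))) = of_real (l / 2) * \<gamma> z + of_real (Re (\<beta> z))"
      by (simp add: complex_add_cnj field_simps)
    from w show ?thesis unfolding c \<beta>[OF z] \<gamma>[OF z] e by blast
  qed
  \<comment> \<open>By the soliton equation the antiholomorphic derivatives of the two terms are opposite.\<close>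
  define E where "E z = \<tau> z + Rz z" for z
  have E: "E holomorphic_on ball 0 \<rho>"
  proof (rule wirt_holomorphic[OF open_ball])
    fix z :: complex assume z: "z \<in> ball 0 \<rho>"
    obtain a where a: "wirt \<tau> a (- (of_real (l / 2) * \<gamma> z) - of_real (Re (\<beta> z))) z"
      using d\<tau>[OF sub[OF z]] unfolding \<gamma>_def \<beta>_def by blast
    obtain b where b: "wirt Rz b (of_real (l / 2) * \<gamma> z + of_real (Re (\<beta> z))) z" using Rzbar[OF z] by blast
    show "\<exists>a. wirt E a 0 z" using wirt_add[OF a b] unfolding E_def by auto
  qed
  have dz1: "dz (\<lambda>z w. 1) z w = 0" for z w by (simp add: dz_def)
  have "\<exists>\<rho>' D. 0 < \<rho>' \<and> \<rho>' \<le> \<rho> \<and> D holomorphic_on ball 0 \<rho>' \<and>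
       (\<forall>z\<in>ball 0 \<rho>'. \<forall>w\<in>ball 0 \<rho>'. dz R z w * 1 - R z w * dz (\<lambda>z w. 1) z w = D z * 1\<^sup>2) \<and>
       ((\<exists>l m. m > 0 \<and> of_nat l = (0::complex) * of_nat m) \<or>
        (\<exists>C. C holomorphic_on ball 0 \<rho>' \<and> (\<forall>z\<in>ball 0 \<rho>'. \<forall>w\<in>ball 0 \<rho>'. dz (\<lambda>z w. 1) z w = C z * 1)))"
  proof (rule diagonal_equation_rigidity[OF \<rho>(1) P finite_rank_const R E])
    show "P 0 0 \<noteq> 0" using P_diag[of 0] \<rho>(1) det0 by simp
    show "(1::complex) \<noteq> 0" by simp
    fix z :: complex assume z: "z \<in> ball 0 \<rho>"
    show "dz P z (cnj z) * 1\<^sup>2 - 0 * dz (\<lambda>z w. 1) z (cnj z) * 1 * P z (cnj z) +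
         (dz R z (cnj z) * 1 - R z (cnj z) * dz (\<lambda>z w. 1) z (cnj z)) * P z (cnj z) = E z * P z (cnj z) * 1\<^sup>2"
      by (simp add: dz1 Pz[OF z] Rz[OF z] E_def algebra_simps)
  qed
  then obtain \<rho>' D where \<rho>': "0 < \<rho>'" "\<rho>' \<le> \<rho>" and D: "D holomorphic_on ball 0 \<rho>'"
    and RD': "\<forall>z\<in>ball 0 \<rho>'. \<forall>w\<in>ball 0 \<rho>'. dz R z w * 1 - R z w * dz (\<lambda>z w. 1) z w = D z * 1\<^sup>2" by blast
  have RD: "dz R z w = D z" if "z \<in> ball 0 \<rho>'" "w \<in> ball 0 \<rho>'" for z w
    using RD'[rule_format, OF that] by (simp add: dz1)
  have 0: "0 \<in> ball (0::complex) \<rho>'" "0 \<in> ball (0::complex) \<rho>" using \<rho>' \<rho> by auto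
  obtain a where a: "wirt Rz a (of_real (l / 2) * \<gamma> 0 + of_real (Re (\<beta> 0))) 0" using Rzbar[OF 0(2)] by blast
  have "wirt Rz (deriv D 0) 0 0"
  proof (rule wirt_cong[OF holomorphic_wirt[OF D open_ball 0(1)] open_ball 0(1)])
    fix z :: complex assume "z \<in> ball 0 \<rho>'"
    then show "D z = Rz z" using RD[of z "cnj z"] Rz[of z] \<rho>'(2) by simp
  qed
  from wirt_unique(2)[OF a this] show ?thesis .
qed

end

section \<open>Complex lines mapped into a negatively curved space form\<close>

text \<open>Vectors in \<open>\<complex> \<oplus> \<complex>\<^sup>m\<close>, indexed by an option type.\<close>

definition tail :: "complex^('m option) \<Rightarrow> complex^'m" where "tail S = (\<chi> i. S $ Some i)"

definition lift :: "complex \<Rightarrow> complex^'m \<Rightarrow> complex^('m option)" where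
  "lift s Y = (\<chi> k. case k of None \<Rightarrow> s | Some i \<Rightarrow> Y $ i)"

lemma lift_nth [simp]: "lift s Y $ None = s" "lift s Y $ Some i = Y $ i"
  by (simp_all add: lift_def)

lemma tail_lift [simp]: "tail (lift s Y) = Y" by (simp add: tail_def vec_eq_iff)
lemma tail_add: "tail (S + S') = tail S + tail S'" by (simp add: tail_def vec_eq_iff)
lemma tail_scale: "tail (c *s S) = c *s tail S" by (simp add: tail_def vec_eq_iff)
lemma lift_add: "lift (s + s') (Y + Y') = lift s Y + lift s' Y'"
  by (simp add: vec_eq_iff lift_def split: option.split)
lemma lift_scale: "lift (c * s) (c *s Y) = c *s lift s Y"
  by (simp add: vec_eq_iff lift_def split: option.split)

context kaehler_space_form
begin

text \<open>The power of the volume form whose logarithmic derivative is \<open>- \<mu>\<close>. For complex hyperbolic space it is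
  \<open>1 - |z|\<^sup>2\<close> up to the modulus of a holomorphic function.\<close>

definition Hf where "Hf x = (of_real (exp (- ln (norm (detq x)) / real (CARD('a) + 1))) :: complex)"

lemma Hf_nonzero: "Hf x \<noteq> 0" by (simp add: Hf_def)

lemma Hf_cnj: "cnj (Hf x) = Hf x" by (simp add: Hf_def)

lemma Hf_has_derivative:
  assumes x: "x \<in> U" shows "(Hf has_derivative (\<lambda>t. - (\<mu> x t + cnj (\<mu> x t)) * Hf x)) (at x)"
proof -
  define d where "d = detq x"
  have d: "d \<noteq> 0" using detq_nonzero[OF x] by (simp add: d_def)
  have real: "tr x t + cnj (tr x t) = of_real (2 * Re (tr x t))" for t by (simp add: complex_add_cnj)
  have "((\<lambda>x. norm (detq x)) has_derivative (\<lambda>t. ((tr x t + cnj (tr x t)) * d) \<bullet> sgn d)) (at x)"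
    using has_derivative_compose[OF detq_has_derivative[OF x] has_derivative_norm[OF detq_nonzero[OF x]]] by (simp add: d_def)
  moreover have "((tr x t + cnj (tr x t)) * d) \<bullet> sgn d = 2 * Re (tr x t) * norm d" for t
  proof -
    have "(tr x t + cnj (tr x t)) * d = (2 * Re (tr x t)) *\<^sub>R d" unfolding real scaleR_conv_of_real ..
    moreover have "d \<bullet> sgn d = norm d" using d by (simp add: sgn_div_norm dot_square_norm power2_eq_square)
    ultimately show ?thesis by simp
  qed
  ultimately have "((\<lambda>x. norm (detq x)) has_derivative (\<lambda>t. 2 * Re (tr x t) * norm d)) (at x)" by simp
  from has_derivative_ln[OF _ this]
  have "((\<lambda>x. ln (norm (detq x))) has_derivative (\<lambda>t. 2 * Re (tr x t))) (at x)"
    using d by (simp add: d_def[symmetric] inverse_eq_divide)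
  from has_derivative_exp[OF has_derivative_mult_right[OF this, of "- 1 / real (CARD('a) + 1)"]]
  have "((\<lambda>x. exp (- ln (norm (detq x)) / real (CARD('a) + 1))) has_derivative
     (\<lambda>t. exp (- ln (norm d) / real (CARD('a) + 1)) * (- (2 * Re (tr x t)) / real (CARD('a) + 1)))) (at x)"
    by (simp add: d_def mult.commute)
  from has_derivative_of_real[OF this]
  show ?thesis
    unfolding Hf_def
  proof (rule has_derivative_eq_rhs, intro ext)
    fix t
    have "\<mu> x t + cnj (\<mu> x t) = of_real (2 * Re (tr x t) / real (CARD('a) + 1))"
      unfolding \<mu>_def of_real_divide real[symmetric] of_real_of_nat_eq
      by (simp only: complex_cnj_divide complex_cnj_of_nat add_divide_distrib)
    then show "complex_of_real (exp (- ln (norm d) / real (CARD('a) + 1)) * (- (2 * Re (tr x t)) / real (CARD('a) + 1)))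
      = - (\<mu> x t + cnj (\<mu> x t)) * of_real (exp (- ln (norm (detq x)) / real (CARD('a) + 1)))"
      by (simp only: d_def) simp
  qed
qed

lemma
  assumes x: "x \<in> U"
  shows \<rho>_add1: "\<rho> x (u + u') v = \<rho> x u v + \<rho> x u' v" and \<rho>_add2: "\<rho> x v (u + u') = \<rho> x v u + \<rho> x v u'"
    and \<rho>_scale1: "\<rho> x (c *s u) v = c * \<rho> x u v" and \<rho>_scale2: "\<rho> x v (c *s u) = c * \<rho> x v u"
proof -
  note d = \<mu>_differentiable[OF x]
  show "\<rho> x (u + u') v = \<rho> x u v + \<rho> x u' v" "\<rho> x (c *s u) v = c * \<rho> x u v"
    by (simp_all add: \<rho>_def del_add del_scale d \<mu>_add[OF x] \<mu>_scale[OF x] christoffel_add_left[OF x] christoffel_scale_left[OF x] algebra_simps)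
  have "del (\<lambda>y. \<mu> y (u + u')) x v = del (\<lambda>y. \<mu> y u + \<mu> y u') x v" by (rule del_cong(1)[OF open_U x]) (rule \<mu>_add)
  then show "\<rho> x v (u + u') = \<rho> x v u + \<rho> x v u'"
    by (simp add: \<rho>_def del_plus d \<mu>_add[OF x] \<mu>_scale[OF x] christoffel_add_right[OF x] algebra_simps)
  have "del (\<lambda>y. \<mu> y (c *s u)) x v = del (\<lambda>y. c * \<mu> y u) x v" by (rule del_cong(1)[OF open_U x]) (rule \<mu>_scale)
  then show "\<rho> x v (c *s u) = c * \<rho> x v u"
    by (simp add: \<rho>_def del_cmult d \<mu>_add[OF x] \<mu>_scale[OF x] christoffel_scale_right[OF x] algebra_simps)
qed

lemma
  assumes x: "x \<in> U"
  shows \<Theta>_add1: "\<Theta> x (u + u') v = \<Theta> x u v + \<Theta> x u' v" and \<Theta>_add2: "\<Theta> x v (u + u') = \<Theta> x v u + \<Theta> x v u'"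
    and \<Theta>_scale1: "\<Theta> x (c *s u) v = c *s \<Theta> x u v" and \<Theta>_scale2: "\<Theta> x v (c *s u) = c *s \<Theta> x v u"
  by (simp_all add: \<Theta>_def vec_eq_iff \<mu>_add[OF x] \<mu>_scale[OF x] christoffel_add_left[OF x] christoffel_scale_left[OF x]
      christoffel_add_right[OF x] christoffel_scale_right[OF x] algebra_simps)

end

context line_data
begin

lemma wirt_Hf:
  assumes z: "z \<in> ball 0 r"
  shows "wirt (\<lambda>z. Hf (y z)) (- \<mu> (y z) (y1 z) * Hf (y z)) (- cnj (\<mu> (y z) (y1 z)) * Hf (y z)) z"
  unfolding wirt_def
  by (rule has_derivative_eq_rhs[OF has_derivative_compose[OF dy[OF z] Hf_has_derivative[OF yW[OF z]]]])
    (simp add: fun_eq_iff \<mu>_scale[OF yW[OF z]] algebra_simps)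

lemma wirt_\<mu>:
  assumes z: "z \<in> ball 0 r" and V: "(V has_derivative (\<lambda>t. t *s V' + cnj t *s Vb)) (at z)"
  shows "wirt (\<lambda>z. \<mu> (y z) (V z))
    (- \<rho> (y z) (y1 z) (V z) + \<mu> (y z) (\<Gamma> (y z) (y1 z) (V z)) - \<mu> (y z) (y1 z) * \<mu> (y z) (V z) + \<mu> (y z) V')
    (of_real \<kappa> * q (y z) (V z) (y1 z) + \<mu> (y z) Vb) z"
proof -
  note W = yW[OF z]
  have d: "(\<lambda>x. \<mu> x (V z)) differentiable (at (y z))" by (rule \<mu>_differentiable[OF W])
  have 1: "- \<rho> (y z) (y1 z) (V z) + \<mu> (y z) (\<Gamma> (y z) (y1 z) (V z)) - \<mu> (y z) (y1 z) * \<mu> (y z) (V z)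
      = del (\<lambda>x. \<mu> x (V z)) (y z) (y1 z)" by (simp add: \<rho>_def)
  show ?thesis
    unfolding wirt_def 1 delbar_\<mu>[OF W, symmetric]
    by (rule has_derivative_eq_rhs[OF \<mu>_along[OF W dy[OF z] V]])
      (simp add: fun_eq_iff del_scale[OF d] delbar_scale[OF d] \<mu>_add[OF W] \<mu>_scale[OF W] algebra_simps)
qed

lemma holo_line_holomorphic:
  assumes f: "holo f W" shows "(\<lambda>z. f (y z)) holomorphic_on ball 0 r"
proof (rule wirt_holomorphic[OF open_ball])
  fix z :: complex assume z: "z \<in> ball 0 r"
  have d: "f differentiable (at (y z))" using f yW[OF z] by (simp add: holo_def)
  have "ddir f (y z) (t *s y1 z) = t * ddir f (y z) (y1 z)" for t
    by (rule linear_complex_linear[OF linear_ddir[OF d] holo_cJ[OF f yW[OF z]]])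
  then have "wirt (\<lambda>z. f (y z)) (ddir f (y z) (y1 z)) 0 z"
    unfolding wirt_def
    using has_derivative_compose[OF dy[OF z] differentiable_has_ddir[OF d]] by simp
  then show "\<exists>a. wirt (\<lambda>z. f (y z)) a 0 z" by blast
qed

lemma \<rho>_line_holomorphic:
  assumes "\<And>i. (\<lambda>z. u z $ i) holomorphic_on ball 0 r" "\<And>i. (\<lambda>z. v z $ i) holomorphic_on ball 0 r"
  shows "(\<lambda>z. \<rho> (y z) (u z) (v z)) holomorphic_on ball 0 r"
proof (rule holomorphic_transform)
  show "(\<lambda>z. \<Sum>i\<in>UNIV. \<Sum>j\<in>UNIV. u z $ i * (v z $ j * \<rho> (y z) (axis i 1) (axis j 1))) holomorphic_on ball 0 r"
    by (intro holomorphic_on_sum holomorphic_on_mult assms holo_line_holomorphic holo_\<rho>)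
  fix z :: complex assume z: "z \<in> ball 0 r"
  have "\<rho> (y z) (u z) (v z) = (\<Sum>i\<in>UNIV. u z $ i * \<rho> (y z) (axis i 1) (v z))"
    by (rule linear_expand) (simp_all add: \<rho>_add1 \<rho>_scale1 yW[OF z])
  also have "\<dots> = (\<Sum>i\<in>UNIV. u z $ i * (\<Sum>j\<in>UNIV. v z $ j * \<rho> (y z) (axis i 1) (axis j 1)))"
    by (subst linear_expand[of "\<rho> (y z) (axis _ 1)" "v z"]) (simp_all add: \<rho>_add2 \<rho>_scale2 yW[OF z])
  finally show "(\<Sum>i\<in>UNIV. \<Sum>j\<in>UNIV. u z $ i * (v z $ j * \<rho> (y z) (axis i 1) (axis j 1))) = \<rho> (y z) (u z) (v z)"
    by (simp add: sum_distrib_left)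
qed

lemma \<Theta>_line_holomorphic:
  assumes "\<And>i. (\<lambda>z. u z $ i) holomorphic_on ball 0 r" "\<And>i. (\<lambda>z. v z $ i) holomorphic_on ball 0 r"
  shows "(\<lambda>z. \<Theta> (y z) (u z) (v z) $ k) holomorphic_on ball 0 r"
proof (rule holomorphic_transform)
  show "(\<lambda>z. \<Sum>i\<in>UNIV. \<Sum>j\<in>UNIV. u z $ i * (v z $ j * \<Theta> (y z) (axis i 1) (axis j 1) $ k)) holomorphic_on ball 0 r"
    by (intro holomorphic_on_sum holomorphic_on_mult assms holo_line_holomorphic holo_\<Theta>)
  fix z :: complex assume z: "z \<in> ball 0 r"
  have "\<Theta> (y z) (u z) (v z) $ k = (\<Sum>i\<in>UNIV. u z $ i * \<Theta> (y z) (axis i 1) (v z) $ k)"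
    by (rule linear_expand) (simp_all add: \<Theta>_add1 \<Theta>_scale1 yW[OF z])
  also have "\<dots> = (\<Sum>i\<in>UNIV. u z $ i * (\<Sum>j\<in>UNIV. v z $ j * \<Theta> (y z) (axis i 1) (axis j 1) $ k))"
    by (subst linear_expand[of "\<lambda>v. \<Theta> (y z) (axis _ 1) v $ k" "v z"]) (simp_all add: \<Theta>_add2 \<Theta>_scale2 yW[OF z])
  finally show "(\<Sum>i\<in>UNIV. \<Sum>j\<in>UNIV. u z $ i * (v z $ j * \<Theta> (y z) (axis i 1) (axis j 1) $ k)) = \<Theta> (y z) (u z) (v z) $ k"
    by (simp add: sum_distrib_left)
qed

text \<open>A Hermitian form on the bundle \<open>\<complex> \<oplus> T\<close> along the line, and a connection that preserves it. For
  complex hyperbolic space these are the trivial bundle \<open>\<complex>\<^sup>N\<^sup>+\<^sup>1\<close> with its indefinite form, written in the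
  splitting determined by the volume form: the section \<open>(1, 0)\<close> is the moving point and \<open>Hf\<close> its
  square length.\<close>

definition L where
  "L z S S' = Hf (y z) * ((S $ None - \<mu> (y z) (tail S)) * cnj (S' $ None - \<mu> (y z) (tail S'))
      - of_real \<kappa> * q (y z) (tail S) (tail S'))"

definition D where
  "D z S = lift (\<rho> (y z) (y1 z) (tail S)) (\<Theta> (y z) (y1 z) (tail S) + S $ None *s y1 z)"

lemma L_sesquilinear: assumes z: "z \<in> ball 0 r" shows "sesquilinear (L z)"
proof -
  interpret Y: hermitian_product "q (y z)" by (rule hermitian[OF yW[OF z]])
  show ?thesis
    by unfold_locales (simp_all add: L_def tail_add tail_scale \<mu>_add[OF yW[OF z]] \<mu>_scale[OF yW[OF z]] Y.add_left Y.scale_left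
        Hf_cnj Y.cnj algebra_simps)
qed

text \<open>Only the holomorphic half has to be computed; the other one follows by Hermitian symmetry.\<close>

lemma L_derivative:
  assumes z: "z \<in> ball 0 r" shows "wirt (\<lambda>z. L z S S') (L z (D z S) S') (L z S (D z S')) z"
proof -
  note W = yW[OF z]
  interpret Y: hermitian_product "q (y z)" by (rule hermitian[OF W])
  interpret L: sesquilinear "L z" by (rule L_sesquilinear[OF z])
  have half: "\<exists>b. wirt (\<lambda>z. L z S S') (L z (D z S) S') b z" for S S'
  proof -
    have c: "((\<lambda>z. v) has_derivative (\<lambda>t. t *s 0 + cnj t *s 0)) (at z)" for v :: "complex^'m"
      using vec_const[of v] by simp
    note m = wirt_diff[OF wirt_const wirt_\<mu>[OF z c]]
    note w = wirt_mult[OF wirt_Hf[OF z] wirt_diff[OF wirt_mult[OF m[of "S $ None" "tail S"] wirt_cnj[OF m[of "S' $ None" "tail S'"]]]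
        wirt_cmult[OF wirt_q[OF z vec_const[of "tail S"] vec_const[of "tail S'"]], of "of_real \<kappa>"]]]
    have m0: "\<mu> (y z) 0 = 0" using \<mu>_scale[OF W, of 0 0] by simp
    have mdiff: "\<mu> (y z) (u - v) = \<mu> (y z) u - \<mu> (y z) v" for u v
      using \<mu>_add[OF W, of u "(-1) *s v"] unfolding \<mu>_scale[OF W] by simp
    show ?thesis
      unfolding L_def
      by (rule exI, rule wirt_eq_rhs[OF w _ refl])
        (simp add: m0 D_def \<Theta>_def \<mu>_add[OF W] mdiff \<mu>_scale[OF W] Y.add_left Y.diff_left Y.scale_left Y.cnj algebra_simps)
  qed
  obtain b where b: "wirt (\<lambda>z. L z S S') (L z (D z S) S') b z" using half by blast
  obtain b' where b': "wirt (\<lambda>z. L z S' S) (L z (D z S') S) b' z" using half by blast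
  have "wirt (\<lambda>z. L z S S') (cnj b') (cnj (L z (D z S') S)) z"
    by (rule wirt_cong[OF wirt_cnj[OF b'] open_ball z]) (simp add: sesquilinear.cnj[OF L_sesquilinear])
  from wirt_unique(2)[OF b this] b show ?thesis by (simp add: L.cnj)
qed

end

context line_data
begin

text \<open>In the parallel frame, \<open>H = L(F0, F0)\<close> for the section \<open>F0 = (1, 0)\<close>. The determinant of the metric is obtained from
  the Gram matrix of the sections \<open>(0, G i)\<close> by the update of rank one that projects them off \<open>F0\<close>; multiplied by
  powers of \<open>H\<close> it is the kernel \<open>P\<close>. The soliton potential is \<open>Re \<mu>(\<xi>) / \<kappa> = R / H\<close>. If \<open>H\<close> were trivial, \<open>\<mu>(y1)\<close> would be
  holomorphic, but its antiholomorphic derivative is \<open>\<kappa> |y1|\<^sup>2\<close>.\<close>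

theorem curved_case:
  assumes \<kappa>: "\<kappa> > 0" and \<gamma>0: "\<gamma> 0 \<noteq> 0"
  shows "Re (\<beta> 0) = 0 \<and> real CARD('n) + 1 + l / (2 * \<kappa>) \<ge> 0"
proof -
  define A :: "complex \<Rightarrow> complex^('m option)^('m option)" where "A z = (\<chi> i j. D z (axis j 1) $ i)" for z
  have y1_hol: "(\<lambda>z. y1 z $ i) holomorphic_on ball 0 r" for i by (rule nth_holomorphic[OF dy1])
  have \<xi>_hol: "(\<lambda>z. \<xi> z $ i) holomorphic_on ball 0 r" for i by (rule nth_holomorphic[OF d\<xi>])
  have G_hol: "(\<lambda>z. G k z $ i) holomorphic_on ball 0 r" for k i by (rule nth_holomorphic[OF dG])
  have A: "A z *v u = D z u" if "z \<in> ball 0 r" for z u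
    unfolding A_def
    by (rule matrix_of_linear)
      (simp_all add: D_def lift_add[symmetric] lift_scale[symmetric] tail_add tail_scale \<rho>_add2 \<rho>_scale2 \<Theta>_add2 \<Theta>_scale2 yW[OF that],
       simp_all add: vec_eq_iff algebra_simps)
  have A_hol: "(\<lambda>z. A z $ i $ j) holomorphic_on ball 0 r" for i j
  proof (cases i)
    case None
    have "(\<lambda>z. \<rho> (y z) (y1 z) (tail (axis j 1))) holomorphic_on ball 0 r"
      by (rule \<rho>_line_holomorphic[OF y1_hol holomorphic_on_const])
    then show ?thesis by (simp add: None A_def D_def)
  next
    case (Some k)
    have "(\<lambda>z. \<Theta> (y z) (y1 z) (tail (axis j 1)) $ k + axis j 1 $ None * y1 z $ k) holomorphic_on ball 0 r"
      by (intro holomorphic_on_add holomorphic_on_mult holomorphic_on_const y1_hol \<Theta>_line_holomorphic)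
    then show ?thesis by (simp add: Some A_def D_def)
  qed
  have "\<exists>\<rho> \<Psi>. 0 < \<rho> \<and> \<rho> \<le> r \<and> (\<forall>i j. (\<lambda>z. \<Psi> z $ i $ j) holomorphic_on ball 0 \<rho>) \<and>
    (\<forall>z\<in>ball 0 \<rho>. \<forall>u v. L z u v = L 0 (\<Psi> z *v u) (\<Psi> z *v v))"
  proof (rule parallel_frame[OF r A_hol])
    fix z u v assume z: "z \<in> ball (0::complex) r"
    show "L z u v = (\<Sum>i\<in>UNIV. \<Sum>j\<in>UNIV. u $ i * cnj (v $ j) * L z (axis i 1) (axis j 1))"
      by (rule sesquilinear.expand[OF L_sesquilinear[OF z]])
    show "((\<lambda>z. L z u v) has_derivative (\<lambda>t. t * L z (A z *v u) v + cnj t * L z u (A z *v v))) (at z)"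
      using L_derivative[OF z, of u v] by (simp add: A[OF z] wirt_def)
  qed
  then obtain \<delta> \<Psi> where \<delta>: "0 < \<delta>" "\<delta> \<le> r" and \<Psi>: "\<And>i j. (\<lambda>z. \<Psi> z $ i $ j) holomorphic_on ball 0 \<delta>"
    and L\<Psi>: "\<And>z u v. z \<in> ball 0 \<delta> \<Longrightarrow> L z u v = L 0 (\<Psi> z *v u) (\<Psi> z *v v)" by blast
  have sub: "z \<in> ball 0 r" if "z \<in> ball 0 \<delta>" for z using that \<delta> by simp
  have subset: "ball 0 \<delta> \<subseteq> ball (0::complex) r" using sub by blast
  interpret L0: sesquilinear "L 0" by (rule L_sesquilinear) (simp add: r)
  define F0 where "F0 z = \<Psi> z *v lift 1 0" for z
  define T where "T z = \<Psi> z *v lift 0 (\<xi> z)" for z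
  define S where "S i z = \<Psi> z *v lift 0 (G i z)" for i z
  have lift_hol: "(\<lambda>z. lift 0 (V z) $ k) holomorphic_on ball 0 \<delta>"
    if "\<And>i. (\<lambda>z. V z $ i) holomorphic_on ball 0 r" for V k
    using that holomorphic_on_subset[OF _ subset] by (cases k) auto
  have F0: "(\<lambda>z. F0 z $ i) holomorphic_on ball 0 \<delta>" for i
    unfolding F0_def by (rule matrix_vector_holomorphic[OF \<Psi> holomorphic_on_const])
  have T: "(\<lambda>z. T z $ i) holomorphic_on ball 0 \<delta>" for i
    unfolding T_def by (rule matrix_vector_holomorphic[OF \<Psi> lift_hol[OF \<xi>_hol]])
  have S: "(\<lambda>z. S k z $ i) holomorphic_on ball 0 \<delta>" for k i
    unfolding S_def by (rule matrix_vector_holomorphic[OF \<Psi> lift_hol[OF G_hol]])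
  define H where "H = L0.kernel F0 F0"
  define R where "R z w = of_real (- 1 / (2 * \<kappa>)) * (L0.kernel T F0 z w + L0.kernel F0 T z w)" for z w
  define P where "P z w = H z w * det (\<chi> i j. L0.kernel (S i) (S j) z w)
    - (\<Sum>i\<in>UNIV. L0.kernel (S i) F0 z w * det (\<chi> k j. if k = i then L0.kernel F0 (S j) z w else L0.kernel (S k) (S j) z w))" for z w
  have H: "finite_rank \<delta> H" unfolding H_def by (rule L0.finite_rank_kernel[OF F0 F0])
  have R: "finite_rank \<delta> R" unfolding R_def
    by (intro finite_rank_mult finite_rank_const finite_rank_add L0.finite_rank_kernel T F0)
  have "finite_rank \<delta> (\<lambda>z w. if k = i then L0.kernel F0 (S j) z w else L0.kernel (S k) (S j) z w)" for i j k
    by (cases "k = i") (simp_all add: L0.finite_rank_kernel F0 S)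
  then have P: "finite_rank \<delta> P" unfolding P_def
    by (intro finite_rank_diff finite_rank_mult finite_rank_sum finite_rank_det H L0.finite_rank_kernel S F0)

  define m where "m z = \<mu> (y z) (\<xi> z)" for z
  define \<mu>1 where "\<mu>1 z = \<mu> (y z) (y1 z)" for z
  define hf where "hf z = Hf (y z)" for z
  define dt where "dt z = det (\<chi> i j. q (y z) (G i z) (G j z))" for z
  have hf: "hf z \<noteq> 0" "cnj (hf z) = hf z" for z by (simp_all add: hf_def Hf_nonzero Hf_cnj)
  have m0: "\<mu> (y z) 0 = 0" if "z \<in> ball 0 \<delta>" for z using \<mu>_scale[OF yW[OF sub[OF that]], of 0 0] by simp
  have q0: "q (y z) 0 v = 0" "q (y z) v 0 = 0" if "z \<in> ball 0 \<delta>" for z v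
    using sesquilinear.zero_left[OF sesquilinear_q] sesquilinear.zero_right[OF sesquilinear_q] yW[OF sub[OF that]] by auto
  have FF: "L z (lift 1 0) (lift 1 0) = hf z" if "z \<in> ball 0 \<delta>" for z
    by (simp add: L_def m0[OF that] q0[OF that] hf_def)
  have VF: "L z (lift 0 V) (lift 1 0) = - hf z * \<mu> (y z) V" "L z (lift 1 0) (lift 0 V) = - hf z * cnj (\<mu> (y z) V)"
    if "z \<in> ball 0 \<delta>" for z V
    by (simp_all add: L_def m0[OF that] q0[OF that] hf_def)
  have VV: "L z (lift 0 V) (lift 0 V') = hf z * (\<mu> (y z) V * cnj (\<mu> (y z) V') - of_real \<kappa> * q (y z) V V')" for z V V'
    by (simp add: L_def hf_def)
  note diag = L0.kernel_diagonal F0_def T_def S_def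
  have H_diag: "H z (cnj z) = hf z" if z: "z \<in> ball 0 \<delta>" for z
    by (simp add: H_def diag L\<Psi>[OF z, symmetric] FF[OF z])
  have R_diag: "R z (cnj z) = hf z * (of_real (1 / (2 * \<kappa>)) * (m z + cnj (m z)))" if z: "z \<in> ball 0 \<delta>" for z
  proof -
    have "R z (cnj z) = of_real (- 1 / (2 * \<kappa>)) * (- hf z * m z + - hf z * cnj (m z))"
      by (simp only: R_def diag L\<Psi>[OF z, symmetric] VF[OF z] m_def)
    also have "of_real (- 1 / (2 * \<kappa>)) = - (of_real (1 / (2 * \<kappa>)) :: complex)" by simp
    also have "- of_real (1 / (2 * \<kappa>)) * (- hf z * m z + - hf z * cnj (m z)) = hf z * (of_real (1 / (2 * \<kappa>)) * (m z + cnj (m z)))"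
      by algebra
    finally show ?thesis .
  qed
  have P_diag: "P z (cnj z) = hf z * ((- of_real \<kappa> * hf z) ^ CARD('n) * dt z)" if z: "z \<in> ball 0 \<delta>" for z
  proof -
    define M :: "complex^'n^'n" where "M = (\<chi> i j. L z (lift 0 (G i z)) (lift 0 (G j z)))"
    define b :: "complex^'n" where "b = (\<chi> j. L z (lift 1 0) (lift 0 (G j z)))"
    define a where "a i = L z (lift 0 (G i z)) (lift 1 0)" for i
    have "(\<chi> k j. if k = i then b $ j else M $ k $ j) = (\<chi> k. if k = i then b else M $ k)" for i
      by (simp add: vec_eq_iff)
    then have "P z (cnj z) = hf z * det M - (\<Sum>i\<in>UNIV. a i * det (\<chi> k. if k = i then b else M $ k))"
      by (simp add: P_def H_diag[OF z] diag L\<Psi>[OF z, symmetric] M_def a_def b_def cong: if_cong)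
    also have "\<dots> = hf z * (det M + (\<Sum>i\<in>UNIV. (- a i / hf z) * det (\<chi> k. if k = i then b else M $ k)))"
    proof -
      have "(\<Sum>i\<in>UNIV. (- a i / hf z) * X i) = - inverse (hf z) * (\<Sum>i\<in>UNIV. a i * X i)" for X
        unfolding sum_distrib_left by (rule sum.cong) (simp_all add: divide_inverse)
      then show ?thesis using hf(1)[of z] by (simp only: distrib_left) simp
    qed
    also have "det M + (\<Sum>i\<in>UNIV. (- a i / hf z) * det (\<chi> k. if k = i then b else M $ k))
        = det (\<chi> k. M $ k + (- a k / hf z) *s b)" by (rule det_rank_one_update[symmetric])
    also have "(\<chi> k. M $ k + (- a k / hf z) *s b) = (\<chi> k. (- of_real \<kappa> * hf z) *s (\<chi> j. q (y z) (G k z) (G j z)))"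
      using hf by (simp add: vec_eq_iff M_def a_def b_def VV VF[OF z] field_simps)
    also have "det \<dots> = (- of_real \<kappa> * hf z) ^ CARD('n) * dt z"
      unfolding det_rows_mul by (simp add: dt_def)
    finally show ?thesis .
  qed

  have w_hf: "wirt hf (- \<mu>1 z * hf z) (- cnj (\<mu>1 z) * hf z) z" if "z \<in> ball 0 \<delta>" for z
    using wirt_Hf[OF sub[OF that]] by (simp add: hf_def[abs_def] \<mu>1_def)
  have Hz: "dz H z (cnj z) = - \<mu>1 z * hf z" if z: "z \<in> ball 0 \<delta>" for z
    by (rule finite_rank_diagonal_unique[OF H z w_hf[OF z] H_diag])
  have Pz: "dz P z (cnj z) = (\<tau> z - of_nat (CARD('n) + 1) * \<mu>1 z) * P z (cnj z)" if z: "z \<in> ball 0 \<delta>" for z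
  proof -
    have "wirt (\<lambda>z. - of_real \<kappa> * hf z) (- \<mu>1 z * (- of_real \<kappa> * hf z)) (- of_real \<kappa> * (- cnj (\<mu>1 z) * hf z)) z"
      using wirt_cmult[OF w_hf[OF z], of "- of_real \<kappa>"] by (simp add: algebra_simps)
    from wirt_power[OF this, of "CARD('n)"]
    obtain b where b: "wirt (\<lambda>z. (- of_real \<kappa> * hf z) ^ CARD('n)) (of_nat CARD('n) * - \<mu>1 z * (- of_real \<kappa> * hf z) ^ CARD('n)) b z" by blast
    obtain c where c: "wirt dt (\<tau> z * dt z) c z" using ddet[OF sub[OF z]] unfolding dt_def by blast
    have "dz P z (cnj z) = hf z * ((- of_real \<kappa> * hf z) ^ CARD('n) * (\<tau> z * dt z)
        + (of_nat CARD('n) * - \<mu>1 z * (- of_real \<kappa> * hf z) ^ CARD('n)) * dt z)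
        + (- \<mu>1 z * hf z) * ((- of_real \<kappa> * hf z) ^ CARD('n) * dt z)"
      by (rule finite_rank_diagonal_unique[OF P z wirt_mult[OF w_hf[OF z] wirt_mult[OF b c]] P_diag])
    then show ?thesis by (simp only: P_diag[OF z] of_nat_add of_nat_1) (simp add: algebra_simps)
  qed

  \<comment> \<open>\<open>Mz\<close> and \<open>mz\<close> are the holomorphic derivatives of \<open>m\<close> and of the potential \<open>(m + cnj m) / (2 \<kappa>)\<close>. Written with the
    holomorphic \<open>\<rho>\<close>, \<open>Mz\<close> can be differentiated again without second derivatives of \<open>\<mu>\<close>.\<close>
  define Mz where "Mz z = - \<rho> (y z) (y1 z) (\<xi> z) + \<mu> (y z) (\<Gamma> (y z) (y1 z) (\<xi> z)) - \<mu>1 z * m z + \<mu> (y z) (\<xi>1 z)" for z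
  define mz where "mz z = of_real (1 / (2 * \<kappa>)) * (Mz z + cnj (of_real \<kappa> * q (y z) (\<xi> z) (y1 z)))" for z
  have vd: "(V has_derivative (\<lambda>t. t *s V' + cnj t *s 0)) (at z)" if "(V has_derivative (\<lambda>t. t *s V')) (at z)"
    for V :: "complex \<Rightarrow> complex^'m" and V' z using that by simp
  have w_m: "wirt m (Mz z) (of_real \<kappa> * q (y z) (\<xi> z) (y1 z)) z" if z: "z \<in> ball 0 \<delta>" for z
    using wirt_\<mu>[OF sub[OF z] vd[OF d\<xi>[OF sub[OF z]]]] m0[OF z] by (simp add: m_def[abs_def] Mz_def \<mu>1_def)
  have Rz: "dz R z (cnj z) = hf z * mz z - \<mu>1 z * R z (cnj z)" if z: "z \<in> ball 0 \<delta>" for z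
  proof -
    have "dz R z (cnj z) = hf z * (of_real (1 / (2 * \<kappa>)) * (Mz z + cnj (of_real \<kappa> * q (y z) (\<xi> z) (y1 z))))
        + (- \<mu>1 z * hf z) * (of_real (1 / (2 * \<kappa>)) * (m z + cnj (m z)))"
      by (rule finite_rank_diagonal_unique[OF R z wirt_mult[OF w_hf[OF z] wirt_cmult[OF wirt_add[OF w_m[OF z] wirt_cnj[OF w_m[OF z]]]]] R_diag])
    then show ?thesis by (simp add: R_diag[OF z] mz_def)
  qed
  have w_\<mu>1: "\<exists>a. wirt \<mu>1 a (of_real \<kappa> * \<gamma> z) z" if z: "z \<in> ball 0 \<delta>" for z
    using wirt_\<mu>[OF sub[OF z] vd[OF dy1[OF sub[OF z]]]] m0[OF z] by (auto simp: \<mu>1_def[abs_def] \<gamma>_def)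
  have w_Mz: "\<exists>a. wirt Mz a (of_real \<kappa> * \<beta> z) z" if z: "z \<in> ball 0 \<delta>" for z
  proof -
    note W = yW[OF sub[OF z]] and z' = sub[OF z]
    interpret Y: hermitian_product "q (y z)" by (rule hermitian[OF W])
    have "\<exists>\<xi>2. (\<xi>1 has_derivative (\<lambda>t. t *s \<xi>2)) (at z)"
    proof -
      have e: "\<xi>1 u $ i = deriv (\<lambda>z. \<xi> z $ i) u" if "u \<in> ball 0 r" for u i
        by (rule DERIV_imp_deriv[symmetric, OF has_derivative_scale_nth[OF d\<xi>[OF that]]])
      have "(\<lambda>z. \<xi>1 z $ i) holomorphic_on ball 0 r" for i
        by (rule holomorphic_transform[OF holomorphic_deriv[OF \<xi>_hol open_ball]]) (simp add: e)
      from holomorphic_derivI[OF this open_ball z']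
      have "((\<lambda>z. \<xi>1 z $ i) has_field_derivative (\<chi> i. deriv (\<lambda>z. \<xi>1 z $ i) z) $ i) (at z)" for i by simp
      from has_derivative_scale_vec[OF this] show ?thesis by blast
    qed
    then obtain \<xi>2 where \<xi>2: "(\<xi>1 has_derivative (\<lambda>t. t *s \<xi>2)) (at z)" by blast
    obtain a where a: "wirt \<mu>1 a (of_real \<kappa> * \<gamma> z) z" using w_\<mu>1[OF z] by blast
    have r0: "wirt (\<lambda>z. - 1 * \<rho> (y z) (y1 z) (\<xi> z)) (- 1 * deriv (\<lambda>z. \<rho> (y z) (y1 z) (\<xi> z)) z) (- 1 * 0) z"
      by (intro wirt_cmult holomorphic_wirt[OF \<rho>_line_holomorphic[OF y1_hol \<xi>_hol] open_ball z'])
    note w = wirt_add[OF wirt_diff[OF wirt_add[OF r0 wirt_\<mu>[OF z' christoffel_line[OF z' dy1[OF z'] d\<xi>[OF z']]]]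
        wirt_mult[OF a w_m[OF z]]] wirt_\<mu>[OF z' vd[OF \<xi>2]]]
    have Mz: "Mz = (\<lambda>z. - 1 * \<rho> (y z) (y1 z) (\<xi> z) + \<mu> (y z) (\<Gamma> (y z) (y1 z) (\<xi> z)) - \<mu>1 z * m z + \<mu> (y z) (\<xi>1 z))"
      by (simp add: Mz_def fun_eq_iff)
    have "of_real \<kappa> * \<beta> z = - 1 * 0 + (of_real \<kappa> * q (y z) (\<Gamma> (y z) (y1 z) (\<xi> z)) (y1 z) + \<mu> (y z) (cv (y z) (y1 z) (\<xi> z) (y1 z)))
        - (\<mu>1 z * (of_real \<kappa> * q (y z) (\<xi> z) (y1 z)) + of_real \<kappa> * \<gamma> z * m z) + (of_real \<kappa> * q (y z) (\<xi>1 z) (y1 z) + \<mu> (y z) 0)"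
      by (simp add: \<beta>_def \<gamma>_def m_def \<mu>1_def m0[OF z] cv_const[OF W] \<mu>_add[OF W] \<mu>_scale[OF W] Y.add_left algebra_simps)
    then show ?thesis unfolding Mz using w by metis
  qed
  have w_mz: "\<exists>a. wirt mz a (of_real (Re (\<beta> z))) z" if z: "z \<in> ball 0 \<delta>" for z
  proof -
    obtain a where a: "wirt Mz a (of_real \<kappa> * \<beta> z) z" using w_Mz[OF z] by blast
    have "wirt (\<lambda>z. q (y z) (\<xi> z) (y1 z)) (\<beta> z) (q (y z) (\<xi> z) (\<Gamma> (y z) (y1 z) (y1 z) + y2 z)) z"
      unfolding \<beta>_def by (rule wirt_q[OF sub[OF z] d\<xi>[OF sub[OF z]] dy1[OF sub[OF z]]])
    from wirt_cmult[OF wirt_add[OF a wirt_cnj[OF wirt_cmult[OF this, of "of_real \<kappa>"]]], of "of_real (1 / (2 * \<kappa>))"]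
    obtain a' where a': "wirt mz a' (of_real (1 / (2 * \<kappa>)) * (of_real \<kappa> * \<beta> z + cnj (of_real \<kappa> * \<beta> z))) z"
      unfolding mz_def by blast
    have "of_real (1 / (2 * \<kappa>)) * (of_real \<kappa> * \<beta> z + cnj (of_real \<kappa> * \<beta> z)) = of_real (1 / (2 * \<kappa>)) * of_real \<kappa> * (\<beta> z + cnj (\<beta> z))"
      by (simp add: distrib_left)
    also have "\<dots> = of_real (Re (\<beta> z))" using \<kappa> by (simp add: complex_add_cnj)
    finally show ?thesis using a' by auto
  qed

  define s where "s = real CARD('n) + 1 + l / (2 * \<kappa>)"
  define E where "E z = \<tau> z + (of_real (l / (2 * \<kappa>)) * \<mu>1 z + mz z)" for z
  have E: "E holomorphic_on ball 0 \<delta>"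
  proof (rule wirt_holomorphic[OF open_ball])
    fix z :: complex assume z: "z \<in> ball 0 \<delta>"
    obtain a where a: "wirt \<tau> a (- (of_real (l / 2) * \<gamma> z) - of_real (Re (\<beta> z))) z"
      using d\<tau>[OF sub[OF z]] unfolding \<gamma>_def \<beta>_def by blast
    obtain b where b: "wirt mz b (of_real (Re (\<beta> z))) z" using w_mz[OF z] by blast
    obtain c where c: "wirt \<mu>1 c (of_real \<kappa> * \<gamma> z) z" using w_\<mu>1[OF z] by blast
    have e: "of_real (l / (2 * \<kappa>)) * (of_real \<kappa> * \<gamma> z) = of_real (l / 2) * \<gamma> z" using \<kappa> by simp
    have "- (of_real (l / 2) * \<gamma> z) - of_real (Re (\<beta> z))
        + (of_real (l / (2 * \<kappa>)) * (of_real \<kappa> * \<gamma> z) + of_real (Re (\<beta> z))) = 0"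
      unfolding e by simp
    then show "\<exists>a. wirt E a 0 z"
      using wirt_add[OF a wirt_add[OF wirt_cmult[OF c, of "of_real (l / (2 * \<kappa>))"] b]] unfolding E_def[abs_def] by metis
  qed
  have "\<exists>\<rho> C. 0 < \<rho> \<and> \<rho> \<le> \<delta> \<and> C holomorphic_on ball 0 \<rho> \<and>
       (\<forall>z\<in>ball 0 \<rho>. \<forall>w\<in>ball 0 \<rho>. dz R z w * H z w - R z w * dz H z w = C z * (H z w)\<^sup>2) \<and>
       ((\<exists>l m. m > 0 \<and> of_nat l = of_real s * (of_nat m :: complex)) \<or>
        (\<exists>C. C holomorphic_on ball 0 \<rho> \<and> (\<forall>z\<in>ball 0 \<rho>. \<forall>w\<in>ball 0 \<rho>. dz H z w = C z * H z w)))"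
  proof (rule diagonal_equation_rigidity[OF \<delta>(1) P H R E])
    have "P 0 0 = hf 0 * ((- of_real \<kappa> * hf 0) ^ CARD('n) * dt 0)" "H 0 0 = hf 0"
      using P_diag[of 0] H_diag[of 0] \<delta>(1) by simp_all
    then show "P 0 0 \<noteq> 0" "H 0 0 \<noteq> 0" using det0 hf \<kappa> by (simp_all add: dt_def)
    fix z :: complex assume z: "z \<in> ball 0 \<delta>"
    show "dz P z (cnj z) * (H z (cnj z))\<^sup>2 - of_real s * dz H z (cnj z) * H z (cnj z) * P z (cnj z) +
         (dz R z (cnj z) * H z (cnj z) - R z (cnj z) * dz H z (cnj z)) * P z (cnj z) = E z * P z (cnj z) * (H z (cnj z))\<^sup>2"
      unfolding Pz[OF z] Hz[OF z] Rz[OF z] H_diag[OF z] E_def s_def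
      by (simp only: of_real_add of_real_1 of_real_of_nat_eq of_nat_add of_nat_1) (simp add: algebra_simps power2_eq_square)
  qed
  then obtain \<epsilon> C where \<epsilon>: "0 < \<epsilon>" "\<epsilon> \<le> \<delta>" and C: "C holomorphic_on ball 0 \<epsilon>"
    and RC: "\<forall>z\<in>ball 0 \<epsilon>. \<forall>w\<in>ball 0 \<epsilon>. dz R z w * H z w - R z w * dz H z w = C z * (H z w)\<^sup>2"
    and or: "(\<exists>l m. m > 0 \<and> of_nat l = of_real s * (of_nat m :: complex)) \<or>
        (\<exists>C. C holomorphic_on ball 0 \<epsilon> \<and> (\<forall>z\<in>ball 0 \<epsilon>. \<forall>w\<in>ball 0 \<epsilon>. dz H z w = C z * H z w))" by blast
  have 0: "0 \<in> ball (0::complex) \<epsilon>" "0 \<in> ball (0::complex) \<delta>" using \<epsilon> \<delta> by auto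
  have sub\<epsilon>: "z \<in> ball 0 \<delta>" if "z \<in> ball 0 \<epsilon>" for z using that \<epsilon> by simp
  have "C z = mz z" if z: "z \<in> ball 0 \<epsilon>" for z
  proof -
    have "(hf z)\<^sup>2 * mz z = C z * (hf z)\<^sup>2"
      using RC[rule_format, OF z, of "cnj z"] z unfolding Rz[OF sub\<epsilon>[OF z]] Hz[OF sub\<epsilon>[OF z]] H_diag[OF sub\<epsilon>[OF z]]
      by (simp add: algebra_simps power2_eq_square)
    then show ?thesis using hf(1)[of z] by simp
  qed
  from wirt_cong[OF holomorphic_wirt[OF C open_ball 0(1)] open_ball 0(1) this] have 1: "wirt mz (deriv C 0) 0 0" .
  obtain a where "wirt mz a (of_real (Re (\<beta> 0))) 0" using w_mz[OF 0(2)] by blast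
  from wirt_unique(2)[OF this 1] have "Re (\<beta> 0) = 0" by simp
  moreover have "s \<ge> 0"
    using or
  proof (elim disjE exE conjE)
    fix k m :: nat assume m: "m > 0" and e: "of_nat k = of_real s * (of_nat m :: complex)"
    from arg_cong[OF e, of Re] have "real k = s * real m" by simp
    then have "s = real k / real m" using m by (simp add: field_simps)
    then show "s \<ge> 0" by simp
  next
    fix C assume C: "C holomorphic_on ball 0 \<epsilon>" and HC: "\<forall>z\<in>ball 0 \<epsilon>. \<forall>w\<in>ball 0 \<epsilon>. dz H z w = C z * H z w"
    have "- C z = \<mu>1 z" if z: "z \<in> ball 0 \<epsilon>" for z
    proof -
      have "- \<mu>1 z * hf z = C z * hf z"
        using HC[rule_format, OF z, of "cnj z"] z unfolding Hz[OF sub\<epsilon>[OF z]] H_diag[OF sub\<epsilon>[OF z]] by simp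
      then have "- \<mu>1 z = C z" using mult_right_cancel[OF hf(1)[of z], of "- \<mu>1 z" "C z"] by blast
      from this[symmetric] show ?thesis by simp
    qed
    from wirt_cong[OF holomorphic_wirt[OF holomorphic_on_minus[OF C] open_ball 0(1)] open_ball 0(1) this]
    have 2: "wirt \<mu>1 (deriv (\<lambda>z. - C z) 0) 0 0" .
    obtain a where "wirt \<mu>1 a (of_real \<kappa> * \<gamma> 0) 0" using w_\<mu>1[OF 0(2)] by blast
    from wirt_unique(2)[OF this 2] show "s \<ge> 0" using \<kappa> \<gamma>0 by simp
  qed
  ultimately show ?thesis by (simp add: s_def)
qed

end

section \<open>Solitons in coordinate domains\<close>

lemma has_derivative_scale_const:
  fixes V :: "'a::real_normed_vector \<Rightarrow> complex^'k"
  assumes "(V has_derivative V') (at x)" shows "((\<lambda>x. c *s V x) has_derivative (\<lambda>t. c *s V' t)) (at x)"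
  by (rule has_derivative_vec)
    (simp, intro has_derivative_mult_right bounded_linear.has_derivative[OF bounded_linear_vec_nth assms])

lemma hol_map_line:
  assumes "hol_map_on V U" "x + z *s v \<in> U"
  shows "((\<lambda>z. V (x + z *s v)) has_derivative (\<lambda>t. t *s ddir V (x + z *s v) v)) (at z)"
proof -
  have d: "V differentiable (at (x + z *s v))" and J: "\<And>t. ddir V (x + z *s v) (cJ t) = cJ (ddir V (x + z *s v) t)"
    using assms by (auto simp: hol_map_on_def)
  have "ddir V (x + z *s v) (t *s v) = t *s ddir V (x + z *s v) v" for t
    by (rule linear_complex_linear_vec[OF linear_ddir[OF d] J])
  then show ?thesis
    using has_derivative_compose[OF line_has_derivative differentiable_has_ddir[OF d]] by simp
qed

locale soliton_map = kaehler_map U g W h F + S: kaehler_space_form W h \<kappa>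
  for U :: "(complex^'n) set" and g and W :: "(complex^'m) set" and h F \<kappa> +
  fixes X :: "complex^'n \<Rightarrow> complex^'n" and l :: real
  assumes hol_X: "hol_map_on X U" and \<kappa>_nonneg: "\<kappa> \<ge> 0"
    and soliton: "x \<in> U \<Longrightarrow> ricci g x v v = l * g x v v + lie_metric X g x v v"
begin

lemma
  assumes x: "x \<in> U"
  shows \<sigma>_add: "\<sigma> x u (a + b) = \<sigma> x u a + \<sigma> x u b" and \<sigma>_scale: "\<sigma> x u (c *s a) = c *s \<sigma> x u a"
proof -
  have "ddir (\<lambda>y. ddir F y (a + b)) x u = ddir (\<lambda>y. ddir F y a + ddir F y b) x u"
    by (rule fun_cong[OF ddir_cong[OF G.open_U x]]) (rule dF_add)
  also have "\<dots> = ddir (\<lambda>y. ddir F y a) x u + ddir (\<lambda>y. ddir F y b) x u"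
    by (intro ddir_eq has_derivative_add dF_has_derivative x)
  finally show "\<sigma> x u (a + b) = \<sigma> x u a + \<sigma> x u b"
    by (simp add: \<sigma>_def second_fundamental_form_def dF_add[OF x] H.christoffel_add_right[OF maps[OF x]] G.christoffel_add_right[OF x])
  have "ddir (\<lambda>y. ddir F y (c *s a)) x u = ddir (\<lambda>y. c *s ddir F y a) x u"
    by (rule fun_cong[OF ddir_cong[OF G.open_U x]]) (rule dF_scale)
  also have "\<dots> = c *s ddir (\<lambda>y. ddir F y a) x u"
    by (intro ddir_eq has_derivative_scale_const dF_has_derivative x)
  finally show "\<sigma> x u (c *s a) = c *s \<sigma> x u a"
    by (simp add: \<sigma>_def second_fundamental_form_def dF_scale[OF x] H.christoffel_scale_right[OF maps[OF x]] G.christoffel_scale_right[OF x]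
        vec_eq_iff algebra_simps)
qed

text \<open>The trace of the Gauss equation. Symmetry of the curvature in its first two arguments puts \<open>v\<close> first in both
  second fundamental forms, which makes the last term a sum of squares.\<close>

lemma ricci_trace:
  fixes E :: "'n \<Rightarrow> complex^'n"
  assumes x: "x \<in> U" and E: "\<And>i j. G.q x (E i) (E j) = (if i = j then 1 else 0)"
  shows "delbar (\<lambda>y. G.tr y v) x v = of_real ((real CARD('n) + 1) * \<kappa>) * G.q x v v
    + (\<Sum>i\<in>UNIV. H.q (F x) (\<sigma> x v (E i)) (\<sigma> x v (E i)))"
proof -
  interpret X: hermitian_product "G.q x" by (rule G.hermitian[OF x])
  interpret Y: hermitian_product "H.q (F x)" by (rule H.hermitian[OF maps[OF x]])
  have "delbar (\<lambda>y. G.tr y v) x v = (\<Sum>k\<in>UNIV. G.cv x (axis k 1) v v $ k)" by (rule G.delbar_tr[OF x])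
  also have "\<dots> = (\<Sum>i\<in>UNIV. G.q x (G.cv x (E i) v v) (E i))"
    by (rule X.trace_orthonormal[OF E]) (rule G.cv_add1[OF x] G.cv_scale1[OF x])+
  also have "\<dots> = (\<Sum>i\<in>UNIV. of_real \<kappa> * (G.q x v (E i) * G.q x (E i) v) + of_real \<kappa> * G.q x v v
      + H.q (F x) (\<sigma> x v (E i)) (\<sigma> x v (E i)))"
    by (rule sum.cong[OF refl])
      (simp add: G.cv_commute[OF x, of "E _" v] gauss[OF x] S.cv_const[OF maps[OF x]] Y.add_left Y.scale_left q_isometric[OF x, symmetric] E)
  also have "\<dots> = of_real \<kappa> * (\<Sum>i\<in>UNIV. G.q x v (E i) * G.q x (E i) v) + of_nat CARD('n) * (of_real \<kappa> * G.q x v v)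
      + (\<Sum>i\<in>UNIV. H.q (F x) (\<sigma> x v (E i)) (\<sigma> x v (E i)))"
    by (simp add: sum.distrib sum_distrib_left)
  also have "(\<Sum>i\<in>UNIV. G.q x v (E i) * G.q x (E i) v) = G.q x v v"
    using arg_cong[OF X.orthonormal_expansion[OF E, of v], of "\<lambda>u. G.q x u v"] by (simp add: X.sum_left X.scale_left)
  finally show ?thesis by (simp add: algebra_simps)
qed

lemma hol_dF_X: "hol_map_on (\<lambda>x. ddir F x (X x)) U"
  unfolding hol_map_on_def
proof (intro ballI)
  fix x assume x: "x \<in> U"
  have dX: "(X has_derivative ddir X x) (at x)" using hol_X x by (auto simp: hol_map_on_def intro: differentiable_has_ddir)
  have holo: "holo (\<lambda>y. ddir F y u $ k) U" for u k using hol_dF[of u, unfolded hol_map_on_iff[OF G.open_U]] by blast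
  define A where "A t = (\<chi> k. ddir (\<lambda>y. ddir F y (X x) $ k) x t + ddir F x (ddir X x t) $ k)" for t
  have "((\<lambda>y. ddir F y (X y) $ k) has_derivative (\<lambda>t. ddir (\<lambda>y. ddir F y (X x) $ k) x t + ddir F x (ddir X x t) $ k)) (at x)" for k
  proof (rule linear_field_has_derivative[where F = "\<lambda>x. x" and p = x, OF G.open_U x _ _ has_derivative_ident dX])
    show "ddir F y u $ k = (\<Sum>i\<in>UNIV. u $ i * ddir F y (axis i 1) $ k)" if "y \<in> U" for y u
      by (rule linear_expand) (simp_all add: dF_add dF_scale that)
    show "(\<lambda>y. ddir F y (axis i 1) $ k) differentiable at x" for i using holo[of "axis i 1" k] x by (simp add: holo_def)
  qed
  then have A: "((\<lambda>y. ddir F y (X y)) has_derivative A) (at x)"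
    by (intro has_derivative_vec) (simp add: A_def)
  then show "(\<lambda>x. ddir F x (X x)) differentiable at x \<and>
      (\<forall>v. ddir (\<lambda>x. ddir F x (X x)) x (cJ v) = cJ (ddir (\<lambda>x. ddir F x (X x)) x v))"
  proof (intro conjI allI)
    show "(\<lambda>x. ddir F x (X x)) differentiable at x" by (rule differentiableI[OF A])
    have XJ: "ddir X x (cJ v) = cJ (ddir X x v)" for v using hol_X x by (auto simp: hol_map_on_def)
    show "ddir (\<lambda>x. ddir F x (X x)) x (cJ v) = cJ (ddir (\<lambda>x. ddir F x (X x)) x v)" for v
      unfolding ddir_eq[OF A] A_def XJ dF_cJ[OF x] holo_cJ[OF holo x] by (simp add: vec_eq_iff algebra_simps)
  qed
qed

text \<open>Both sides are the \<open>(1, 0)\<close> derivative of \<open>\<langle>X, v\<rangle>\<close> in the direction \<open>v\<close>.\<close>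

lemma q_covariant_derivative:
  assumes x: "x \<in> U"
  shows "H.q (F x) (H.\<Gamma> (F x) (ddir F x v) (ddir F x (X x)) + ddir (\<lambda>x. ddir F x (X x)) x v) (ddir F x v)
    = G.q x (G.\<Gamma> x v (X x) + ddir X x v) v"
proof -
  interpret X: hermitian_product "G.q x" by (rule G.hermitian[OF x])
  interpret Y: hermitian_product "H.q (F x)" by (rule H.hermitian[OF maps[OF x]])
  have dX: "(X has_derivative ddir X x) (at x)" "\<And>t. ddir X x (cJ t) = cJ (ddir X x t)"
    using hol_X x by (auto simp: hol_map_on_def intro: differentiable_has_ddir)
  have d\<xi>: "((\<lambda>x. ddir F x (X x)) has_derivative ddir (\<lambda>x. ddir F x (X x)) x) (at x)"
    "\<And>t. ddir (\<lambda>x. ddir F x (X x)) x (cJ t) = cJ (ddir (\<lambda>x. ddir F x (X x)) x t)"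
    using hol_dF_X x by (auto simp: hol_map_on_def intro: differentiable_has_ddir)
  have Jl: "G.q x (cJ a) b = \<i> * G.q x a b" "G.q x a (cJ b) = - \<i> * G.q x a b" "G.\<Gamma> x (cJ a) b = cJ (G.\<Gamma> x a b)" for a b
    by (simp_all add: cJ_def X.scale_left X.scale_right G.christoffel_scale_left[OF x])
  have Jr: "H.q (F x) (cJ a) b = \<i> * H.q (F x) a b" "H.q (F x) a (cJ b) = - \<i> * H.q (F x) a b"
     "H.\<Gamma> (F x) (cJ a) b = cJ (H.\<Gamma> (F x) a b)" for a b
    by (simp_all add: cJ_def Y.scale_left Y.scale_right H.christoffel_scale_left[OF maps[OF x]])
  have "((\<lambda>x. G.q x (X x) v) has_derivative
      (\<lambda>t. G.q x (G.\<Gamma> x t (X x) + ddir X x t) v + G.q x (X x) (G.\<Gamma> x t v + 0))) (at x)"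
    by (rule G.metric_compatible[where F = "\<lambda>x. x" and p = x, OF x has_derivative_ident dX(1) has_derivative_const])
  then have 1: "del (\<lambda>x. G.q x (X x) v) x v = G.q x (G.\<Gamma> x v (X x) + ddir X x v) v"
    by (rule del_delbar_eq(1)) (simp_all only: dX(2) Jl cJ_add[symmetric] add_0_right)
  have "((\<lambda>x. H.q (F x) (ddir F x (X x)) (ddir F x v)) has_derivative
      (\<lambda>t. H.q (F x) (H.\<Gamma> (F x) (ddir F x t) (ddir F x (X x)) + ddir (\<lambda>x. ddir F x (X x)) x t) (ddir F x v)
        + H.q (F x) (ddir F x (X x)) (cd x t v))) (at x)"
    using H.metric_compatible[where F = F and p = x, OF maps[OF x] F_has_derivative[OF x] d\<xi>(1) dF_has_derivative[OF x]]
    by (simp only: cd_def)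
  then have "del (\<lambda>x. H.q (F x) (ddir F x (X x)) (ddir F x v)) x v
      = H.q (F x) (H.\<Gamma> (F x) (ddir F x v) (ddir F x (X x)) + ddir (\<lambda>x. ddir F x (X x)) x v) (ddir F x v)"
    by (rule del_delbar_eq(1)) (simp_all only: d\<xi>(2) cd_cJ[OF x] dF_cJ[OF x] Jr cJ_add[symmetric])
  moreover have "del (\<lambda>x. G.q x (X x) v) x v = del (\<lambda>x. H.q (F x) (ddir F x (X x)) (ddir F x v)) x v"
    by (rule del_cong(1)[OF G.open_U x]) (rule q_isometric)
  ultimately show ?thesis using 1 by simp
qed

text \<open>The sum of the nonnegative \<open>T i\<close> is the difference of the soliton equation and the curvature term; the results on
  lines show that it is not positive.\<close>

theorem second_fundamental_form_vanishes:
  assumes x0: "x0 \<in> U" shows "\<sigma> x0 v u = 0"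
proof -
  interpret X: hermitian_product "G.q x0" by (rule G.hermitian[OF x0])
  interpret Y: hermitian_product "H.q (F x0)" by (rule H.hermitian[OF maps[OF x0]])
  obtain E :: "'n \<Rightarrow> complex^'n" where E: "\<And>i j. G.q x0 (E i) (E j) = (if i = j then 1 else 0)"
    using X.orthonormal_frame by blast
  define T where "T i = Re (H.q (F x0) (\<sigma> x0 v (E i)) (\<sigma> x0 v (E i)))" for i
  have T_nonneg: "T i \<ge> 0" for i
    using Y.pos[of "\<sigma> x0 v (E i)"] by (cases "\<sigma> x0 v (E i) = 0") (auto simp: T_def)
  have \<delta>: "Re (delbar (\<lambda>y. G.tr y v) x0 v) = (real CARD('n) + 1) * \<kappa> * g x0 v v + (\<Sum>i\<in>UNIV. T i)"
    unfolding ricci_trace[OF x0 E] T_def by (simp add: G.q_def)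
  \<comment> \<open>The trace is real by the Gauss equation, so the Ricci tensor, which is \<open>- 2\<close> times its real part, determines it.\<close>
  have sol: "delbar (\<lambda>y. G.tr y v) x v = - (of_real (l / 2) * G.q x v v) - of_real (Re (G.q x (G.\<Gamma> x v (X x) + ddir X x v) v))"
    if x: "x \<in> U" for x
  proof -
    interpret X1: hermitian_product "G.q x" by (rule G.hermitian[OF x])
    interpret Y1: hermitian_product "H.q (F x)" by (rule H.hermitian[OF maps[OF x]])
    obtain E :: "'n \<Rightarrow> complex^'n" where E: "\<And>i j. G.q x (E i) (E j) = (if i = j then 1 else 0)"
      using X1.orthonormal_frame by blast
    have "Im (delbar (\<lambda>y. G.tr y v) x v) = 0"
      unfolding ricci_trace[OF x E] by (simp add: X1.self_real Y1.self_real)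
    moreover have "X differentiable (at x)" using hol_X x by (auto simp: hol_map_on_def)
    from soliton[OF x, of v] have "- 2 * Re (delbar (\<lambda>y. G.tr y v) x v) = l * g x v v + 2 * Re (G.q x (G.\<Gamma> x v (X x) + ddir X x v) v)"
      unfolding G.ricci_eq[OF x] G.lie_metric_eq[OF x \<open>X differentiable (at x)\<close>] .
    moreover have "Re (G.q x v v) = g x v v" by (simp add: G.q_def)
    ultimately show ?thesis by (simp add: complex_eq_iff X1.self_real)
  qed
  have "(\<Sum>i\<in>UNIV. T i) \<le> 0"
  proof (cases "v = 0")
    case True
    have "delbar (\<lambda>y. G.tr y v) x0 v = 0"
      using delbar_scale[OF G.tr_differentiable[OF x0], of v 0 0] by (simp add: True)
    moreover have "g x0 v v = 0" using X.zero_left[of 0] by (simp add: True G.q_def complex_eq_iff)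
    ultimately show ?thesis using \<delta> by simp
  next
    case False
    obtain e where e: "e > 0" "ball x0 e \<subseteq> U" using G.open_U x0 unfolding open_contains_ball by blast
    define r where "r = e / norm v"
    have r: "r > 0" using e False by (simp add: r_def)
    have xU: "x0 + z *s v \<in> U" if "z \<in> ball 0 r" for z
    proof -
      have "norm (z *s v) < e" using that False by (simp add: norm_complex_scale r_def field_simps)
      then show ?thesis using e by (auto simp: dist_norm)
    qed
    interpret line_data W h \<kappa> r "\<lambda>z. F (x0 + z *s v)" "\<lambda>z. ddir F (x0 + z *s v) v" "\<lambda>z. ddir (\<lambda>x. ddir F x v) (x0 + z *s v) v"
      "\<lambda>z. ddir F (x0 + z *s v) (X (x0 + z *s v))" "\<lambda>z. ddir (\<lambda>x. ddir F x (X x)) (x0 + z *s v) v"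
      "\<lambda>i z. ddir F (x0 + z *s v) (axis i 1)" "\<lambda>i z. ddir (\<lambda>x. ddir F x (axis i 1)) (x0 + z *s v) v"
      "\<lambda>z. G.tr (x0 + z *s v) v" l
    proof (intro_locales, unfold_locales)
      fix z :: complex
      have det_eq: "det (\<chi> i j. H.q (F x) (ddir F x (axis i 1)) (ddir F x (axis j 1))) = G.detq x" if "x \<in> U" for x
        by (simp add: G.detq_def q_isometric[OF that])
      show "det (\<chi> i j. H.q (F (x0 + 0 *s v)) (ddir F (x0 + 0 *s v) (axis i 1)) (ddir F (x0 + 0 *s v) (axis j 1))) \<noteq> 0"
        using det_eq[OF x0] G.detq_nonzero[OF x0] by simp
      show "0 < r" by (rule r)
      assume z: "z \<in> ball 0 r"
      note x = xU[OF z]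
      show "F (x0 + z *s v) \<in> W" by (rule maps[OF x])
      show "((\<lambda>z. F (x0 + z *s v)) has_derivative (\<lambda>t. t *s ddir F (x0 + z *s v) v)) (at z)"
        by (rule hol_map_line[OF hol x])
      show "((\<lambda>z. ddir F (x0 + z *s v) v) has_derivative (\<lambda>t. t *s ddir (\<lambda>x. ddir F x v) (x0 + z *s v) v)) (at z)"
        by (rule hol_map_line[OF hol_dF x])
      show "((\<lambda>z. ddir F (x0 + z *s v) (axis i 1)) has_derivative (\<lambda>t. t *s ddir (\<lambda>x. ddir F x (axis i 1)) (x0 + z *s v) v)) (at z)" for i
        by (rule hol_map_line[OF hol_dF x])
      show "((\<lambda>z. ddir F (x0 + z *s v) (X (x0 + z *s v))) has_derivative (\<lambda>t. t *s ddir (\<lambda>x. ddir F x (X x)) (x0 + z *s v) v)) (at z)"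
        by (rule hol_map_line[OF hol_dF_X x])
      have "wirt (\<lambda>z. G.tr (x0 + z *s v) v) (del (\<lambda>y. G.tr y v) (x0 + z *s v) v) (delbar (\<lambda>y. G.tr y v) (x0 + z *s v) v) z"
        unfolding wirt_def
        by (rule has_derivative_eq_rhs[OF has_derivative_compose[OF line_has_derivative has_derivative_del[OF G.tr_differentiable[OF x]]]])
          (simp add: fun_eq_iff del_scale delbar_scale G.tr_differentiable x)
      then show "\<exists>a. wirt (\<lambda>z. G.tr (x0 + z *s v) v) a (- (of_real (l / 2) * H.q (F (x0 + z *s v)) (ddir F (x0 + z *s v) v) (ddir F (x0 + z *s v) v))
        - of_real (Re (H.q (F (x0 + z *s v)) (H.\<Gamma> (F (x0 + z *s v)) (ddir F (x0 + z *s v) v) (ddir F (x0 + z *s v) (X (x0 + z *s v)))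
          + ddir (\<lambda>x. ddir F x (X x)) (x0 + z *s v) v) (ddir F (x0 + z *s v) v)))) z"
        unfolding sol[OF x] q_covariant_derivative[OF x] q_isometric[OF x, symmetric] by blast
      have "wirt (\<lambda>z. G.detq (x0 + z *s v)) (G.tr (x0 + z *s v) v * G.detq (x0 + z *s v)) (cnj (G.tr (x0 + z *s v) v) * G.detq (x0 + z *s v)) z"
        unfolding wirt_def
        by (rule has_derivative_eq_rhs[OF has_derivative_compose[OF line_has_derivative G.detq_has_derivative[OF x]]])
          (simp add: fun_eq_iff G.tr_scale[OF x] algebra_simps)
      from wirt_cong[OF this open_ball z det_eq[OF xU, symmetric]]
      show "\<exists>b. wirt (\<lambda>z. det (\<chi> i j. H.q (F (x0 + z *s v)) (ddir F (x0 + z *s v) (axis i 1)) (ddir F (x0 + z *s v) (axis j 1))))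
          (G.tr (x0 + z *s v) v * det (\<chi> i j. H.q (F (x0 + z *s v)) (ddir F (x0 + z *s v) (axis i 1)) (ddir F (x0 + z *s v) (axis j 1)))) b z"
        unfolding det_eq[OF x] by blast
    qed
    have \<gamma>: "\<gamma> 0 = of_real (g x0 v v)" using X.self_real[of v]
      by (simp add: \<gamma>_def q_isometric[OF x0, symmetric] complex_eq_iff) (simp add: G.q_def)
    have \<beta>: "\<beta> 0 = G.q x0 (G.\<Gamma> x0 v (X x0) + ddir X x0 v) v" by (simp add: \<beta>_def q_covariant_derivative[OF x0])
    have g: "g x0 v v > 0" by (rule G.h_pos[OF x0 False])
    have \<delta>': "Re (delbar (\<lambda>y. G.tr y v) x0 v) = - (l / 2 * g x0 v v) - Re (\<beta> 0)"
      unfolding sol[OF x0] \<beta> by (simp add: G.q_def)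
    show ?thesis
    proof (cases "\<kappa> = 0")
      case True
      have "l / 2 * g x0 v v + Re (\<beta> 0) = 0"
        using arg_cong[OF flat_case[OF True], of Re] by (simp add: \<gamma>)
      with \<delta> \<delta>' True show ?thesis by simp
    next
      case False
      then have \<kappa>: "\<kappa> > 0" using \<kappa>_nonneg by simp
      have "\<gamma> 0 \<noteq> 0" using g by (simp add: \<gamma>)
      note c = curved_case[OF \<kappa> this]
      have e: "\<kappa> * (real CARD('n) + 1 + l / (2 * \<kappa>)) = (real CARD('n) + 1) * \<kappa> + l / 2"
        using \<kappa> by (simp add: field_simps)
      have "(\<Sum>i\<in>UNIV. T i) = - (\<kappa> * (real CARD('n) + 1 + l / (2 * \<kappa>)) * g x0 v v)"
        using \<delta> \<delta>' conjunct1[OF c] unfolding e distrib_right by linarith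
      moreover have "\<kappa> * (real CARD('n) + 1 + l / (2 * \<kappa>)) * g x0 v v \<ge> 0"
        using c \<kappa> g by (intro mult_nonneg_nonneg) auto
      ultimately show ?thesis by linarith
    qed
  qed
  then have "(\<Sum>i\<in>UNIV. T i) = 0" using sum_nonneg[of UNIV T] T_nonneg by (intro antisym) auto
  then have "T i = 0" for i using sum_nonneg_eq_0_iff[of UNIV T] T_nonneg by auto
  then have 0: "\<sigma> x0 v (E i) = 0" for i using Y.pos[of "\<sigma> x0 v (E i)"] by (auto simp: T_def)
  have sum: "\<sigma> x0 v (\<Sum>i\<in>I. f i) = (\<Sum>i\<in>I. \<sigma> x0 v (f i))" for f :: "'n \<Rightarrow> complex^'n" and I
    by (rule additive.sum[OF additive.intro[OF \<sigma>_add[OF x0]]])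
  have "\<sigma> x0 v u = \<sigma> x0 v (\<Sum>i\<in>UNIV. G.q x0 u (E i) *s E i)"
    by (rule arg_cong[OF X.orthonormal_expansion[OF E]])
  then show ?thesis by (simp add: sum \<sigma>_scale[OF x0] 0)
qed

end

section \<open>Manifolds\<close>

lemma smooth_on_subset:
  assumes "smooth_on f S" "T \<subseteq> S" shows "smooth_on f T"
proof -
  have "Ck_on k f S \<Longrightarrow> Ck_on k f T" for k and f :: "'a::real_normed_vector \<Rightarrow> 'b::real_normed_vector"
  proof (induction k arbitrary: f)
    case 0
    then show ?case using continuous_on_subset[OF _ assms(2)] by simp
  next
    case (Suc k)
    then show ?case using assms(2) by auto
  qed
  then show ?thesis using assms(1) unfolding smooth_on_def by blast
qed

lemma chart_kaehler_domain:
  assumes "kaehler_metric A g" "a \<in> A" "open U" "U \<subseteq> chart_map a ` chart_dom a"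
  shows "kaehler_domain U (g a)"
proof
  note g = assms(1)[unfolded kaehler_metric_def riemannian_metric_def]
  show "open U" by fact
  show "smooth_on (\<lambda>x. g a x u v) U" for u v using g assms(2) smooth_on_subset[OF _ assms(4)] by blast
  fix x assume "x \<in> U"
  then have x: "x \<in> chart_map a ` chart_dom a" using assms(4) by blast
  show "bilinear (g a x)" using g assms(2) x by blast
  show "g a x u v = g a x v u" for u v using g assms(2) x by blast
  show "u \<noteq> 0 \<Longrightarrow> 0 < g a x u u" for u using g assms(2) x by blast
  show "g a x (cJ u) (cJ v) = g a x u v" for u v using g assms(2) x by blast
  show "ddir (\<lambda>y. g a y (cJ v) w) x u + ddir (\<lambda>y. g a y (cJ w) u) x v + ddir (\<lambda>y. g a y (cJ u) v) x w = 0" for u v w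
    using g assms(2) x by blast
qed

lemma local_dom_open:
  assumes M: "complex_manifold M A" and a: "a \<in> A" and b: "openin N (chart_dom b)" and f: "continuous_map M N f"
  shows "open (local_dom a b f)"
proof -
  have Ma: "openin M (chart_dom a)" "open (chart_map a ` chart_dom a)"
    "homeomorphic_map (subtopology M (chart_dom a)) (top_of_set (chart_map a ` chart_dom a)) (chart_map a)"
    using M a unfolding complex_manifold_def by blast+
  have "openin M {p \<in> topspace M. f p \<in> chart_dom b}" by (rule openin_continuous_map_preimage[OF f b])
  then have "openin (subtopology M (chart_dom a)) ({p \<in> topspace M. f p \<in> chart_dom b} \<inter> chart_dom a)"
    unfolding openin_subtopology by blast
  moreover have "{p \<in> topspace M. f p \<in> chart_dom b} \<inter> chart_dom a = {p \<in> chart_dom a. f p \<in> chart_dom b}"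
    using openin_subset[OF Ma(1)] by blast
  ultimately have "openin (top_of_set (chart_map a ` chart_dom a)) (local_dom a b f)"
    using homeomorphic_imp_open_map[OF Ma(3)] unfolding open_map_def local_dom_def by simp
  then show ?thesis using openin_open_eq[OF Ma(2)] by blast
qed

lemma local_rep_maps:
  assumes M: "complex_manifold M A" and a: "a \<in> A" and x: "x \<in> local_dom a b f"
  shows "local_rep a b f x \<in> chart_map b ` chart_dom b"
proof -
  have Ma: "openin M (chart_dom a)" "homeomorphic_map (subtopology M (chart_dom a)) (top_of_set (chart_map a ` chart_dom a)) (chart_map a)"
    using M a unfolding complex_manifold_def by blast+
  have "inj_on (chart_map a) (chart_dom a)"
    using homeomorphic_imp_injective_map[OF Ma(2)] openin_subset[OF Ma(1)] by (simp add: inf.absorb2)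
  moreover obtain p where "p \<in> chart_dom a" "f p \<in> chart_dom b" "x = chart_map a p"
    using x unfolding local_dom_def by blast
  ultimately show ?thesis by (simp add: local_rep_def)
qed

theorem corollary1p5:
  fixes M :: "'m topology" and A :: "('m, 'n::finite) chart set"
    and g :: "('m, 'n) metric" and X :: "('m, 'n) vfield"
    and N :: "'p topology" and B :: "('p, 'q::finite) chart set"
    and h :: "('p, 'q) metric" and c :: real and f :: "'m \<Rightarrow> 'p"
  assumes "complex_manifold M A"
    and "kaehler_ricci_soliton A g X"
    and "complex_space_form N B h (2 * c)" and "c \<le> 0"
    and "kaehler_immersion M A g N B h f"
  shows "totally_geodesic A g B h f"
  unfolding totally_geodesic_def
proof (intro ballI allI)
  fix a b x u v assume a: "a \<in> A" and b: "b \<in> B" and x: "x \<in> local_dom a b f"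
  define U where "U = local_dom a b f"
  define W where "W = chart_map b ` chart_dom b"
  define F where "F = local_rep a b f"
  obtain l where l: "\<And>x u v. x \<in> chart_map a ` chart_dom a \<Longrightarrow> ricci (g a) x u v = l * g a x u v + lie_metric (X a) (g a) x u v"
    using assms(2) a unfolding kaehler_ricci_soliton_def by blast
  have gX: "kaehler_metric A g" "hol_map_on (X a) (chart_map a ` chart_dom a)"
    using assms(2) a unfolding kaehler_ricci_soliton_def holomorphic_vfield_def by blast+
  have N: "complex_manifold N B" "kaehler_metric B h"
    "\<And>x u. x \<in> W \<Longrightarrow> u \<noteq> 0 \<Longrightarrow> sectional_curvature (h b) x u (cJ u) = 2 * c"
    using assms(3) b unfolding complex_space_form_def W_def by blast+
  have f: "continuous_map M N f" "hol_map_on F U"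
    using assms(5) a b unfolding kaehler_immersion_def holomorphic_map_def F_def U_def by blast+
  have iso: "x \<in> U \<Longrightarrow> g a x u v = h b (F x) (ddir F x u) (ddir F x v)" for x u v
    using assms(5) a b unfolding kaehler_immersion_def F_def U_def by blast
  have Nb: "openin N (chart_dom b)" "open W"
    using N(1) b unfolding complex_manifold_def W_def by blast+
  have U: "open U" unfolding U_def by (rule local_dom_open[OF assms(1) a Nb(1) f(1)])
  have sub: "U \<subseteq> chart_map a ` chart_dom a" unfolding U_def local_dom_def by blast
  interpret G: kaehler_domain U "g a" by (rule chart_kaehler_domain[OF gX(1) a U sub])
  interpret H: kaehler_domain W "h b" by (rule chart_kaehler_domain[OF N(2) b Nb(2)]) (simp add: W_def)
  interpret soliton_map U "g a" W "h b" F "- c / 2" "X a" l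
  proof unfold_locales
    show "hol_map_on F U" by (rule f(2))
    show "F x \<in> W" if "x \<in> U" for x
      using local_rep_maps[OF assms(1) a] that unfolding F_def U_def W_def by blast
    show "g a x u v = h b (F x) (ddir F x u) (ddir F x v)" if "x \<in> U" for x u v by (rule iso[OF that])
    show "H.cv x v w u = (of_real (- c / 2) * H.q x w u) *s v + (of_real (- c / 2) * H.q x v u) *s w" if "x \<in> W" for x v w u
      by (rule H.constant_holomorphic_curvature[OF that N(3)[OF that]])
    show "hol_map_on (X a) U" using gX(2) sub unfolding hol_map_on_def by blast
    show "0 \<le> - c / 2" using assms(4) by simp
    show "ricci (g a) x v v = l * g a x v v + lie_metric (X a) (g a) x v v" if "x \<in> U" for x v
      using l sub that by blast
  qed
  have "\<sigma> x u v = 0" by (rule second_fundamental_form_vanishes) (simp add: U_def x)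
  then show "second_fundamental_form (g a) (h b) (local_rep a b f) x u v = 0"
    unfolding \<sigma>_def by (simp only: F_def)
qed

end
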